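(* Let $K$ be an algebraically closed field of characteristic $0$, $S=K[x_1,\ldots,x_n]$, and let $(0)\neq I\subset S$ be a graded ideal with $\dim I=m>0$. Let $U\subset\operatorname{GL}_n(K)$ be a nonempty Zariski-open set as in the context. Then for every $g\in U$ and every maximal cone $C$ of $T(g(I))$, the intrinsic multiplicity satisfies $m(C)=m(I)$; that is, it is constant and equals the multiplicity of $I$.
   Context: $\dim I$ is the Krull dimension of $S/I$. For $\omega\in\mathbb{R}^n$ the $\omega$-weight of a term $cx^\nu$ is $\omega\cdot\nu$; $\operatorname{in}_\omega(f)$ is the sum of the terms of $f$ of minimal $\omega$-weight; $\operatorname{in}_\omega(I)=(\operatorname{in}_\omega(f):f\in I)$. The Gröbner fan $\operatorname{GF}(I)$ is the complete fan in $\mathbb{R}^n$ in which $\omega,\omega'$ lie in the same relatively open cone iff $\operatorname{in}_\omega(I)=\operatorname{in}_{\omega'}(I)$; for a cone $C$ of it, $\operatorname{in}_C(I)$ denotes $\operatorname{in}_\omega(I)$ for any $\omega$ in the relative interior of $C$. The tropical variety $T(I)=\{\omega\in\mathbb{R}^n:\operatorname{in}_\omega(I)\text{ contains no monomial}\}$ is a subfan of $\operatorname{GF}(I)$. A matrix $g\in\operatorname{GL}_n(K)$ acts by $x_i\mapsto\sum_j g_{ji}x_j$. It is known (for $\dim I>0$) that there is a nonempty Zariski-open $U\subset\operatorname{GL}_n(K)$, fixed from now on, such that for all $g\in U$: $\operatorname{GF}(g(I))$ is one and the same fan, $T(g(I))$ is one and the same fan $\operatorname{gT}(I)$, and for every term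 order $\succ$, $\operatorname{in}_\succ(g(I))$ is one and the same ideal $\operatorname{gin}_\succ(I)$. Multiplicity: the Hilbert series of $S/I$ can be written $H_{S/I}(t)=Q(t)/(1-t)^{\dim I}$ with $Q(1)\neq 0$, and $m(I)=Q(1)$. Intrinsic multiplicity: for a graded ideal $I'$, a maximal cone $C$ of $T(I')$ and $J=\operatorname{in}_C(I')$, set $m(C)=\sum_P\ell((S/J)_P)$, where the sum is over all minimal primes $P$ of $J$ with $\dim P=\dim J$ which do not contain a monomial, and $\ell$ denotes the length of the localized module. *)

theory Defs
  imports
    "HOL-Analysis.Analysis"
    "HOL-Computational_Algebra.Computational_Algebra"
    "HOL-Library.Poly_Mapping"
    "HOL-Library.Extended_Real"
    "HOL-Algebra.QuotRing"
    "HOL-Algebra.Embedded_Algebras"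
begin

section \<open>The polynomial ring\<close>

text \<open>
  \<open>('v, 'k) mpol\<close> is the polynomial ring over \<open>'k\<close> in variables indexed by \<open>'v\<close>;
  an exponent vector is a finitely supported function \<open>'v \<Rightarrow>\<^sub>0 nat\<close>.
  For \<open>S = K[x\<^sub>1,\<dots>,x\<^sub>n]\<close> the index type is an arbitrary finite type with \<open>n\<close> elements.
\<close>

type_synonym ('v, 'k) mpol = "('v \<Rightarrow>\<^sub>0 nat) \<Rightarrow>\<^sub>0 'k"

definition mpol_ring :: "('v, 'k::comm_ring_1) mpol ring" where
  "mpol_ring = \<lparr>carrier = UNIV, mult = (*), one = 1, zero = 0, add = (+)\<rparr>"

definition mconst :: "'k::zero \<Rightarrow> ('v, 'k) mpol" where
  "mconst c = Poly_Mapping.single 0 c"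

definition mvar :: "'v \<Rightarrow> ('v, 'k::zero_neq_one) mpol" where
  "mvar i = Poly_Mapping.single (Poly_Mapping.single i 1) 1"

definition monomial :: "('v \<Rightarrow>\<^sub>0 nat) \<Rightarrow> ('v, 'k::zero_neq_one) mpol" where
  "monomial \<nu> = Poly_Mapping.single \<nu> 1"

text \<open>Substitution of \<open>x v\<close> for the variable \<open>v\<close>, the coefficients being mapped by \<open>h\<close>.\<close>

definition mpol_subst ::
  "('k::comm_ring_1 \<Rightarrow> 'b::comm_ring_1) \<Rightarrow> ('v::finite \<Rightarrow> 'b) \<Rightarrow> ('v, 'k) mpol \<Rightarrow> 'b" where
  "mpol_subst h x f =
     (\<Sum>\<nu>\<in>Poly_Mapping.keys f. h (Poly_Mapping.lookup f \<nu>) * (\<Prod>v\<in>UNIV. x v ^ Poly_Mapping.lookup \<nu> v))"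

definition total_degree :: "('v::finite \<Rightarrow>\<^sub>0 nat) \<Rightarrow> nat" where
  "total_degree \<nu> = (\<Sum>v\<in>UNIV. Poly_Mapping.lookup \<nu> v)"

definition hom_part :: "nat \<Rightarrow> ('v::finite, 'k::comm_ring_1) mpol set" where
  "hom_part d = {f. \<forall>\<nu>\<in>Poly_Mapping.keys f. total_degree \<nu> = d}"

definition hom_component :: "nat \<Rightarrow> ('v::finite, 'k::comm_ring_1) mpol \<Rightarrow> ('v, 'k) mpol" where
  "hom_component d f =
     (\<Sum>\<nu> | \<nu> \<in> Poly_Mapping.keys f \<and> total_degree \<nu> = d. Poly_Mapping.single \<nu> (Poly_Mapping.lookup f \<nu>))"

definition graded_ideal :: "('v::finite, 'k::comm_ring_1) mpol set \<Rightarrow> bool" where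
  "graded_ideal I \<longleftrightarrow> ideal I mpol_ring \<and> (\<forall>f\<in>I. \<forall>d. hom_component d f \<in> I)"


section \<open>Krull dimension, Hilbert series and multiplicity\<close>

text \<open>The supremum of the lengths of chains of prime ideals; the zero ring gets dimension \<open>0\<close>.\<close>

definition krull_dim :: "('a, 'm) ring_scheme \<Rightarrow> enat" where
  "krull_dim R = Sup {enat k | k. \<exists>p :: nat \<Rightarrow> 'a set.
     (\<forall>i\<le>k. primeideal (p i) R) \<and> (\<forall>i<k. p i \<subset> p (Suc i))}"

definition ideal_dim :: "('v, 'k::comm_ring_1) mpol set \<Rightarrow> enat" where
  "ideal_dim I = krull_dim (mpol_ring Quot I)"

text \<open>The coefficient at \<open>t ^ d\<close> is the \<open>K\<close>-dimension of the degree \<open>d\<close> part of \<open>S/I\<close>, where \<open>K\<close>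
  is regarded as a subfield of \<open>S/I\<close>.\<close>

definition hilbert_series :: "('v::finite, 'k::comm_ring_1) mpol set \<Rightarrow> int fps" where
  "hilbert_series I = Abs_fps (\<lambda>d. int (ring.dim (mpol_ring Quot I)
     ((\<lambda>c. I +>\<^bsub>mpol_ring\<^esub> mconst c) ` UNIV)
     ((\<lambda>f. I +>\<^bsub>mpol_ring\<^esub> f) ` hom_part d)))"

text \<open>The polynomial \<open>Q\<close> in \<open>H(t) = Q(t) / (1 - t) ^ dim I\<close>.\<close>

definition hilbert_numerator :: "('v::finite, 'k::comm_ring_1) mpol set \<Rightarrow> int poly" where
  "hilbert_numerator I = (THE Q.
     hilbert_series I * (1 - fps_X) ^ the_enat (ideal_dim I) = fps_of_poly Q \<and> poly Q 1 \<noteq> 0)"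

definition multiplicity_of_ideal :: "('v::finite, 'k::comm_ring_1) mpol set \<Rightarrow> int" where
  "multiplicity_of_ideal I = poly (hilbert_numerator I) 1"


section \<open>Initial ideals, Groebner fan and tropical variety\<close>

definition weight :: "real ^ 'n \<Rightarrow> ('n::finite \<Rightarrow>\<^sub>0 nat) \<Rightarrow> real" where
  "weight w \<nu> = (\<Sum>i\<in>UNIV. w $ i * real (Poly_Mapping.lookup \<nu> i))"

definition in_weight :: "real ^ 'n \<Rightarrow> ('n::finite, 'k::comm_ring_1) mpol \<Rightarrow> ('n, 'k) mpol" where
  "in_weight w f =
     (\<Sum>\<nu> | \<nu> \<in> Poly_Mapping.keys f \<and> (\<forall>\<mu>\<in>Poly_Mapping.keys f. weight w \<nu> \<le> weight w \<mu>).
        Poly_Mapping.single \<nu> (Poly_Mapping.lookup f \<nu>))"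

definition in_weight_ideal ::
  "real ^ 'n \<Rightarrow> ('n::finite, 'k::comm_ring_1) mpol set \<Rightarrow> ('n, 'k) mpol set" where
  "in_weight_ideal w I = genideal mpol_ring (in_weight w ` I)"

text \<open>The relatively open cones of the Groebner fan of a graded ideal are the classes of weights
  with the same initial ideal; the cones of the fan are the closures of these.\<close>

definition groebner_fan :: "('n::finite, 'k::comm_ring_1) mpol set \<Rightarrow> (real ^ 'n) set set" where
  "groebner_fan I = {closure {w'. in_weight_ideal w' I = in_weight_ideal w I} | w. True}"

definition in_cone_ideal ::
  "(real ^ 'n) set \<Rightarrow> ('n::finite, 'k::comm_ring_1) mpol set \<Rightarrow> ('n, 'k) mpol set" where
  "in_cone_ideal C I = in_weight_ideal (SOME w. w \<in> rel_interior C) I"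

definition contains_monomial :: "('n, 'k::comm_ring_1) mpol set \<Rightarrow> bool" where
  "contains_monomial J \<longleftrightarrow> (\<exists>\<nu>. monomial \<nu> \<in> J)"

definition tropical_variety :: "('n::finite, 'k::comm_ring_1) mpol set \<Rightarrow> (real ^ 'n) set" where
  "tropical_variety I = {w. \<not> contains_monomial (in_weight_ideal w I)}"

definition tropical_fan :: "('n::finite, 'k::comm_ring_1) mpol set \<Rightarrow> (real ^ 'n) set set" where
  "tropical_fan I = {C \<in> groebner_fan I. C \<subseteq> tropical_variety I}"

definition maximal_cone :: "'a set \<Rightarrow> 'a set set \<Rightarrow> bool" where
  "maximal_cone C F \<longleftrightarrow> C \<in> F \<and> (\<forall>D\<in>F. C \<subseteq> D \<longrightarrow> D = C)"

text \<open>\<open>(s, t) \<in> r\<close> means that \<open>t\<close> is greater than or equal to \<open>s\<close>.\<close>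

definition term_order :: "('n \<Rightarrow>\<^sub>0 nat) rel \<Rightarrow> bool" where
  "term_order r \<longleftrightarrow> linear_order r \<and> (\<forall>s. (0, s) \<in> r) \<and>
     (\<forall>s t u. (s, t) \<in> r \<longrightarrow> (s + u, t + u) \<in> r)"

definition leading_term ::
  "('n \<Rightarrow>\<^sub>0 nat) rel \<Rightarrow> ('n, 'k::comm_ring_1) mpol \<Rightarrow> ('n, 'k) mpol" where
  "leading_term r f =
     (\<Sum>\<nu> | \<nu> \<in> Poly_Mapping.keys f \<and> (\<forall>\<mu>\<in>Poly_Mapping.keys f. (\<mu>, \<nu>) \<in> r).
        Poly_Mapping.single \<nu> (Poly_Mapping.lookup f \<nu>))"

definition in_order_ideal ::
  "('n \<Rightarrow>\<^sub>0 nat) rel \<Rightarrow> ('n, 'k::comm_ring_1) mpol set \<Rightarrow> ('n, 'k) mpol set" where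
  "in_order_ideal r I = genideal mpol_ring (leading_term r ` I)"


section \<open>Generic coordinates\<close>

definition gl_act :: "'k::comm_ring_1 ^ 'n ^ 'n \<Rightarrow> ('n::finite, 'k) mpol \<Rightarrow> ('n, 'k) mpol" where
  "gl_act g = mpol_subst mconst (\<lambda>i. \<Sum>j\<in>UNIV. mconst (g $ j $ i) * mvar j)"

text \<open>Open subsets of \<open>GL\<^sub>n\<close> in the topology induced from the Zariski topology on matrices.\<close>

definition zariski_open_GL :: "('k::field ^ 'n ^ 'n::finite) set \<Rightarrow> bool" where
  "zariski_open_GL U \<longleftrightarrow> (\<exists>F :: ('n \<times> 'n, 'k) mpol set.
     U = {g. invertible g \<and> (\<exists>p\<in>F. mpol_subst id (\<lambda>(i, j). g $ i $ j) p \<noteq> 0)})"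

definition generic_for ::
  "('n::finite, 'k::field) mpol set \<Rightarrow> ('k ^ 'n ^ 'n) set \<Rightarrow> bool" where
  "generic_for I U \<longleftrightarrow> U \<noteq> {} \<and> zariski_open_GL U \<and>
     (\<exists>GF. \<forall>g\<in>U. groebner_fan (gl_act g ` I) = GF) \<and>
     (\<exists>gT. \<forall>g\<in>U. tropical_fan (gl_act g ` I) = gT) \<and>
     (\<forall>r. term_order r \<longrightarrow> (\<exists>gin. \<forall>g\<in>U. in_order_ideal r (gl_act g ` I) = gin))"


section \<open>Localization and length\<close>

text \<open>The fraction \<open>m / s\<close>, as the set of all equivalent pairs, for a multiplicative subset \<open>W\<close> of \<open>R\<close>.\<close>

definition fraction ::
  "('a, 'm) ring_scheme \<Rightarrow> 'a set \<Rightarrow> ('a, 'b, 'l) module_scheme \<Rightarrow> 'b \<Rightarrow> 'a \<Rightarrow> ('b \<times> 'a) set" where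
  "fraction R W M m s = {(m', s'). m' \<in> carrier M \<and> s' \<in> W \<and>
     (\<exists>u\<in>W. u \<odot>\<^bsub>M\<^esub> (s' \<odot>\<^bsub>M\<^esub> m) = u \<odot>\<^bsub>M\<^esub> (s \<odot>\<^bsub>M\<^esub> m'))}"

definition self_module :: "('a, 'm) ring_scheme \<Rightarrow> ('a, 'a) module" where
  "self_module R = \<lparr>carrier = carrier R, mult = mult R, one = \<one>\<^bsub>R\<^esub>,
     zero = \<zero>\<^bsub>R\<^esub>, add = add R,
     smult = mult R\<rparr>"

definition local_ring :: "('a, 'm) ring_scheme \<Rightarrow> 'a set \<Rightarrow> ('a \<times> 'a) set ring" where
  "local_ring R P = (let W = carrier R - P; fr = fraction R W (self_module R) in
     \<lparr>carrier = {fr r s | r s. r \<in> carrier R \<and> s \<in> W},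
      mult = (\<lambda>X Y. \<Union>x\<in>X. \<Union>y\<in>Y. fr (fst x \<otimes>\<^bsub>R\<^esub> fst y) (snd x \<otimes>\<^bsub>R\<^esub> snd y)),
      one = fr \<one>\<^bsub>R\<^esub> \<one>\<^bsub>R\<^esub>,
      zero = fr \<zero>\<^bsub>R\<^esub> \<one>\<^bsub>R\<^esub>,
      add = (\<lambda>X Y. \<Union>x\<in>X. \<Union>y\<in>Y.
               fr ((snd y \<otimes>\<^bsub>R\<^esub> fst x) \<oplus>\<^bsub>R\<^esub> (snd x \<otimes>\<^bsub>R\<^esub> fst y)) (snd x \<otimes>\<^bsub>R\<^esub> snd y))\<rparr>)"

text \<open>The fields \<open>mult\<close> and \<open>one\<close> of a module record play no role for modules.\<close>

definition local_module ::
  "('a, 'm) ring_scheme \<Rightarrow> 'a set \<Rightarrow> ('a, 'b, 'l) module_scheme \<Rightarrow>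
   (('a \<times> 'a) set, ('b \<times> 'a) set) module" where
  "local_module R P M = (let W = carrier R - P; fr = fraction R W M in
     \<lparr>carrier = {fr m s | m s. m \<in> carrier M \<and> s \<in> W},
      mult = (\<lambda>_ _. undefined),
      one = undefined,
      zero = fr \<zero>\<^bsub>M\<^esub> \<one>\<^bsub>R\<^esub>,
      add = (\<lambda>X Y. \<Union>x\<in>X. \<Union>y\<in>Y.
               fr ((snd y \<odot>\<^bsub>M\<^esub> fst x) \<oplus>\<^bsub>M\<^esub> (snd x \<odot>\<^bsub>M\<^esub> fst y)) (snd x \<otimes>\<^bsub>R\<^esub> snd y)),
      smult = (\<lambda>A X. \<Union>a\<in>A. \<Union>x\<in>X. fr (fst a \<odot>\<^bsub>M\<^esub> fst x) (snd a \<otimes>\<^bsub>R\<^esub> snd x))\<rparr>)"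

definition quotient_module :: "('a, 'm) ring_scheme \<Rightarrow> 'a set \<Rightarrow> ('a, 'a set) module" where
  "quotient_module R J = \<lparr>carrier = carrier (R Quot J), mult = mult (R Quot J),
     one = \<one>\<^bsub>R Quot J\<^esub>, zero = \<zero>\<^bsub>R Quot J\<^esub>, add = add (R Quot J),
     smult = (\<lambda>r X. (J +>\<^bsub>R\<^esub> r) \<otimes>\<^bsub>R Quot J\<^esub> X)\<rparr>"

definition module_length :: "('a, 'm) ring_scheme \<Rightarrow> ('a, 'b, 'l) module_scheme \<Rightarrow> enat" where
  "module_length R M = Sup {enat k | k. \<exists>N :: nat \<Rightarrow> 'b set.
     (\<forall>i\<le>k. submodule (N i) R M) \<and> (\<forall>i<k. N i \<subset> N (Suc i))}"


section \<open>Intrinsic multiplicity\<close>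

definition minimal_prime_over :: "('a, 'm) ring_scheme \<Rightarrow> 'a set \<Rightarrow> 'a set \<Rightarrow> bool" where
  "minimal_prime_over R J P \<longleftrightarrow> primeideal P R \<and> J \<subseteq> P \<and>
     (\<forall>P'. primeideal P' R \<and> J \<subseteq> P' \<and> P' \<subseteq> P \<longrightarrow> P' = P)"

definition intrinsic_multiplicity ::
  "('n::finite, 'k::comm_ring_1) mpol set \<Rightarrow> (real ^ 'n) set \<Rightarrow> enat" where
  "intrinsic_multiplicity I C = (let J = in_cone_ideal C I in
     \<Sum>P | minimal_prime_over mpol_ring J P \<and> ideal_dim P = ideal_dim J \<and> \<not> contains_monomial P.
       module_length (local_ring mpol_ring P) (local_module mpol_ring P (quotient_module mpol_ring J)))"

end

theory Submission
  imports Defs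
begin

text \<open>
  Let \<open>m = dim I\<close>. Any \<open>m\<close> variables can be made a system of parameters modulo \<open>I\<close> by some linear
  change of coordinates, hence by a general one; as a suitable generic initial ideal detects this,
  it holds for \<open>I' = g(I)\<close> with any \<open>g \<in> U\<close>. It follows that \<open>T(I')\<close> consists of the weights whose minimum is
  attained at more than \<open>n - m\<close> coordinates, and that the initial ideal of a maximal cone is
  \<open>J = in\<^sub>w(I')\<close> for a weight \<open>w\<close> whose minimum is attained exactly on a set \<open>A\<close> of \<open>n - m + 1\<close> coordinates.

  For such a \<open>w\<close> and \<open>i, j \<in> A\<close>, all but boundedly many powers of \<open>x\<^sub>i\<close> can be split off modulo \<open>J\<close> from
  a form in the variables of \<open>A\<close>. Hence \<open>J\<close> contains a binary form in \<open>x\<^sub>i, x\<^sub>j\<close>, which is a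
  product of linear forms over the algebraically closed field. So the \<open>m\<close>-dimensional primes over \<open>J\<close>
  are among finitely many primes generated by forms \<open>x\<^sub>j - c\<^sub>j x\<^sub>i\<close> with \<open>i, j \<in> A\<close>; those over \<open>J\<close> contain no monomial and
  have multiplicity \<open>1\<close>. In a filtration of \<open>S/J\<close> with factors \<open>S/P\<close>, such a prime \<open>P\<close> occurs as often
  as the length of \<open>(S/J)\<^sub>P\<close>, and the other factors do not contribute to the multiplicity of \<open>J\<close>,
  which is that of \<open>I\<close> because the Hilbert function does not change.
\<close>

section \<open>Ideals, gradings and substitutions\<close>

text \<open>Genericity is usable only through objects that are constant on \<open>U\<close>. Being a
  system of parameters is an open condition, hence holds at some point of \<open>U\<close>, and the
  order \<open>tord D\<close> is built so that its initial ideal carries the property to every other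
  point. The cones themselves are never computed. A weight inside a maximal cone is moved in a
  direction that enlarges its set of non-minimal coordinates to \<open>m - 1\<close> elements; the
  class of the moved weight has the old class in its closure, so maximality forces the two cones to
  coincide. Dimension enters through lengths of prime chains. The primes of a chain need not be
  graded, so chains are bounded by the growth of the affine Hilbert function. Multiplicity is the
  value at 1 of a numerator over \<open>(1 - t)^m\<close> and is additive along filtrations; length
  is made comparable with it by counting chains of saturated ideals. Characteristic 0 supplies
  infinitely many scalars for the arguments along lines.\<close>

global_interpretation rm: Modules.module "(*) :: 'a::comm_ring_1 \<Rightarrow> 'a \<Rightarrow> 'a"
  by unfold_locales (simp_all add: algebra_simps)

declare rm.scale_scale [simp del]

text \<open>Over itself the ring is a module whose submodules are the ideals, so general facts about
  spans apply to generated ideals (\<open>rm.span\<close>) and their sums.\<close>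

abbreviation idl :: "'a::comm_ring_1 set \<Rightarrow> bool" where "idl \<equiv> rm.subspace"

definition prm :: "'a::comm_ring_1 set \<Rightarrow> bool" where
  "prm P \<longleftrightarrow> idl P \<and> 1 \<notin> P \<and> (\<forall>a b. a * b \<in> P \<longrightarrow> a \<in> P \<or> b \<in> P)"

definition colon :: "'a::comm_ring_1 set \<Rightarrow> 'a \<Rightarrow> 'a set" where
  "colon J f = {a. a * f \<in> J}"

definition scl :: "'k::comm_ring_1 \<Rightarrow> ('v, 'k) mpol \<Rightarrow> ('v, 'k) mpol" where
  "scl c f = mconst c * f"

text \<open>The grading function is arbitrary: total degree, real weights, the degree
  \<open>odeg\<close> outside a set of variables, and even the truth value of membership in a set of
  exponents are used, so one set of lemmas serves every way of cutting a polynomial into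
  parts.\<close>

definition gcomp :: "(('v \<Rightarrow>\<^sub>0 nat) \<Rightarrow> 'w) \<Rightarrow> 'w \<Rightarrow> ('v, 'k::comm_ring_1) mpol \<Rightarrow> ('v, 'k) mpol" where
  "gcomp \<phi> v f = (\<Sum>\<nu> | \<nu> \<in> Poly_Mapping.keys f \<and> \<phi> \<nu> = v. Poly_Mapping.single \<nu> (Poly_Mapping.lookup f \<nu>))"

definition hg :: "(('v \<Rightarrow>\<^sub>0 nat) \<Rightarrow> 'w) \<Rightarrow> 'w \<Rightarrow> ('v, 'k::comm_ring_1) mpol \<Rightarrow> bool" where
  "hg \<phi> v f \<longleftrightarrow> (\<forall>\<nu>\<in>Poly_Mapping.keys f. \<phi> \<nu> = v)"

definition gr :: "(('v \<Rightarrow>\<^sub>0 nat) \<Rightarrow> 'w) \<Rightarrow> ('v, 'k::comm_ring_1) mpol set \<Rightarrow> bool" where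
  "gr \<phi> J \<longleftrightarrow> idl J \<and> (\<forall>f\<in>J. \<forall>v. gcomp \<phi> v f \<in> J)"

lemma idl_mult:
  assumes "idl J" "a \<in> J"
  shows "r * a \<in> J" "a * r \<in> J"
proof -
  show "r * a \<in> J" using assms by (rule rm.subspace_scale)
  then show "a * r \<in> J" by (subst mult.commute)
qed

lemma idl_colon:
  assumes J: "idl J"
  shows "idl (colon J f)"
proof (rule rm.subspaceI)
  show "0 \<in> colon J f" using J by (simp add: colon_def rm.subspace_0)
  fix x y c assume x: "x \<in> colon J f"
  show "c * x \<in> colon J f"
    using idl_mult(1)[OF J, of "x * f" c] x by (simp add: colon_def mult.assoc)
  assume "y \<in> colon J f"
  with x show "x + y \<in> colon J f"
    using rm.subspace_add[OF J, of "x * f" "y * f"] by (simp add: colon_def distrib_right)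
qed

lemma colon_superset: "idl J \<Longrightarrow> J \<subseteq> colon J f"
  using idl_mult(2) by (force simp: colon_def)

lemma colon_prime: "prm P \<Longrightarrow> f \<notin> P \<Longrightarrow> colon P f = P"
  using idl_mult(2)[of P] by (force simp: colon_def prm_def)

lemma prm_power: "prm P \<Longrightarrow> a ^ n \<in> P \<Longrightarrow> a \<in> P"
  by (induction n) (auto simp: prm_def)

lemma prm_prod: "finite A \<Longrightarrow> prm P \<Longrightarrow> (\<Prod>i\<in>A. f i) \<in> P \<Longrightarrow> \<exists>i\<in>A. f i \<in> P"
  by (induction A rule: finite_induct) (auto simp: prm_def)

lemma span_insert_idl: "idl J \<Longrightarrow> x \<in> rm.span (insert f J) \<longleftrightarrow> (\<exists>r. x - r * f \<in> J)"
  by (simp add: rm.span_breakdown_eq rm.span_eq_iff[THEN iffD2])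

lemma lookup_sum_single:
  "finite A \<Longrightarrow> Poly_Mapping.lookup (\<Sum>\<nu>\<in>A. Poly_Mapping.single \<nu> (c \<nu>)) \<mu> = (if \<mu> \<in> A then c \<mu> else 0)"
  by (simp add: lookup_sum lookup_single when_def sum.delta cong: if_cong)

lemma lookup_comp: "Poly_Mapping.lookup (gcomp \<phi> v f) \<nu> = (if \<phi> \<nu> = v then Poly_Mapping.lookup f \<nu> else 0)"
  by (auto simp: gcomp_def lookup_sum_single in_keys_iff)

lemma hom_component_eq_comp: "hom_component = gcomp total_degree"
  by (simp add: fun_eq_iff hom_component_def gcomp_def)

lemma lookup_in_weight: "Poly_Mapping.lookup (in_weight w f) \<nu> =
    (if \<forall>\<mu>\<in>Poly_Mapping.keys f. weight w \<nu> \<le> weight w \<mu> then Poly_Mapping.lookup f \<nu> else 0)"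
  by (auto simp: in_weight_def lookup_sum_single in_keys_iff)

lemma sum_single_lookup: "(\<Sum>\<nu>\<in>Poly_Mapping.keys f. Poly_Mapping.single \<nu> (Poly_Mapping.lookup f \<nu>)) = f"
  by (rule poly_mapping_eqI) (simp add: lookup_sum_single in_keys_iff)

lemma keys_comp: "Poly_Mapping.keys (gcomp \<phi> v f) = {\<nu>\<in>Poly_Mapping.keys f. \<phi> \<nu> = v}"
  by (auto simp: in_keys_iff lookup_comp split: if_splits)

lemma hg_comp: "hg \<phi> v (gcomp \<phi> v f)"
  by (simp add: hg_def keys_comp)

lemma comp_hg: "hg \<phi> w f \<Longrightarrow> gcomp \<phi> v f = (if v = w then f else 0)"
  by (rule poly_mapping_eqI) (auto simp: lookup_comp hg_def in_keys_iff)

lemma comp_0 [simp]: "gcomp \<phi> v 0 = 0"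
  by (simp add: gcomp_def)

lemma comp_add: "gcomp \<phi> v (f + g) = gcomp \<phi> v f + gcomp \<phi> v g"
  by (rule poly_mapping_eqI) (simp add: lookup_comp lookup_add)

lemma comp_diff: "gcomp \<phi> v (f - g) = gcomp \<phi> v f - gcomp \<phi> v g"
  by (rule poly_mapping_eqI) (simp add: lookup_comp lookup_minus)

lemma comp_sum: "gcomp \<phi> v (\<Sum>i\<in>A. f i) = (\<Sum>i\<in>A. gcomp \<phi> v (f i))"
  by (rule poly_mapping_eqI) (simp add: lookup_comp lookup_sum)

lemma sum_comp: "(\<Sum>v\<in>\<phi> ` Poly_Mapping.keys f. gcomp \<phi> v f) = f"
proof (rule poly_mapping_eqI)
  fix \<nu>
  show "Poly_Mapping.lookup (\<Sum>v\<in>\<phi> ` Poly_Mapping.keys f. gcomp \<phi> v f) \<nu> = Poly_Mapping.lookup f \<nu>"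
    by (auto simp: lookup_sum lookup_comp sum.delta in_keys_iff)
qed

lemma hg_0 [simp]: "hg \<phi> v 0"
  by (simp add: hg_def)

lemma hg_lookup: "hg \<phi> v f \<longleftrightarrow> (\<forall>\<nu>. Poly_Mapping.lookup f \<nu> \<noteq> 0 \<longrightarrow> \<phi> \<nu> = v)"
  by (auto simp: hg_def in_keys_iff)

lemma hg_add: "hg \<phi> v f \<Longrightarrow> hg \<phi> v g \<Longrightarrow> hg \<phi> v (f + g)"
  unfolding hg_lookup by (metis add.right_neutral lookup_add)

lemma hg_diff: "hg \<phi> v f \<Longrightarrow> hg \<phi> v g \<Longrightarrow> hg \<phi> v (f - g)"
  unfolding hg_lookup by (metis diff_zero lookup_minus)

lemma hg_sum: "(\<And>i. i \<in> A \<Longrightarrow> hg \<phi> v (f i)) \<Longrightarrow> hg \<phi> v (\<Sum>i\<in>A. f i)"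
  by (induction A rule: infinite_finite_induct) (auto intro: hg_add)

lemma hg_comp_other: "hg \<phi> v f \<Longrightarrow> hg \<phi> v (gcomp \<psi> w f)"
  by (auto simp: hg_def keys_comp)

lemma hg_single: "hg \<phi> (\<phi> \<nu>) (Poly_Mapping.single \<nu> c)"
  by (simp add: hg_def)

lemma hg_mult:
  assumes "\<And>\<mu> \<nu>. \<phi> (\<mu> + \<nu>) = \<phi> \<mu> + \<phi> \<nu>" "hg \<phi> v f" "hg \<phi> w g"
  shows "hg \<phi> (v + w) (f * g)"
  using keys_mult[of f g] assms by (fastforce simp: hg_def)

lemma mult_sum_single: "f * g = (\<Sum>\<mu>\<in>Poly_Mapping.keys f. Poly_Mapping.single \<mu> (Poly_Mapping.lookup f \<mu>) * g)"
  by (simp only: sum_distrib_right[symmetric] sum_single_lookup)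

lemma gr_span:
  fixes \<phi> :: "('v \<Rightarrow>\<^sub>0 nat) \<Rightarrow> 'w::ab_semigroup_add"
  assumes add: "\<And>\<mu> \<nu>. \<phi> (\<mu> + \<nu>) = \<phi> \<mu> + \<phi> \<nu>" and hom: "\<And>x. x \<in> X \<Longrightarrow> \<exists>v. hg \<phi> v x"
  shows "gr \<phi> (rm.span X)"
proof -
  have "\<forall>v. gcomp \<phi> v f \<in> rm.span X" if "f \<in> rm.span X" for f
    using that
  proof (induction rule: rm.span_induct_alt)
    case base
    then show ?case by (simp add: rm.span_zero)
  next
    case (step c x y)
    obtain w where w: "hg \<phi> w x" using hom step.hyps by blast
    have "gcomp \<phi> v (c * x) \<in> rm.span X" for v
    proof -
      have "gcomp \<phi> v (c * x) = (\<Sum>\<mu>\<in>Poly_Mapping.keys c. gcomp \<phi> v (Poly_Mapping.single \<mu> (Poly_Mapping.lookup c \<mu>) * x))"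
        by (subst mult_sum_single) (simp add: comp_sum)
      also have "\<dots> \<in> rm.span X"
      proof (rule rm.span_sum)
        fix \<mu>
        have "hg \<phi> (\<phi> \<mu> + w) (Poly_Mapping.single \<mu> (Poly_Mapping.lookup c \<mu>) * x)"
          by (intro hg_mult add hg_single w)
        then show "gcomp \<phi> v (Poly_Mapping.single \<mu> (Poly_Mapping.lookup c \<mu>) * x) \<in> rm.span X"
          using step.hyps by (auto simp: comp_hg rm.span_zero rm.span_base intro!: rm.span_scale)
      qed
      finally show ?thesis .
    qed
    with step.IH show ?case by (simp add: comp_add rm.span_add)
  qed
  then show ?thesis by (simp add: gr_def)
qed

lemma gr_idl: "gr \<phi> J \<Longrightarrow> idl J"
  by (simp add: gr_def)

lemma gr_decomp: "gr \<phi> J \<Longrightarrow> f \<in> J \<longleftrightarrow> (\<forall>v. gcomp \<phi> v f \<in> J)"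
  using rm.subspace_sum[of J "\<phi> ` Poly_Mapping.keys f" "\<lambda>v. gcomp \<phi> v f"] by (auto simp: gr_def sum_comp)

text \<open>Multiplication by a homogeneous element shifts degrees, and cancellation among the
  degrees guarantees that only the component of degree \<open>v\<close> moves to
  \<open>v + w\<close>.\<close>

lemma comp_mult_hg:
  fixes \<phi> :: "('v \<Rightarrow>\<^sub>0 nat) \<Rightarrow> 'w::cancel_ab_semigroup_add"
  assumes add: "\<And>\<mu> \<nu>. \<phi> (\<mu> + \<nu>) = \<phi> \<mu> + \<phi> \<nu>" and g: "hg \<phi> w g"
  shows "gcomp \<phi> (v + w) (f * g) = gcomp \<phi> v f * g"
proof -
  have "f * g = (\<Sum>u\<in>\<phi> ` Poly_Mapping.keys f. gcomp \<phi> u f * g)"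
    by (simp only: sum_distrib_right[symmetric] sum_comp)
  then have "gcomp \<phi> (v + w) (f * g) = (\<Sum>u\<in>\<phi> ` Poly_Mapping.keys f. gcomp \<phi> (v + w) (gcomp \<phi> u f * g))"
    by (simp only: comp_sum)
  also have "\<dots> = (\<Sum>u\<in>\<phi> ` Poly_Mapping.keys f. if u = v then gcomp \<phi> v f * g else 0)"
  proof (rule sum.cong[OF refl])
    fix u
    have "hg \<phi> (u + w) (gcomp \<phi> u f * g)" by (intro hg_mult add hg_comp g)
    then show "gcomp \<phi> (v + w) (gcomp \<phi> u f * g) = (if u = v then gcomp \<phi> v f * g else 0)"
      by (auto simp: comp_hg)
  qed
  also have "\<dots> = gcomp \<phi> v f * g"
  proof (cases "v \<in> \<phi> ` Poly_Mapping.keys f")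
    case False
    then have "gcomp \<phi> v f = 0" unfolding gcomp_def by (intro sum.neutral) auto
    then show ?thesis by simp
  qed (simp add: sum.delta)
  finally show ?thesis .
qed

lemma gr_colon:
  fixes \<phi> :: "('v \<Rightarrow>\<^sub>0 nat) \<Rightarrow> 'w::cancel_ab_semigroup_add"
  assumes add: "\<And>\<mu> \<nu>. \<phi> (\<mu> + \<nu>) = \<phi> \<mu> + \<phi> \<nu>" and J: "gr \<phi> J" and f: "hg \<phi> w f"
  shows "gr \<phi> (colon J f)"
  using J idl_colon[of J f] by (auto simp: gr_def colon_def comp_mult_hg[OF add f, symmetric])

text \<open>For the primality test the lowest components outside of the ideal are compared.\<close>

lemma gr_prime:
  fixes \<phi> :: "('v \<Rightarrow>\<^sub>0 nat) \<Rightarrow> nat"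
  assumes add: "\<And>\<mu> \<nu>. \<phi> (\<mu> + \<nu>) = \<phi> \<mu> + \<phi> \<nu>" and P: "gr \<phi> P" and one: "1 \<notin> P"
    and hom: "\<And>v w a b. hg \<phi> v a \<Longrightarrow> hg \<phi> w b \<Longrightarrow> a * b \<in> P \<Longrightarrow> a \<in> P \<or> b \<in> P"
  shows "prm P"
proof -
  have idl: "idl P" using P by (simp add: gr_def)
  have False if ab: "a * b \<in> P" and a: "a \<notin> P" and b: "b \<notin> P" for a b
  proof -
    obtain i where i: "gcomp \<phi> i a \<notin> P" "\<And>k. k < i \<Longrightarrow> gcomp \<phi> k a \<in> P"
      using a gr_decomp[OF P] exists_least_iff[of "\<lambda>i. gcomp \<phi> i a \<notin> P"] by blast
    obtain j where j: "gcomp \<phi> j b \<notin> P" "\<And>k. k < j \<Longrightarrow> gcomp \<phi> k b \<in> P"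
      using b gr_decomp[OF P] exists_least_iff[of "\<lambda>i. gcomp \<phi> i b \<notin> P"] by blast
    define A where "A = \<phi> ` Poly_Mapping.keys a"
    have fin: "finite A" by (simp add: A_def)
    \<comment> \<open>Everything except the product of the two chosen components drops into
      \<open>P\<close>: for \<open>k < i\<close> the factor from \<open>a\<close> lies in
      \<open>P\<close>, for \<open>i < k \<le> i + j\<close> the matching factor from
      \<open>b\<close> has degree below \<open>j\<close>, and for larger \<open>k\<close> the degree
      exceeds \<open>i + j\<close>.\<close>
    have inP: "gcomp \<phi> (i + j) (gcomp \<phi> k a * b) \<in> P" if "k \<noteq> i" for k
    proof (cases "k < i")
      case True
      then have "gcomp \<phi> k a * b \<in> P" using i idl by (auto intro: idl_mult)
      then show ?thesis using P by (simp add: gr_def)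
    next
      case False
      with that have "i < k" by simp
      show ?thesis
      proof (cases "k \<le> i + j")
        case True
        then obtain l where l: "i + j = l + k" "l < j"
          using \<open>i < k\<close> by (intro that[of "i + j - k"]) auto
        have "gcomp \<phi> (l + k) (b * gcomp \<phi> k a) = gcomp \<phi> l b * gcomp \<phi> k a"
          by (rule comp_mult_hg[OF add hg_comp])
        moreover have "gcomp \<phi> l b * gcomp \<phi> k a \<in> P" using j(2)[OF l(2)] idl by (simp add: idl_mult)
        ultimately show ?thesis by (simp add: l(1) mult.commute[of _ b])
      next
        case False
        have "gcomp \<phi> (i + j) (gcomp \<phi> k a * b) = (\<Sum>l\<in>\<phi> ` Poly_Mapping.keys b. gcomp \<phi> (i + j) (gcomp \<phi> k a * gcomp \<phi> l b))"
          by (simp only: comp_sum[symmetric] sum_distrib_left[symmetric] sum_comp)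
        also have "\<dots> = 0"
        proof (rule sum.neutral, rule ballI)
          fix l
          have "hg \<phi> (k + l) (gcomp \<phi> k a * gcomp \<phi> l b)" by (intro hg_mult add hg_comp)
          then show "gcomp \<phi> (i + j) (gcomp \<phi> k a * gcomp \<phi> l b) = 0"
            using False by (auto simp: comp_hg)
        qed
        finally show ?thesis using idl by (simp add: rm.subspace_0)
      qed
    qed
    have "gcomp \<phi> (i + j) (a * b) = (\<Sum>k\<in>insert i A. gcomp \<phi> (i + j) (gcomp \<phi> k a * b))"
    proof -
      have "a = (\<Sum>k\<in>insert i A. gcomp \<phi> k a)"
      proof (cases "i \<in> A")
        case True then show ?thesis by (simp add: A_def insert_absorb sum_comp)
      next
        case False
        then have "gcomp \<phi> i a = 0" unfolding gcomp_def A_def by (intro sum.neutral) auto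
        then show ?thesis using False by (simp add: fin) (simp add: A_def sum_comp)
      qed
      then have "a * b = (\<Sum>k\<in>insert i A. gcomp \<phi> k a * b)" by (metis sum_distrib_right)
      then show ?thesis by (simp only: comp_sum)
    qed
    also have "\<dots> = gcomp \<phi> (i + j) (gcomp \<phi> i a * b) + (\<Sum>k\<in>A - {i}. gcomp \<phi> (i + j) (gcomp \<phi> k a * b))"
      using fin by (simp add: sum.insert_remove)
    finally have "gcomp \<phi> (i + j) (gcomp \<phi> i a * b) =
        gcomp \<phi> (i + j) (a * b) - (\<Sum>k\<in>A - {i}. gcomp \<phi> (i + j) (gcomp \<phi> k a * b))" by simp
    also have "\<dots> \<in> P"
      using ab P inP idl by (intro rm.subspace_diff rm.subspace_sum) (auto simp: gr_def)
    finally have "gcomp \<phi> (i + j) (gcomp \<phi> i a * b) \<in> P" .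
    moreover have "gcomp \<phi> (j + i) (b * gcomp \<phi> i a) = gcomp \<phi> j b * gcomp \<phi> i a"
      by (rule comp_mult_hg[OF add hg_comp])
    ultimately have "gcomp \<phi> j b * gcomp \<phi> i a \<in> P" by (simp add: add.commute[of j] mult.commute[of b])
    with hom[OF hg_comp hg_comp] i j show False by blast
  qed
  then show ?thesis using idl one by (auto simp: prm_def)
qed

section \<open>Total degree, weights and monomials\<close>

lemma total_degree_add: "total_degree (\<mu> + \<nu>) = total_degree \<mu> + total_degree \<nu>"
  by (simp add: total_degree_def lookup_add sum.distrib)

lemma total_degree_0 [simp]: "total_degree 0 = 0"
  by (simp add: total_degree_def)

lemma total_degree_single: "total_degree (Poly_Mapping.single i k) = k"
  by (simp add: total_degree_def lookup_single when_def sum.delta)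

lemma weight_add: "weight w (\<mu> + \<nu>) = weight w \<mu> + weight w \<nu>"
  by (simp add: weight_def lookup_add sum.distrib algebra_simps)

lemma lookup_le_total_degree: "Poly_Mapping.lookup \<nu> i \<le> total_degree \<nu>"
  unfolding total_degree_def by (rule member_le_sum) auto

lemma total_degree_eq_0: "total_degree \<nu> = 0 \<longleftrightarrow> \<nu> = 0"
  using poly_mapping_eqI[of \<nu> 0] by (auto simp: total_degree_def)

lemma finite_total_degree_le: "finite {\<nu> :: 'n::finite \<Rightarrow>\<^sub>0 nat. total_degree \<nu> \<le> d}"
proof -
  have "inj_on Poly_Mapping.lookup {\<nu> :: 'n \<Rightarrow>\<^sub>0 nat. total_degree \<nu> \<le> d}"
    by (intro inj_onI poly_mapping_eqI) simp
  moreover have "Poly_Mapping.lookup ` {\<nu> :: 'n \<Rightarrow>\<^sub>0 nat. total_degree \<nu> \<le> d} \<subseteq> PiE UNIV (\<lambda>_. {..d})"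
    using order_trans[OF lookup_le_total_degree] by auto
  moreover have "finite (PiE (UNIV :: 'n set) (\<lambda>_. {..d}))"
    by (rule finite_PiE) auto
  ultimately show ?thesis
    using finite_imageD finite_subset by blast
qed

lemma finite_total_degree: "finite {\<nu> :: 'n::finite \<Rightarrow>\<^sub>0 nat. total_degree \<nu> = d}"
  by (rule finite_subset[OF _ finite_total_degree_le[of d]]) auto

lemma mconst_mult: "mconst (a * b) = mconst a * mconst b"
  by (simp add: mconst_def mult_single)

lemma mconst_add: "mconst (a + b) = mconst a + mconst b"
  by (simp add: mconst_def single_add)

lemma mconst_0 [simp]: "mconst 0 = 0" and mconst_1 [simp]: "mconst 1 = 1"
  by (simp_all add: mconst_def)

lemma single_eq_scl: "Poly_Mapping.single \<nu> c = scl c (monomial \<nu>)"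
  by (simp add: scl_def mconst_def monomial_def mult_single)

lemma monomial_add: "(monomial (\<mu> + \<nu>) :: ('v, 'k::comm_ring_1) mpol) = monomial \<mu> * monomial \<nu>"
  by (simp add: monomial_def mult_single)

lemma monomial_0 [simp]: "monomial 0 = 1"
  by (simp add: monomial_def)

lemma mvar_eq_monomial: "mvar i = monomial (Poly_Mapping.single i 1)"
  by (simp add: mvar_def monomial_def)

lemma hg_monomial: "hg \<phi> (\<phi> \<nu>) (monomial \<nu>)"
  by (simp add: monomial_def hg_single)

lemma lookup_scl: "Poly_Mapping.lookup (scl c f) \<nu> = c * Poly_Mapping.lookup f \<nu>"
  by (simp add: scl_def mconst_def mult_map_scale_conv_mult[symmetric])
    (simp add: Poly_Mapping.map.rep_eq when_def)

lemma hg_scl: "hg \<phi> v f \<Longrightarrow> hg \<phi> v (scl c f)"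
  unfolding hg_lookup lookup_scl by (metis mult_zero_right)

lemma idl_scl: "idl J \<Longrightarrow> f \<in> J \<Longrightarrow> scl c f \<in> J"
  by (simp add: scl_def idl_mult)

lemma hom_part_eq: "f \<in> hom_part d \<longleftrightarrow> hg total_degree d f"
  by (simp add: hom_part_def hg_def)

lemma split_var:
  fixes \<nu> :: "'v \<Rightarrow>\<^sub>0 nat"
  assumes "Poly_Mapping.lookup \<nu> i > 0"
  obtains \<mu> where "\<nu> = Poly_Mapping.single i 1 + \<mu>"
proof
  show "\<nu> = Poly_Mapping.single i 1 + (\<nu> - Poly_Mapping.single i 1)"
    using assms by (intro poly_mapping_eqI) (auto simp: lookup_add lookup_minus lookup_single when_def)
qed

lemma in_span_monomials:
  "(\<And>\<nu>. \<nu> \<in> Poly_Mapping.keys f \<Longrightarrow> monomial \<nu> \<in> J) \<Longrightarrow> idl J \<Longrightarrow> f \<in> J"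
  using rm.subspace_sum[of J "Poly_Mapping.keys f" "\<lambda>\<nu>. Poly_Mapping.single \<nu> (Poly_Mapping.lookup f \<nu>)"]
  by (simp add: single_eq_scl idl_scl) (simp add: single_eq_scl[symmetric] sum_single_lookup)

section \<open>Substitution as a ring homomorphism\<close>

locale coeff_hom =
  fixes h :: "'k::comm_ring_1 \<Rightarrow> 'b::comm_ring_1" and x :: "'v::finite \<Rightarrow> 'b"
  assumes h_0: "h 0 = 0" and h_add: "h (a + b) = h a + h b" and h_1: "h 1 = 1" and h_mult: "h (a * b) = h a * h b"
begin

abbreviation "\<sigma> \<equiv> mpol_subst h x"

lemma subst_superset:
  assumes "finite A" "Poly_Mapping.keys f \<subseteq> A"
  shows "\<sigma> f = (\<Sum>\<nu>\<in>A. h (Poly_Mapping.lookup f \<nu>) * (\<Prod>v\<in>UNIV. x v ^ Poly_Mapping.lookup \<nu> v))"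
  unfolding mpol_subst_def using assms
  by (intro sum.mono_neutral_left) (auto simp: in_keys_iff h_0)

lemma subst_add: "\<sigma> (f + g) = \<sigma> f + \<sigma> g"
proof -
  let ?A = "Poly_Mapping.keys f \<union> Poly_Mapping.keys g"
  have "Poly_Mapping.keys (f + g) \<subseteq> ?A" by (rule keys_add)
  then show ?thesis
    by (subst (1 2 3) subst_superset[of ?A]) (auto simp: lookup_add h_add algebra_simps sum.distrib)
qed

lemma subst_0 [simp]: "\<sigma> 0 = 0"
  by (simp add: mpol_subst_def)

lemma subst_sum: "\<sigma> (\<Sum>i\<in>A. f i) = (\<Sum>i\<in>A. \<sigma> (f i))"
  by (induction A rule: infinite_finite_induct) (auto simp: subst_add)

lemma subst_diff: "\<sigma> (f - g) = \<sigma> f - \<sigma> g"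
  by (metis add_diff_cancel_right' diff_add_cancel subst_add)

lemma subst_single: "\<sigma> (Poly_Mapping.single \<nu> c) = h c * (\<Prod>v\<in>UNIV. x v ^ Poly_Mapping.lookup \<nu> v)"
  by (subst subst_superset[of "{\<nu>}"]) auto

lemma subst_single_mult:
  "\<sigma> (Poly_Mapping.single \<mu> c * Poly_Mapping.single \<nu> d) = \<sigma> (Poly_Mapping.single \<mu> c) * \<sigma> (Poly_Mapping.single \<nu> d)"
  by (simp add: subst_single mult_single h_mult lookup_add power_add prod.distrib algebra_simps)

lemma subst_mult: "\<sigma> (f * g) = \<sigma> f * \<sigma> g"
proof -
  have "f * g = (\<Sum>\<mu>\<in>Poly_Mapping.keys f. \<Sum>\<nu>\<in>Poly_Mapping.keys g.
      Poly_Mapping.single \<mu> (Poly_Mapping.lookup f \<mu>) * Poly_Mapping.single \<nu> (Poly_Mapping.lookup g \<nu>))"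
    by (simp add: sum_product[symmetric] sum_single_lookup)
  also have "\<sigma> \<dots> = \<sigma> (\<Sum>\<mu>\<in>Poly_Mapping.keys f. Poly_Mapping.single \<mu> (Poly_Mapping.lookup f \<mu>)) *
      \<sigma> (\<Sum>\<nu>\<in>Poly_Mapping.keys g. Poly_Mapping.single \<nu> (Poly_Mapping.lookup g \<nu>))"
    by (simp only: subst_sum subst_single_mult sum_product)
  finally show ?thesis by (simp only: sum_single_lookup)
qed

lemma subst_mconst [simp]: "\<sigma> (mconst c) = h c"
  by (simp add: mconst_def subst_single)

lemma subst_1 [simp]: "\<sigma> 1 = 1"
  using subst_mconst[of 1] by (simp only: mconst_1 h_1)

lemma subst_mvar [simp]: "\<sigma> (mvar i) = x i"
proof -
  have "x v ^ Poly_Mapping.lookup (Poly_Mapping.single i (1::nat)) v = (if v = i then x i else 1)" for v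
    by (auto simp: lookup_single when_def)
  then show ?thesis by (simp add: mvar_def subst_single h_1)
qed

lemma subst_scl: "\<sigma> (scl c f) = h c * \<sigma> f"
  by (simp add: scl_def subst_mult)

lemma subst_monomial: "\<sigma> (monomial \<nu>) = (\<Prod>v\<in>UNIV. x v ^ Poly_Mapping.lookup \<nu> v)"
  by (simp add: monomial_def subst_single h_1)

end

lemma monomial_eq_prod: "(monomial \<nu> :: ('v::finite, 'k::comm_ring_1) mpol) = (\<Prod>v\<in>UNIV. mvar v ^ Poly_Mapping.lookup \<nu> v)"
proof -
  have pow: "(mvar v :: ('v, 'k) mpol) ^ k = monomial (Poly_Mapping.single v k)" for v :: 'v and k
    by (induction k) (auto simp: mvar_eq_monomial monomial_add[symmetric] single_add[symmetric])
  have "(\<Prod>v\<in>A. monomial (s v)) = (monomial (\<Sum>v\<in>A. s v) :: ('v, 'k) mpol)" for A :: "'v set" and s :: "'v \<Rightarrow> 'v \<Rightarrow>\<^sub>0 nat"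
    by (induction A rule: infinite_finite_induct) (auto simp: monomial_add)
  moreover have "(\<Sum>v\<in>UNIV. Poly_Mapping.single v (Poly_Mapping.lookup \<nu> v)) = \<nu>"
    by (rule poly_mapping_eqI) (simp add: lookup_sum lookup_single when_def)
  ultimately show ?thesis unfolding pow by (simp only:)
qed

text \<open>Constants and variables generate the ring, so identities between substitutions need only
  be checked on them; the composition law of linear substitutions is obtained in this way.\<close>

lemma mpol_hom_eq:
  fixes F :: "('v::finite, 'k::comm_ring_1) mpol \<Rightarrow> 'b::comm_ring_1"
  assumes F: "\<And>f g. F (f + g) = F f + F g" "\<And>f g. F (f * g) = F f * F g" "F 1 = 1" "F 0 = 0"
    and G: "\<And>f g. G (f + g) = G f + G g" "\<And>f g. G (f * g) = G f * G g" "G 1 = 1" "G 0 = 0"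
    and c: "\<And>c. F (mconst c) = G (mconst c)" and v: "\<And>i. F (mvar i) = G (mvar i)"
  shows "F f = G f"
proof -
  have pow: "F (f ^ k) = F f ^ k" "G (f ^ k) = G f ^ k" for f k
    by (induction k) (auto simp: F G)
  have pr: "F (\<Prod>i\<in>A. f i) = (\<Prod>i\<in>A. F (f i))" "G (\<Prod>i\<in>A. f i) = (\<Prod>i\<in>A. G (f i))" for A :: "'v set" and f
    by (induction A rule: infinite_finite_induct) (auto simp: F G)
  have m: "F (monomial \<nu>) = G (monomial \<nu>)" for \<nu>
    by (simp add: monomial_eq_prod pr pow v)
  have s: "F (\<Sum>i\<in>A. f i) = (\<Sum>i\<in>A. F (f i))" "G (\<Sum>i\<in>A. f i) = (\<Sum>i\<in>A. G (f i))" for A :: "('v \<Rightarrow>\<^sub>0 nat) set" and f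
    by (induction A rule: infinite_finite_induct) (auto simp: F G)
  have "F (\<Sum>\<nu>\<in>Poly_Mapping.keys f. Poly_Mapping.single \<nu> (Poly_Mapping.lookup f \<nu>)) =
      G (\<Sum>\<nu>\<in>Poly_Mapping.keys f. Poly_Mapping.single \<nu> (Poly_Mapping.lookup f \<nu>))"
    unfolding s single_eq_scl scl_def F(2) G(2) c m ..
  then show ?thesis by (simp only: sum_single_lookup)
qed

section \<open>Finite-dimensional subspaces and Hilbert functions\<close>

context vector_space
begin

text \<open>\<open>dim\<close> is the size of a basis and hence 0 for infinite-dimensional spaces
  such as a whole polynomial ring. This is why the lemmas below carry finite spanning sets of the
  ambient spaces.\<close>

lemma finite_basis:
  assumes "subspace V" "V \<subseteq> span W" "finite W"
  obtains A where "A \<subseteq> V" "independent A" "finite A" "span A = V" "card A = dim V"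
proof -
  obtain A where A: "A \<subseteq> V" "independent A" "V \<subseteq> span A" "card A = dim V"
    using basis_exists[of V] by blast
  moreover have "finite A"
    using independent_span_bound[OF assms(3) A(2)] A(1) assms(2) by blast
  moreover have "span A = V" using A assms(1) span_subspace by blast
  ultimately show ?thesis using that by blast
qed

lemma dim_le_of_subset:
  assumes "U \<subseteq> V" "V \<subseteq> span W" "finite W"
  shows "dim U \<le> dim V"
proof -
  have "span V \<subseteq> span W" using assms(2) by (simp add: span_minimal)
  then obtain A where A: "finite A" "span A = span V" "card A = dim (span V)"
    using finite_basis[OF subspace_span _ assms(3), of V] by metis
  then have "U \<subseteq> span A" using assms(1) span_superset by blast
  then show ?thesis using dim_le_card[of U A] A by simp
qed

text \<open>Extending a basis of \<open>U\<close> inside a given spanning set \<open>M\<close> keeps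
  control over the new vectors; taking monomials for \<open>M\<close> yields monomial
  complements.\<close>

lemma basis_extension:
  assumes "subspace U" "subspace V" "U \<subseteq> V" "V \<subseteq> span W" "finite W" "V \<subseteq> span M" "M \<subseteq> V"
  obtains A B where "finite A" "finite B" "A \<inter> B = {}" "independent (A \<union> B)" "span A = U"
    "span (A \<union> B) = V" "card A = dim U" "card A + card B = dim V" "B \<subseteq> M"
proof -
  obtain A where A: "A \<subseteq> U" "independent A" "finite A" "span A = U" "card A = dim U"
    using finite_basis[of U W] assms by blast
  obtain C where C: "A \<subseteq> C" "C \<subseteq> A \<union> M" "independent C" "A \<union> M \<subseteq> span C"
    using maximal_independent_subset_extend[of A "A \<union> M"] A by blast
  have spC: "span C = V"
  proof (rule span_subspace)
    show "C \<subseteq> V" using C A assms by blast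
    show "V \<subseteq> span C" using assms(6) C(4) span_minimal[of M "span C"] by auto
  qed (fact assms)
  then have fin: "finite C"
    using independent_span_bound[OF assms(5) C(3)] assms(4) span_superset by blast
  have "card C = dim V" using spC dim_span_eq_card_independent[OF C(3)] by simp
  moreover have "card C = card A + card (C - A)"
    using C fin by (metis Diff_disjoint Diff_partition card_Un_disjoint finite_Diff finite_subset)
  ultimately show ?thesis
    using that[of A "C - A"] A C fin spC by (auto simp: Un_absorb1)
qed

lemma dim_eq_imp_eq:
  assumes "subspace U" "subspace V" "U \<subseteq> V" "V \<subseteq> span W" "finite W" "dim V \<le> dim U"
  shows "U = V"
proof -
  obtain A B where "finite A" "finite B" "span A = U" "span (A \<union> B) = V" "card A = dim U" "card A + card B = dim V"
    using basis_extension[OF assms(1-5), of V] span_superset by (metis order_refl)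
  then have "card B = 0" using assms(6) by linarith
  then show ?thesis using \<open>finite B\<close> \<open>span A = U\<close> \<open>span (A \<union> B) = V\<close> by simp
qed

lemma span_Int_of_independent:
  assumes "finite B" "independent (A \<union> B)" "A \<inter> B = {}" "v \<in> span A" "v \<in> span B"
  shows "v = 0"
  using assms
proof (induction B arbitrary: v rule: finite_induct)
  case empty
  then show ?case by simp
next
  case (insert b B)
  obtain k where k: "v - scale k b \<in> span B" using insert.prems span_breakdown_eq by blast
  have ib: "b \<notin> span (A \<union> B)" "independent (A \<union> B)"
    using insert.prems insert.hyps by (auto simp: independent_insert)
  have "v \<in> span (A \<union> B)" "v - scale k b \<in> span (A \<union> B)"
    using k insert.prems span_mono[of A "A \<union> B"] span_mono[of B "A \<union> B"] by auto
  then have "v - (v - scale k b) \<in> span (A \<union> B)" by (rule span_diff)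
  then have "k = 0" using ib span_scale[of "scale k b" "A \<union> B" "inverse k"] by (cases "k = 0") auto
  then show ?case using insert k ib by auto
qed

lemma independent_Un_image:
  assumes f: "Vector_Spaces.linear scale scale f" and C: "independent C" and X: "span C = X"
    and "finite C" "finite B" "independent B" and inj: "\<And>v. v \<in> span B \<Longrightarrow> f v \<in> X \<Longrightarrow> v = 0"
  shows "independent (C \<union> f ` B) \<and> finite (C \<union> f ` B) \<and> card (C \<union> f ` B) = card C + card B"
  using assms(5-7)
proof (induction B rule: finite_induct)
  case empty
  then show ?case using assms by simp
next
  case (insert b B)
  interpret f: Vector_Spaces.linear scale scale f by (fact f)
  have IH: "independent (C \<union> f ` B)" "finite (C \<union> f ` B)" "card (C \<union> f ` B) = card C + card B"
    using insert.IH insert.prems independent_mono[of "insert b B" B] span_mono[of B "insert b B"] by blast+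
  have "f b \<notin> span (C \<union> f ` B)"
  proof
    assume "f b \<in> span (C \<union> f ` B)"
    then obtain x v where xv: "f b = x + f v" "x \<in> X" "v \<in> span B"
      unfolding span_Un X f.span_image by auto
    then have "f (b - v) \<in> X" by (simp add: f.diff)
    moreover have "b - v \<in> span (insert b B)"
      using xv(3) span_mono[OF subset_insertI[of B b]] by (auto intro: span_diff span_base)
    ultimately have "b - v = 0" by (intro insert.prems(2))
    then have "b \<in> span B" using xv(3) by simp
    then show False using insert by (simp add: independent_insert)
  qed
  then show ?case using IH insert.hyps span_superset[of "C \<union> f ` B"]
    by (auto simp: independent_insert)
qed

text \<open>Rank-nullity for the map that sends a pair \<open>(x, v)\<close> to
  \<open>x + f v\<close>, whose kernel is isomorphic to the space of those \<open>v\<close> with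
  \<open>f v\<close> in \<open>X\<close>. For \<open>f\<close> the multiplication by a polynomial
  this counts dimensions in the sequence that relates an ideal, its colon ideal and its sum with the
  polynomial.\<close>

lemma dim_sum_image:
  assumes f: "Vector_Spaces.linear scale scale f" and "subspace X" "X \<subseteq> span W" "finite W"
    and "subspace V" "V \<subseteq> span W'" "finite W'"
  shows "dim {x + f v | x v. x \<in> X \<and> v \<in> V} + dim {v \<in> V. f v \<in> X} = dim X + dim V"
proof -
  interpret f: Vector_Spaces.linear scale scale f by (fact f)
  let ?U = "{v \<in> V. f v \<in> X}"
  have "subspace ?U"
    using subspace_inter[OF assms(5) f.subspace_linear_preimage[OF assms(2)]] by (simp add: Int_def)
  then obtain A B where AB: "finite A" "finite B" "A \<inter> B = {}" "independent (A \<union> B)" "span A = ?U"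
    "span (A \<union> B) = V" "card A = dim ?U" "card A + card B = dim V"
    using basis_extension[of ?U V W' V] assms span_superset by (metis (no_types, lifting) mem_Collect_eq order_refl subsetI)
  obtain C where C: "independent C" "finite C" "span C = X" "card C = dim X"
    using finite_basis[OF assms(2-4)] by metis
  have iB: "independent B" using AB independent_mono by blast
  have "v = 0" if v: "v \<in> span B" "f v \<in> X" for v
  proof -
    have "v \<in> span A" using v AB span_mono[of B "A \<union> B"] by auto
    then show ?thesis using span_Int_of_independent[of B A v] v(1) AB by blast
  qed
  then have B: "independent (C \<union> f ` B)" "card (C \<union> f ` B) = card C + card B"
    using independent_Un_image[OF f C(1,3,2) AB(2) iB] by blast+
  have "span (C \<union> f ` B) = {x + f v | x v. x \<in> X \<and> v \<in> V}"
  proof -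
    have "x + f v \<in> span (C \<union> f ` B)" if "x \<in> X" "v \<in> V" for x v
    proof -
      obtain a b where "v = a + b" "a \<in> span A" "b \<in> span B" using \<open>v \<in> V\<close> AB(6) unfolding span_Un by blast
      then have "x + f v = (x + f a) + f b" "x + f a \<in> span C" "f b \<in> span (f ` B)"
        using AB(5) C(3) that(1) assms(2) by (auto simp: f.add f.span_image subspace_add)
      then show ?thesis unfolding span_Un by blast
    qed
    moreover have "\<exists>x v. y = x + f v \<and> x \<in> X \<and> v \<in> V" if y: "y \<in> span (C \<union> f ` B)" for y
    proof -
      obtain x v where "y = x + f v" "x \<in> X" "v \<in> span B" using y unfolding span_Un C(3) f.span_image by blast
      moreover have "span B \<subseteq> V" using AB(6) span_mono[of B "A \<union> B"] by blast
      ultimately show ?thesis by blast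
    qed
    ultimately show ?thesis by blast
  qed
  then have "dim {x + f v | x v. x \<in> X \<and> v \<in> V} = card C + card B"
    using dim_span_eq_card_independent[OF B(1)] B(2) by simp
  then show ?thesis using AB C by simp
qed

lemma dim_sum_Int:
  assumes "subspace X" "X \<subseteq> span W" "finite W" "subspace V" "V \<subseteq> span W'" "finite W'"
  shows "dim {x + v | x v. x \<in> X \<and> v \<in> V} + dim (V \<inter> X) = dim X + dim V"
  using dim_sum_image[of "\<lambda>v. v", OF _ assms] vector_space_axioms
  by (simp add: Vector_Spaces.linear_iff Int_def)

text \<open>Applied to the monomials of one degree, basis exchange provides standard monomials, also
  for weights that are not term orders.\<close>

lemma complement_from_spanning_set:
  assumes "subspace U" "U \<subseteq> span M" "finite M"
  obtains N where "N \<subseteq> M" "independent N" "finite N" "U \<inter> span N = {0}" "card N + dim U = dim (span M)"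
proof -
  obtain A B where AB: "finite A" "finite B" "A \<inter> B = {}" "independent (A \<union> B)" "span A = U"
    "span (A \<union> B) = span M" "card A = dim U" "card A + card B = dim (span M)" "B \<subseteq> M"
    using basis_extension[of U "span M" M M] assms span_superset by auto
  have iB: "independent B" using AB independent_mono by blast
  have "dim {x + v | x v. x \<in> U \<and> v \<in> span B} + dim (span B \<inter> U) = dim U + dim (span B)"
    by (rule dim_sum_Int[of U M "span B" B]) (use assms AB in auto)
  moreover have "{x + v | x v. x \<in> U \<and> v \<in> span B} = span M"
    using AB(5,6) by (simp add: span_Un)
  ultimately have "dim (span B \<inter> U) = 0"
    using AB dim_span_eq_card_independent[OF iB] by simp
  moreover have "subspace (U \<inter> span B)" by (simp add: assms(1) subspace_inter)
  ultimately have "U \<inter> span B = {0}"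
    using dim_eq_imp_eq[of "{0}" "U \<inter> span B" M] assms subspace_0 by (simp add: Int_commute) blast
  then show ?thesis using that[of B] AB iB by simp
qed

lemma dim_inj_image:
  assumes f: "Vector_Spaces.linear scale scale f" and "inj_on f V" "subspace V"
  shows "dim (f ` V) = dim V"
proof -
  interpret f: Vector_Spaces.linear scale scale f by (fact f)
  obtain B where B: "B \<subseteq> V" "independent B" "V \<subseteq> span B" "card B = dim V"
    using basis_exists by blast
  then have sp: "span B = V" using assms(3) span_subspace by blast
  have "independent (f ` B)" using f.independent_injective_image B(2) assms(2) sp by blast
  moreover have "card (f ` B) = card B" using assms(2) B(1) by (meson card_image inj_on_subset)
  moreover have "span (f ` B) = f ` V" by (simp add: f.span_image sp)
  ultimately show ?thesis using B(4) dim_span_eq_card_independent by metis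
qed

end

section \<open>The polynomial ring as a vector space over its coefficients\<close>

lemma scl_mult_left: "scl c f * g = scl c (f * g)"
  by (simp add: scl_def mult.assoc)

lemma scl_mult_right: "f * scl c g = scl c (f * g)"
  by (simp add: scl_def mult.left_commute)

global_interpretation Kv: vector_space "scl :: 'k::field \<Rightarrow> ('v, 'k) mpol \<Rightarrow> ('v, 'k) mpol"
  by unfold_locales (simp_all add: scl_def mconst_add mconst_mult distrib_left distrib_right mult.assoc)

definition Sp :: "('v \<Rightarrow>\<^sub>0 nat) set \<Rightarrow> ('v, 'k::field) mpol set" where
  "Sp M = {f. Poly_Mapping.keys f \<subseteq> M}"

lemma Sp_iff: "f \<in> Sp M \<longleftrightarrow> (\<forall>\<nu>. \<nu> \<notin> M \<longrightarrow> Poly_Mapping.lookup f \<nu> = 0)"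
  by (auto simp: Sp_def in_keys_iff)

lemma subspace_Sp [simp]: "Kv.subspace (Sp M)"
  by (rule Kv.subspaceI) (auto simp: Sp_iff lookup_add lookup_scl)

lemma span_monomials: "Kv.span (monomial ` M) = Sp M"
proof (rule Kv.span_subspace)
  show "monomial ` M \<subseteq> Sp M" by (auto simp: Sp_def monomial_def)
  show "Sp M \<subseteq> Kv.span (monomial ` M)"
  proof
    fix f assume "f \<in> Sp M"
    then have "(\<Sum>\<nu>\<in>Poly_Mapping.keys f. Poly_Mapping.single \<nu> (Poly_Mapping.lookup f \<nu>)) \<in> Kv.span (monomial ` M)"
      unfolding single_eq_scl by (intro Kv.span_sum Kv.span_scale Kv.span_base) (auto simp: Sp_def)
    then show "f \<in> Kv.span (monomial ` M)" by (simp only: sum_single_lookup)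
  qed
qed simp

lemma inj_monomial: "inj (monomial :: ('v \<Rightarrow>\<^sub>0 nat) \<Rightarrow> ('v, 'k::comm_ring_1) mpol)"
  by (intro injI) (metis keys_single monomial_def singleton_inject zero_neq_one)

lemma independent_monomials: "Kv.independent (monomial ` M :: ('v, 'k::field) mpol set)"
proof -
  have "\<not> Kv.dependent (monomial ` M :: ('v, 'k) mpol set)"
    unfolding Kv.dependent_def
  proof clarsimp
    fix \<nu> assume "(monomial \<nu> :: ('v, 'k) mpol) \<in> Kv.span (monomial ` M - {monomial \<nu>})"
    moreover have "monomial ` M - {monomial \<nu> :: ('v, 'k) mpol} = monomial ` (M - {\<nu>})"
      using inj_monomial by (auto simp: inj_def)
    ultimately have "(monomial \<nu> :: ('v, 'k) mpol) \<in> Sp (M - {\<nu>})"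
      by (simp add: span_monomials)
    then show False by (simp add: Sp_def monomial_def)
  qed
  then show ?thesis .
qed

lemma dim_Sp: "Kv.dim (Sp M :: ('v, 'k::field) mpol set) = card M"
  using Kv.dim_span_eq_card_independent[OF independent_monomials[of M]]
    card_image[OF inj_on_subset[OF inj_monomial[where 'k='k] subset_UNIV[of M]]]
  by (metis span_monomials)

lemma hom_part_Sp: "hom_part d = Sp {\<nu>. total_degree \<nu> = d}"
  by (auto simp: hom_part_def Sp_def)

lemma idl_Kv: "idl J \<Longrightarrow> Kv.subspace J"
  by (rule Kv.subspaceI) (auto simp: rm.subspace_0 rm.subspace_add idl_scl)

section \<open>Hilbert functions of ideals\<close>

definition degle :: "nat \<Rightarrow> ('v::finite \<Rightarrow>\<^sub>0 nat) set" where
  "degle d = {\<nu>. total_degree \<nu> \<le> d}"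

definition hf :: "('v::finite, 'k::field) mpol set \<Rightarrow> nat \<Rightarrow> nat" where
  "hf J d = Kv.dim (hom_part d :: ('v, 'k) mpol set) - Kv.dim (J \<inter> hom_part d)"

text \<open>The affine Hilbert function, counting degrees up to \<open>d\<close>. Unlike
  \<open>hf\<close> it is informative for primes that are not graded, and such primes occur in
  chains.\<close>

definition hc :: "('v::finite, 'k::field) mpol set \<Rightarrow> nat \<Rightarrow> nat" where
  "hc J d = Kv.dim (Sp (degle d) :: ('v, 'k) mpol set) - Kv.dim (J \<inter> Sp (degle d))"

lemma finite_degle [simp]: "finite (degle d)"
  by (simp add: degle_def finite_total_degree_le)

lemma Kv_dim_mono: "U \<subseteq> V \<Longrightarrow> V \<subseteq> Sp M \<Longrightarrow> finite M \<Longrightarrow> Kv.dim U \<le> Kv.dim V"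
  using Kv.dim_le_of_subset[of U V "monomial ` M"] by (simp add: span_monomials)

lemma Kv_dim_eq: "Kv.subspace U \<Longrightarrow> Kv.subspace V \<Longrightarrow> U \<subseteq> V \<Longrightarrow> V \<subseteq> Sp M \<Longrightarrow> finite M \<Longrightarrow> Kv.dim V \<le> Kv.dim U \<Longrightarrow> U = V"
  using Kv.dim_eq_imp_eq[of U V "monomial ` M"] by (simp add: span_monomials)

lemma linear_mult: "Vector_Spaces.linear scl scl (\<lambda>v. v * f)"
  by (simp add: Vector_Spaces.linear_iff Kv.vector_space_axioms distrib_right scl_mult_left)

lemma dim_add_mult:
  fixes X :: "('v, 'k::field) mpol set"
  assumes "Kv.subspace X" "X \<subseteq> Sp M" "finite M" "finite M'"
  shows "Kv.dim {x + v * f | x v. x \<in> X \<and> v \<in> Sp M'} + Kv.dim {v \<in> Sp M'. v * f \<in> X} = Kv.dim X + Kv.dim (Sp M' :: ('v, 'k) mpol set)"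
  by (rule Kv.dim_sum_image[OF linear_mult, of X "monomial ` M" "Sp M'" "monomial ` M'"])
    (use assms in \<open>auto simp: span_monomials\<close>)

lemma hf_le: "J \<subseteq> J' \<Longrightarrow> hf J' d \<le> hf J d"
  unfolding hf_def hom_part_Sp
  by (intro diff_le_mono2 Kv_dim_mono[OF _ _ finite_total_degree]) auto

lemma hf_add:
  fixes J :: "('v::finite, 'k::field) mpol set"
  shows "hf J d + Kv.dim (J \<inter> hom_part d) = Kv.dim (hom_part d :: ('v, 'k) mpol set)"
  unfolding hf_def hom_part_Sp
  by (intro le_add_diff_inverse2 Kv_dim_mono[OF _ _ finite_total_degree]) auto

lemma hc_add:
  fixes J :: "('v::finite, 'k::field) mpol set"
  shows "hc J d + Kv.dim (J \<inter> Sp (degle d)) = Kv.dim (Sp (degle d) :: ('v, 'k) mpol set)"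
  unfolding hc_def by (intro le_add_diff_inverse2 Kv_dim_mono[OF _ _ finite_degle]) auto

lemma hc_0:
  fixes J :: "('v::finite, 'k::field) mpol set"
  assumes J: "1 \<notin> J" "idl J"
  shows "1 \<le> hc J d"
proof (rule ccontr)
  assume "\<not> 1 \<le> hc J d"
  then have "Kv.dim (Sp (degle d) :: ('v, 'k) mpol set) \<le> Kv.dim (J \<inter> Sp (degle d))"
    using hc_add[of J d] by simp
  then have "J \<inter> Sp (degle d) = Sp (degle d)"
    using J by (intro Kv_dim_eq[OF _ _ _ _ finite_degle]) (auto intro: Kv.subspace_inter idl_Kv)
  moreover have "(1 :: ('v, 'k) mpol) \<in> Sp (degle d)" by (simp add: Sp_def degle_def)
  ultimately show False using J by blast
qed

text \<open>In each degree the inclusion is one of finite-dimensional spaces of equal dimension.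
  Initial ideals keep the Hilbert function of the original ideal, so for them one inclusion will
  suffice.\<close>

lemma hf_eq_imp_eq:
  assumes "J \<subseteq> J'" "gr total_degree J" "gr total_degree J'" "\<And>d. hf J d = hf J' d"
  shows "J = J'"
proof -
  have "J \<inter> hom_part d = J' \<inter> hom_part d" for d
  proof (rule Kv_dim_eq[OF _ _ _ _ finite_total_degree])
    show "J' \<inter> hom_part d \<subseteq> Sp {\<nu>. total_degree \<nu> = d}" by (simp add: hom_part_Sp)
    show "Kv.dim (J' \<inter> hom_part d) \<le> Kv.dim (J \<inter> hom_part d)"
      using hf_add[of J d] hf_add[of J' d] assms(4)[of d] by simp
  qed (use assms(1) Kv.subspace_inter[OF idl_Kv[OF gr_idl[OF assms(2)]] subspace_Sp]
      Kv.subspace_inter[OF idl_Kv[OF gr_idl[OF assms(3)]] subspace_Sp] in \<open>auto simp: hom_part_Sp\<close>)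
  moreover have "gcomp total_degree d f \<in> hom_part d" for d and f :: "('a, 'b) mpol"
    by (simp add: hom_part_eq hg_comp)
  ultimately have "gcomp total_degree d f \<in> J \<longleftrightarrow> gcomp total_degree d f \<in> J'" for d f
    by blast
  then show ?thesis using gr_decomp[OF assms(2)] gr_decomp[OF assms(3)] by blast
qed

lemma hf_eq_0:
  fixes J :: "('v::finite, 'k::field) mpol set"
  assumes J: "idl J"
  shows "hf J d = 0 \<longleftrightarrow> hom_part d \<subseteq> J"
proof
  assume "hf J d = 0"
  then have "Kv.dim (hom_part d :: ('v, 'k) mpol set) \<le> Kv.dim (J \<inter> hom_part d)" using hf_add[of J d] by simp
  then have "J \<inter> hom_part d = hom_part d"
    using J unfolding hom_part_Sp by (intro Kv_dim_eq[OF _ _ _ _ finite_total_degree[of d]]) (auto intro: Kv.subspace_inter idl_Kv)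
  then show "hom_part d \<subseteq> J" by blast
next
  assume "hom_part d \<subseteq> J"
  then have "J \<inter> hom_part d = hom_part d" by blast
  then show "hf J d = 0" by (simp add: hf_def)
qed

lemma comp_mult_low:
  assumes g: "hg total_degree e g" and "d < e"
  shows "gcomp total_degree d (f * g) = 0"
proof -
  have "f * g = (\<Sum>u\<in>total_degree ` Poly_Mapping.keys f. gcomp total_degree u f * g)"
    by (simp only: sum_distrib_right[symmetric] sum_comp)
  then have "gcomp total_degree d (f * g) = (\<Sum>u\<in>total_degree ` Poly_Mapping.keys f. gcomp total_degree d (gcomp total_degree u f * g))"
    by (simp only: comp_sum)
  also have "\<dots> = 0"
  proof (rule sum.neutral, rule ballI)
    fix u
    have "hg total_degree (u + e) (gcomp total_degree u f * g)"
      by (intro hg_mult total_degree_add hg_comp g)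
    then show "gcomp total_degree d (gcomp total_degree u f * g) = 0" using assms(2) by (simp add: comp_hg)
  qed
  finally show ?thesis .
qed

lemma hf_insert_low:
  assumes J: "gr total_degree J" and f: "hg total_degree e f" and "d < e"
  shows "hf J d = hf (rm.span (insert f J)) d"
proof -
  have "x \<in> J" if x: "x \<in> rm.span (insert f J)" "x \<in> hom_part d" for x
  proof -
    obtain r where r: "x - r * f \<in> J" using x(1) span_insert_idl[OF gr_idl[OF J], of x f] by blast
    then have "gcomp total_degree d (x - r * f) \<in> J" using J by (simp add: gr_def)
    moreover have "gcomp total_degree d x = x" using that(2) by (simp add: hom_part_eq comp_hg)
    ultimately show ?thesis by (simp add: comp_diff comp_mult_low[OF f assms(3)])
  qed
  moreover have "J \<subseteq> rm.span (insert f J)" using rm.span_superset[of "insert f J"] by simp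
  ultimately have "rm.span (insert f J) \<inter> hom_part d = J \<inter> hom_part d"
    by (intro equalityI subsetI) auto
  then show ?thesis by (simp only: hf_def)
qed

text \<open>Dimensions in the exact sequence \<open>0 \<rightarrow> S/(J : f) \<rightarrow> S/J
  \<rightarrow> S/(J + f) \<rightarrow> 0\<close>, whose first map multiplies by \<open>f\<close>
  and raises the degree by \<open>e\<close>.\<close>

lemma hf_insert:
  fixes J :: "('v::finite, 'k::field) mpol set"
  assumes J: "gr total_degree J" and f: "hg total_degree e f"
  shows "hf J (d + e) = hf (rm.span (insert f J)) (d + e) + hf (colon J f) d"
proof -
  let ?X = "J \<inter> hom_part (d + e)" and ?V = "hom_part d :: ('v, 'k) mpol set"
  have idl: "idl J" using J by (rule gr_idl)
  have fv: "v * f \<in> hom_part (d + e)" if "v \<in> ?V" for v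
    using hg_mult[OF total_degree_add, of d v e f] that f by (simp add: hom_part_eq)
  have 1: "{x + v * f | x v. x \<in> ?X \<and> v \<in> ?V} = rm.span (insert f J) \<inter> hom_part (d + e)"
  proof (intro equalityI subsetI)
    fix y assume "y \<in> {x + v * f | x v. x \<in> ?X \<and> v \<in> ?V}"
    then obtain x v where "y = x + v * f" "x \<in> ?X" "v \<in> ?V" by blast
    then show "y \<in> rm.span (insert f J) \<inter> hom_part (d + e)"
      using fv[of v] span_insert_idl[OF idl, of y f] by (auto simp: hom_part_eq intro!: hg_add exI[of _ v])
  next
    fix y assume y: "y \<in> rm.span (insert f J) \<inter> hom_part (d + e)"
    then obtain r where r: "y - r * f \<in> J" using span_insert_idl[OF idl, of y f] by blast
    \<comment> \<open>As \<open>y\<close> and \<open>f\<close> are homogeneous, the coefficient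
      \<open>r\<close> may be replaced by its component of degree \<open>d\<close>.\<close>
    let ?v = "gcomp total_degree d r"
    have "gcomp total_degree (d + e) (y - r * f) \<in> J" using r J by (simp add: gr_def)
    then have "y - ?v * f \<in> J"
      using y comp_hg[of total_degree "d + e" y "d + e"]
      by (simp add: comp_diff comp_mult_hg[OF total_degree_add f] hom_part_eq)
    moreover have v: "?v \<in> ?V" by (simp add: hom_part_eq hg_comp)
    moreover have "y - ?v * f \<in> hom_part (d + e)" using y fv[OF v] by (auto simp: hom_part_eq intro: hg_diff)
    ultimately have "y = (y - ?v * f) + ?v * f \<and> y - ?v * f \<in> ?X \<and> ?v \<in> ?V" by simp
    then show "y \<in> {x + v * f | x v. x \<in> ?X \<and> v \<in> ?V}" by blast
  qed
  have 2: "{v \<in> ?V. v * f \<in> ?X} = colon J f \<inter> ?V"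
    using fv by (auto simp: colon_def)
  have "Kv.dim {x + v * f | x v. x \<in> ?X \<and> v \<in> ?V} + Kv.dim {v \<in> ?V. v * f \<in> ?X} = Kv.dim ?X + Kv.dim ?V"
    unfolding hom_part_Sp
    by (rule dim_add_mult[OF _ _ finite_total_degree finite_total_degree])
      (use idl in \<open>auto intro: Kv.subspace_inter idl_Kv\<close>)
  then show ?thesis unfolding 1 2
    using hf_add[of J "d + e"] hf_add[of "colon J f" d] hf_add[of "rm.span (insert f J)" "d + e"] by linarith
qed

text \<open>Multiplication by \<open>f\<close> is injective modulo the prime \<open>P\<close> and
  has its image in \<open>P'\<close>. The image need not exhaust \<open>P'\<close> in the given
  range of degrees, hence only an inequality.\<close>

lemma hc_prime_chain:
  fixes P :: "('v::finite, 'k::field) mpol set"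
  assumes P: "prm P" "idl P'" "P \<subseteq> P'" "f \<in> P'" "f \<notin> P" "f \<in> Sp (degle e)"
  shows "hc P' (d + e) + hc P d \<le> hc P (d + e)"
proof -
  let ?X = "P \<inter> Sp (degle (d + e))" and ?V = "Sp (degle d) :: ('v, 'k) mpol set"
  have idl: "idl P" using P by (simp add: prm_def)
  have fv: "v * f \<in> Sp (degle (d + e))" if "v \<in> ?V" for v
  proof -
    have "total_degree \<nu> \<le> d + e" if \<nu>: "\<nu> \<in> Poly_Mapping.keys (v * f)" for \<nu>
    proof -
      obtain a b where "\<nu> = a + b" "a \<in> Poly_Mapping.keys v" "b \<in> Poly_Mapping.keys f"
        using keys_mult[of v f] \<nu> by blast
      moreover have "total_degree a \<le> d" "total_degree b \<le> e"
        using calculation \<open>v \<in> ?V\<close> P(6) by (auto simp: Sp_def degle_def)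
      ultimately show ?thesis by (simp add: total_degree_add)
    qed
    then show ?thesis by (auto simp: Sp_def degle_def)
  qed
  have "{x + v * f | x v. x \<in> ?X \<and> v \<in> ?V} \<subseteq> P' \<inter> Sp (degle (d + e))"
  proof -
    have "x + v * f \<in> P' \<inter> Sp (degle (d + e))" if "x \<in> ?X" "v \<in> ?V" for x v
      using that fv[of v] P(2-4) idl_mult[OF P(2)] by (auto intro!: rm.subspace_add[OF P(2)] Kv.subspace_add[OF subspace_Sp])
    then show ?thesis by blast
  qed
  then have 1: "Kv.dim {x + v * f | x v. x \<in> ?X \<and> v \<in> ?V} \<le> Kv.dim (P' \<inter> Sp (degle (d + e)))"
    by (rule Kv_dim_mono[OF _ _ finite_degle[of "d + e"]]) auto
  have 2: "{v \<in> ?V. v * f \<in> ?X} = P \<inter> ?V"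
    using fv colon_prime[OF P(1,5)] by (auto simp: colon_def)
  have "Kv.dim {x + v * f | x v. x \<in> ?X \<and> v \<in> ?V} + Kv.dim {v \<in> ?V. v * f \<in> ?X} = Kv.dim ?X + Kv.dim ?V"
    by (rule dim_add_mult[OF _ _ finite_degle finite_degle])
      (use idl in \<open>auto intro: Kv.subspace_inter idl_Kv\<close>)
  then show ?thesis unfolding 2
    using 1 hc_add[of P "d + e"] hc_add[of P d] hc_add[of P' "d + e"] by linarith
qed

lemma hc_sum:
  fixes J :: "('v::finite, 'k::field) mpol set"
  assumes J: "gr total_degree J"
  shows "hc J d = (\<Sum>j\<le>d. hf J j)"
proof -
  have idl: "idl J" using J by (rule gr_idl)
  have *: "Kv.dim (X \<inter> Sp (degle d)) = (\<Sum>j\<le>d. Kv.dim (X \<inter> hom_part j))" if X: "gr total_degree X"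
    for X :: "('v, 'k) mpol set"
  proof (induction d)
    case 0
    then show ?case by (simp add: degle_def hom_part_Sp)
  next
    case (Suc d)
    let ?A = "X \<inter> Sp (degle d)" and ?B = "X \<inter> hom_part (Suc d)"
    have sX: "Kv.subspace X" using gr_idl[OF X] by (rule idl_Kv)
    have "{x + v | x v. x \<in> ?A \<and> v \<in> ?B} = X \<inter> Sp (degle (Suc d))"
    proof (intro equalityI subsetI)
      fix y assume "y \<in> {x + v | x v. x \<in> ?A \<and> v \<in> ?B}"
      then obtain x v where "y = x + v" "x \<in> ?A" "v \<in> ?B" by blast
      moreover have "x \<in> Sp (degle (Suc d))" "v \<in> Sp (degle (Suc d))"
        using calculation(2,3) by (auto simp: Sp_def degle_def hom_part_def)
      ultimately show "y \<in> X \<inter> Sp (degle (Suc d))"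
        using Kv.subspace_add[OF sX] Kv.subspace_add[OF subspace_Sp] by simp
    next
      fix y assume y: "y \<in> X \<inter> Sp (degle (Suc d))"
      let ?v = "gcomp total_degree (Suc d) y"
      have v: "?v \<in> ?B" using y X by (auto simp: gr_def hom_part_eq hg_comp)
      moreover have "y - ?v \<in> X" using y v Kv.subspace_diff[OF sX, of y ?v] by simp
      moreover have "y - ?v \<in> Sp (degle d)"
        unfolding Sp_iff
      proof (intro allI impI)
        fix \<nu> :: "'v \<Rightarrow>\<^sub>0 nat" assume "\<nu> \<notin> degle d"
        moreover have "Poly_Mapping.lookup y \<nu> = 0" if "\<nu> \<notin> degle (Suc d)" using y that by (simp add: Sp_iff)
        ultimately show "Poly_Mapping.lookup (y - ?v) \<nu> = 0"
          by (auto simp: lookup_minus lookup_comp degle_def)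
      qed
      ultimately have "y = (y - ?v) + ?v \<and> y - ?v \<in> ?A \<and> ?v \<in> ?B" by simp
      then show "y \<in> {x + v | x v. x \<in> ?A \<and> v \<in> ?B}" by blast
    qed
    moreover have "?B \<inter> ?A = {0}"
    proof -
      have "x = 0" if "x \<in> Sp (degle d)" "x \<in> hom_part (Suc d)" for x :: "('v, 'k) mpol"
      proof -
        have "\<nu> \<notin> Poly_Mapping.keys x" for \<nu>
          using that subsetD[of "Poly_Mapping.keys x" "degle d" \<nu>] by (auto simp: Sp_def degle_def hom_part_def)
        then show ?thesis by (metis keys_eq_empty equals0I)
      qed
      moreover have "0 \<in> ?B" "0 \<in> ?A" using Kv.subspace_0[OF sX] by (auto simp: Sp_def hom_part_def)
      ultimately show ?thesis by (intro equalityI subsetI) auto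
    qed
    moreover have "Kv.dim {x + v | x v. x \<in> ?A \<and> v \<in> ?B} + Kv.dim (?B \<inter> ?A) = Kv.dim ?A + Kv.dim ?B"
    proof (rule Kv.dim_sum_Int)
      show "Kv.subspace ?A" "Kv.subspace ?B"
        unfolding hom_part_Sp by (intro Kv.subspace_inter sX subspace_Sp)+
      show "?A \<subseteq> Kv.span (monomial ` degle d)" "?B \<subseteq> Kv.span (monomial ` {\<nu>. total_degree \<nu> = Suc d})"
        by (simp_all add: span_monomials hom_part_Sp)
      show "finite (monomial ` degle d :: ('v, 'k) mpol set)" by simp
      show "finite (monomial ` {\<nu>. total_degree \<nu> = Suc d} :: ('v, 'k) mpol set)" by (simp add: finite_total_degree)
    qed
    moreover have "Kv.dim ({0} :: ('v, 'k) mpol set) = 0" using Kv.dim_le_card[of "{0}" "{}"] by simp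
    ultimately show ?case using Suc by (simp only: sum.atMost_Suc)
  qed
  have "gr total_degree (UNIV :: ('v, 'k) mpol set)" by (simp add: gr_def)
  from *[OF this] have 1: "Kv.dim (Sp (degle d) :: ('v, 'k) mpol set) = (\<Sum>j\<le>d. Kv.dim (hom_part j :: ('v, 'k) mpol set))"
    unfolding Int_UNIV_left .
  have 2: "(\<Sum>j\<le>d. hf J j) + (\<Sum>j\<le>d. Kv.dim (J \<inter> hom_part j)) = (\<Sum>j\<le>d. Kv.dim (hom_part j :: ('v, 'k) mpol set))"
    unfolding sum.distrib[symmetric] hf_add ..
  have "hc J d + (\<Sum>j\<le>d. Kv.dim (J \<inter> hom_part j)) = (\<Sum>j\<le>d. Kv.dim (hom_part j :: ('v, 'k) mpol set))"
    using hc_add[of J d] unfolding 1 *[OF J] .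
  with 2 show ?thesis by (metis add_right_imp_eq)
qed

section \<open>Term orders and the ascending chain condition\<close>

text \<open>Positions 0 and 1 decide the comparison that matters; the full list of exponents from
  position 2 on breaks ties and makes the key injective. Every entry is additive, so the induced
  order respects multiplication.\<close>

definition okey :: "'v set \<Rightarrow> ('v::finite \<Rightarrow>\<^sub>0 nat) \<Rightarrow> nat \<Rightarrow>\<^sub>0 nat" where
  "okey D \<nu> = Poly_Mapping.single 0 (total_degree \<nu>) +
     Poly_Mapping.single 1 (\<Sum>i\<in>- D. Poly_Mapping.lookup \<nu> i) +
     (\<Sum>i\<in>UNIV. Poly_Mapping.single (2 + to_nat i) (Poly_Mapping.lookup \<nu> i))"

text \<open>Finitely supported functions are ordered lexicographically, so terms are compared by their
  degree, then by their degree outside of \<open>D\<close>. On homogeneous polynomials this is a reverse order in the variables of \<open>D\<close>: a leading term in the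
  ideal \<open>(x\<^sub>i : i \<in> D)\<close> forces the polynomial to lie in that ideal.\<close>

definition tord :: "'v set \<Rightarrow> ('v::finite \<Rightarrow>\<^sub>0 nat) rel" where
  "tord D = {(s, t). okey D s \<le> okey D t}"

lemma okey_add: "okey D (\<mu> + \<nu>) = okey D \<mu> + okey D \<nu>"
  by (simp add: okey_def total_degree_add lookup_add sum.distrib single_add ac_simps)

lemma lookup_okey_2: "Poly_Mapping.lookup (okey D \<nu>) (2 + to_nat i) = Poly_Mapping.lookup \<nu> i"
proof -
  have "(\<Sum>j\<in>UNIV. Poly_Mapping.lookup \<nu> j when to_nat j = to_nat i) = (\<Sum>j\<in>UNIV. if j = i then Poly_Mapping.lookup \<nu> j else 0)"
    by (rule sum.cong) (auto simp: when_def)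
  then show ?thesis
    by (simp add: okey_def lookup_add lookup_sum lookup_single)
qed

lemma lookup_okey_0: "Poly_Mapping.lookup (okey D \<nu>) 0 = total_degree \<nu>"
  by (simp add: okey_def lookup_add lookup_sum lookup_single)

lemma lookup_okey_1: "Poly_Mapping.lookup (okey D \<nu>) (Suc 0) = (\<Sum>i\<in>- D. Poly_Mapping.lookup \<nu> i)"
  by (simp add: okey_def lookup_add lookup_sum lookup_single)

lemma okey_inj: "okey D \<mu> = okey D \<nu> \<longleftrightarrow> \<mu> = \<nu>"
  by (metis lookup_okey_2 poly_mapping_eqI)

lemma okey_less_degree: "total_degree \<mu> < total_degree \<nu> \<Longrightarrow> okey D \<mu> < okey D \<nu>"
  unfolding less_poly_mapping.rep_eq less_fun_def
  by (rule exI[of _ 0]) (simp add: lookup_okey_0)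

lemma okey_less_outside:
  assumes "total_degree \<mu> = total_degree \<nu>"
    "(\<Sum>i\<in>- D. Poly_Mapping.lookup \<mu> i) < (\<Sum>i\<in>- D. Poly_Mapping.lookup \<nu> i)"
  shows "okey D \<mu> < okey D \<nu>"
  unfolding less_poly_mapping.rep_eq less_fun_def
  by (rule exI[of _ "Suc 0"]) (use assms in \<open>simp add: lookup_okey_0 lookup_okey_1\<close>)

lemma term_order_tord: "term_order (tord D)"
proof -
  have "linear_order (tord D)"
    by (auto simp: tord_def linear_order_on_def partial_order_on_def preorder_on_def refl_on_def
        trans_def antisym_def total_on_def okey_inj)
  moreover have "okey D 0 \<le> okey D s" for s
  proof (cases "s = 0")
    case False
    then have "total_degree 0 < total_degree s" by (metis gr0I total_degree_0 total_degree_eq_0)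
    then show ?thesis by (intro less_imp_le okey_less_degree)
  qed simp
  ultimately show ?thesis
    by (auto simp: term_order_def tord_def okey_add intro: add_right_mono)
qed

definition is_lead :: "'v set \<Rightarrow> ('v::finite \<Rightarrow>\<^sub>0 nat) \<Rightarrow> ('v, 'k::zero) mpol \<Rightarrow> bool" where
  "is_lead D \<nu> f \<longleftrightarrow> \<nu> \<in> Poly_Mapping.keys f \<and> (\<forall>\<mu>\<in>Poly_Mapping.keys f. okey D \<mu> \<le> okey D \<nu>)"

lemma ex_lead:
  assumes "f \<noteq> 0"
  shows "\<exists>\<nu>. is_lead D \<nu> f"
proof -
  have "okey D ` Poly_Mapping.keys f \<noteq> {}" using assms by simp
  then have "Max (okey D ` Poly_Mapping.keys f) \<in> okey D ` Poly_Mapping.keys f" by (intro Max_in) auto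
  then obtain \<nu> where "\<nu> \<in> Poly_Mapping.keys f" "Max (okey D ` Poly_Mapping.keys f) = okey D \<nu>" by blast
  then show ?thesis unfolding is_lead_def by (metis Max_ge finite_imageI finite_keys imageI)
qed

lemma keys_monomial_mult: "Poly_Mapping.keys (monomial \<mu> * f) = (+) \<mu> ` Poly_Mapping.keys (f :: ('v, 'k::comm_ring_1) mpol)"
proof -
  have "monomial \<mu> * f = (\<Sum>\<nu>\<in>Poly_Mapping.keys f. Poly_Mapping.single (\<mu> + \<nu>) (Poly_Mapping.lookup f \<nu>))"
    by (subst mult.commute, subst mult_sum_single) (simp add: monomial_def mult_single ac_simps)
  also have "\<dots> = (\<Sum>\<nu>\<in>(+) \<mu> ` Poly_Mapping.keys f. Poly_Mapping.single \<nu> (Poly_Mapping.lookup f (\<nu> - \<mu>)))"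
    by (simp add: sum.reindex)
  finally show ?thesis
    by (auto simp: in_keys_iff lookup_sum_single split: if_splits)
qed

lemma is_lead_mult: "is_lead D \<nu> f \<Longrightarrow> is_lead D (\<mu> + \<nu>) (monomial \<mu> * f :: ('v::finite, 'k::comm_ring_1) mpol)"
  by (auto simp: is_lead_def keys_monomial_mult okey_add)

definition lexps :: "('v::finite, 'k::zero) mpol set \<Rightarrow> ('v \<Rightarrow>\<^sub>0 nat) set" where
  "lexps J = {\<nu>. \<exists>f\<in>J. is_lead {} \<nu> f}"

lemma cancel_lead:
  fixes f g :: "('v::finite, 'k::field) mpol"
  assumes "is_lead D \<nu> f" "is_lead D \<nu> g" "\<mu> \<in> Poly_Mapping.keys (f - scl (Poly_Mapping.lookup f \<nu> / Poly_Mapping.lookup g \<nu>) g)"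
  shows "okey D \<mu> < okey D \<nu>"
proof -
  have "\<mu> \<noteq> \<nu>"
    using assms by (auto simp: is_lead_def in_keys_iff lookup_minus lookup_scl)
  moreover have "\<mu> \<in> Poly_Mapping.keys f \<or> \<mu> \<in> Poly_Mapping.keys g"
    using assms(3) by (auto simp: in_keys_iff lookup_minus lookup_scl)
  ultimately show ?thesis using assms(1,2) by (auto simp: is_lead_def okey_inj less_le)
qed

text \<open>Division by leading terms: subtracting a multiple of an element of \<open>J\<close>
  lowers the leading exponent. This terminates because the order refines the degree, which leaves
  only finitely many smaller exponents.\<close>

lemma eq_of_lexps:
  fixes J J' :: "('v::finite, 'k::field) mpol set"
  assumes J: "idl J" "idl J'" "J \<subseteq> J'" "lexps J' \<subseteq> lexps J"
  shows "J = J'"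
proof -
  have fin: "finite {\<mu> :: 'v \<Rightarrow>\<^sub>0 nat. okey {} \<mu> < okey {} \<nu>}" for \<nu> :: "'v \<Rightarrow>\<^sub>0 nat"
  proof (rule finite_subset[OF _ finite_total_degree_le[of "total_degree \<nu>"]])
    show "{\<mu> :: 'v \<Rightarrow>\<^sub>0 nat. okey {} \<mu> < okey {} \<nu>} \<subseteq> {\<mu>. total_degree \<mu> \<le> total_degree \<nu>}"
      using okey_less_degree[of \<nu> _ "{}"] by (meson Collect_mono less_asym not_le)
  qed
  have "f \<in> J" if "f \<in> J'" "f \<noteq> 0 \<Longrightarrow> is_lead {} \<nu> f" for f \<nu>
    using that
  proof (induction "card {\<mu> :: 'v \<Rightarrow>\<^sub>0 nat. okey {} \<mu> < okey {} \<nu>}" arbitrary: f \<nu> rule: less_induct)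
    case less
    show ?case
    proof (cases "f = 0")
      case True then show ?thesis using J by (simp add: rm.subspace_0)
    next
      case False
      then have l: "is_lead {} \<nu> f" using less by blast
      then obtain g where g: "g \<in> J" "is_lead {} \<nu> g" using less.prems(1) J(4) by (auto simp: lexps_def)
      define h where "h = f - scl (Poly_Mapping.lookup f \<nu> / Poly_Mapping.lookup g \<nu>) g"
      have h: "h \<in> J'" unfolding h_def using J g less.prems(1) by (intro rm.subspace_diff idl_scl) auto
      have "h \<in> J"
      proof (cases "h = 0")
        case True then show ?thesis using J by (simp add: rm.subspace_0)
      next
        case False
        then obtain \<mu> where \<mu>: "is_lead {} \<mu> h" using ex_lead by blast
        then have "okey {} \<mu> < okey {} \<nu>" using cancel_lead[OF l g(2)] by (auto simp: is_lead_def h_def)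
        then have "{\<rho> :: 'v \<Rightarrow>\<^sub>0 nat. okey {} \<rho> < okey {} \<mu>} \<subset> {\<rho>. okey {} \<rho> < okey {} \<nu>}" by auto
        then show ?thesis using less.hyps[OF psubset_card_mono[OF fin]] h \<mu> by blast
      qed
      then have "h + scl (Poly_Mapping.lookup f \<nu> / Poly_Mapping.lookup g \<nu>) g \<in> J"
        using g J by (intro rm.subspace_add idl_scl) auto
      then show ?thesis by (simp add: h_def)
    qed
  qed
  then show ?thesis using J(3) ex_lead by blast
qed

section \<open>Dickson's lemma and the ascending chain condition\<close>

lemma nat_incseq_subseq:
  fixes s :: "nat \<Rightarrow> nat"
  shows "\<exists>g. strict_mono g \<and> incseq (s \<circ> g)"
proof -
  obtain g where g: "strict_mono (g :: nat \<Rightarrow> nat)" "monoseq (\<lambda>n. s (g n))" using seq_monosub[of s] by blast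
  show ?thesis
  proof (cases "incseq (\<lambda>n. s (g n))")
    case True then show ?thesis using g by (auto simp: comp_def)
  next
    case False
    then have dec: "decseq (\<lambda>n. s (g n))" using g(2) by (simp add: monoseq_iff)
    obtain N where N: "\<And>n. s (g N) \<le> s (g n)"
      using ex_has_least_nat[of "\<lambda>_. True" 0 "\<lambda>n. s (g n)"] by blast
    have "s (g (n + N)) = s (g N)" for n
      using N[of "n + N"] dec by (simp add: decseq_def order_antisym)
    then have "incseq (s \<circ> (\<lambda>n. g (n + N)))" by (simp add: incseq_def)
    moreover have "strict_mono (\<lambda>n. g (n + N))" using g(1) by (simp add: strict_mono_def)
    ultimately show ?thesis by blast
  qed
qed

text \<open>Passing to subsequences one variable at a time makes all coordinates nondecreasing; then
  the first two members already compare.\<close>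

lemma dickson:
  fixes s :: "nat \<Rightarrow> 'v::finite \<Rightarrow>\<^sub>0 nat"
  shows "\<exists>i j \<mu>. i < j \<and> s j = \<mu> + s i"
proof -
  have "\<exists>g. strict_mono g \<and> (\<forall>v\<in>F. incseq (\<lambda>n. Poly_Mapping.lookup (s (g n)) v))" if "finite F" for F :: "'v set"
    using that
  proof (induction F rule: finite_induct)
    case empty
    show ?case by (auto intro!: exI[of _ id] simp: strict_mono_id)
  next
    case (insert v F)
    then obtain g where g: "strict_mono g" "\<And>u. u \<in> F \<Longrightarrow> incseq (\<lambda>n. Poly_Mapping.lookup (s (g n)) u)" by blast
    obtain h where h: "strict_mono h" "incseq ((\<lambda>n. Poly_Mapping.lookup (s (g n)) v) \<circ> h)"
      using nat_incseq_subseq[of "\<lambda>n. Poly_Mapping.lookup (s (g n)) v"] by blast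
    have "incseq (\<lambda>n. Poly_Mapping.lookup (s ((g \<circ> h) n)) u)" if "u \<in> insert v F" for u
      using that h(2) g(2)[of u] strict_mono_less_eq[OF h(1)] by (auto simp: incseq_def)
    then show ?case using strict_mono_o[OF g(1) h(1)] by blast
  qed
  from this[of UNIV] obtain g where g: "strict_mono g" "\<And>v. incseq (\<lambda>n. Poly_Mapping.lookup (s (g n)) v)"
    by auto
  have "s (g 1) = (s (g 1) - s (g 0)) + s (g 0)"
    by (rule poly_mapping_eqI) (use g(2) in \<open>simp add: lookup_add lookup_minus incseq_def\<close>)
  moreover have "g 0 < g 1" using g(1) by (simp add: strict_mono_less)
  ultimately show ?thesis by blast
qed

text \<open>Every strict inclusion produces a new leading exponent by \<open>eq_of_lexps\<close>,
  but by Dickson's lemma one of these exponents is a multiple of an earlier one and so not new. The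
  pairs are oriented such that well-founded induction passes from larger ideals to smaller
  ones.\<close>

theorem wf_ideals: "wf {(J', J :: ('v::finite, 'k::field) mpol set). idl J \<and> idl J' \<and> J \<subset> J'}"
  unfolding wf_iff_no_infinite_down_chain
proof
  assume "\<exists>F. \<forall>i. (F (Suc i), F i) \<in> {(J', J :: ('v, 'k) mpol set). idl J \<and> idl J' \<and> J \<subset> J'}"
  then obtain F :: "nat \<Rightarrow> ('v, 'k) mpol set" where
    "\<forall>i. (F (Suc i), F i) \<in> {(J', J). idl J \<and> idl J' \<and> J \<subset> J'}" by blast
  then have F: "\<And>i. idl (F i)" "\<And>i. F i \<subset> F (Suc i)" by simp_all
  have "\<exists>\<nu>. \<nu> \<in> lexps (F (Suc i)) \<and> \<nu> \<notin> lexps (F i)" for i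
    using eq_of_lexps[of "F i" "F (Suc i)"] F by blast
  then obtain s where s: "\<And>i. s i \<in> lexps (F (Suc i)) \<and> s i \<notin> lexps (F i)" by metis
  obtain i j \<mu> where ij: "i < j" "s j = \<mu> + s i" using dickson by blast
  have "F (Suc i) \<subseteq> F j" using lift_Suc_mono_le[of F "Suc i" j] F(2) ij(1) by auto
  then obtain f where f: "f \<in> F j" "is_lead {} (s i) f" using s[of i] by (auto simp: lexps_def)
  have "monomial \<mu> * f \<in> F j" using F(1) f(1) by (simp add: idl_mult)
  then have "s j \<in> lexps (F j)" using is_lead_mult[OF f(2), of \<mu>] ij(2) by (auto simp: lexps_def)
  then show False using s by blast
qed

text \<open>The finite set is taken inside the prescribed generators: for initial ideals these are
  initial forms, and finitely many of them admit a common bound on a perturbation.\<close>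

lemma ideal_finitely_generated:
  fixes J :: "('v::finite, 'k::field) mpol set"
  assumes "rm.span X = J"
  obtains F where "finite F" "F \<subseteq> X" "rm.span F = J"
proof -
  let ?S = "{rm.span F | F. finite F \<and> F \<subseteq> X}"
  have "rm.span {} \<in> ?S" by blast
  then obtain M where M: "M \<in> ?S" "\<And>y. (y, M) \<in> {(J', J). idl J \<and> idl J' \<and> J \<subset> J'} \<Longrightarrow> y \<notin> ?S"
    by (rule wfE_min[OF wf_ideals]) blast
  then obtain F where F: "finite F" "F \<subseteq> X" "M = rm.span F" by blast
  have "x \<in> M" if x: "x \<in> X" for x
  proof (rule ccontr)
    assume "x \<notin> M"
    moreover have "M \<subseteq> rm.span (insert x F)" using F(3) by (simp add: rm.span_mono subset_insertI)
    moreover have "x \<in> rm.span (insert x F)" by (simp add: rm.span_base)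
    ultimately have "M \<subset> rm.span (insert x F)" by blast
    moreover have "rm.span (insert x F) \<in> ?S"
      by (rule CollectI, rule exI[of _ "insert x F"]) (simp add: F x)
    ultimately show False using M(2)[of "rm.span (insert x F)"] F(3) by simp
  qed
  then have "J \<subseteq> M" using F(3) assms rm.span_minimal[of X M] by auto
  moreover have "M \<subseteq> J" using F assms rm.span_mono[of F X] by simp
  ultimately show ?thesis using that[of F] F by blast
qed

text \<open>A graded ideal is generated by its homogeneous elements, so the sum again has
  homogeneous generators.\<close>

lemma gr_span_Un:
  fixes \<phi> :: "('v \<Rightarrow>\<^sub>0 nat) \<Rightarrow> 'w::ab_semigroup_add"
  assumes add: "\<And>\<mu> \<nu>. \<phi> (\<mu> + \<nu>) = \<phi> \<mu> + \<phi> \<nu>" and J: "gr \<phi> J" and hom: "\<And>x. x \<in> X \<Longrightarrow> \<exists>v. hg \<phi> v x"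
  shows "gr \<phi> (rm.span (J \<union> X))"
proof -
  let ?H = "{x \<in> J. \<exists>v. hg \<phi> v x} \<union> X"
  have "x \<in> rm.span ?H" if "x \<in> J" for x
  proof -
    have "gcomp \<phi> v x \<in> ?H" for v using J that hg_comp[of \<phi> v x] by (auto simp: gr_def)
    then have "(\<Sum>v\<in>\<phi> ` Poly_Mapping.keys x. gcomp \<phi> v x) \<in> rm.span ?H"
      by (intro rm.span_sum rm.span_base)
    then show ?thesis by (simp only: sum_comp)
  qed
  then have "J \<union> X \<subseteq> rm.span ?H" using rm.span_superset[of ?H] by blast
  then have "rm.span (J \<union> X) = rm.span ?H" by (simp add: rm.span_eq) (use rm.span_superset[of "J \<union> X"] in blast)
  moreover have "gr \<phi> (rm.span ?H)" using hom by (intro gr_span add) auto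
  ultimately show ?thesis by simp
qed

section \<open>Filtrations with prime factors\<close>

lemma gr_insert: "gr total_degree J \<Longrightarrow> hg total_degree e f \<Longrightarrow> gr total_degree (rm.span (insert f J))"
  using gr_span_Un[OF total_degree_add, of J "{f}"] by (simp add: Un_commute) blast

lemma hg_total_degree_0: "hg total_degree 0 (1 :: ('v::finite, 'k::comm_ring_1) mpol)"
  using hg_monomial[of total_degree 0] by (simp only: total_degree_0 monomial_0)

text \<open>An annihilator that is maximal among those of homogeneous elements of \<open>S/J\<close>
  is prime: if \<open>b * f\<close> is nonzero modulo \<open>J\<close>, its annihilator contains
  that of \<open>f\<close> and so equals it. As the ideal is graded, testing homogeneous factors is
  enough.\<close>

lemma graded_associated_prime:
  fixes J :: "('v::finite, 'k::field) mpol set"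
  assumes J: "gr total_degree J" and "1 \<notin> J"
  obtains f e where "f \<notin> J" "hg total_degree e f" "prm (colon J f)"
proof -
  let ?S = "{colon J f | f. f \<notin> J \<and> (\<exists>e. hg total_degree e f)}"
  have "colon J 1 \<in> ?S" using assms(2) hg_total_degree_0 by blast
  then obtain M where M: "M \<in> ?S" "\<And>y. (y, M) \<in> {(J', J). idl J \<and> idl J' \<and> J \<subset> J'} \<Longrightarrow> y \<notin> ?S"
    by (rule wfE_min[OF wf_ideals]) blast
  then obtain f e where f: "f \<notin> J" "hg total_degree e f" "M = colon J f" by blast
  have "prm (colon J f)"
  proof (rule gr_prime[OF total_degree_add gr_colon[OF total_degree_add J f(2)]])
    show "1 \<notin> colon J f" using f by (simp add: colon_def)
    fix v w a b assume ab: "hg total_degree v a" "hg total_degree w b" "a * b \<in> colon J f"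
    show "a \<in> colon J f \<or> b \<in> colon J f"
    proof (rule disjCI)
      assume "b \<notin> colon J f"
      then have "b * f \<notin> J" by (simp add: colon_def)
      moreover have "hg total_degree (w + e) (b * f)" using ab f by (intro hg_mult total_degree_add)
      ultimately have "colon J (b * f) \<in> ?S" by blast
      moreover have "colon J f \<subseteq> colon J (b * f)"
      proof
        fix x assume "x \<in> colon J f"
        then have "b * (x * f) \<in> J" using gr_idl[OF J] by (simp add: colon_def idl_mult)
        then show "x \<in> colon J (b * f)" by (simp add: colon_def mult.left_commute)
      qed
      ultimately have "colon J f = colon J (b * f)"
        using M(2)[of "colon J (b * f)"] f(3) gr_idl[OF J] idl_colon by blast
      moreover have "a \<in> colon J (b * f)" using ab(3) by (simp add: colon_def mult.assoc)
      ultimately show "a \<in> colon J f" by simp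
    qed
  qed
  then show ?thesis using that f by blast
qed

text \<open>Noetherian induction along a filtration of \<open>S/J\<close> whose successive factors
  are shifted copies of \<open>S/P\<close> with a graded prime \<open>P = (J' : f)\<close>.
  Rationality of the Hilbert series, finiteness of the minimal primes and the count of
  multiplicities all rest on it.\<close>

lemma graded_ideal_induct [consumes 1, case_names UNIV step]:
  fixes J :: "('v::finite, 'k::field) mpol set"
  assumes J: "gr total_degree J" and UNIV: "\<Phi> UNIV"
    and step: "\<And>J' f e. gr total_degree J' \<Longrightarrow> J \<subseteq> J' \<Longrightarrow> f \<notin> J' \<Longrightarrow> hg total_degree e f \<Longrightarrow>
      prm (colon J' f) \<Longrightarrow> gr total_degree (colon J' f) \<Longrightarrow> gr total_degree (rm.span (insert f J')) \<Longrightarrow>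
      \<Phi> (rm.span (insert f J')) \<Longrightarrow> \<Phi> J'"
  shows "\<Phi> J"
proof -
  have "gr total_degree J' \<Longrightarrow> J \<subseteq> J' \<Longrightarrow> \<Phi> J'" for J'
  proof (induction J' rule: wf_induct_rule[OF wf_ideals])
    case (1 J')
    have i: "idl J'" using 1 gr_idl by blast
    show ?case
    proof (cases "1 \<in> J'")
      case True
      then have "J' = UNIV" using idl_mult(1)[OF i True] by auto
      then show ?thesis using UNIV by simp
    next
      case False
      then obtain f e where f: "f \<notin> J'" "hg total_degree e f" "prm (colon J' f)"
        using graded_associated_prime[OF "1.prems"(1)] by metis
      have g: "gr total_degree (rm.span (insert f J'))" using "1.prems"(1) f(2) by (rule gr_insert)
      have "J' \<subset> rm.span (insert f J')" using f(1) rm.span_superset[of "insert f J'"] by blast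
      then have "\<Phi> (rm.span (insert f J'))" using "1.IH"[of "rm.span (insert f J')"] i g "1.prems"(2) by auto
      then show ?thesis using step[OF "1.prems" f gr_colon[OF total_degree_add "1.prems"(1) f(2)] g] by blast
    qed
  qed
  then show ?thesis using J by blast
qed

section \<open>Hilbert series\<close>

definition HS :: "('v::finite, 'k::field) mpol set \<Rightarrow> int fps" where
  "HS J = Abs_fps (\<lambda>d. int (hf J d))"

text \<open>Division by \<open>1 - fps_X\<close>, written out as partial sums.\<close>

definition psum :: "int fps \<Rightarrow> int fps" where
  "psum a = Abs_fps (\<lambda>d. \<Sum>k\<le>d. fps_nth a k)"

lemma one_minus_X_nth: "fps_nth (a * (1 - fps_X)) d = fps_nth a d - (if d = 0 then 0 else fps_nth a (d - 1))"
  for a :: "int fps"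
  by (simp add: right_diff_distrib fps_mult_fps_X_commute[symmetric])

lemma psum_mult: "psum a * (1 - fps_X) = a"
proof (rule fps_ext)
  fix d show "fps_nth (psum a * (1 - fps_X)) d = fps_nth a d"
    unfolding one_minus_X_nth by (cases d) (simp_all add: psum_def)
qed

lemma one_minus_X_neq_0: "(1 - fps_X :: int fps) \<noteq> 0"
proof
  assume "(1 - fps_X :: int fps) = 0"
  then have "fps_nth (1 - fps_X :: int fps) 0 = 0" by simp
  then show False by simp
qed

lemma psum_unique: "b * (1 - fps_X) = a \<Longrightarrow> b = psum a"
  using psum_mult[of a] one_minus_X_neq_0 by (metis mult_right_cancel)

lemma fps_of_poly_one_minus_X: "fps_of_poly [:1, - 1 :: int:] = 1 - fps_X"
  by (simp add: fps_of_poly_pCons)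

lemma poly_1_eq_sum: "degree Q \<le> d \<Longrightarrow> poly Q (1 :: int) = (\<Sum>k\<le>d. Polynomial.coeff Q k)"
proof -
  assume "degree Q \<le> d"
  then have "(\<Sum>k\<le>d. Polynomial.coeff Q k) = (\<Sum>k\<le>degree Q. Polynomial.coeff Q k)"
    by (intro sum.mono_neutral_right) (auto simp: coeff_eq_0)
  then show ?thesis by (simp add: poly_altdef)
qed

text \<open>After division by one factor the coefficients equal the value of \<open>Q\<close> at 1
  from the degree of \<open>Q\<close> on; every further summation lets them decrease by at least 1
  in each late step.\<close>

lemma negative_eventually:
  assumes "a * (1 - fps_X) ^ Suc m = fps_of_poly Q" "poly Q (1::int) < 0"
  shows "\<exists>N. \<forall>d\<ge>N. fps_nth a d \<le> - 1"
  using assms(1)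
proof (induction m arbitrary: a)
  case 0
  then have a: "a = psum (fps_of_poly Q)" by (intro psum_unique) simp
  have "fps_nth a d \<le> - 1" if "d \<ge> degree Q" for d
    using poly_1_eq_sum[OF that] assms(2) by (simp add: a psum_def)
  then show ?case by blast
next
  case (Suc m)
  define b where "b = a * (1 - fps_X)"
  have "b * (1 - fps_X) ^ Suc m = fps_of_poly Q" using Suc.prems by (simp add: b_def mult.assoc)
  then obtain N where N: "\<And>d. d \<ge> N \<Longrightarrow> fps_nth b d \<le> - 1" using Suc.IH by blast
  have ab: "a = psum b" by (rule psum_unique) (simp add: b_def)
  have step: "fps_nth a (N + d) \<le> fps_nth a N - int d" for d
  proof (induction d)
    case (Suc d)
    have "fps_nth a (N + Suc d) = fps_nth a (N + d) + fps_nth b (N + Suc d)" by (simp add: ab psum_def)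
    then show ?case using Suc N[of "N + Suc d"] by simp
  qed simp
  have "fps_nth a d \<le> - 1" if "d \<ge> N + nat (fps_nth a N + 1)" for d
    using step[of "d - N"] that by (simp add: of_nat_diff)
  then show ?case by blast
qed

text \<open>A negative value would make coefficients negative eventually. They are summed once more
  beforehand, so that a factor \<open>1 - t\<close> is present even for
  \<open>m = 0\<close>.\<close>

lemma numerator_nonneg:
  assumes "\<And>d. fps_nth a d \<ge> 0" "a * (1 - fps_X) ^ m = fps_of_poly Q"
  shows "poly Q (1::int) \<ge> 0"
proof (rule ccontr)
  assume "\<not> 0 \<le> poly Q 1"
  then have "poly Q 1 < 0" by simp
  moreover have "psum a * (1 - fps_X) ^ Suc m = fps_of_poly Q"
    using assms(2) psum_mult[of a] by (simp add: mult.assoc[symmetric])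
  ultimately obtain N where "fps_nth (psum a) N \<le> - 1" using negative_eventually by blast
  moreover have "fps_nth (psum a) N \<ge> 0" using assms(1) by (simp add: psum_def sum_nonneg)
  ultimately show False by simp
qed

lemma numerator_growth:
  assumes "a * (1 - fps_X) ^ Suc k = fps_of_poly Q"
  shows "\<exists>C. \<forall>d. \<bar>fps_nth a d\<bar> \<le> int C * (int d + 1) ^ k"
  using assms
proof (induction k arbitrary: a)
  case 0
  then have a: "a = psum (fps_of_poly Q)" by (intro psum_unique) simp
  have "\<bar>fps_nth a d\<bar> \<le> (\<Sum>k\<le>degree Q. \<bar>Polynomial.coeff Q k\<bar>)" for d
  proof -
    have "\<bar>fps_nth a d\<bar> \<le> (\<Sum>k\<le>d. \<bar>Polynomial.coeff Q k\<bar>)" by (simp add: a psum_def sum_abs)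
    also have "\<dots> \<le> (\<Sum>k\<le>max d (degree Q). \<bar>Polynomial.coeff Q k\<bar>)" by (rule sum_mono2) auto
    also have "\<dots> = (\<Sum>k\<le>degree Q. \<bar>Polynomial.coeff Q k\<bar>)" by (rule sum.mono_neutral_right) (auto simp: coeff_eq_0)
    finally show ?thesis .
  qed
  moreover have "(\<Sum>k\<le>degree Q. \<bar>Polynomial.coeff Q k\<bar>) = int (nat (\<Sum>k\<le>degree Q. \<bar>Polynomial.coeff Q k\<bar>))"
    by (simp add: sum_nonneg)
  ultimately show ?case by (metis mult.right_neutral power_0)
next
  case (Suc k)
  define b where "b = a * (1 - fps_X)"
  have "b * (1 - fps_X) ^ Suc k = fps_of_poly Q" using Suc.prems by (simp add: b_def mult.assoc)
  then obtain C where C: "\<And>d. \<bar>fps_nth b d\<bar> \<le> int C * (int d + 1) ^ k" using Suc.IH by blast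
  have ab: "a = psum b" by (rule psum_unique) (simp add: b_def)
  have "\<bar>fps_nth a d\<bar> \<le> int C * (int d + 1) ^ Suc k" for d
  proof -
    have "\<bar>fps_nth a d\<bar> \<le> (\<Sum>j\<le>d. \<bar>fps_nth b j\<bar>)" by (simp add: ab psum_def sum_abs)
    also have "\<dots> \<le> (\<Sum>j\<le>d. int C * (int d + 1) ^ k)"
    proof (rule sum_mono)
      fix j assume "j \<in> {..d}"
      then have "int C * (int j + 1) ^ k \<le> int C * (int d + 1) ^ k" by (intro mult_left_mono power_mono) auto
      then show "\<bar>fps_nth b j\<bar> \<le> int C * (int d + 1) ^ k" using C[of j] by linarith
    qed
    also have "\<dots> = int C * (int d + 1) ^ Suc k" by (simp add: algebra_simps)
    finally show ?thesis .
  qed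
  then show ?case by blast
qed

lemma HS_nth [simp]: "fps_nth (HS J) d = int (hf J d)"
  by (simp add: HS_def)

lemma HS_UNIV [simp]: "HS UNIV = 0"
  by (rule fps_ext) (simp add: hf_eq_0)

lemma HS_insert:
  assumes "gr total_degree J" "hg total_degree e f"
  shows "HS J = HS (rm.span (insert f J)) + fps_X ^ e * HS (colon J f)"
proof (rule fps_ext)
  fix d
  show "fps_nth (HS J) d = fps_nth (HS (rm.span (insert f J)) + fps_X ^ e * HS (colon J f)) d"
  proof (cases "d < e")
    case True
    then show ?thesis using hf_insert_low[OF assms] by (simp add: fps_X_power_mult_nth)
  next
    case False
    then show ?thesis using hf_insert[OF assms, of "d - e"] by (simp add: fps_X_power_mult_nth)
  qed
qed

text \<open>The quotient by \<open>J\<close> and the variables of \<open>D\<close> is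
  finite-dimensional; if \<open>card D\<close> is the dimension of \<open>J\<close>, these variables
  form a system of parameters modulo \<open>J\<close>.\<close>

definition primary :: "'v set \<Rightarrow> ('v::finite, 'k::comm_ring_1) mpol set \<Rightarrow> bool" where
  "primary D J \<longleftrightarrow> (\<exists>N. \<forall>\<nu>. total_degree \<nu> \<ge> N \<longrightarrow> monomial \<nu> \<in> rm.span (J \<union> mvar ` D))"

section \<open>Systems of parameters and rationality of the Hilbert series\<close>

lemma primary_mono: "primary D J \<Longrightarrow> J \<subseteq> J' \<Longrightarrow> D \<subseteq> D' \<Longrightarrow> primary D' J'"
  unfolding primary_def using rm.span_mono[of "J \<union> mvar ` D" "J' \<union> mvar ` D'"] by blast

lemma span_span_Un: "rm.span (rm.span A \<union> B) = rm.span (A \<union> B)"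
proof -
  have "rm.span A \<subseteq> rm.span (A \<union> B)" by (simp add: rm.span_mono)
  moreover have "A \<union> B \<subseteq> rm.span (A \<union> B)" by (rule rm.span_superset)
  moreover have "A \<union> B \<subseteq> rm.span (rm.span A \<union> B)"
    using rm.span_superset[of A] rm.span_superset[of "rm.span A \<union> B"] by auto
  ultimately show ?thesis unfolding rm.span_eq by auto
qed

lemma primary_insert:
  "primary (insert b D) J \<longleftrightarrow> primary D (rm.span (insert (mvar b) J))"
proof -
  have "rm.span (rm.span (insert (mvar b) J) \<union> mvar ` D) = rm.span (J \<union> mvar ` insert b D)"
    unfolding span_span_Un by simp
  then show ?thesis by (simp only: primary_def)
qed

lemma primary_insert_mem: "mvar b \<in> J \<Longrightarrow> primary (insert b D) J \<longleftrightarrow> primary D J"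
proof -
  assume "mvar b \<in> J"
  then have "J \<union> mvar ` insert b D = J \<union> mvar ` D" by auto
  then show ?thesis by (simp only: primary_def)
qed

lemma hg_mvar: "hg total_degree 1 (mvar i :: ('v::finite, 'k::comm_ring_1) mpol)"
  using hg_monomial[of total_degree "Poly_Mapping.single i 1"] by (simp add: mvar_eq_monomial total_degree_single)

lemma HS_insert_mvar:
  assumes "gr total_degree P" "prm P" "mvar b \<notin> P"
  shows "HS P * (1 - fps_X) = HS (rm.span (insert (mvar b) P))"
  using HS_insert[OF assms(1) hg_mvar, of b] colon_prime[OF assms(2,3)] by (simp add: algebra_simps)

theorem hilbert_serre:
  fixes J :: "('v::finite, 'k::field) mpol set"
  assumes "gr total_degree J" "primary D J"
  shows "\<exists>Q. HS J * (1 - fps_X) ^ card D = fps_of_poly Q"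
  using finite[of D] assms
proof (induction D arbitrary: J rule: finite_induct)
  case empty
  then obtain N where N: "\<And>\<nu>. total_degree \<nu> \<ge> N \<Longrightarrow> monomial \<nu> \<in> J"
    by (auto simp: primary_def rm.span_eq_iff[THEN iffD2, OF gr_idl])
  have "hf J d = 0" if "d \<ge> N" for d
  proof -
    have "hom_part d \<subseteq> J"
    proof
      fix f :: "('v, 'k) mpol" assume f: "f \<in> hom_part d"
      show "f \<in> J"
        by (rule in_span_monomials) (use f that N empty in \<open>auto simp: hom_part_def gr_idl\<close>)
    qed
    then show ?thesis using hf_eq_0 gr_idl[OF empty(1)] by blast
  qed
  then have "HS J = fps_of_poly (Poly (map (\<lambda>d. int (hf J d)) [0..<N]))"
    by (intro fps_ext) (auto simp: coeff_Poly_eq nth_default_def)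
  then show ?case by (metis card.empty mult.right_neutral power_0)
next
  case (insert b D)
  have pr: "\<exists>Q. HS P * (1 - fps_X) ^ Suc (card D) = fps_of_poly Q"
    if P: "gr total_degree P" "prm P" "primary (insert b D) P" for P :: "('v, 'k) mpol set"
  proof (cases "mvar b \<in> P")
    case True
    then obtain Q where Q: "HS P * (1 - fps_X) ^ card D = fps_of_poly Q"
      using insert.IH[OF P(1)] P(3) primary_insert_mem by blast
    have "HS P * (1 - fps_X) ^ Suc (card D) = fps_of_poly (Q * [:1, - 1:])"
      unfolding fps_of_poly_mult fps_of_poly_one_minus_X Q[symmetric] by (simp add: ac_simps)
    then show ?thesis by blast
  next
    case False
    have "\<exists>Q. HS (rm.span (insert (mvar b) P)) * (1 - fps_X) ^ card D = fps_of_poly Q"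
      using insert.IH[OF gr_insert[OF P(1) hg_mvar]] P(3) primary_insert by blast
    then show ?thesis
      unfolding HS_insert_mvar[OF P(1,2) False, symmetric] by (simp add: mult.assoc)
  qed
  show ?case using insert.prems(1)
  proof (induction rule: graded_ideal_induct)
    case UNIV
    show ?case by (auto intro!: exI[of _ 0])
  next
    case (step J' f e)
    have "J \<subseteq> colon J' f" using step(2) colon_superset[OF gr_idl[OF step(1)], of f] by blast
    then obtain Q where Q: "HS (colon J' f) * (1 - fps_X) ^ Suc (card D) = fps_of_poly Q"
      using pr[OF step(6,5)] primary_mono[OF insert.prems(2)] by blast
    obtain R where R: "HS (rm.span (insert f J')) * (1 - fps_X) ^ card (insert b D) = fps_of_poly R"
      using step by blast
    have "HS J' * (1 - fps_X) ^ card (insert b D) = fps_of_poly (R + Polynomial.monom 1 e * Q)"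
      unfolding HS_insert[OF step(1,4)] fps_of_poly_add fps_of_poly_mult R[symmetric] Q[symmetric]
      using insert.hyps by (simp add: fps_of_poly_monom' algebra_simps)
    then show ?case by blast
  qed
qed

section \<open>Chains of prime ideals\<close>

definition prime_chain :: "('v::finite, 'k::field) mpol set \<Rightarrow> nat \<Rightarrow> (nat \<Rightarrow> ('v, 'k) mpol set) \<Rightarrow> bool" where
  "prime_chain I k p \<longleftrightarrow> I \<subseteq> p 0 \<and> (\<forall>i\<le>k. prm (p i)) \<and> (\<forall>i<k. p i \<subset> p (Suc i))"

lemma hc_le: "J \<subseteq> J' \<Longrightarrow> hc J' d \<le> hc J d"
  unfolding hc_def by (intro diff_le_mono2 Kv_dim_mono[OF _ _ finite_degle]) auto

text \<open>Descending the chain, \<open>hc_prime_chain\<close> gives the recursion of Pascal's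
  triangle with steps of length \<open>e\<close> in the degree. So a chain of length
  \<open>k\<close> forces growth of order at least \<open>d^k\<close>.\<close>

lemma prime_chain_growth:
  "prime_chain I k p \<Longrightarrow> \<exists>e>0. \<forall>d. (d div e + k) choose k \<le> hc (p 0) d"
proof (induction k arbitrary: p I)
  case 0
  then have "1 \<le> hc (p 0) d" for d by (intro hc_0) (auto simp: prime_chain_def prm_def)
  then show ?case by (auto intro!: exI[of _ 1])
next
  case (Suc k)
  have "prime_chain (p 1) k (\<lambda>i. p (Suc i))" using Suc.prems by (auto simp: prime_chain_def)
  from Suc.IH[OF this] obtain e1 where e1: "e1 > 0" "\<And>d. (d div e1 + k) choose k \<le> hc (p 1) d"
    unfolding One_nat_def by blast
  have p0: "prm (p 0)" "prm (p 1)" "p 0 \<subset> p 1" using Suc.prems by (auto simp: prime_chain_def)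
  then obtain f where f: "f \<in> p 1" "f \<notin> p 0" by blast
  \<comment> \<open>\<open>e\<close> bounds the degree of \<open>f\<close> and is at least
    \<open>e1\<close>, so that the estimate for the shorter chain survives the coarser step.\<close>
  define e where "e = Max (insert e1 (total_degree ` Poly_Mapping.keys f))"
  have e: "e1 \<le> e" "f \<in> Sp (degle e)" by (auto simp: e_def Sp_def degle_def)
  have "(d div e + Suc k) choose Suc k \<le> hc (p 0) d" for d
  proof (induction d rule: less_induct)
    case (less d)
    show ?case
    proof (cases "d < e")
      case True
      then show ?thesis using hc_0[of "p 0" d] p0 by (simp add: prm_def)
    next
      case False
      define d' where "d' = d - e"
      have d: "d = d' + e" "d' < d" using False e(1) e1(1) by (auto simp: d'_def)
      have q: "d div e = Suc (d' div e)" using d(1) e(1) e1(1) by simp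
      have "(d' div e + Suc k) choose k \<le> hc (p 1) (d' + e)"
      proof -
        have "d div e \<le> d div e1" using e(1) e1(1) by (simp add: div_le_mono2)
        then have "(d div e + k) choose k \<le> (d div e1 + k) choose k" by (intro binomial_right_mono) simp
        then show ?thesis using e1(2)[of d] q d(1) by simp
      qed
      moreover have "hc (p 1) (d' + e) + hc (p 0) d' \<le> hc (p 0) (d' + e)"
        using p0 f e(2) by (intro hc_prime_chain) (auto simp: prm_def)
      ultimately show ?thesis using less.IH[OF d(2)] d(1) q by simp
    qed
  qed
  then show ?case using e(1) e1(1) by (intro exI[of _ e]) auto
qed

lemma power_le_binomial: "(q + 1) ^ k \<le> fact k * ((q + k) choose k :: nat)"
proof (induction k)
  case (Suc k)
  have "(q + 1) ^ Suc k \<le> (q + Suc k) * (fact k * ((q + k) choose k))"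
    using mult_mono[of "q + 1" "q + Suc k" "(q + 1) ^ k" "fact k * ((q + k) choose k)"] Suc by simp
  also have "\<dots> = fact k * (Suc (q + k) * ((q + k) choose k))" by (simp only: mult.left_commute add_Suc_right)
  also have "\<dots> = fact (Suc k) * ((q + Suc k) choose Suc k)"
    unfolding Suc_times_binomial_eq by (simp only: fact_Suc of_nat_id mult_ac add_Suc_right)
  finally show ?case .
qed simp

lemma growth_le:
  assumes "e > 0" "\<And>d. (d div e + k) choose k \<le> h d" "\<And>d. int (h d) \<le> int C * (int d + 1) ^ j"
  shows "k \<le> j"
proof (rule ccontr)
  assume "\<not> k \<le> j"
  then have kj: "Suc j \<le> k" by simp
  \<comment> \<open>At this value the comparison of growths turns into
    \<open>(q + 1)^(j + 1) \<le> q (q + 1)^j\<close>.\<close>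
  define q where "q = fact k * C * e ^ j"
  have h: "h (e * q) \<le> C * (e * q + 1) ^ j"
  proof -
    have "int (C * (e * q + 1) ^ j) = int C * (int (e * q) + 1) ^ j" by (simp add: add.commute)
    then show ?thesis using assms(3)[of "e * q"] by linarith
  qed
  have "(q + 1) ^ Suc j \<le> (q + 1) ^ k" using kj by (intro power_increasing) auto
  also have "\<dots> \<le> fact k * ((q + k) choose k)" by (rule power_le_binomial)
  also have "(q + k) choose k \<le> h (e * q)" using assms(1) assms(2)[of "e * q"] by simp
  also have "h (e * q) \<le> C * (e * q + 1) ^ j" by (rule h)
  also have "(e * q + 1) ^ j \<le> (e * (q + 1)) ^ j" using assms(1) by (intro power_mono) auto
  finally have "(q + 1) ^ Suc j \<le> fact k * (C * (e * (q + 1)) ^ j)" by simp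
  also have "\<dots> = q * (q + 1) ^ j" unfolding q_def power_mult_distrib by (simp only: mult_ac)
  finally show False by simp
qed

text \<open>Summing the Hilbert function gives the affine one, with denominator
  \<open>(1 - t)^(m + 1)\<close> and hence growth of order at most \<open>d^m\<close>. If the
  numerator vanishes at 1, one factor cancels and the order drops; conversely a chain of length
  \<open>m\<close> certifies a nonzero value at 1.\<close>

theorem prime_chain_bound:
  fixes I :: "('v::finite, 'k::field) mpol set"
  assumes I: "gr total_degree I" and HS: "HS I * (1 - fps_X) ^ m = fps_of_poly Q" and p: "prime_chain I k p"
  shows "k \<le> m" and "poly Q 1 = 0 \<Longrightarrow> k < m"
proof -
  define c where "c = Abs_fps (\<lambda>d. int (hc I d))"
  have c: "c = psum (HS I)"
    by (rule fps_ext) (simp add: c_def psum_def hc_sum[OF I])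
  have cm: "c * (1 - fps_X) ^ Suc m = fps_of_poly Q"
    using HS psum_mult[of "HS I"] by (simp add: c mult.assoc[symmetric])
  obtain e where e: "e > 0" "\<And>d. (d div e + k) choose k \<le> hc (p 0) d" using prime_chain_growth[OF p] by blast
  have "hc (p 0) d \<le> hc I d" for d using p by (intro hc_le) (simp add: prime_chain_def)
  then have e2: "(d div e + k) choose k \<le> hc I d" for d using e(2)[of d] le_trans by blast
  obtain C where "\<And>d. \<bar>fps_nth c d\<bar> \<le> int C * (int d + 1) ^ m" using numerator_growth[OF cm] by blast
  then show "k \<le> m" using growth_le[OF e(1) e2, of C m] by (simp add: c_def)
  assume "poly Q 1 = 0"
  then have "[:- 1, 1:] dvd Q" by (simp add: poly_eq_0_iff_dvd)
  then obtain R where "Q = [:- 1, 1:] * R" by blast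
  then have R: "Q = - R * [:1, - 1:]" by simp
  have "c * (1 - fps_X) ^ m * (1 - fps_X) = fps_of_poly (- R) * (1 - fps_X)"
    using cm unfolding R fps_of_poly_mult fps_of_poly_one_minus_X by (simp add: ac_simps)
  then have cR: "c * (1 - fps_X) ^ m = fps_of_poly (- R)" using one_minus_X_neq_0 by simp
  show "k < m"
  proof (cases m)
    case 0
    \<comment> \<open>The affine Hilbert function is now the coefficient sequence of a polynomial
      and vanishes in large degrees, while the binomial bound stays positive.\<close>
    then have "int (hc I (Suc (degree R))) = 0"
      using cR by (metis c_def coeff_eq_0 degree_minus fps_nth_Abs_fps fps_of_poly_nth lessI mult.right_neutral power_0)
    then have "(Suc (degree R) div e + k) choose k = 0" using e2[of "Suc (degree R)"] by simp
    then show ?thesis by simp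
  next
    case (Suc l)
    obtain C where "\<And>d. \<bar>fps_nth c d\<bar> \<le> int C * (int d + 1) ^ l" using numerator_growth[of c l "- R"] cR Suc by blast
    then have "k \<le> l" using growth_le[OF e(1) e2, of C l] by (simp add: c_def)
    then show ?thesis using Suc by simp
  qed
qed

section \<open>Linear changes of coordinates\<close>

no_notation fps_nth (infixl \<open>$\<close> 75)

lemma mconst_sum: "mconst (\<Sum>j\<in>A. s j) = (\<Sum>j\<in>A. mconst (s j))"
  by (induction A rule: infinite_finite_induct) (auto simp: mconst_add)

interpretation gl: coeff_hom mconst "\<lambda>i. \<Sum>j\<in>UNIV. mconst (g $ j $ i) * mvar j" for g :: "'k::comm_ring_1 ^ 'n ^ 'n::finite"
  by unfold_locales (simp_all add: mconst_add mconst_mult)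

lemmas gl_add = gl.subst_add[folded gl_act_def]
  and gl_mult = gl.subst_mult[folded gl_act_def]
  and gl_diff = gl.subst_diff[folded gl_act_def]
  and gl_sum = gl.subst_sum[folded gl_act_def]
  and gl_monomial = gl.subst_monomial[folded gl_act_def]

lemma gl_0 [simp]: "gl_act g 0 = 0" and gl_1 [simp]: "gl_act g 1 = 1"
  and gl_mconst [simp]: "gl_act g (mconst c) = mconst c"
  and gl_mvar: "gl_act g (mvar i) = (\<Sum>j\<in>UNIV. mconst (g $ j $ i) * mvar j)"
  by (simp_all add: gl_act_def)

lemma gl_scl: "gl_act g (scl c f) = scl c (gl_act g f)"
  by (simp add: scl_def gl_mult)

text \<open>The image of \<open>mvar i\<close> has its coefficients in column \<open>i\<close>,
  which makes the substitution a left action; inverse matrices therefore give inverse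
  substitutions.\<close>

lemma gl_compose: "gl_act g (gl_act h f) = gl_act (g ** h) f"
proof (rule mpol_hom_eq[of "\<lambda>f. gl_act g (gl_act h f)"])
  fix i
  have "gl_act g (gl_act h (mvar i)) = (\<Sum>j\<in>UNIV. \<Sum>k\<in>UNIV. mconst (h $ j $ i) * (mconst (g $ k $ j) * mvar k))"
    by (simp add: gl_mvar gl_sum gl_mult sum_distrib_left)
  also have "\<dots> = (\<Sum>k\<in>UNIV. \<Sum>j\<in>UNIV. mconst (h $ j $ i) * (mconst (g $ k $ j) * mvar k))"
    by (rule sum.swap)
  also have "\<dots> = (\<Sum>k\<in>UNIV. mconst ((g ** h) $ k $ i) * mvar k)"
  proof (rule sum.cong[OF refl])
    fix k
    show "(\<Sum>j\<in>UNIV. mconst (h $ j $ i) * (mconst (g $ k $ j) * mvar k)) = mconst ((g ** h) $ k $ i) * mvar k"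
      by (simp add: matrix_matrix_mult_def mconst_mult mconst_sum sum_distrib_left ac_simps)
  qed
  finally show "gl_act g (gl_act h (mvar i)) = gl_act (g ** h) (mvar i)" by (simp add: gl_mvar)
qed (auto simp: gl_add gl_mult)

lemma gl_mat_1: "gl_act (mat 1) f = f"
proof (rule mpol_hom_eq[of "gl_act (mat 1)" "\<lambda>f. f"])
  fix i :: 'a
  have "gl_act (mat 1) (mvar i) = (\<Sum>j\<in>UNIV. if j = i then mvar j else (0 :: ('a, 'b) mpol))"
    unfolding gl_mvar by (rule sum.cong) (auto simp: mat_def)
  then show "gl_act (mat 1) (mvar i) = (mvar i :: ('a, 'b) mpol)" by simp
qed (auto simp: gl_add gl_mult)

lemma gl_inverse:
  assumes "invertible g"
  obtains h where "invertible h" "\<And>f. gl_act h (gl_act g f) = f" "\<And>f. gl_act g (gl_act h f) = f"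
proof -
  obtain h where h: "g ** h = mat 1" "h ** g = mat 1" using assms by (auto simp: invertible_def)
  then have "invertible h" by (auto simp: invertible_def)
  then show ?thesis using that h by (simp add: gl_compose gl_mat_1)
qed

lemma hg_gl:
  assumes "hg total_degree d f"
  shows "hg total_degree d (gl_act g f)"
proof -
  have lin: "hg total_degree 1 (gl_act g (mvar i))" for i
  proof -
    have "hg total_degree 1 (scl (g $ j $ i) (mvar j))" for j by (intro hg_scl hg_mvar)
    then show ?thesis unfolding gl_mvar scl_def[symmetric] by (intro hg_sum)
  qed
  have pow: "hg total_degree k (gl_act g (mvar i) ^ k)" for i k
  proof (induction k)
    case 0 then show ?case by (simp add: hg_total_degree_0)
  next
    case (Suc k)
    then show ?case using hg_mult[OF total_degree_add lin Suc] by simp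
  qed
  have prod: "hg total_degree (\<Sum>i\<in>A. Poly_Mapping.lookup \<nu> i) (\<Prod>i\<in>A. gl_act g (mvar i) ^ Poly_Mapping.lookup \<nu> i)" for A \<nu>
    by (induction A rule: infinite_finite_induct) (auto simp: hg_total_degree_0 intro: hg_mult[OF total_degree_add pow])
  have mon: "hg total_degree (total_degree \<nu>) (gl_act g (monomial \<nu>))" for \<nu>
    using prod[of \<nu> UNIV] by (simp add: gl_monomial total_degree_def gl_mvar)
  have "gl_act g f = (\<Sum>\<nu>\<in>Poly_Mapping.keys f. scl (Poly_Mapping.lookup f \<nu>) (gl_act g (monomial \<nu>)))"
    using arg_cong[OF sum_single_lookup[of f], of "gl_act g"]
    by (simp add: gl_sum single_eq_scl gl_scl)
  also have "hg total_degree d \<dots>"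
    using mon assms by (intro hg_sum hg_scl) (auto simp: hg_def)
  finally show ?thesis .
qed

lemma gcomp_gl: "gcomp total_degree d (gl_act g f) = gl_act g (gcomp total_degree d f)"
proof -
  have "gl_act g f = (\<Sum>e\<in>total_degree ` Poly_Mapping.keys f. gl_act g (gcomp total_degree e f))"
    by (simp only: gl_sum[symmetric] sum_comp)
  then have "gcomp total_degree d (gl_act g f) = (\<Sum>e\<in>total_degree ` Poly_Mapping.keys f. gcomp total_degree d (gl_act g (gcomp total_degree e f)))"
    by (simp only: comp_sum)
  also have "\<dots> = (\<Sum>e\<in>total_degree ` Poly_Mapping.keys f. if e = d then gl_act g (gcomp total_degree d f) else 0)"
    by (intro sum.cong refl) (auto simp: comp_hg[OF hg_gl[OF hg_comp]])
  also have "\<dots> = gl_act g (gcomp total_degree d f)"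
  proof (cases "d \<in> total_degree ` Poly_Mapping.keys f")
    case False
    then have "gcomp total_degree d f = 0" unfolding gcomp_def by (intro sum.neutral) auto
    then show ?thesis by simp
  qed (simp add: sum.delta)
  finally show ?thesis .
qed

lemma idl_gl: "invertible g \<Longrightarrow> idl I \<Longrightarrow> idl (gl_act g ` I)"
proof (rule rm.subspaceI)
  assume g: "invertible g" and I: "idl I"
  obtain h where h: "\<And>f. gl_act g (gl_act h f) = f" using gl_inverse[OF g] by metis
  show "0 \<in> gl_act g ` I" using I by (intro image_eqI[of _ _ 0]) (simp_all add: rm.subspace_0)
  fix x y c assume x: "x \<in> gl_act g ` I"
  then obtain x' where x': "x = gl_act g x'" "x' \<in> I" by blast
  have "c * x = gl_act g (gl_act h c * x')" by (simp add: x' gl_mult h)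
  then show "c * x \<in> gl_act g ` I" using x' I by (simp add: idl_mult)
  assume "y \<in> gl_act g ` I"
  then obtain y' where y': "y = gl_act g y'" "y' \<in> I" by blast
  have "x + y = gl_act g (x' + y')" by (simp add: x' y' gl_add)
  then show "x + y \<in> gl_act g ` I" using rm.subspace_add[OF I x'(2) y'(2)] by blast
qed

lemma gr_gl: "invertible g \<Longrightarrow> gr total_degree I \<Longrightarrow> gr total_degree (gl_act g ` I)"
  by (auto simp: gr_def idl_gl gcomp_gl)

lemma inj_gl: "invertible g \<Longrightarrow> inj (gl_act g)"
  by (metis gl_inverse injI)

lemma hf_gl:
  fixes I :: "('n::finite, 'k::field) mpol set"
  assumes "invertible g" "idl I"
  shows "hf (gl_act g ` I) d = hf I d"
proof -
  obtain h where h: "\<And>f. gl_act h (gl_act g f) = f" "\<And>f. gl_act g (gl_act h f) = f"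
    using gl_inverse[OF assms(1)] by metis
  have "gl_act g ` I \<inter> hom_part d = gl_act g ` (I \<inter> hom_part d)"
  proof (intro equalityI subsetI)
    fix y assume "y \<in> gl_act g ` I \<inter> hom_part d"
    then obtain x where x: "y = gl_act g x" "x \<in> I" "hg total_degree d y" by (auto simp: hom_part_eq)
    then have "hg total_degree d (gl_act h y)" by (intro hg_gl)
    then show "y \<in> gl_act g ` (I \<inter> hom_part d)" using x h by (auto simp: hom_part_eq)
  qed (auto simp: hom_part_eq hg_gl)
  moreover have "Kv.dim (gl_act g ` (I \<inter> hom_part d)) = Kv.dim (I \<inter> hom_part d)"
  proof (rule Kv.dim_inj_image)
    show "Vector_Spaces.linear scl scl (gl_act g)"
      by (simp add: Vector_Spaces.linear_iff Kv.vector_space_axioms gl_add gl_scl)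
    show "inj_on (gl_act g) (I \<inter> hom_part d)" using inj_gl[OF assms(1)] inj_on_subset by blast
    show "Kv.subspace (I \<inter> hom_part d)" unfolding hom_part_Sp by (intro Kv.subspace_inter idl_Kv assms subspace_Sp)
  qed
  ultimately show ?thesis by (simp add: hf_def)
qed

lemma prm_gl_vimage: "prm p \<Longrightarrow> prm (gl_act g -` p)"
  unfolding prm_def
  by (intro conjI rm.subspaceI)
    (auto simp: gl_add gl_mult rm.subspace_0 rm.subspace_add rm.subspace_scale)

section \<open>Linear systems of parameters\<close>

text \<open>The primes \<open>(J' : f)\<close> met along the filtration suffice: a prime over
  \<open>J'\<close> either contains \<open>f\<close> and lies over the next step, or omits
  \<open>f\<close> and then contains \<open>(J' : f)\<close>.\<close>

lemma finite_minimal_primes: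
  fixes J :: "('v::finite, 'k::field) mpol set"
  assumes "gr total_degree J"
  shows "\<exists>\<P>. finite \<P> \<and> (\<forall>P\<in>\<P>. prm P \<and> J \<subseteq> P) \<and> (\<forall>p. prm p \<and> J \<subseteq> p \<longrightarrow> (\<exists>P\<in>\<P>. P \<subseteq> p))"
  using assms
proof (induction rule: graded_ideal_induct)
  case UNIV
  then show ?case by (intro exI[of _ "{}"]) (auto simp: prm_def)
next
  case (step J' f e)
  then obtain \<P> where P: "finite \<P>" "\<And>P. P \<in> \<P> \<Longrightarrow> prm P \<and> rm.span (insert f J') \<subseteq> P"
    "\<And>p. prm p \<Longrightarrow> rm.span (insert f J') \<subseteq> p \<Longrightarrow> \<exists>P\<in>\<P>. P \<subseteq> p" by metis
  have "\<exists>P\<in>insert (colon J' f) \<P>. P \<subseteq> p" if p: "prm p" "J' \<subseteq> p" for p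
  proof (cases "f \<in> p")
    case True
    then have "rm.span (insert f J') \<subseteq> p" using p by (intro rm.span_minimal) (auto simp: prm_def)
    then show ?thesis using P(3)[OF p(1)] by blast
  next
    case False
    then have "colon J' f \<subseteq> p" using p by (auto simp: colon_def prm_def)
    then show ?thesis by blast
  qed
  moreover have "J' \<subseteq> rm.span (insert f J')" using rm.span_superset[of "insert f J'"] by simp
  moreover have "prm P \<and> J' \<subseteq> P" if "P \<in> insert (colon J' f) \<P>" for P
    using that P(2)[of P] step(5) colon_superset[OF gr_idl[OF step(1)], of f] calculation(2) by auto
  ultimately show ?case using P(1)
    by (intro exI[of _ "insert (colon J' f) \<P>"] conjI ballI allI impI) simp_all
qed

text \<open>Vanishing of the constant term describes the ideal generated by all variables, the only
  graded maximal ideal.\<close>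

definition irrelevant :: "('v, 'k::comm_ring_1) mpol set" where
  "irrelevant = {f. Poly_Mapping.lookup f 0 = 0}"

lemma lookup_mult_0: "Poly_Mapping.lookup (f * g) 0 = Poly_Mapping.lookup f 0 * Poly_Mapping.lookup g 0"
  for f g :: "('v::finite, 'k::comm_ring_1) mpol"
proof -
  have eq: "Poly_Mapping.lookup f 0 = mpol_subst id (\<lambda>_. 0) f" for f :: "('v, 'k) mpol"
  proof -
    have "(\<Prod>v\<in>UNIV. (0::'k) ^ Poly_Mapping.lookup \<nu> v) = (if \<nu> = 0 then 1 else 0)" for \<nu> :: "'v \<Rightarrow>\<^sub>0 nat"
    proof (cases "\<nu> = 0")
      case False
      then obtain v where "Poly_Mapping.lookup \<nu> v \<noteq> 0" by (metis lookup_zero poly_mapping_eqI)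
      then show ?thesis using False by (auto intro!: prod_zero bexI[of _ v] simp: zero_power)
    qed simp
    then have "mpol_subst id (\<lambda>_. 0) f = (\<Sum>\<nu>\<in>Poly_Mapping.keys f. if \<nu> = 0 then Poly_Mapping.lookup f 0 else 0)"
      unfolding mpol_subst_def by (intro sum.cong) auto
    then show ?thesis by (simp add: in_keys_iff)
  qed
  interpret coeff_hom "id :: 'k \<Rightarrow> 'k" "\<lambda>_ :: 'v. 0" by unfold_locales auto
  show ?thesis by (simp add: eq subst_mult)
qed

lemma prm_irrelevant: "prm (irrelevant :: ('v::finite, 'k::field) mpol set)"
  unfolding prm_def
  by (intro conjI rm.subspaceI) (auto simp: irrelevant_def lookup_add lookup_mult_0 lookup_one)

lemma irrelevant_maximal:
  fixes p :: "('v::finite, 'k::field) mpol set"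
  assumes "idl p" "irrelevant \<subset> p"
  shows "1 \<in> p"
proof -
  obtain f where f: "f \<in> p" "Poly_Mapping.lookup f 0 \<noteq> 0" using assms(2) by (auto simp: irrelevant_def)
  let ?c = "Poly_Mapping.lookup f 0"
  have "f - mconst ?c \<in> irrelevant" by (simp add: irrelevant_def lookup_minus mconst_def)
  then have "f - mconst ?c \<in> p" using assms(2) by blast
  then have "f - (f - mconst ?c) \<in> p" using f assms(1) rm.subspace_diff by blast
  then have "scl (inverse ?c) (mconst ?c) \<in> p" using assms(1) by (simp add: idl_scl)
  then show ?thesis using f(2) by (simp add: scl_def mconst_mult[symmetric])
qed

lemma monomial_in_irrelevant: "\<nu> \<noteq> 0 \<Longrightarrow> (monomial \<nu> :: ('v, 'k::comm_ring_1) mpol) \<in> irrelevant"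
  by (simp add: irrelevant_def monomial_def lookup_single)

lemma irrelevant_subset:
  fixes p :: "('v::finite, 'k::field) mpol set"
  assumes "idl p" "\<And>i. mvar i \<in> p"
  shows "irrelevant \<subseteq> p"
proof
  fix f :: "('v, 'k) mpol" assume f: "f \<in> irrelevant"
  show "f \<in> p"
  proof (rule in_span_monomials[OF _ assms(1)])
    fix \<nu> assume "\<nu> \<in> Poly_Mapping.keys f"
    then have "\<nu> \<noteq> 0" using f by (auto simp: irrelevant_def in_keys_iff)
    then obtain i where "Poly_Mapping.lookup \<nu> i > 0" by (metis gr0I lookup_zero poly_mapping_eqI)
    then obtain \<mu> where "\<nu> = Poly_Mapping.single i 1 + \<mu>" by (rule split_var)
    then show "monomial \<nu> \<in> p" using assms by (simp add: monomial_add mvar_eq_monomial idl_mult)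
  qed
qed

lemma graded_proper_in_irrelevant:
  fixes P :: "('v::finite, 'k::field) mpol set"
  assumes "gr total_degree P" "1 \<notin> P"
  shows "P \<subseteq> irrelevant"
proof
  fix f assume "f \<in> P"
  then have "gcomp total_degree 0 f \<in> P" using assms(1) by (simp add: gr_def)
  moreover have "gcomp total_degree 0 f = mconst (Poly_Mapping.lookup f 0)"
    by (rule poly_mapping_eqI) (auto simp: lookup_comp mconst_def lookup_single when_def total_degree_eq_0)
  ultimately have *: "scl (inverse (Poly_Mapping.lookup f 0)) (mconst (Poly_Mapping.lookup f 0)) \<in> P"
    using gr_idl[OF assms(1)] by (simp add: idl_scl)
  have "Poly_Mapping.lookup f 0 = 0"
  proof (rule ccontr)
    assume "Poly_Mapping.lookup f 0 \<noteq> 0"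
    then show False using * assms(2) by (simp add: scl_def mconst_mult[symmetric])
  qed
  then show "f \<in> irrelevant" by (simp add: irrelevant_def)
qed

text \<open>Under the hypothesis all variables kill the factors of the filtration, so each step back
  along it costs just one more degree.\<close>

lemma all_primes_irrelevant_imp_primary:
  fixes J :: "('v::finite, 'k::field) mpol set"
  assumes "gr total_degree J" and "\<And>P. gr total_degree P \<Longrightarrow> prm P \<Longrightarrow> J \<subseteq> P \<Longrightarrow> (\<forall>i. mvar i \<in> P)"
  shows "\<exists>N. \<forall>\<nu>. total_degree \<nu> \<ge> N \<longrightarrow> monomial \<nu> \<in> J"
  using assms(1)
proof (induction rule: graded_ideal_induct)
  case UNIV
  then show ?case by simp
next
  case (step J' f e)
  have idl: "idl J'" using step(1) by (rule gr_idl)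
  obtain N where N: "\<And>\<nu>. total_degree \<nu> \<ge> N \<Longrightarrow> monomial \<nu> \<in> rm.span (insert f J')" using step by blast
  have v: "mvar i * f \<in> J'" for i
    using assms(2)[OF step(6,5)] colon_superset[OF idl, of f] step(2) by (auto simp: colon_def)
  have "monomial \<nu> \<in> J'" if \<nu>: "total_degree \<nu> \<ge> Suc N" for \<nu>
  proof -
    have "\<nu> \<noteq> 0" using \<nu> by auto
    then obtain i where "Poly_Mapping.lookup \<nu> i > 0" by (metis gr0I lookup_zero poly_mapping_eqI)
    then obtain \<mu> where \<mu>: "\<nu> = Poly_Mapping.single i 1 + \<mu>" by (rule split_var)
    then have "monomial \<mu> \<in> rm.span (insert f J')" using \<nu> N by (simp add: total_degree_add total_degree_single)
    then obtain r where r: "monomial \<mu> - r * f \<in> J'" using span_insert_idl[OF idl] by blast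
    have "mvar i * (monomial \<mu> - r * f) + r * (mvar i * f) \<in> J'"
      using idl_mult(1)[OF idl r] idl_mult(1)[OF idl v] idl rm.subspace_add by blast
    then show ?thesis by (simp add: \<mu> monomial_add mvar_eq_monomial algebra_simps)
  qed
  then show ?case by blast
qed

text \<open>A line \<open>a + t b\<close> has at most one point in a subspace that does not contain
  both \<open>a\<close> and \<open>b\<close>, and an infinite field has a parameter that avoids
  finitely many points.\<close>

lemma avoid_subspaces:
  fixes V :: "('v, 'k::{field, ring_char_0}) mpol set"
  assumes "finite \<P>" "Kv.subspace V" "\<And>P. P \<in> \<P> \<Longrightarrow> Kv.subspace P \<and> \<not> V \<subseteq> P"
  shows "\<exists>v\<in>V. \<forall>P\<in>\<P>. v \<notin> P"
  using assms(1,3)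
proof (induction \<P> rule: finite_induct)
  case empty
  then show ?case using Kv.subspace_0[OF assms(2)] by auto
next
  case (insert P \<P>)
  then obtain a where a: "a \<in> V" "\<And>Q. Q \<in> \<P> \<Longrightarrow> a \<notin> Q" by auto
  obtain b where b: "b \<in> V" "b \<notin> P" using insert.prems[of P] by blast
  have sub: "Kv.subspace Q" if "Q \<in> insert P \<P>" for Q using insert.prems that by blast
  have bad: "t = s" if Q: "Q \<in> insert P \<P>" "a + scl t b \<in> Q" "a + scl s b \<in> Q" for Q t s
  proof (rule ccontr)
    assume ts: "t \<noteq> s"
    have "(a + scl t b) - (a + scl s b) \<in> Q" using Q sub by (intro Kv.subspace_diff) auto
    then have "scl (t - s) b \<in> Q" by (simp add: Kv.scale_left_diff_distrib)
    then have bQ: "b \<in> Q" using ts Kv.subspace_scale[OF sub[OF Q(1)], of "scl (t - s) b" "inverse (t - s)"] by simp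
    then have "(a + scl t b) - scl t b \<in> Q" using Q sub[OF Q(1)] by (intro Kv.subspace_diff Kv.subspace_scale) auto
    then have "a \<in> Q" by simp
    then show False using Q(1) a b(2) bQ by auto
  qed
  have "finite (\<Union>Q\<in>insert P \<P>. {t. a + scl t b \<in> Q})"
  proof (intro finite_UN_I)
    fix Q assume Q: "Q \<in> insert P \<P>"
    show "finite {t. a + scl t b \<in> Q}"
    proof (cases "\<exists>t. a + scl t b \<in> Q")
      case True
      then obtain t where "a + scl t b \<in> Q" by blast
      then have "{t. a + scl t b \<in> Q} \<subseteq> {t}" using bad[OF Q] by blast
      then show ?thesis using finite_subset by blast
    qed simp
  qed (use insert in auto)
  then obtain t where "t \<notin> (\<Union>Q\<in>insert P \<P>. {t. a + scl t b \<in> Q})"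
    using ex_new_if_finite[OF infinite_UNIV_char_0[where 'a='k]] by blast
  then show ?case using a(1) b(1) assms(2)
    by (intro bexI[of _ "a + scl t b"] Kv.subspace_add Kv.subspace_scale) auto
qed

section \<open>Cutting down the dimension with linear forms\<close>

definition chain_dim_le :: "('v::finite, 'k::field) mpol set \<Rightarrow> nat \<Rightarrow> bool" where
  "chain_dim_le J k \<longleftrightarrow> (\<forall>l p. prime_chain J l p \<longrightarrow> l \<le> k)"

text \<open>The identity with column \<open>i\<close> replaced by \<open>a\<close>: the substitution
  sends \<open>mvar i\<close> to the linear form with coefficients \<open>a\<close> and fixes the
  other variables.\<close>

definition col_matrix :: "'n \<Rightarrow> ('n \<Rightarrow> 'k) \<Rightarrow> 'k::field ^ 'n ^ 'n::finite" where
  "col_matrix i a = (\<chi> j c. if c = i then a j else if j = c then 1 else 0)"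

lemma col_matrix_mult:
  fixes a b :: "'n::finite \<Rightarrow> 'k::field"
  assumes a: "a i \<noteq> 0" and b: "b = (\<lambda>j. if j = i then inverse (a i) else - a j / a i)"
  shows "col_matrix i a ** col_matrix i b = mat 1 \<and> col_matrix i b ** col_matrix i a = mat 1"
proof -
  have mult: "(col_matrix i u ** col_matrix i w) $ j $ c =
      (if c = i then u j * w i + (if j = i then 0 else w j) else if j = c then 1 else 0)" for u w :: "'n \<Rightarrow> 'k" and j c
  proof (cases "c = i")
    case True
    have "(\<Sum>k\<in>UNIV. (if k = i then u j else if j = k then 1 else 0) * w k) =
        (\<Sum>k\<in>UNIV. (if k = i then u j * w k else 0) + (if k = j then (if j = i then 0 else w k) else 0))"
      by (rule sum.cong) auto
    also have "\<dots> = u j * w i + (if j = i then 0 else w j)" by (simp add: sum.distrib)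
    finally show ?thesis using True by (simp add: matrix_matrix_mult_def col_matrix_def)
  next
    case False
    have "(\<Sum>k\<in>UNIV. (if k = i then u j else if j = k then 1 else 0) * (if k = c then 1 else 0)) =
        (\<Sum>k\<in>UNIV. if k = c then (if j = c then 1 else 0) else 0)"
      using False by (intro sum.cong) auto
    also have "\<dots> = (if j = c then 1 else 0)" by simp
    finally show ?thesis using False by (simp add: matrix_matrix_mult_def col_matrix_def)
  qed
  show ?thesis
    unfolding vec_eq_iff mult using a by (auto simp: mat_def b field_simps)
qed

lemma gl_col_matrix:
  fixes a :: "'n::finite \<Rightarrow> 'k::field"
  shows "c \<noteq> i \<Longrightarrow> gl_act (col_matrix i a) (mvar c) = mvar c"
    and "gl_act (col_matrix i a) (mvar i) = (\<Sum>j\<in>UNIV. scl (a j) (mvar j))"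
proof -
  assume "c \<noteq> i"
  then have "gl_act (col_matrix i a) (mvar c) = (\<Sum>j\<in>UNIV. if j = c then mvar j else 0)"
    unfolding gl_mvar by (intro sum.cong) (auto simp: col_matrix_def)
  then show "gl_act (col_matrix i a) (mvar c) = mvar c" by simp
qed (simp add: gl_mvar scl_def col_matrix_def)

lemma Sp_degree_1:
  fixes v :: "('v::finite, 'k::comm_ring_1) mpol"
  assumes "hg total_degree 1 v"
  shows "v = (\<Sum>j\<in>UNIV. scl (Poly_Mapping.lookup v (Poly_Mapping.single j 1)) (mvar j))"
proof (rule poly_mapping_eqI)
  fix \<nu>
  have inj: "Poly_Mapping.single j (1::nat) = Poly_Mapping.single k 1 \<longleftrightarrow> j = k" for j k :: 'v
    by (metis lookup_single_eq lookup_single_not_eq zero_neq_one)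
  show "Poly_Mapping.lookup v \<nu> = Poly_Mapping.lookup (\<Sum>j\<in>UNIV. scl (Poly_Mapping.lookup v (Poly_Mapping.single j 1)) (mvar j)) \<nu>"
  proof (cases "\<exists>k. \<nu> = Poly_Mapping.single k 1")
    case True
    then obtain k where k: "\<nu> = Poly_Mapping.single k 1" by blast
    have "Poly_Mapping.lookup (\<Sum>j\<in>UNIV. scl (Poly_Mapping.lookup v (Poly_Mapping.single j 1)) (mvar j)) \<nu> =
        (\<Sum>j\<in>UNIV. if j = k then Poly_Mapping.lookup v (Poly_Mapping.single j 1) else 0)"
      unfolding lookup_sum
      by (rule sum.cong) (auto simp: lookup_scl mvar_def lookup_single when_def k inj[unfolded One_nat_def])
    then show ?thesis using k by simp
  next
    case False
    have "\<nu> \<notin> Poly_Mapping.keys v"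
    proof
      assume "\<nu> \<in> Poly_Mapping.keys v"
      then have d: "total_degree \<nu> = 1" using assms by (simp add: hg_def)
      then have "\<nu> \<noteq> 0" by auto
      then obtain i where "Poly_Mapping.lookup \<nu> i > 0" by (metis gr0I lookup_zero poly_mapping_eqI)
      then obtain \<mu> where "\<nu> = Poly_Mapping.single i 1 + \<mu>" by (rule split_var)
      moreover from this have "\<mu> = 0" using d by (simp add: total_degree_add total_degree_single total_degree_eq_0)
      ultimately have "\<nu> = Poly_Mapping.single i 1" by simp
      then show False using False by blast
    qed
    moreover have "Poly_Mapping.lookup (\<Sum>j\<in>UNIV. scl (Poly_Mapping.lookup v (Poly_Mapping.single j 1)) (mvar j)) \<nu> = 0"
      unfolding lookup_sum using False
      by (intro sum.neutral) (auto simp: lookup_scl mvar_def lookup_single when_def)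
    ultimately show ?thesis by (simp add: in_keys_iff)
  qed
qed

text \<open>A linear form that avoids all minimal primes which can be avoided lowers the dimension.
  It is moved to \<open>mvar i\<close> by a substitution fixing the other variables, so that
  parameters already placed stay in place.\<close>

lemma dimension_drop:
  fixes J :: "('v::finite, 'k::{field, ring_char_0}) mpol set"
  assumes J: "gr total_degree J" "chain_dim_le J (Suc k)"
  obtains h where "invertible h" "\<And>c. c \<noteq> i \<Longrightarrow> gl_act h (mvar c) = mvar c"
    "chain_dim_le (rm.span (insert (mvar i) (gl_act h ` J))) k"
proof -
  obtain \<P> where P: "finite \<P>" "\<And>P. P \<in> \<P> \<Longrightarrow> prm P \<and> J \<subseteq> P" "\<And>p. prm p \<Longrightarrow> J \<subseteq> p \<Longrightarrow> \<exists>P\<in>\<P>. P \<subseteq> p"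
    using finite_minimal_primes[OF J(1)] by metis
  let ?V = "hom_part 1 :: ('v, 'k) mpol set"
  \<comment> \<open>Avoiding \<open>?H\<close> gives the form a nonzero coefficient at
    \<open>mvar i\<close>, which makes the column matrix invertible.\<close>
  let ?H = "{v :: ('v, 'k) mpol. Poly_Mapping.lookup v (Poly_Mapping.single i 1) = 0}"
  have "\<exists>v\<in>?V. \<forall>P\<in>insert ?H {P\<in>\<P>. \<not> ?V \<subseteq> P}. v \<notin> P"
  proof (rule avoid_subspaces)
    fix P assume "P \<in> insert ?H {P\<in>\<P>. \<not> ?V \<subseteq> P}"
    moreover have "Kv.subspace ?H"
      by (rule Kv.subspaceI) (auto simp: lookup_add lookup_scl)
    moreover have "mvar i \<in> ?V \<and> mvar i \<notin> ?H" using hg_mvar[of i, where 'k='k] by (simp add: hom_part_eq) (simp add: mvar_def)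
    ultimately show "Kv.subspace P \<and> \<not> ?V \<subseteq> P" using P(2) idl_Kv by (auto simp: prm_def)
  qed (use P(1) in \<open>auto simp: hom_part_Sp\<close>)
  then obtain v where v: "v \<in> ?V" "v \<notin> ?H" "\<And>P. P \<in> \<P> \<Longrightarrow> v \<in> P \<Longrightarrow> ?V \<subseteq> P" by blast
  define a where "a j = Poly_Mapping.lookup v (Poly_Mapping.single j 1)" for j
  define b where "b = (\<lambda>j. if j = i then inverse (a i) else - a j / a i)"
  have ai: "a i \<noteq> 0" using v(2) by (simp add: a_def)
  have inv: "invertible (col_matrix i b)" using col_matrix_mult[OF ai b_def] by (auto simp: invertible_def)
  have "v = gl_act (col_matrix i a) (mvar i)"
    using Sp_degree_1[of v] v(1) by (simp add: gl_col_matrix a_def hom_part_eq)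
  then have hv: "gl_act (col_matrix i b) v = mvar i"
    using col_matrix_mult[OF ai b_def] by (simp add: gl_compose gl_mat_1)
  have "chain_dim_le (rm.span (insert (mvar i) (gl_act (col_matrix i b) ` J))) k"
    unfolding chain_dim_le_def
  proof (intro allI impI)
    fix l p assume p: "prime_chain (rm.span (insert (mvar i) (gl_act (col_matrix i b) ` J))) l p"
    define q where "q j = gl_act (col_matrix i b) -` p j" for j
    have q: "prm (q j)" if "j \<le> l" for j using p that by (simp add: q_def prime_chain_def prm_gl_vimage)
    have q2: "q j \<subset> q (Suc j)" if "j < l" for j
    proof -
      have "p j \<subset> p (Suc j)" using p that by (simp add: prime_chain_def)
      moreover have "gl_act (col_matrix i b) (gl_act (col_matrix i a) x) = x" for x
        using col_matrix_mult[OF ai b_def] by (simp add: gl_compose gl_mat_1)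
      ultimately show ?thesis unfolding q_def
        by (metis surj_image_vimage_eq surjI vimage_mono psubset_eq)
    qed
    have "insert (mvar i) (gl_act (col_matrix i b) ` J) \<subseteq> p 0"
      using p rm.span_superset[of "insert (mvar i) (gl_act (col_matrix i b) ` J)"] by (auto simp: prime_chain_def)
    then have q0: "J \<subseteq> q 0" "v \<in> q 0" using hv by (auto simp: q_def)
    obtain P where PP: "P \<in> \<P>" "P \<subseteq> q 0" using P(3)[OF q[of 0] q0(1)] by blast
    show "l \<le> k"
    proof (cases "?V \<subseteq> P")
      case True
      \<comment> \<open>A minimal prime with all linear forms contains the irrelevant ideal; that
        ideal is maximal, so the chain has length 0.\<close>
      then have "irrelevant \<subseteq> q 0"
      proof (intro irrelevant_subset)
        show "idl (q 0)" using q[of 0] by (simp add: prm_def)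
        have "mvar j \<in> ?V" for j by (simp only: hom_part_eq hg_mvar)
        then show "mvar j \<in> q 0" for j using True PP(2) by blast
      qed
      then have "l = 0" using q2[of 0] q[of 1] irrelevant_maximal[of "q 1"] by (cases l) (auto simp: prm_def)
      then show ?thesis by simp
    next
      case False
      \<comment> \<open>This minimal prime omits \<open>v\<close>, hence lies strictly below the
        chain and lengthens it.\<close>
      then have "P \<subset> q 0" using PP v(3) q0(2) by blast
      moreover have "prm P" using P(2) PP(1) by blast
      ultimately have "prime_chain J (Suc l) (case_nat P q)"
        using q q2 P(2)[OF PP(1)] by (auto simp: prime_chain_def split: nat.split)
      then have "Suc l \<le> Suc k" using J(2) unfolding chain_dim_le_def by blast
      then show ?thesis by simp
    qed
  qed
  then show ?thesis using that inv gl_col_matrix(1) by blast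
qed

lemma mvar_in_irrelevant: "(mvar i :: ('v, 'k::comm_ring_1) mpol) \<in> irrelevant"
proof -
  have "Poly_Mapping.single i (1 :: nat) \<noteq> 0" by (metis lookup_single_eq lookup_zero one_neq_zero)
  then show ?thesis unfolding mvar_eq_monomial by (rule monomial_in_irrelevant)
qed

text \<open>\<open>E\<close> collects the variables already used as parameters. They belong to the
  enlarged ideal, and later substitutions must fix them in order that the successive changes of
  coordinates can be composed.\<close>

theorem parameters_exist:
  fixes J :: "('v::finite, 'k::field_char_0) mpol set"
  assumes "gr total_degree J" "mvar ` E \<subseteq> J" "E \<inter> D = {}" "chain_dim_le J (card D)"
  shows "\<exists>g. invertible g \<and> (\<forall>e\<in>E. gl_act g (mvar e) = mvar e) \<and> primary D (gl_act g ` J)"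
  using finite[of D] assms
proof (induction D arbitrary: J E rule: finite_induct)
  case empty
  have "\<forall>i. mvar i \<in> P" if P: "gr total_degree P" "prm P" "J \<subseteq> P" for P :: "('v, 'k) mpol set"
  proof (rule ccontr)
    assume "\<not> (\<forall>i. mvar i \<in> P)"
    then have "P \<noteq> irrelevant" using mvar_in_irrelevant by blast
    moreover have "P \<subseteq> irrelevant" using P by (intro graded_proper_in_irrelevant) (auto simp: prm_def)
    ultimately have "prime_chain J 1 (\<lambda>i. if i = 0 then P else irrelevant)"
      using P prm_irrelevant by (auto simp: prime_chain_def)
    then have "1 \<le> (0::nat)" using empty(4) unfolding chain_dim_le_def card.empty by blast
    then show False by simp
  qed
  then obtain N where N: "\<forall>\<nu>. total_degree \<nu> \<ge> N \<longrightarrow> monomial \<nu> \<in> J"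
    using all_primes_irrelevant_imp_primary[OF empty(1)] by blast
  then have "primary {} J" using rm.span_superset[of "J \<union> mvar ` {}"] by (auto simp: primary_def)
  moreover have "gl_act (mat 1) ` J = J" by (simp add: gl_mat_1)
  moreover have "invertible (mat 1 :: 'k ^ 'v ^ 'v)" by (auto simp: invertible_def)
  ultimately show ?case by (intro exI[of _ "mat 1"]) (simp add: gl_mat_1)
next
  case (insert i D)
  have "chain_dim_le J (Suc (card D))" using insert by simp
  then obtain h where h: "invertible h" "\<And>c. c \<noteq> i \<Longrightarrow> gl_act h (mvar c) = mvar c"
    "chain_dim_le (rm.span (insert (mvar i) (gl_act h ` J))) (card D)"
    using dimension_drop[OF insert.prems(1)] by metis
  let ?J = "rm.span (insert (mvar i) (gl_act h ` J))"
  have grJ: "gr total_degree ?J"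
    by (rule gr_insert[OF gr_gl[OF h(1) insert.prems(1)] hg_mvar])
  have "mvar e \<in> ?J" if "e \<in> insert i E" for e
  proof (cases "e = i")
    case False
    then have "mvar e = gl_act h (mvar e)" "mvar e \<in> J" using that h insert.prems by auto
    then have "mvar e \<in> gl_act h ` J" by blast
    then show ?thesis by (intro rm.span_base) simp
  qed (simp add: rm.span_base)
  then have "\<exists>g. invertible g \<and> (\<forall>e\<in>insert i E. gl_act g (mvar e) = mvar e) \<and> primary D (gl_act g ` ?J)"
    using insert.prems insert.hyps by (intro insert.IH grJ h) auto
  then obtain g where g: "invertible g" "\<And>e. e \<in> insert i E \<Longrightarrow> gl_act g (mvar e) = mvar e" "primary D (gl_act g ` ?J)"
    by blast
  have "gl_act g x \<in> rm.span (insert (mvar i) (gl_act (g ** h) ` J))" if x: "x \<in> ?J" for x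
  proof -
    have "x \<in> rm.span (insert (mvar i) (gl_act h ` J)) \<longleftrightarrow> (\<exists>r. x - r * mvar i \<in> gl_act h ` J)"
      by (rule span_insert_idl[OF idl_gl[OF h(1) gr_idl[OF insert.prems(1)]]])
    then obtain r y where r: "x - r * mvar i = gl_act h y" "y \<in> J" using x by blast
    have "gl_act g x = gl_act g (x - r * mvar i) + gl_act g r * gl_act g (mvar i)"
      by (simp add: gl_diff gl_mult)
    also have "\<dots> = gl_act (g ** h) y + gl_act g r * mvar i" using g(2)[of i] r by (simp add: gl_compose)
    also have "\<dots> \<in> rm.span (insert (mvar i) (gl_act (g ** h) ` J))"
      using r(2) by (intro rm.span_add rm.span_scale rm.span_base) auto
    finally show ?thesis .
  qed
  then have "primary D (rm.span (insert (mvar i) (gl_act (g ** h) ` J)))"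
    using primary_mono[OF g(3)] by blast
  then have "primary (insert i D) (gl_act (g ** h) ` J)" by (simp only: primary_insert)
  moreover have "invertible (g ** h)" using g(1) h(1) by (rule invertible_mult)
  moreover have "gl_act (g ** h) (mvar e) = mvar e" if "e \<in> E" for e
  proof -
    have "e \<noteq> i" using that insert.prems(3) by auto
    then show ?thesis using that g(2)[of e] h(2)[of e] by (simp add: gl_compose[symmetric])
  qed
  ultimately show ?case by blast
qed

section \<open>Polynomial curves and genericity\<close>

text \<open>For scalar curves \<open>c\<close> is the identity; for curves of polynomials it is
  \<open>mconst\<close>, which embeds the parameter into the ring.\<close>

definition pcurve :: "('k \<Rightarrow> 'a::comm_ring_1) \<Rightarrow> ('k \<Rightarrow> 'a) \<Rightarrow> bool" where
  "pcurve c F \<longleftrightarrow> (\<exists>p. \<forall>t. F t = poly p (c t))"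

lemma pcurve_const: "pcurve c (\<lambda>t. a)"
  unfolding pcurve_def by (rule exI[of _ "[:a:]"]) simp

lemma pcurve_param: "pcurve c c"
  unfolding pcurve_def by (rule exI[of _ "[:0, 1:]"]) simp

lemma pcurve_add: "pcurve c F \<Longrightarrow> pcurve c G \<Longrightarrow> pcurve c (\<lambda>t. F t + G t)"
  unfolding pcurve_def by (metis poly_add)

lemma pcurve_diff: "pcurve c F \<Longrightarrow> pcurve c G \<Longrightarrow> pcurve c (\<lambda>t. F t - G t)"
  unfolding pcurve_def by (metis poly_diff)

lemma pcurve_mult: "pcurve c F \<Longrightarrow> pcurve c G \<Longrightarrow> pcurve c (\<lambda>t. F t * G t)"
  unfolding pcurve_def by (metis poly_mult)

lemma pcurve_sum: "(\<And>i. i \<in> A \<Longrightarrow> pcurve c (F i)) \<Longrightarrow> pcurve c (\<lambda>t. \<Sum>i\<in>A. F i t)"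
  by (induction A rule: infinite_finite_induct) (auto intro: pcurve_const pcurve_add)

lemma pcurve_prod: "(\<And>i. i \<in> A \<Longrightarrow> pcurve c (F i)) \<Longrightarrow> pcurve c (\<lambda>t. \<Prod>i\<in>A. F i t)"
  by (induction A rule: infinite_finite_induct) (auto intro: pcurve_const pcurve_mult)

lemma pcurve_power: "pcurve c F \<Longrightarrow> pcurve c (\<lambda>t. F t ^ n)"
  by (induction n) (auto intro: pcurve_const pcurve_mult)

lemma pcurve_finite_zeros:
  fixes F :: "'k::idom \<Rightarrow> 'k"
  assumes "pcurve (\<lambda>t. t) F" "F t0 \<noteq> 0"
  shows "finite {t. F t = 0}"
proof -
  obtain p where p: "\<And>t. F t = poly p t" using assms(1) by (auto simp: pcurve_def)
  then have "p \<noteq> 0" using assms(2) by auto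
  then show ?thesis unfolding p by (rule poly_roots_finite)
qed

lemma pcurve_lookup:
  fixes F :: "'k::comm_ring_1 \<Rightarrow> ('v, 'k) mpol"
  assumes "pcurve mconst F"
  shows "pcurve (\<lambda>t. t) (\<lambda>t. Poly_Mapping.lookup (F t) \<mu>)"
proof -
  obtain p where p: "\<And>t. F t = poly p (mconst t)" using assms by (auto simp: pcurve_def)
  have pow: "mconst t ^ k = mconst (t ^ k)" for t :: 'k and k by (induction k) (auto simp: mconst_mult)
  have "Poly_Mapping.lookup (F t) \<mu> = (\<Sum>k\<le>Polynomial.degree p. t ^ k * Poly_Mapping.lookup (Polynomial.coeff p k) \<mu>)" for t
    by (simp add: p poly_altdef lookup_sum pow mult.commute[of _ "mconst _"] lookup_scl flip: scl_def)
  then show ?thesis by (simp only:) (intro pcurve_sum pcurve_mult pcurve_power pcurve_param pcurve_const)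
qed

text \<open>Stated for families instead of sets, since members that depend on a parameter may
  coincide for some of its values.\<close>

definition family_indep :: "'i set \<Rightarrow> ('i \<Rightarrow> ('v, 'k::field) mpol) \<Rightarrow> bool" where
  "family_indep I F \<longleftrightarrow> (\<forall>c. (\<Sum>i\<in>I. scl (c i) (F i)) = 0 \<longrightarrow> (\<forall>i\<in>I. c i = 0))"

lemma family_indepD: "family_indep I F \<Longrightarrow> (\<Sum>i\<in>I. scl (c i) (F i)) = 0 \<Longrightarrow> \<forall>i\<in>I. c i = 0"
  by (simp add: family_indep_def)

text \<open>Independence at one parameter propagates to almost all parameters, by Gaussian elimination
  with polynomial entries: the pivot coefficient is cleared without dividing by it.\<close>

lemma family_indep_generic:
  fixes F :: "'i \<Rightarrow> 'k \<Rightarrow> ('v, 'k::field) mpol"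
  assumes "finite I" "\<And>i \<mu>. i \<in> I \<Longrightarrow> pcurve (\<lambda>t. t) (\<lambda>t. Poly_Mapping.lookup (F i t) \<mu>)"
    "family_indep I (\<lambda>i. F i t0)"
  shows "finite {t. \<not> family_indep I (\<lambda>i. F i t)}"
  using assms
proof (induction I arbitrary: F rule: finite_induct)
  case empty
  then show ?case by (simp add: family_indep_def)
next
  case (insert i I)
  have "F i t0 \<noteq> 0"
  proof
    assume "F i t0 = 0"
    then have "(\<Sum>j\<in>insert i I. scl (if j = i then 1 else 0) (F j t0)) = 0"
      using insert.hyps by (auto intro!: sum.neutral)
    then have "\<forall>j\<in>insert i I. (if j = i then 1 else 0 :: 'k) = 0"
      by (rule family_indepD[OF insert.prems(2)])
    then show False by simp
  qed
  then obtain \<mu> where \<mu>: "Poly_Mapping.lookup (F i t0) \<mu> \<noteq> 0" by (metis lookup_zero poly_mapping_eqI)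
  define a where "a t = Poly_Mapping.lookup (F i t) \<mu>" for t
  define b where "b j t = Poly_Mapping.lookup (F j t) \<mu>" for j t
  define G where "G j t = scl (a t) (F j t) - scl (b j t) (F i t)" for j t
  have comb: "(\<Sum>j\<in>I. scl (c j) (G j t)) = scl (a t) (\<Sum>j\<in>I. scl (c j) (F j t)) - scl (\<Sum>j\<in>I. c j * b j t) (F i t)" for c t
    by (simp add: G_def sum_subtractf Kv.scale_right_diff_distrib Kv.scale_sum_right Kv.scale_sum_left mult.commute)
  have "pcurve (\<lambda>t. t) (\<lambda>t. Poly_Mapping.lookup (G j t) \<rho>)" if "j \<in> I" for j \<rho>
    unfolding G_def lookup_minus lookup_scl a_def b_def
    using that insert.prems(1) by (intro pcurve_diff pcurve_mult) auto
  moreover have "family_indep I (\<lambda>j. G j t0)"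
    unfolding family_indep_def
  proof (intro allI impI)
    fix c assume "(\<Sum>j\<in>I. scl (c j) (G j t0)) = 0"
    then have "(\<Sum>j\<in>insert i I. scl (if j = i then - (\<Sum>j\<in>I. c j * b j t0) else a t0 * c j) (F j t0)) = 0"
      using insert.hyps by (simp add: comb Kv.scale_sum_right) (subst sum.cong[OF refl, of I _ "\<lambda>j. scl (a t0 * c j) (F j t0)"], auto)
    then have "\<forall>j\<in>insert i I. (if j = i then - (\<Sum>j\<in>I. c j * b j t0) else a t0 * c j) = 0"
      by (rule family_indepD[OF insert.prems(2)])
    then have "a t0 * c j = 0" if "j \<in> I" for j using that insert.hyps by (metis insertCI)
    then show "\<forall>j\<in>I. c j = 0" using \<mu> by (simp add: a_def)
  qed
  ultimately have fin: "finite {t. \<not> family_indep I (\<lambda>j. G j t)}" by (intro insert.IH) auto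
  have "finite {t. a t = 0}" using insert.prems(1) \<mu> unfolding a_def by (intro pcurve_finite_zeros) auto
  moreover have "family_indep (insert i I) (\<lambda>j. F j t)" if t: "a t \<noteq> 0" "family_indep I (\<lambda>j. G j t)" for t
    unfolding family_indep_def
  proof (intro allI impI)
    fix c assume "(\<Sum>j\<in>insert i I. scl (c j) (F j t)) = 0"
    then have sum0: "(\<Sum>j\<in>I. scl (c j) (F j t)) = - scl (c i) (F i t)"
      using insert.hyps by (simp add: eq_neg_iff_add_eq_0 add.commute)
    then have "Poly_Mapping.lookup (\<Sum>j\<in>I. scl (c j) (F j t)) \<mu> = Poly_Mapping.lookup (- scl (c i) (F i t)) \<mu>" by simp
    then have l: "(\<Sum>j\<in>I. c j * b j t) = - (c i * a t)" by (simp add: lookup_sum lookup_scl a_def b_def)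
    have "(\<Sum>j\<in>I. scl (c j) (G j t)) = 0" unfolding comb sum0 l by (simp add: mult.commute)
    then have cI: "\<forall>j\<in>I. c j = 0" by (rule family_indepD[OF t(2)])
    then have "c i * a t = 0" using l by simp
    then show "\<forall>j\<in>insert i I. c j = 0" using t(1) cI by simp
  qed
  ultimately show ?case
    using finite_subset[of "{t. \<not> family_indep (insert i I) (\<lambda>i. F i t)}" "{t. a t = 0} \<union> {t. \<not> family_indep I (\<lambda>j. G j t)}"] fin
    by blast
qed

lemma family_indep_independent:
  fixes F :: "'i \<Rightarrow> ('v, 'k::field) mpol"
  assumes "finite M" "family_indep M F"
  shows "inj_on F M" "Kv.independent (F ` M)"
proof -
  show inj: "inj_on F M"
  proof (rule inj_onI, rule ccontr)
    fix x y assume xy: "x \<in> M" "y \<in> M" "F x = F y" "x \<noteq> y"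
    have "(\<Sum>i\<in>M. scl (if i = x then 1 else if i = y then - 1 else 0) (F i)) =
        (\<Sum>i\<in>M. (if i = x then F x else 0) - (if i = y then F y else 0))"
      using xy by (intro sum.cong) auto
    also have "\<dots> = 0" using xy assms(1) by (simp add: sum_subtractf)
    finally have "\<forall>i\<in>M. (if i = x then 1 else if i = y then - 1 else 0 :: 'k) = 0"
      by (rule family_indepD[OF assms(2)])
    then show False using xy(1) by auto
  qed
  show "Kv.independent (F ` M)"
  proof (rule Kv.independent_if_scalars_zero)
    fix f x assume f: "(\<Sum>x\<in>F ` M. scl (f x) x) = 0" and x: "x \<in> F ` M"
    have "(\<Sum>i\<in>M. scl (f (F i)) (F i)) = 0" using f by (simp add: sum.reindex[OF inj])
    then have "\<forall>i\<in>M. f (F i) = 0" by (rule family_indepD[OF assms(2)])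
    then show "f x = 0" using x by blast
  qed (use assms(1) in simp)
qed

lemma family_indep_span:
  fixes F :: "_ \<Rightarrow> ('v, 'k::field) mpol"
  assumes "finite M" "family_indep M F" "\<And>\<nu>. \<nu> \<in> M \<Longrightarrow> F \<nu> \<in> Sp M"
  shows "Kv.span (F ` M) = Sp M"
proof (rule Kv_dim_eq[OF _ _ _ _ assms(1)])
  show "Kv.span (F ` M) \<subseteq> Sp M" using assms(3) by (intro Kv.span_minimal) auto
  show "Kv.dim (Sp M :: ('v, 'k) mpol set) \<le> Kv.dim (Kv.span (F ` M))"
    using Kv.dim_span_eq_card_independent[OF family_indep_independent(2)[OF assms(1,2)]]
      family_indep_independent(1)[OF assms(1,2)] by (simp add: dim_Sp card_image)
qed auto

lemma span_mvars_iff: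
  "f \<in> rm.span (mvar ` D) \<longleftrightarrow> (\<forall>\<nu>\<in>Poly_Mapping.keys (f :: ('v, 'k::comm_ring_1) mpol). \<exists>i\<in>D. Poly_Mapping.lookup \<nu> i > 0)"
proof
  assume "f \<in> rm.span (mvar ` D)"
  then show "\<forall>\<nu>\<in>Poly_Mapping.keys f. \<exists>i\<in>D. Poly_Mapping.lookup \<nu> i > 0"
  proof (induction rule: rm.span_induct_alt)
    case (step c x y)
    then obtain i where i: "i \<in> D" "x = mvar i" by blast
    have "\<exists>i\<in>D. Poly_Mapping.lookup \<nu> i > 0" if "\<nu> \<in> Poly_Mapping.keys (c * x)" for \<nu>
      using that i keys_monomial_mult[of "Poly_Mapping.single i 1" c]
      by (auto simp: mvar_eq_monomial mult.commute[of c] lookup_add intro!: bexI[of _ i])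
    then show ?case using step keys_add[of "c * x" y] by blast
  qed simp
next
  assume *: "\<forall>\<nu>\<in>Poly_Mapping.keys f. \<exists>i\<in>D. Poly_Mapping.lookup \<nu> i > 0"
  show "f \<in> rm.span (mvar ` D)"
  proof (rule in_span_monomials)
    fix \<nu> assume "\<nu> \<in> Poly_Mapping.keys f"
    then obtain i where i: "i \<in> D" "Poly_Mapping.lookup \<nu> i > 0" using * by blast
    from i(2) obtain \<mu> where "\<nu> = Poly_Mapping.single i 1 + \<mu>" by (rule split_var)
    then have "monomial \<nu> = monomial \<mu> * (mvar i :: ('v, 'k) mpol)" by (simp add: monomial_add mvar_eq_monomial mult.commute)
    moreover have "monomial \<mu> * mvar i \<in> rm.span (mvar ` D :: ('v, 'k) mpol set)"
      by (intro rm.span_scale rm.span_base imageI i(1))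
    ultimately show "monomial \<nu> \<in> rm.span (mvar ` D :: ('v, 'k) mpol set)" by (simp only:)
  qed simp
qed

section \<open>Testing parameters in a single degree\<close>

definition free_mons :: "'v set \<Rightarrow> nat \<Rightarrow> ('v::finite \<Rightarrow>\<^sub>0 nat) set" where
  "free_mons D d = {\<nu>. total_degree \<nu> = d \<and> (\<forall>i\<in>D. Poly_Mapping.lookup \<nu> i = 0)}"

lemma primary_iff_free_mons:
  fixes J :: "('v::finite, 'k::field) mpol set"
  shows "primary D J \<longleftrightarrow> (\<exists>N. \<forall>d\<ge>N. \<forall>\<nu>\<in>free_mons D d. monomial \<nu> \<in> rm.span (J \<union> mvar ` D))"
proof
  assume "\<exists>N. \<forall>d\<ge>N. \<forall>\<nu>\<in>free_mons D d. monomial \<nu> \<in> rm.span (J \<union> mvar ` D)"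
  then obtain N where N: "\<And>d \<nu>. d \<ge> N \<Longrightarrow> \<nu> \<in> free_mons D d \<Longrightarrow> monomial \<nu> \<in> rm.span (J \<union> mvar ` D)" by blast
  have "monomial \<nu> \<in> rm.span (J \<union> mvar ` D)" if "total_degree \<nu> \<ge> N" for \<nu>
  proof (cases "\<nu> \<in> free_mons D (total_degree \<nu>)")
    case False
    then have "monomial \<nu> \<in> rm.span (mvar ` D :: ('v, 'k) mpol set)"
      unfolding span_mvars_iff by (auto simp: free_mons_def monomial_def)
    then show ?thesis using rm.span_mono[of "mvar ` D" "J \<union> mvar ` D"] by blast
  qed (use N that in blast)
  then show "primary D J" by (auto simp: primary_def)
qed (auto simp: primary_def free_mons_def)

text \<open>Higher degrees follow by multiplying with variables, so that being a system of
  parameters becomes a condition on one finite-dimensional space.\<close>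

lemma primary_if_degree:
  fixes J :: "('v::finite, 'k::field) mpol set"
  assumes "\<forall>\<nu>\<in>free_mons D d. monomial \<nu> \<in> rm.span (J \<union> mvar ` D)"
  shows "primary D J"
proof -
  have "monomial \<nu> \<in> rm.span (J \<union> mvar ` D)" if "\<nu> \<in> free_mons D (d + e)" for \<nu> e
    using that
  proof (induction e arbitrary: \<nu>)
    case 0 then show ?case using assms by simp
  next
    case (Suc e)
    then have "\<nu> \<noteq> 0" by (auto simp: free_mons_def)
    then obtain i where "Poly_Mapping.lookup \<nu> i > 0" by (metis gr0I lookup_zero poly_mapping_eqI)
    then obtain \<mu> where \<mu>: "\<nu> = Poly_Mapping.single i 1 + \<mu>" by (rule split_var)
    then have "\<mu> \<in> free_mons D (d + e)"
      using Suc.prems by (auto simp: free_mons_def total_degree_add total_degree_single lookup_add)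
    then show ?case using Suc.IH by (simp add: \<mu> monomial_add rm.span_scale)
  qed
  then show ?thesis unfolding primary_iff_free_mons by (metis le_Suc_ex)
qed

text \<open>Witnesses in normalized form: modulo the variables of \<open>D\<close> the form
  \<open>u\<close> is exactly the monomial. The Boolean grading cuts out its part free of
  \<open>D\<close>.\<close>

lemma primary_generators:
  fixes I :: "('v::finite, 'k::field) mpol set"
  assumes I: "gr total_degree I" and prim: "primary D I"
  obtains d where "\<And>\<nu>. \<nu> \<in> free_mons D d \<Longrightarrow>
    \<exists>u\<in>I. hg total_degree d u \<and> gcomp (\<lambda>\<mu>. \<mu> \<in> free_mons D d) True u = monomial \<nu>"
proof -
  obtain d where d: "\<And>\<nu>. \<nu> \<in> free_mons D d \<Longrightarrow> monomial \<nu> \<in> rm.span (I \<union> mvar ` D)"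
    using prim unfolding primary_iff_free_mons by blast
  have "\<exists>u\<in>I. hg total_degree d u \<and> gcomp (\<lambda>\<mu>. \<mu> \<in> free_mons D d) True u = monomial \<nu>" if \<nu>: "\<nu> \<in> free_mons D d" for \<nu>
  proof -
    have "monomial \<nu> \<in> {x + y | x y. x \<in> rm.span I \<and> y \<in> rm.span (mvar ` D)}"
      using d[OF \<nu>] by (simp only: rm.span_Un)
    then obtain x y where xy: "monomial \<nu> = x + y" "x \<in> I" "y \<in> rm.span (mvar ` D)"
      using rm.span_eq_iff[THEN iffD2, OF gr_idl[OF I]] by auto
    let ?u = "gcomp total_degree d x"
    have "Poly_Mapping.lookup (gcomp (\<lambda>\<mu>. \<mu> \<in> free_mons D d) True ?u) \<mu> = Poly_Mapping.lookup (monomial \<nu>) \<mu>" for \<mu>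
    proof (cases "\<mu> \<in> free_mons D d")
      case True
      then have "\<mu> \<notin> Poly_Mapping.keys y" using xy(3) unfolding span_mvars_iff by (force simp: free_mons_def)
      then have "Poly_Mapping.lookup (monomial \<nu>) \<mu> = Poly_Mapping.lookup x \<mu>"
        by (simp add: xy(1) lookup_add in_keys_iff)
      then show ?thesis using True by (simp add: lookup_comp free_mons_def)
    next
      case False
      then have "Poly_Mapping.lookup (monomial \<nu> :: ('v, 'k) mpol) \<mu> = 0" using \<nu>
        by (auto simp: monomial_def lookup_single when_def)
      then show ?thesis using False by (simp add: lookup_comp)
    qed
    then have "gcomp (\<lambda>\<mu>. \<mu> \<in> free_mons D d) True ?u = monomial \<nu>" by (rule poly_mapping_eqI)
    moreover have "?u \<in> I" using I xy(2) by (simp add: gr_def)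
    ultimately show ?thesis using hg_comp[of total_degree d x] by blast
  qed
  then show ?thesis using that by blast
qed

definition line :: "'k ^ 'n ^ 'n \<Rightarrow> 'k ^ 'n ^ 'n \<Rightarrow> 'k \<Rightarrow> 'k::field ^ 'n ^ 'n::finite" where
  "line g0 g1 t = (\<chi> i j. (1 - t) * g0 $ i $ j + t * g1 $ i $ j)"

lemma line_0 [simp]: "line g0 g1 0 = g0" and line_1 [simp]: "line g0 g1 1 = g1"
  by (simp_all add: line_def vec_eq_iff)

lemma pcurve_gl_line:
  fixes u :: "('n::finite, 'k::field) mpol"
  shows "pcurve mconst (\<lambda>t. gl_act (line g0 g1 t) u)"
proof -
  have entry: "pcurve mconst (\<lambda>t. mconst (line g0 g1 t $ i $ j) :: ('n, 'k) mpol)" for i j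
  proof -
    have "(mconst (line g0 g1 t $ i $ j) :: ('n, 'k) mpol) = mconst (g0 $ i $ j) + mconst t * mconst (g1 $ i $ j - g0 $ i $ j)" for t
      by (simp add: line_def mconst_add[symmetric] mconst_mult[symmetric] algebra_simps)
    then show ?thesis by (simp only:) (intro pcurve_add pcurve_mult pcurve_const pcurve_param)
  qed
  show ?thesis
    unfolding gl_act_def mpol_subst_def
    by (intro pcurve_sum pcurve_mult pcurve_const pcurve_prod pcurve_power entry)
qed

lemma pcurve_line_entry: "pcurve (\<lambda>t. t) (\<lambda>t. line g0 g1 t $ i $ j)"
  unfolding line_def by (simp add: pcurve_add pcurve_mult pcurve_const pcurve_param pcurve_diff)

lemma pcurve_det_line: "pcurve (\<lambda>t. t) (\<lambda>t. Determinants.det (line g0 g1 t))"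
  unfolding Determinants.det_def by (intro pcurve_sum pcurve_mult pcurve_prod pcurve_const pcurve_line_entry)

text \<open>The forms in \<open>I\<close> that exhibit the parameters after \<open>g0\<close> do so
  after \<open>g\<close> whenever their \<open>D\<close>-free parts remain linearly independent. On
  the line from \<open>g0\<close> to a point where an equation of \<open>U\<close> does not vanish,
  all but finitely many matrices keep this property, are invertible and lie in
  \<open>U\<close>.\<close>

lemma generic_primary:
  fixes I :: "('n::finite, 'k::field_char_0) mpol set"
  assumes I: "gr total_degree I" and g0: "invertible g0" "primary D (gl_act g0 ` I)"
    and U: "U \<noteq> {}" "zariski_open_GL U"
  shows "\<exists>g\<in>U. primary D (gl_act g ` I)"
proof -
  obtain F where F: "U = {g. invertible g \<and> (\<exists>p\<in>F. mpol_subst id (\<lambda>(i, j). g $ i $ j) p \<noteq> 0)}"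
    using U(2) by (auto simp: zariski_open_GL_def)
  obtain g1 p where g1: "p \<in> F" "mpol_subst id (\<lambda>(i, j). g1 $ i $ j) p \<noteq> 0" using U(1) F by blast
  obtain d where d: "\<And>\<nu>. \<nu> \<in> free_mons D d \<Longrightarrow>
      \<exists>u\<in>gl_act g0 ` I. hg total_degree d u \<and> gcomp (\<lambda>\<mu>. \<mu> \<in> free_mons D d) True u = monomial \<nu>"
    using primary_generators[OF gr_gl[OF g0(1) I] g0(2)] by blast
  let ?M = "free_mons D d" and ?\<chi> = "\<lambda>\<mu>. \<mu> \<in> free_mons D d"
  have "\<forall>\<nu>\<in>?M. \<exists>u\<in>I. hg total_degree d u \<and> gcomp ?\<chi> True (gl_act g0 u) = monomial \<nu>"
  proof
    fix \<nu> assume "\<nu> \<in> ?M"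
    then obtain u where u: "u \<in> I" "hg total_degree d (gl_act g0 u)" "gcomp ?\<chi> True (gl_act g0 u) = monomial \<nu>"
      using d by blast
    have "gl_act g0 (gcomp total_degree d u) = gl_act g0 u"
      using gcomp_gl[of d g0 u] comp_hg[OF u(2), of d] by simp
    moreover have "gcomp total_degree d u \<in> I" using I u(1) by (simp add: gr_def)
    ultimately show "\<exists>u\<in>I. hg total_degree d u \<and> gcomp ?\<chi> True (gl_act g0 u) = monomial \<nu>"
      using u(3) hg_comp by metis
  qed
  then obtain u where u: "\<And>\<nu>. \<nu> \<in> ?M \<Longrightarrow> u \<nu> \<in> I \<and> hg total_degree d (u \<nu>) \<and> gcomp ?\<chi> True (gl_act g0 (u \<nu>)) = monomial \<nu>"
    by metis
  define V where "V \<nu> t = gcomp ?\<chi> True (gl_act (line g0 g1 t) (u \<nu>))" for \<nu> t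
  have finM: "finite ?M" by (rule finite_subset[OF _ finite_total_degree[of d]]) (auto simp: free_mons_def)
  have "finite {t. \<not> family_indep ?M (\<lambda>\<nu>. V \<nu> t)}"
  proof (rule family_indep_generic[OF finM])
    fix \<nu> \<mu>
    have "pcurve (\<lambda>t. t) (\<lambda>t. Poly_Mapping.lookup (gl_act (line g0 g1 t) (u \<nu>)) \<mu>)"
      by (rule pcurve_lookup[OF pcurve_gl_line])
    then show "pcurve (\<lambda>t. t) (\<lambda>t. Poly_Mapping.lookup (V \<nu> t) \<mu>)"
      by (cases "\<mu> \<in> ?M") (simp_all add: V_def lookup_comp pcurve_const)
  next
    show "family_indep ?M (\<lambda>\<nu>. V \<nu> 0)"
      unfolding family_indep_def
    proof (intro allI impI ballI)
      fix c \<mu> assume c: "(\<Sum>\<nu>\<in>?M. scl (c \<nu>) (V \<nu> 0)) = 0" and \<mu>: "\<mu> \<in> ?M"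
      have "(\<Sum>\<nu>\<in>?M. scl (c \<nu>) (V \<nu> 0)) = (\<Sum>\<nu>\<in>?M. Poly_Mapping.single \<nu> (c \<nu>))"
        using u by (intro sum.cong) (auto simp: V_def single_eq_scl)
      then show "c \<mu> = 0" using c \<mu> lookup_sum_single[OF finM, of c \<mu>] by simp
    qed
  qed
  moreover have "finite {t. Determinants.det (line g0 g1 t) = 0}"
    using g0(1) by (intro pcurve_finite_zeros[OF pcurve_det_line, of _ _ 0]) (simp add: invertible_det_nz)
  moreover have "finite {t. mpol_subst id (\<lambda>(i, j). line g0 g1 t $ i $ j) p = 0}"
  proof (rule pcurve_finite_zeros[of _ 1])
    show "pcurve (\<lambda>t. t) (\<lambda>t. mpol_subst id (\<lambda>(i, j). line g0 g1 t $ i $ j) p)"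
      unfolding mpol_subst_def
      by (intro pcurve_sum pcurve_mult pcurve_const pcurve_prod pcurve_power) (auto simp: pcurve_line_entry split: prod.split)
  qed (use g1 in simp)
  ultimately have "finite ({t. \<not> family_indep ?M (\<lambda>\<nu>. V \<nu> t)} \<union> {t. Determinants.det (line g0 g1 t) = 0} \<union>
      {t. mpol_subst id (\<lambda>(i, j). line g0 g1 t $ i $ j) p = 0})" by simp
  from ex_new_if_finite[OF infinite_UNIV_char_0 this] obtain t where
    t: "family_indep ?M (\<lambda>\<nu>. V \<nu> t)" "Determinants.det (line g0 g1 t) \<noteq> 0"
      "mpol_subst id (\<lambda>(i, j). line g0 g1 t $ i $ j) p \<noteq> 0"
    by (simp only: Un_iff mem_Collect_eq de_Morgan_disj not_not) metis
  let ?g = "line g0 g1 t"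
  have inv: "invertible ?g" using t(2) by (simp add: invertible_det_nz)
  then have gU: "?g \<in> U" using F t(3) g1(1) by blast
  \<comment> \<open>There are as many independent elements as monomials in \<open>?M\<close>, so
    they span, and every \<open>D\<close>-free monomial of degree \<open>d\<close> is
    recovered.\<close>
  have sp: "Kv.span ((\<lambda>\<nu>. V \<nu> t) ` ?M) = Sp ?M"
    by (rule family_indep_span[OF finM t(1)]) (auto simp: V_def Sp_iff lookup_comp)
  have "V \<nu> t \<in> rm.span (gl_act ?g ` I \<union> mvar ` D)" if \<nu>: "\<nu> \<in> ?M" for \<nu>
  proof -
    have h: "hg total_degree d (gl_act ?g (u \<nu>))" using u[OF \<nu>] by (simp add: hg_gl)
    have "gl_act ?g (u \<nu>) - V \<nu> t \<in> rm.span (mvar ` D)"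
      unfolding span_mvars_iff
    proof
      fix \<mu> assume "\<mu> \<in> Poly_Mapping.keys (gl_act ?g (u \<nu>) - V \<nu> t)"
      then have "\<mu> \<notin> ?M" "\<mu> \<in> Poly_Mapping.keys (gl_act ?g (u \<nu>))"
        by (auto simp: in_keys_iff lookup_minus V_def lookup_comp split: if_splits)
      then show "\<exists>i\<in>D. 0 < Poly_Mapping.lookup \<mu> i" using h by (auto simp: hg_def free_mons_def)
    qed
    then have 1: "gl_act ?g (u \<nu>) - V \<nu> t \<in> rm.span (gl_act ?g ` I \<union> mvar ` D)"
      using rm.span_mono[of "mvar ` D" "gl_act ?g ` I \<union> mvar ` D"] by blast
    have "gl_act ?g (u \<nu>) \<in> rm.span (gl_act ?g ` I \<union> mvar ` D)" using u[OF \<nu>] by (intro rm.span_base) blast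
    from rm.span_diff[OF this 1] show ?thesis by simp
  qed
  then have "Kv.span ((\<lambda>\<nu>. V \<nu> t) ` ?M) \<subseteq> rm.span (gl_act ?g ` I \<union> mvar ` D)"
    by (intro Kv.span_minimal idl_Kv) auto
  then have "Sp ?M \<subseteq> rm.span (gl_act ?g ` I \<union> mvar ` D)" by (simp add: sp)
  moreover have "monomial \<nu> \<in> Sp ?M" if "\<nu> \<in> ?M" for \<nu> using that by (simp add: Sp_def monomial_def)
  ultimately have "primary D (gl_act ?g ` I)" by (intro primary_if_degree[of D d]) blast
  then show ?thesis using gU by blast
qed

section \<open>Detecting parameters in the initial ideal\<close>

lemma lookup_leading_term: "Poly_Mapping.lookup (leading_term r f) \<nu> =
    (if \<forall>\<mu>\<in>Poly_Mapping.keys f. (\<mu>, \<nu>) \<in> r then Poly_Mapping.lookup f \<nu> else 0)"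
  by (auto simp: leading_term_def lookup_sum_single in_keys_iff)

lemma span_leading_terms:
  fixes J :: "('v::finite, 'k::field) mpol set"
  assumes J: "idl J" and y: "y \<in> rm.span (leading_term (tord D) ` J)" and \<nu>: "\<nu> \<in> Poly_Mapping.keys y"
  shows "\<exists>f\<in>J. is_lead D \<nu> f"
  using y \<nu>
proof (induction arbitrary: \<nu> rule: rm.span_induct_alt)
  case (step c x y)
  from keys_add[of "c * x" y] step.prems consider "\<nu> \<in> Poly_Mapping.keys (c * x)" | "\<nu> \<in> Poly_Mapping.keys y" by blast
  then show ?case
  proof cases
    case 1
    obtain f where f: "f \<in> J" "x = leading_term (tord D) f" using step.hyps by blast
    obtain a b where ab: "\<nu> = a + b" "b \<in> Poly_Mapping.keys x" using 1 keys_mult[of c x] by blast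
    then have "is_lead D b f" using f(2)
      by (auto simp: is_lead_def in_keys_iff lookup_leading_term tord_def split: if_splits)
    then have "is_lead D \<nu> (monomial a * f)" unfolding ab(1) by (rule is_lead_mult)
    then show ?thesis using f(1) J idl_mult by blast
  qed (use step.IH in blast)
qed simp

text \<open>In degree \<open>d\<close> a monomial free of \<open>D\<close> is greater than every
  monomial involving \<open>D\<close>, so it is the leading monomial of its witness in
  \<open>J\<close>. Equality of the initial ideals gives a form in \<open>J'\<close> with this
  leading monomial, and reduction by such forms brings all of degree \<open>d\<close> into
  \<open>J'\<close> plus the variables of \<open>D\<close>.\<close>

lemma primary_if_same_initial:
  fixes J J' :: "('v::finite, 'k::field) mpol set"
  assumes J: "gr total_degree J" "gr total_degree J'" "primary D J"
    and eq: "rm.span (leading_term (tord D) ` J) = rm.span (leading_term (tord D) ` J')"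
  shows "primary D J'"
proof -
  obtain d where d: "\<And>\<nu>. \<nu> \<in> free_mons D d \<Longrightarrow>
      \<exists>u\<in>J. hg total_degree d u \<and> gcomp (\<lambda>\<mu>. \<mu> \<in> free_mons D d) True u = monomial \<nu>"
    using primary_generators[OF J(1,3)] by blast
  have lead: "\<exists>f\<in>J'. is_lead D \<nu> f \<and> hg total_degree d f" if \<nu>: "\<nu> \<in> free_mons D d" for \<nu>
  proof -
    obtain u where u: "u \<in> J" "hg total_degree d u" "gcomp (\<lambda>\<mu>. \<mu> \<in> free_mons D d) True u = monomial \<nu>"
      using d[OF \<nu>] by blast
    have lu: "Poly_Mapping.lookup u \<mu> = Poly_Mapping.lookup (monomial \<nu>) \<mu>" if "\<mu> \<in> free_mons D d" for \<mu>
      using that arg_cong[OF u(3), of "\<lambda>f. Poly_Mapping.lookup f \<mu>"] by (simp add: lookup_comp)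
    have less: "okey D \<mu> < okey D \<nu>" if \<mu>: "\<mu> \<in> Poly_Mapping.keys u" "\<mu> \<noteq> \<nu>" for \<mu>
    proof -
      have deg: "total_degree \<mu> = d" "total_degree \<nu> = d" using u(2) \<mu> \<nu> by (auto simp: hg_def free_mons_def)
      have "\<mu> \<notin> free_mons D d"
        using lu[of \<mu>] \<mu> by (auto simp: in_keys_iff monomial_def lookup_single when_def)
      then obtain i where i: "i \<in> D" "Poly_Mapping.lookup \<mu> i > 0" using deg by (auto simp: free_mons_def)
      have split: "total_degree \<rho> = (\<Sum>i\<in>- D. Poly_Mapping.lookup \<rho> i) + (\<Sum>i\<in>D. Poly_Mapping.lookup \<rho> i)" for \<rho> :: "'v \<Rightarrow>\<^sub>0 nat"
        unfolding total_degree_def using sum.union_disjoint[of "- D" D "Poly_Mapping.lookup \<rho>"] by (simp add: Compl_partition2)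
      have "(\<Sum>i\<in>D. Poly_Mapping.lookup \<nu> i) = 0" using \<nu> by (simp add: free_mons_def)
      moreover have "(\<Sum>i\<in>D. Poly_Mapping.lookup \<mu> i) > 0"
        using i by (metis finite gr0I sum_eq_0_iff less_numeral_extra(3))
      ultimately show ?thesis using deg split[of \<mu>] split[of \<nu>] by (intro okey_less_outside) auto
    qed
    have k: "\<nu> \<in> Poly_Mapping.keys u" using lu[OF \<nu>] by (simp add: in_keys_iff monomial_def)
    then have "is_lead D \<nu> u" using less by (force simp: is_lead_def)
    then have "\<nu> \<in> Poly_Mapping.keys (leading_term (tord D) u)"
      using k by (auto simp: is_lead_def in_keys_iff lookup_leading_term tord_def)
    moreover have "leading_term (tord D) u \<in> rm.span (leading_term (tord D) ` J')"
      unfolding eq[symmetric] using u(1) by (intro rm.span_base imageI)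
    ultimately obtain f where f: "f \<in> J'" "is_lead D \<nu> f" using span_leading_terms[OF gr_idl[OF J(2)]] by blast
    have "is_lead D \<nu> (gcomp total_degree d f)"
      using f(2) \<nu> by (auto simp: is_lead_def keys_comp free_mons_def)
    moreover have "gcomp total_degree d f \<in> J'" using f(1) J(2) by (simp add: gr_def)
    ultimately show ?thesis using hg_comp[of total_degree d f] by blast
  qed
  let ?S = "rm.span (J' \<union> mvar ` D)"
  have "monomial \<nu> \<in> ?S" if "total_degree \<nu> = d" for \<nu>
    using that
  proof (induction "card {\<mu>. total_degree \<mu> = d \<and> okey D \<mu> < okey D \<nu>}" arbitrary: \<nu> rule: less_induct)
    case less
    show ?case
    proof (cases "\<nu> \<in> free_mons D d")
      case False
      then have "monomial \<nu> \<in> rm.span (mvar ` D :: ('v, 'k) mpol set)"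
        unfolding span_mvars_iff using less.prems by (auto simp: free_mons_def monomial_def)
      then show ?thesis using rm.span_mono[of "mvar ` D" "J' \<union> mvar ` D"] by blast
    next
      case True
      then obtain f where f: "f \<in> J'" "is_lead D \<nu> f" "hg total_degree d f" using lead by blast
      define c where "c = Poly_Mapping.lookup f \<nu>"
      have c: "c \<noteq> 0" using f(2) by (simp add: c_def is_lead_def in_keys_iff)
      have "monomial \<nu> - scl (1 / c) f \<in> ?S"
      proof (rule in_span_monomials)
        fix \<mu> assume \<mu>: "\<mu> \<in> Poly_Mapping.keys (monomial \<nu> - scl (1 / c) f)"
        have "\<mu> \<noteq> \<nu>" using \<mu> c by (auto simp: in_keys_iff lookup_minus lookup_scl monomial_def c_def)
        then have mf: "\<mu> \<in> Poly_Mapping.keys f"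
          using \<mu> by (auto simp: in_keys_iff lookup_minus lookup_scl monomial_def lookup_single when_def)
        then have lt: "okey D \<mu> < okey D \<nu>" "total_degree \<mu> = d"
          using f \<open>\<mu> \<noteq> \<nu>\<close> by (auto simp: is_lead_def hg_def okey_inj less_le)
        have "{\<rho>. total_degree \<rho> = d \<and> okey D \<rho> < okey D \<mu>} \<subset> {\<rho>. total_degree \<rho> = d \<and> okey D \<rho> < okey D \<nu>}"
          using lt by auto
        moreover have "finite {\<rho> :: 'v \<Rightarrow>\<^sub>0 nat. total_degree \<rho> = d \<and> okey D \<rho> < okey D \<nu>}"
          by (rule finite_subset[OF _ finite_total_degree[of d]]) auto
        ultimately show "monomial \<mu> \<in> ?S" using less.hyps[OF psubset_card_mono lt(2)] by blast
      qed simp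
      moreover have "scl (1 / c) f \<in> ?S" unfolding scl_def using f(1) by (intro rm.span_scale rm.span_base) simp
      ultimately have "monomial \<nu> - scl (1 / c) f + scl (1 / c) f \<in> ?S" by (rule rm.span_add)
      then show ?thesis by simp
    qed
  qed
  then have "\<forall>\<nu>\<in>free_mons D d. monomial \<nu> \<in> ?S" by (simp add: free_mons_def)
  then show ?thesis by (rule primary_if_degree)
qed

section \<open>Initial ideals with respect to weights\<close>

lemma cring_mpol: "cring (mpol_ring :: ('v, 'k::comm_ring_1) mpol ring)"
proof (rule cringI)
  show "abelian_group (mpol_ring :: ('v, 'k) mpol ring)"
  proof (rule abelian_groupI)
    fix x assume "x \<in> carrier (mpol_ring :: ('v, 'k) mpol ring)"
    show "\<exists>y\<in>carrier mpol_ring. y \<oplus>\<^bsub>mpol_ring\<^esub> x = \<zero>\<^bsub>mpol_ring\<^esub>"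
      by (rule bexI[of _ "- x"]) (simp_all add: mpol_ring_def)
  qed (simp_all add: mpol_ring_def ac_simps)
  show "comm_monoid (mpol_ring :: ('v, 'k) mpol ring)"
    by (rule comm_monoidI) (simp_all add: mpol_ring_def ac_simps)
qed (simp add: mpol_ring_def distrib_right)

lemma mpol_ring_simps [simp]: "carrier mpol_ring = UNIV" "(\<otimes>\<^bsub>mpol_ring\<^esub>) = (*)" "(\<oplus>\<^bsub>mpol_ring\<^esub>) = (+)"
  "\<one>\<^bsub>mpol_ring\<^esub> = 1" "\<zero>\<^bsub>mpol_ring\<^esub> = 0"
  by (simp_all add: mpol_ring_def)

lemma ideal_iff_idl: "ideal I (mpol_ring :: ('v, 'k::comm_ring_1) mpol ring) \<longleftrightarrow> idl I"
proof
  assume "ideal I (mpol_ring :: ('v, 'k) mpol ring)"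
  then interpret ideal I "mpol_ring :: ('v, 'k) mpol ring" .
  show "idl I"
  proof (rule rm.subspaceI)
    show "0 \<in> I" using additive_subgroup.zero_closed[OF additive_subgroup_axioms] by simp
    fix x y c assume "x \<in> I"
    then show "c * x \<in> I" using I_l_closed[of x c] by simp
    assume "y \<in> I"
    then show "x + y \<in> I" using additive_subgroup.a_closed[OF additive_subgroup_axioms \<open>x \<in> I\<close>] by simp
  qed
next
  assume I: "idl I"
  interpret cring "mpol_ring :: ('v, 'k) mpol ring" by (rule cring_mpol)
  have inv: "inv\<^bsub>add_monoid (mpol_ring :: ('v, 'k) mpol ring)\<^esub> x = - x" for x
    using minus_equality[of "- x" x] by (simp add: a_inv_def)
  show "ideal I (mpol_ring :: ('v, 'k) mpol ring)"
  proof (rule idealI)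
    show "subgroup I (add_monoid (mpol_ring :: ('v, 'k) mpol ring))"
      by (rule subgroup.intro) (use I inv in \<open>auto simp: rm.subspace_0 rm.subspace_add rm.subspace_neg\<close>)
    show "a \<in> I \<Longrightarrow> x \<otimes>\<^bsub>mpol_ring\<^esub> a \<in> I" for a x using I by (simp add: idl_mult)
    show "a \<in> I \<Longrightarrow> a \<otimes>\<^bsub>mpol_ring\<^esub> x \<in> I" for a x using I by (simp add: idl_mult)
  qed (rule ring_axioms)
qed

lemma genideal_eq_span: "genideal mpol_ring S = rm.span S"
proof
  show "genideal mpol_ring S \<subseteq> rm.span S"
    unfolding genideal_def by (rule Inter_lower) (simp add: ideal_iff_idl rm.span_superset)
  show "rm.span S \<subseteq> genideal mpol_ring S"
    unfolding genideal_def by (rule Inter_greatest) (auto simp: ideal_iff_idl intro: rm.span_minimal[THEN subsetD])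
qed

lemma in_weight_ideal_eq: "in_weight_ideal w J = rm.span (in_weight w ` J)"
  by (simp add: in_weight_ideal_def genideal_eq_span)

text \<open>Only a lower bound, which need not be attained: it is preserved by sums, and zero
  satisfies it for every \<open>v\<close>.\<close>

definition lowest :: "real ^ 'n \<Rightarrow> real \<Rightarrow> ('n::finite, 'k::comm_ring_1) mpol \<Rightarrow> bool" where
  "lowest w v f \<longleftrightarrow> (\<forall>\<mu>\<in>Poly_Mapping.keys f. v \<le> weight w \<mu>)"

lemma lowest_0 [simp]: "lowest w v 0"
  by (simp add: lowest_def)

lemma lowest_add: "lowest w v f \<Longrightarrow> lowest w v g \<Longrightarrow> lowest w v (f + g)"
  using keys_add[of f g] by (auto simp: lowest_def)

lemma lowest_scl: "lowest w v f \<Longrightarrow> lowest w v (scl c f)"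
  by (metis (no_types, lifting) in_keys_iff lookup_scl lowest_def mult_zero_right)

lemma in_weight_lowest:
  assumes "lowest w v f" "gcomp (weight w) v f \<noteq> 0"
  shows "in_weight w f = gcomp (weight w) v f"
proof (rule poly_mapping_eqI)
  obtain \<rho> where \<rho>: "\<rho> \<in> Poly_Mapping.keys f" "weight w \<rho> = v"
    using assms(2) keys_comp[of "weight w" v f] by (metis (mono_tags, lifting) empty_Collect_eq keys_eq_empty)
  fix \<nu>
  show "Poly_Mapping.lookup (in_weight w f) \<nu> = Poly_Mapping.lookup (gcomp (weight w) v f) \<nu>"
  proof (cases "\<nu> \<in> Poly_Mapping.keys f")
    case True
    then have "(\<forall>\<mu>\<in>Poly_Mapping.keys f. weight w \<nu> \<le> weight w \<mu>) \<longleftrightarrow> weight w \<nu> = v"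
      using assms(1) \<rho> by (auto simp: lowest_def intro: antisym)
    then show ?thesis by (simp add: lookup_in_weight lookup_comp)
  qed (simp add: lookup_in_weight lookup_comp in_keys_iff)
qed

lemma in_weight_0 [simp]: "in_weight w 0 = 0"
  by (simp add: in_weight_def)

lemma ex_lowest:
  assumes "f \<noteq> 0"
  obtains v where "lowest w v f" "in_weight w f = gcomp (weight w) v f" "gcomp (weight w) v f \<noteq> 0"
proof -
  let ?v = "Min (weight w ` Poly_Mapping.keys f)"
  have "?v \<in> weight w ` Poly_Mapping.keys f" using assms by (intro Min_in) auto
  then have "Poly_Mapping.keys (gcomp (weight w) ?v f) \<noteq> {}" unfolding keys_comp by force
  then have "gcomp (weight w) ?v f \<noteq> 0" by auto
  moreover have "lowest w ?v f" by (simp add: lowest_def)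
  ultimately show ?thesis using that in_weight_lowest by blast
qed

lemma in_weight_eq_0: "in_weight w f = 0 \<longleftrightarrow> f = 0"
  by (metis ex_lowest in_weight_0)

lemma keys_in_weight: "Poly_Mapping.keys (in_weight w f) \<subseteq> Poly_Mapping.keys f"
  by (auto simp: in_keys_iff lookup_in_weight split: if_splits)

lemma hg_in_weight: "hg \<phi> v f \<Longrightarrow> hg \<phi> v (in_weight w f)"
  using keys_in_weight by (fastforce simp: hg_def)

lemma ex_hg_in_weight: "\<exists>v. hg (weight w) v (in_weight w f)"
proof (cases "f = 0")
  case False
  then obtain v where "in_weight w f = gcomp (weight w) v f" using ex_lowest by metis
  then show ?thesis by (metis hg_comp)
qed simp

text \<open>If the component is nonzero, the minimal weight of \<open>f\<close> is attained in it,
  so passing to the component of \<open>f\<close> does not change the minimum.\<close>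

lemma gcomp_in_weight:
  assumes "gcomp \<phi> v (in_weight w f) \<noteq> 0"
  shows "gcomp \<phi> v (in_weight w f) = in_weight w (gcomp \<phi> v f)"
proof (rule poly_mapping_eqI)
  obtain \<rho> where "\<rho> \<in> Poly_Mapping.keys (gcomp \<phi> v (in_weight w f))" using assms by (metis all_not_in_conv keys_eq_empty)
  then have \<rho>: "\<phi> \<rho> = v" "\<rho> \<in> Poly_Mapping.keys f" "\<And>\<mu>. \<mu> \<in> Poly_Mapping.keys f \<Longrightarrow> weight w \<rho> \<le> weight w \<mu>"
    by (auto simp: in_keys_iff lookup_comp lookup_in_weight split: if_splits)
  fix \<nu>
  show "Poly_Mapping.lookup (gcomp \<phi> v (in_weight w f)) \<nu> = Poly_Mapping.lookup (in_weight w (gcomp \<phi> v f)) \<nu>"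
  proof (cases "\<phi> \<nu> = v")
    case True
    have "(\<forall>\<mu>\<in>Poly_Mapping.keys f. weight w \<nu> \<le> weight w \<mu>) \<longleftrightarrow>
        (\<forall>\<mu>\<in>{\<mu>\<in>Poly_Mapping.keys f. \<phi> \<mu> = v}. weight w \<nu> \<le> weight w \<mu>)"
      using \<rho>(1,2) order_trans[OF _ \<rho>(3), of "weight w \<nu>"] by auto
    then show ?thesis using True by (simp only: lookup_comp lookup_in_weight keys_comp if_True refl)
  qed (simp add: lookup_comp lookup_in_weight)
qed

lemma in_weight_monomial_mult: "in_weight w (monomial \<mu> * f) = monomial \<mu> * in_weight w f"
proof (cases "f = 0")
  case False
  then obtain v where v: "lowest w v f" "in_weight w f = gcomp (weight w) v f" "gcomp (weight w) v f \<noteq> 0"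
    using ex_lowest by metis
  have "gcomp (weight w) (v + weight w \<mu>) (f * monomial \<mu>) = gcomp (weight w) v f * monomial \<mu>"
    by (rule comp_mult_hg[OF weight_add hg_monomial])
  then have "gcomp (weight w) (weight w \<mu> + v) (monomial \<mu> * f) = monomial \<mu> * in_weight w f"
    using v(2) by (simp add: mult.commute add.commute)
  moreover have "lowest w (weight w \<mu> + v) (monomial \<mu> * f)"
    using v(1) by (auto simp: lowest_def keys_monomial_mult weight_add)
  moreover have "monomial \<mu> * in_weight w f \<noteq> 0"
    using v(2,3) by (metis image_is_empty keys_eq_empty keys_monomial_mult)
  ultimately show ?thesis using in_weight_lowest by metis
qed simp

context
  fixes J :: "('n::finite, 'k::field) mpol set" and w :: "real ^ 'n"
  assumes J: "gr total_degree J"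
begin

abbreviation "inJ \<equiv> rm.span (in_weight w ` J)"

lemma gr_weight_in: "gr (weight w) inJ"
  using ex_hg_in_weight by (intro gr_span weight_add) auto

lemma in_weight_gcomp_mem: "f \<in> J \<Longrightarrow> gcomp total_degree d (in_weight w f) = 0 \<or> gcomp total_degree d (in_weight w f) \<in> in_weight w ` (J \<inter> hom_part d)"
proof -
  assume f: "f \<in> J"
  have "gcomp total_degree d f \<in> J \<inter> hom_part d" using f J by (simp add: gr_def hom_part_eq hg_comp)
  then show ?thesis using gcomp_in_weight[of total_degree d w f] by (metis imageI)
qed

text \<open>Monomial multiples of initial forms are initial forms again, so linear combinations over
  the field suffice in each degree.\<close>

lemma gcomp_span_in:
  assumes "x \<in> inJ"
  shows "gcomp total_degree d x \<in> Kv.span (in_weight w ` (J \<inter> hom_part d))"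
  using assms
proof (induction rule: rm.span_induct_alt)
  case base
  then show ?case by (simp add: Kv.span_zero)
next
  case (step c x y)
  then obtain f where f: "f \<in> J" "x = in_weight w f" by blast
  have "c * x = (\<Sum>\<mu>\<in>Poly_Mapping.keys c. scl (Poly_Mapping.lookup c \<mu>) (in_weight w (monomial \<mu> * f)))"
    unfolding in_weight_monomial_mult f(2) by (subst mult_sum_single) (simp add: single_eq_scl scl_mult_left)
  then have "gcomp total_degree d (c * x) = (\<Sum>\<mu>\<in>Poly_Mapping.keys c. gcomp total_degree d (scl (Poly_Mapping.lookup c \<mu>) (in_weight w (monomial \<mu> * f))))"
    by (simp only: comp_sum)
  also have "\<dots> \<in> Kv.span (in_weight w ` (J \<inter> hom_part d))"
  proof (rule Kv.span_sum)
    fix \<mu>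
    have "monomial \<mu> * f \<in> J" using f(1) gr_idl[OF J] by (simp add: idl_mult)
    from in_weight_gcomp_mem[OF this, of d]
    have "gcomp total_degree d (in_weight w (monomial \<mu> * f)) \<in> Kv.span (in_weight w ` (J \<inter> hom_part d))"
      using Kv.span_base Kv.span_zero by metis
    moreover have "gcomp total_degree d (scl a g) = scl a (gcomp total_degree d g)" for a and g :: "('n, 'k) mpol"
      by (rule poly_mapping_eqI) (simp add: lookup_comp lookup_scl)
    ultimately show "gcomp total_degree d (scl (Poly_Mapping.lookup c \<mu>) (in_weight w (monomial \<mu> * f))) \<in> Kv.span (in_weight w ` (J \<inter> hom_part d))"
      by (simp add: Kv.span_scale)
  qed
  finally show ?case using step.IH by (simp add: comp_add Kv.span_add)
qed

lemma Kv_span_in_subset: "Kv.span (in_weight w ` (J \<inter> hom_part d)) \<subseteq> inJ \<inter> hom_part d"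
proof (rule Kv.span_minimal)
  show "in_weight w ` (J \<inter> hom_part d) \<subseteq> inJ \<inter> hom_part d"
    by (auto simp: hom_part_eq hg_in_weight rm.span_base)
  show "Kv.subspace (inJ \<inter> hom_part d)"
    unfolding hom_part_Sp by (intro Kv.subspace_inter idl_Kv subspace_Sp rm.subspace_span)
qed

lemma gr_degree_in: "gr total_degree inJ"
  using gcomp_span_in Kv_span_in_subset by (auto simp: gr_def)

lemma in_hom_part: "inJ \<inter> hom_part d = Kv.span (in_weight w ` (J \<inter> hom_part d))"
proof
  show "inJ \<inter> hom_part d \<subseteq> Kv.span (in_weight w ` (J \<inter> hom_part d))"
  proof
    fix x assume x: "x \<in> inJ \<inter> hom_part d"
    then have "gcomp total_degree d x = x" using comp_hg[of total_degree d x d] by (simp add: hom_part_eq)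
    then show "x \<in> Kv.span (in_weight w ` (J \<inter> hom_part d))" using gcomp_span_in[of x d] x by simp
  qed
qed (rule Kv_span_in_subset)

text \<open>Elements of the initial ideal are in general only sums of initial forms. With a common
  bound \<open>v\<close> the lifts of the summands can be added without creating terms below
  \<open>v\<close>.\<close>

lemma lift_weight_component:
  assumes "x \<in> inJ" "hg total_degree d x"
  shows "\<exists>f\<in>J \<inter> hom_part d. lowest w v f \<and> gcomp (weight w) v f = gcomp (weight w) v x"
proof -
  have "x \<in> inJ \<inter> hom_part d" using assms by (simp add: hom_part_eq)
  then have "x \<in> Kv.span (in_weight w ` (J \<inter> hom_part d))" by (simp only: in_hom_part)
  then show ?thesis
  proof (induction rule: Kv.span_induct_alt)
    case base
    then show ?case using gr_idl[OF J] by (intro bexI[of _ 0]) (auto simp: hom_part_eq rm.subspace_0)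
  next
    case (step c x y)
    then obtain g where g: "g \<in> J \<inter> hom_part d" "lowest w v g" "gcomp (weight w) v g = gcomp (weight w) v y" by blast
    obtain f where f: "f \<in> J \<inter> hom_part d" "x = in_weight w f" using step.hyps by blast
    have "\<exists>f\<in>J \<inter> hom_part d. lowest w v f \<and> gcomp (weight w) v f = gcomp (weight w) v x"
    proof (cases "gcomp (weight w) v x = 0")
      case True
      then show ?thesis using gr_idl[OF J] by (intro bexI[of _ 0]) (auto simp: hom_part_eq rm.subspace_0)
    next
      case False
      then have "f \<noteq> 0" using f by auto
      then obtain u where u: "lowest w u f" "in_weight w f = gcomp (weight w) u f" "gcomp (weight w) u f \<noteq> 0"
        by (rule ex_lowest)
      have "u = v" using False f(2) u(2) comp_hg[OF hg_comp, of "weight w" v u f] by (auto split: if_splits)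
      then show ?thesis using f u comp_hg[OF hg_comp, of "weight w" v v f] by (intro bexI[of _ f]) auto
    qed
    then obtain f' where f': "f' \<in> J \<inter> hom_part d" "lowest w v f'" "gcomp (weight w) v f' = gcomp (weight w) v x" by blast
    have sc: "gcomp (weight w) v (scl a q) = scl a (gcomp (weight w) v q)" for a and q :: "('n, 'k) mpol"
      by (rule poly_mapping_eqI) (simp add: lookup_comp lookup_scl)
    have "scl c f' + g \<in> J \<inter> hom_part d"
      using f'(1) g(1) gr_idl[OF J] by (auto simp: hom_part_eq intro: rm.subspace_add idl_scl hg_add hg_scl)
    then show ?case using f' g
      by (intro bexI[of _ "scl c f' + g"]) (auto simp: comp_add sc intro: lowest_add lowest_scl)
  qed
qed

text \<open>For an element homogeneous in both degree and weight the lifted component is the whole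
  element.\<close>

lemma in_weight_lift:
  assumes "x \<in> inJ" "hg total_degree d x" "hg (weight w) v x"
  shows "x \<in> in_weight w ` J"
proof (cases "x = 0")
  case True
  then show ?thesis using gr_idl[OF J] by (intro image_eqI[of _ _ 0]) (auto simp: rm.subspace_0)
next
  case False
  obtain f where f: "f \<in> J" "lowest w v f" "gcomp (weight w) v f = gcomp (weight w) v x"
    using lift_weight_component[OF assms(1,2)] by blast
  then have "gcomp (weight w) v f = x" using comp_hg[OF assms(3), of v] by simp
  then show ?thesis using f False in_weight_lowest[of w v f] by (intro image_eqI[of _ _ f]) auto
qed

text \<open>The set \<open>N\<close> takes the part of the standard monomials of a Groebner
  basis.\<close>

lemma monomial_complement:
  obtains N where "N \<subseteq> {\<nu>. total_degree \<nu> = d}" "inJ \<inter> Sp N = {0}" "card N + Kv.dim (inJ \<inter> hom_part d) = Kv.dim (hom_part d :: ('n, 'k) mpol set)"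
proof -
  let ?M = "{\<nu> :: 'n \<Rightarrow>\<^sub>0 nat. total_degree \<nu> = d}"
  have "Kv.subspace (inJ \<inter> hom_part d)"
    unfolding hom_part_Sp by (intro Kv.subspace_inter idl_Kv subspace_Sp rm.subspace_span)
  then obtain B where B: "B \<subseteq> monomial ` ?M" "finite B" "inJ \<inter> hom_part d \<inter> Kv.span B = {0}"
    "card B + Kv.dim (inJ \<inter> hom_part d) = Kv.dim (Kv.span (monomial ` ?M :: ('n, 'k) mpol set))"
    by (rule Kv.complement_from_spanning_set[of _ "monomial ` ?M"])
      (auto simp: span_monomials hom_part_Sp finite_total_degree)
  obtain N where N: "N \<subseteq> ?M" "B = monomial ` N" using B(1) by (meson subset_imageE)
  have "card B = card N" unfolding N(2) by (rule card_image[OF inj_on_subset[OF inj_monomial]]) simp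
  moreover have "Sp N \<subseteq> (hom_part d :: ('n, 'k) mpol set)" using N(1) by (auto simp: Sp_def hom_part_def)
  ultimately show ?thesis using that[of N] B N by (auto simp: span_monomials hom_part_Sp Int_assoc inf.absorb2)
qed

lemma complement_Int:
  assumes "N \<subseteq> {\<nu>. total_degree \<nu> = d}" "inJ \<inter> Sp N = {0}"
  shows "J \<inter> Sp N = {0}"
proof -
  have "f = 0" if f: "f \<in> J" "f \<in> Sp N" for f
  proof -
    have "in_weight w f \<in> inJ" using f(1) by (simp add: rm.span_base)
    moreover have "in_weight w f \<in> Sp N" using f(2) keys_in_weight[of w f] by (auto simp: Sp_def)
    ultimately have "in_weight w f = 0" using assms(2) by blast
    then show ?thesis by (simp add: in_weight_eq_0)
  qed
  moreover have "0 \<in> J" using gr_idl[OF J] by (rule rm.subspace_0)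
  ultimately show ?thesis by (auto simp: Sp_def)
qed

text \<open>A basis of initial forms lifts to independent elements: in a relation among the lifts,
  the part of least weight would be a relation among the initial forms.\<close>

lemma dim_in_le: "Kv.dim (inJ \<inter> hom_part d) \<le> Kv.dim (J \<inter> hom_part d)"
proof -
  let ?G = "in_weight w ` (J \<inter> hom_part d)"
  obtain B where B: "B \<subseteq> ?G" "Kv.independent B" "?G \<subseteq> Kv.span B"
    using Kv.maximal_independent_subset[of ?G] by blast
  have "B \<subseteq> Kv.span (monomial ` {\<nu>. total_degree \<nu> = d})"
    using B(1) by (auto simp: span_monomials hom_part_Sp[symmetric] hom_part_eq hg_in_weight)
  then have fin: "finite B"
    using Kv.independent_span_bound[OF _ B(2), of "monomial ` {\<nu>. total_degree \<nu> = d}"] finite_total_degree[of d] by auto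
  have "inJ \<inter> hom_part d = Kv.span B"
    unfolding in_hom_part using B(1,3) Kv.span_mono[OF B(1)] Kv.span_minimal[OF B(3)] by simp
  then have dimB: "Kv.dim (inJ \<inter> hom_part d) = card B" using Kv.dim_span_eq_card_independent[OF B(2)] by simp
  have "\<forall>b\<in>B. \<exists>f\<in>J \<inter> hom_part d. b = in_weight w f" using B(1) by blast
  then obtain F where F: "\<And>b. b \<in> B \<Longrightarrow> F b \<in> J \<inter> hom_part d" "\<And>b. b \<in> B \<Longrightarrow> b = in_weight w (F b)" by metis
  have "\<forall>b\<in>B. \<exists>v. lowest w v (F b) \<and> b = gcomp (weight w) v (F b)"
  proof
    fix b assume b: "b \<in> B"
    then have "b \<noteq> 0" using B(2) Kv.dependent_zero by blast
    then have "F b \<noteq> 0" using F(2)[OF b] by auto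
    then show "\<exists>v. lowest w v (F b) \<and> b = gcomp (weight w) v (F b)" using F(2)[OF b] ex_lowest by metis
  qed
  then obtain wt where wt: "\<And>b. b \<in> B \<Longrightarrow> lowest w (wt b) (F b) \<and> b = gcomp (weight w) (wt b) (F b)" by metis
  have "family_indep B F"
    unfolding family_indep_def
  proof (intro allI impI)
    fix c assume c: "(\<Sum>b\<in>B. scl (c b) (F b)) = 0"
    show "\<forall>b\<in>B. c b = 0"
    proof (rule ccontr)
      assume "\<not> (\<forall>b\<in>B. c b = 0)"
      define Z where "Z = {b\<in>B. c b \<noteq> 0}"
      have Z: "finite Z" "Z \<noteq> {}" using fin \<open>\<not> (\<forall>b\<in>B. c b = 0)\<close> by (auto simp: Z_def)
      define v where "v = Min (wt ` Z)"
      have v: "v \<in> wt ` Z" "\<And>b. b \<in> Z \<Longrightarrow> v \<le> wt b" using Z by (auto simp: v_def)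
      have "(\<Sum>b\<in>B. scl (if wt b = v then c b else 0) b) = (\<Sum>b\<in>B. gcomp (weight w) v (scl (c b) (F b)))"
      proof (rule sum.cong[OF refl])
        fix b assume b: "b \<in> B"
        have sc: "gcomp (weight w) v (scl (c b) (F b)) = scl (c b) (gcomp (weight w) v (F b))"
          by (rule poly_mapping_eqI) (simp add: lookup_comp lookup_scl)
        show "scl (if wt b = v then c b else 0) b = gcomp (weight w) v (scl (c b) (F b))"
        proof (cases "wt b = v")
          case True
          then show ?thesis using wt[OF b] by (simp add: sc)
        next
          case False
          show ?thesis
          proof (cases "c b = 0")
            case False
            then have "v < wt b" using b v(2)[of b] \<open>wt b \<noteq> v\<close> by (simp add: Z_def)
            then have "gcomp (weight w) v (F b) = 0"
              using wt[OF b] unfolding gcomp_def lowest_def by (intro sum.neutral) force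
            then show ?thesis using \<open>wt b \<noteq> v\<close> by (simp add: sc)
          qed (simp add: sc)
        qed
      qed
      also have "\<dots> = gcomp (weight w) v (\<Sum>b\<in>B. scl (c b) (F b))" by (simp only: comp_sum)
      also have "\<dots> = 0" by (simp only: c comp_0)
      finally have "b \<in> B \<Longrightarrow> (if wt b = v then c b else 0) = 0" for b
        using Kv.independentD[OF B(2) fin subset_refl, of "\<lambda>b. if wt b = v then c b else 0"] by blast
      moreover obtain b0 where "b0 \<in> B" "c b0 \<noteq> 0" "wt b0 = v" using v(1) by (auto simp: Z_def)
      ultimately show False by (metis (full_types))
    qed
  qed
  note ind = family_indep_independent[OF fin this]
  have "card B = Kv.dim (Kv.span (F ` B))"
    unfolding Kv.dim_span_eq_card_independent[OF ind(2)] card_image[OF ind(1)] ..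
  also have "\<dots> \<le> Kv.dim (J \<inter> hom_part d)"
  proof (rule Kv_dim_mono[OF _ _ finite_total_degree[of d]])
    show "Kv.span (F ` B) \<subseteq> J \<inter> hom_part d"
      using F(1) gr_idl[OF J] unfolding hom_part_Sp
      by (intro Kv.span_minimal Kv.subspace_inter idl_Kv subspace_Sp) auto
  qed (simp add: hom_part_Sp)
  finally show ?thesis by (simp add: dimB)
qed

lemma dim_sum_complement:
  assumes N: "N \<subseteq> {\<nu>. total_degree \<nu> = d}" "J \<inter> Sp N = {0}"
  shows "Kv.dim {x + v | x v. x \<in> J \<inter> hom_part d \<and> v \<in> Sp N} = Kv.dim (J \<inter> hom_part d) + card N"
proof -
  have finN: "finite N" using N(1) finite_total_degree finite_subset by blast
  have "Kv.dim {x + v | x v. x \<in> J \<inter> hom_part d \<and> v \<in> Sp N} + Kv.dim (Sp N \<inter> (J \<inter> hom_part d)) = Kv.dim (J \<inter> hom_part d) + Kv.dim (Sp N :: ('n, 'k) mpol set)"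
  proof (rule Kv.dim_sum_Int[of _ "monomial ` {\<nu>. total_degree \<nu> = d}" _ "monomial ` N"])
    show "Kv.subspace (J \<inter> hom_part d)"
      unfolding hom_part_Sp by (intro Kv.subspace_inter idl_Kv subspace_Sp gr_idl[OF J])
  qed (auto simp: span_monomials hom_part_Sp finite_total_degree finN)
  moreover have "Sp N \<inter> (J \<inter> hom_part d) \<subseteq> {0}" using N(2) by blast
  then have "Kv.dim (Sp N \<inter> (J \<inter> hom_part d)) = 0"
    using Kv.dim_le_card[of "Sp N \<inter> (J \<inter> hom_part d)" "{}"] by simp
  ultimately show ?thesis by (simp add: dim_Sp)
qed

text \<open>Lifting initial forms bounds the dimension of \<open>J\<close> from below. For the upper
  bound the monomial complement of the initial ideal meets \<open>J\<close> only in 0, because a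
  nonzero common element would have its initial form in the complement.\<close>

lemma hf_in: "hf inJ d = hf J d"
proof -
  obtain N where N: "N \<subseteq> {\<nu>. total_degree \<nu> = d}" "inJ \<inter> Sp N = {0}"
    "card N + Kv.dim (inJ \<inter> hom_part d) = Kv.dim (hom_part d :: ('n, 'k) mpol set)"
    using monomial_complement by metis
  have "Kv.dim {x + v | x v. x \<in> J \<inter> hom_part d \<and> v \<in> Sp N} \<le> Kv.dim (hom_part d :: ('n, 'k) mpol set)"
  proof (rule Kv_dim_mono[OF _ _ finite_total_degree[of d]])
    have "Sp N \<subseteq> (hom_part d :: ('n, 'k) mpol set)" using N(1) by (auto simp: Sp_def hom_part_def)
    then show "{x + v | x v. x \<in> J \<inter> hom_part d \<and> v \<in> Sp N} \<subseteq> hom_part d"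
      by (auto simp: hom_part_eq intro!: hg_add)
  qed (simp add: hom_part_Sp)
  then have "Kv.dim (J \<inter> hom_part d) \<le> Kv.dim (inJ \<inter> hom_part d)"
    using dim_sum_complement[OF N(1) complement_Int[OF N(1,2)]] N(3) by simp
  then show ?thesis using dim_in_le[of d] by (simp add: hf_def)
qed

text \<open>Modulo the ideal, an initial form can be completed by terms of strictly higher weight,
  namely by its normal form with respect to a monomial complement of the initial ideal.\<close>

lemma normal_form_higher:
  assumes N: "N \<subseteq> {\<nu>. total_degree \<nu> = d}" "inJ \<inter> Sp N = {0}"
    and h: "h \<in> inJ" "hg (weight w) v h" "h \<noteq> 0" "h - n \<in> J" "n \<in> Sp N"
  shows "\<forall>\<mu>\<in>Poly_Mapping.keys n. v < weight w \<mu>"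
proof (rule ccontr)
  assume neg: "\<not> ?thesis"
  then have n0: "n \<noteq> 0" by auto
  then obtain u where u: "lowest w u n" "gcomp (weight w) u n \<noteq> 0" using ex_lowest by metis
  obtain \<rho> where "\<rho> \<in> Poly_Mapping.keys n" "weight w \<rho> \<le> v" using neg by force
  then have uv: "u \<le> v" using u(1) by (force simp: lowest_def)
  have "lowest w u h" using h(2) uv by (simp add: lowest_def hg_def)
  then have low: "lowest w u (h - n)"
    using lowest_add[of w u h "- n"] u(1) by (simp add: lowest_def)
  have nN: "gcomp (weight w) u n \<in> Sp N" using h(5) by (simp add: Sp_def keys_comp) blast
  have gh: "gcomp (weight w) u h \<in> inJ" using gr_weight_in h(1) by (simp add: gr_def)
  \<comment> \<open>The parts of weight \<open>u\<close> of \<open>h - n\<close> and of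
    \<open>h\<close> lie in the initial ideal, hence so does that of \<open>n\<close>; but it is
    nonzero and supported on \<open>N\<close>.\<close>
  have "gcomp (weight w) u (h - n) \<in> inJ"
  proof (cases "gcomp (weight w) u (h - n) = 0")
    case False
    then have "in_weight w (h - n) = gcomp (weight w) u (h - n)" using low by (intro in_weight_lowest)
    then show ?thesis using rm.span_base[OF imageI[OF h(4), of "in_weight w"]] by simp
  qed (simp add: rm.span_zero)
  then have "gcomp (weight w) u h - gcomp (weight w) u (h - n) \<in> inJ" using gh by (intro rm.span_diff)
  then have "gcomp (weight w) u n \<in> inJ" by (simp add: comp_diff)
  then show False using nN N(2) u(2) by blast
qed

end

text \<open>The first initial ideal is spanned by elements homogeneous in degree and weight, and
  each of these is the initial form of a single element of \<open>J\<close>. Only generators of this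
  kind can be followed under a perturbation of the weight.\<close>

lemma in_weight_initial_span:
  fixes J :: "('n::finite, 'k::field) mpol set"
  assumes J: "gr total_degree J"
  shows "rm.span (in_weight \<eta> ` rm.span (in_weight w ` J)) = rm.span ((\<lambda>f. in_weight \<eta> (in_weight w f)) ` J)"
    (is "rm.span (_ ` ?I) = rm.span ?X")
proof -
  have "in_weight \<eta> h \<in> rm.span ?X" if h: "h \<in> ?I" for h
  proof -
    have "gcomp total_degree d (gcomp (weight w) v (in_weight \<eta> h)) \<in> rm.span ?X" for d v
    proof (cases "gcomp total_degree d (gcomp (weight w) v (in_weight \<eta> h)) = 0")
      case False
      then have 1: "gcomp (weight w) v (in_weight \<eta> h) = in_weight \<eta> (gcomp (weight w) v h)"
        by (intro gcomp_in_weight) auto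
      have 2: "gcomp total_degree d (gcomp (weight w) v (in_weight \<eta> h)) = in_weight \<eta> (gcomp total_degree d (gcomp (weight w) v h))"
        using False unfolding 1 by (rule gcomp_in_weight)
      have "gcomp (weight w) v h \<in> ?I" using gr_weight_in[OF J, of w] h by (simp add: gr_def)
      then have "gcomp total_degree d (gcomp (weight w) v h) \<in> ?I" using gr_degree_in[OF J, of w] by (simp add: gr_def)
      then have "gcomp total_degree d (gcomp (weight w) v h) \<in> in_weight w ` J"
        by (rule in_weight_lift[OF J _ hg_comp hg_comp_other[OF hg_comp]])
      then obtain f where "f \<in> J" "gcomp total_degree d (gcomp (weight w) v h) = in_weight w f" by blast
      then show ?thesis unfolding 2 by (intro rm.span_base) auto
    qed (simp add: rm.span_zero)
    then have "(\<Sum>d\<in>total_degree ` Poly_Mapping.keys (gcomp (weight w) v (in_weight \<eta> h)). gcomp total_degree d (gcomp (weight w) v (in_weight \<eta> h))) \<in> rm.span ?X" for v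
      by (intro rm.span_sum)
    then have "gcomp (weight w) v (in_weight \<eta> h) \<in> rm.span ?X" for v by (simp only: sum_comp)
    then have "(\<Sum>v\<in>weight w ` Poly_Mapping.keys (in_weight \<eta> h). gcomp (weight w) v (in_weight \<eta> h)) \<in> rm.span ?X"
      by (intro rm.span_sum)
    then show ?thesis by (simp only: sum_comp)
  qed
  then have "rm.span (in_weight \<eta> ` ?I) \<subseteq> rm.span ?X" by (intro rm.span_minimal) auto
  moreover have "?X \<subseteq> in_weight \<eta> ` ?I" by (auto intro: rm.span_base)
  then have "rm.span ?X \<subseteq> rm.span (in_weight \<eta> ` ?I)" by (rule rm.span_mono)
  ultimately show ?thesis by (rule subset_antisym)
qed

section \<open>Moving the weight\<close>

lemma weight_perturb: "weight (w + e *\<^sub>R \<eta>) \<nu> = weight w \<nu> + e * weight \<eta> \<nu>"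
  by (simp add: weight_def distrib_right sum.distrib sum_distrib_left mult.assoc)

text \<open>Only finitely many pairs of terms are compared: a small \<open>e\<close> reverses no
  strict inequality between their weights for \<open>w\<close>, and \<open>\<eta>\<close> decides
  between terms of equal weight.\<close>

lemma in_weight_perturb: "\<exists>e0>0. \<forall>e. 0 < e \<and> e < e0 \<longrightarrow> in_weight (w + e *\<^sub>R \<eta>) f = in_weight \<eta> (in_weight w f)"
proof -
  let ?W = "\<lambda>e \<nu>. weight w \<nu> + e * weight \<eta> \<nu>"
  have "eventually (\<lambda>e. \<forall>p\<in>Poly_Mapping.keys f \<times> Poly_Mapping.keys f.
      weight w (fst p) < weight w (snd p) \<longrightarrow> ?W e (fst p) < ?W e (snd p)) (at_right 0)"
  proof (rule eventually_ball_finite)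
    show "\<forall>p\<in>Poly_Mapping.keys f \<times> Poly_Mapping.keys f. eventually (\<lambda>e. weight w (fst p) < weight w (snd p) \<longrightarrow> ?W e (fst p) < ?W e (snd p)) (at_right 0)"
    proof
      fix p
      show "eventually (\<lambda>e. weight w (fst p) < weight w (snd p) \<longrightarrow> ?W e (fst p) < ?W e (snd p)) (at_right 0)"
      proof (cases "weight w (fst p) < weight w (snd p)")
        case True
        have "((\<lambda>e. ?W e (snd p) - ?W e (fst p)) \<longlongrightarrow> (weight w (snd p) + 0 * weight \<eta> (snd p)) - (weight w (fst p) + 0 * weight \<eta> (fst p))) (at_right 0)"
          by (intro tendsto_intros)
        then have "eventually (\<lambda>e. ?W e (snd p) - ?W e (fst p) > 0) (at_right 0)"
          by (rule order_tendstoD(1)) (use True in simp)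
        then show ?thesis by (rule eventually_mono) simp
      qed simp
    qed
  qed simp
  then obtain e0 where e0: "e0 > 0" "\<And>e \<nu> \<mu>. 0 < e \<Longrightarrow> e < e0 \<Longrightarrow> \<nu> \<in> Poly_Mapping.keys f \<Longrightarrow> \<mu> \<in> Poly_Mapping.keys f \<Longrightarrow>
      weight w \<nu> < weight w \<mu> \<Longrightarrow> ?W e \<nu> < ?W e \<mu>"
    unfolding eventually_at_right_field by force
  have "in_weight (w + e *\<^sub>R \<eta>) f = in_weight \<eta> (in_weight w f)" if e: "0 < e" "e < e0" for e
  proof (rule poly_mapping_eqI)
    fix \<nu>
    show "Poly_Mapping.lookup (in_weight (w + e *\<^sub>R \<eta>) f) \<nu> = Poly_Mapping.lookup (in_weight \<eta> (in_weight w f)) \<nu>"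
    proof (cases "\<nu> \<in> Poly_Mapping.keys f")
      case \<nu>: True
      have "(\<forall>\<mu>\<in>Poly_Mapping.keys f. ?W e \<nu> \<le> ?W e \<mu>) \<longleftrightarrow>
          (\<forall>\<mu>\<in>Poly_Mapping.keys (in_weight w f). weight \<eta> \<nu> \<le> weight \<eta> \<mu>) \<and> (\<forall>\<mu>\<in>Poly_Mapping.keys f. weight w \<nu> \<le> weight w \<mu>)"
      proof (intro iffI conjI ballI)
        fix \<mu> assume L: "\<forall>\<mu>\<in>Poly_Mapping.keys f. ?W e \<nu> \<le> ?W e \<mu>"
        show wle: "\<mu> \<in> Poly_Mapping.keys f \<Longrightarrow> weight w \<nu> \<le> weight w \<mu>"
          using L e0(2)[OF e, of \<mu> \<nu>] \<nu> by (meson not_le)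
        assume \<mu>: "\<mu> \<in> Poly_Mapping.keys (in_weight w f)"
        then have "\<mu> \<in> Poly_Mapping.keys f" "weight w \<mu> \<le> weight w \<nu>"
          using \<nu> by (auto simp: in_keys_iff lookup_in_weight split: if_splits)
        moreover from this have "weight w \<nu> \<le> weight w \<mu>" using L e0(2)[OF e, of \<mu> \<nu>] \<nu> by (meson not_le)
        ultimately have "e * weight \<eta> \<nu> \<le> e * weight \<eta> \<mu>" using L by force
        then show "weight \<eta> \<nu> \<le> weight \<eta> \<mu>" using e(1) by simp
      next
        fix \<mu> assume R: "(\<forall>\<mu>\<in>Poly_Mapping.keys (in_weight w f). weight \<eta> \<nu> \<le> weight \<eta> \<mu>) \<and> (\<forall>\<mu>\<in>Poly_Mapping.keys f. weight w \<nu> \<le> weight w \<mu>)"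
          and \<mu>: "\<mu> \<in> Poly_Mapping.keys f"
        show "?W e \<nu> \<le> ?W e \<mu>"
        proof (cases "weight w \<nu> < weight w \<mu>")
          case True
          then show ?thesis using e0(2)[OF e \<nu> \<mu>] by simp
        next
          case False
          then have eq: "weight w \<nu> = weight w \<mu>" using R \<mu> by force
          then have "\<mu> \<in> Poly_Mapping.keys (in_weight w f)" using R \<mu> by (simp add: in_keys_iff lookup_in_weight)
          then have "weight \<eta> \<nu> \<le> weight \<eta> \<mu>" using R by blast
          then show ?thesis using eq e(1) by simp
        qed
      qed
      then show ?thesis by (simp add: lookup_in_weight weight_perturb)
    qed (simp add: lookup_in_weight in_keys_iff)
  qed
  then show ?thesis using e0(1) by blast
qed

text \<open>Finitely many initial forms generate the iterated initial ideal, so one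
  \<open>e0\<close> works for all of them. This yields an inclusion, and both ideals have the
  Hilbert function of \<open>J\<close>.\<close>

theorem initial_ideal_perturb:
  fixes J :: "('n::finite, 'k::field) mpol set"
  assumes J: "gr total_degree J"
  shows "\<exists>e0>0. \<forall>e. 0 < e \<and> e < e0 \<longrightarrow>
    rm.span (in_weight (w + e *\<^sub>R \<eta>) ` J) = rm.span (in_weight \<eta> ` rm.span (in_weight w ` J))"
proof -
  let ?I = "rm.span (in_weight \<eta> ` rm.span (in_weight w ` J))"
  obtain F where F: "finite F" "F \<subseteq> (\<lambda>f. in_weight \<eta> (in_weight w f)) ` J" "rm.span F = ?I"
    using ideal_finitely_generated[OF in_weight_initial_span[OF J, symmetric]] by metis
  have "\<forall>x\<in>F. \<exists>e0>0. \<forall>e. 0 < e \<and> e < e0 \<longrightarrow> x \<in> in_weight (w + e *\<^sub>R \<eta>) ` J"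
  proof
    fix x assume "x \<in> F"
    then obtain f where f: "f \<in> J" "x = in_weight \<eta> (in_weight w f)" using F(2) by blast
    obtain e0 where "e0 > 0" "\<forall>e. 0 < e \<and> e < e0 \<longrightarrow> in_weight (w + e *\<^sub>R \<eta>) f = in_weight \<eta> (in_weight w f)"
      using in_weight_perturb by metis
    then show "\<exists>e0>0. \<forall>e. 0 < e \<and> e < e0 \<longrightarrow> x \<in> in_weight (w + e *\<^sub>R \<eta>) ` J"
      using f by (intro exI[of _ e0]) (metis imageI)
  qed
  then obtain E where E: "\<And>x. x \<in> F \<Longrightarrow> E x > 0" "\<And>x e. x \<in> F \<Longrightarrow> 0 < e \<Longrightarrow> e < E x \<Longrightarrow> x \<in> in_weight (w + e *\<^sub>R \<eta>) ` J"
    by metis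
  define e0 where "e0 = Min (insert 1 (E ` F))"
  have e0: "e0 > 0" "\<And>x. x \<in> F \<Longrightarrow> e0 \<le> E x" using F(1) E(1) by (auto simp: e0_def)
  have "rm.span (in_weight (w + e *\<^sub>R \<eta>) ` J) = ?I" if e: "0 < e" "e < e0" for e
  proof -
    have "F \<subseteq> in_weight (w + e *\<^sub>R \<eta>) ` J"
    proof
      fix x assume x: "x \<in> F"
      then show "x \<in> in_weight (w + e *\<^sub>R \<eta>) ` J" using E(2)[OF x e(1)] e0(2)[OF x] e(2) by simp
    qed
    then have "?I \<subseteq> rm.span (in_weight (w + e *\<^sub>R \<eta>) ` J)" using rm.span_mono F(3) by metis
    then have "?I = rm.span (in_weight (w + e *\<^sub>R \<eta>) ` J)"
    proof (rule hf_eq_imp_eq)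
      show "gr total_degree ?I" by (rule gr_degree_in[OF gr_degree_in[OF J]])
      show "gr total_degree (rm.span (in_weight (w + e *\<^sub>R \<eta>) ` J))" by (rule gr_degree_in[OF J])
      show "hf ?I d = hf (rm.span (in_weight (w + e *\<^sub>R \<eta>) ` J)) d" for d
        by (simp only: hf_in[OF J] hf_in[OF gr_degree_in[OF J]])
    qed
    then show ?thesis by simp
  qed
  then show ?thesis using e0(1) by blast
qed

lemma weight_convex: "weight ((1 - s) *\<^sub>R w + s *\<^sub>R w') \<nu> = (1 - s) * weight w \<nu> + s * weight w' \<nu>"
  by (simp add: weight_def distrib_right sum.distrib sum_distrib_left mult.assoc)

lemma span_gcomp_mem:
  assumes "\<And>d. gcomp \<phi> d y \<in> rm.span X"
  shows "y \<in> rm.span X"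
proof -
  have "(\<Sum>d\<in>\<phi> ` Poly_Mapping.keys y. gcomp \<phi> d y) \<in> rm.span X"
    by (intro rm.span_sum assms)
  then show ?thesis by (simp only: sum_comp)
qed

text \<open>The normal form \<open>n\<close> of an element \<open>h\<close> of the common initial
  ideal serves both weights at once. Its terms are higher than \<open>h\<close> for \<open>w\<close>
  and for \<open>w'\<close>, hence for every convex combination, which makes \<open>h\<close> the
  initial form of \<open>h - n\<close> there.\<close>

theorem initial_ideal_convex:
  fixes J :: "('n::finite, 'k::field) mpol set"
  assumes J: "gr total_degree J" and eq: "rm.span (in_weight w ` J) = rm.span (in_weight w' ` J)"
    and s: "0 \<le> s" "s \<le> 1"
  shows "rm.span (in_weight ((1 - s) *\<^sub>R w + s *\<^sub>R w') ` J) = rm.span (in_weight w ` J)"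
proof -
  let ?I = "rm.span (in_weight w ` J)" and ?W = "(1 - s) *\<^sub>R w + s *\<^sub>R w'"
  have bihom: "h \<in> rm.span (in_weight ?W ` J)"
    if h: "h \<in> ?I" "hg (weight w) v h" "hg (weight w') v' h" "hg total_degree d h" for h v v' d
  proof (cases "h = 0")
    case False
    obtain N where N: "N \<subseteq> {\<nu>. total_degree \<nu> = d}" "?I \<inter> Sp N = {0}"
      "card N + Kv.dim (?I \<inter> hom_part d) = Kv.dim (hom_part d :: ('n, 'k) mpol set)"
      using monomial_complement[OF J] by metis
    let ?S = "{x + v | x v. x \<in> J \<inter> hom_part d \<and> v \<in> Sp N}"
    have SpN: "Sp N \<subseteq> (hom_part d :: ('n, 'k) mpol set)" using N(1) by (auto simp: Sp_def hom_part_def)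
    \<comment> \<open>By dimensions, \<open>J\<close> and the monomials of \<open>N\<close> together
      fill degree \<open>d\<close>; this provides the normal form.\<close>
    have "?S = hom_part d"
    proof (rule Kv_dim_eq[OF _ _ _ _ finite_total_degree[of d]])
      have "Kv.subspace (J \<inter> hom_part d)"
        unfolding hom_part_Sp by (intro Kv.subspace_inter idl_Kv subspace_Sp gr_idl[OF J])
      then show "Kv.subspace ?S" by (intro Kv.subspace_sums) auto
      show "?S \<subseteq> hom_part d" using SpN by (auto simp: hom_part_eq intro!: hg_add)
      have "Kv.dim (J \<inter> hom_part d) = Kv.dim (?I \<inter> hom_part d)"
        using hf_in[OF J, of w d] hf_add[of J d] hf_add[of ?I d] by simp
      then show "Kv.dim (hom_part d :: ('n, 'k) mpol set) \<le> Kv.dim ?S"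
        using dim_sum_complement[OF J N(1) complement_Int[OF J N(1,2)]] N(3) by simp
    qed (simp_all add: hom_part_Sp)
    then have "h \<in> ?S" using h(4) by (simp add: hom_part_eq)
    then obtain f n where fn: "h = f + n" "f \<in> J" "n \<in> Sp N" by blast
    have hn: "h - n \<in> J" using fn by simp
    have 1: "\<forall>\<mu>\<in>Poly_Mapping.keys n. v < weight w \<mu>"
      by (rule normal_form_higher[OF J N(1,2) h(1,2) False hn fn(3)])
    have 2: "\<forall>\<mu>\<in>Poly_Mapping.keys n. v' < weight w' \<mu>"
      by (rule normal_form_higher[OF J N(1) N(2)[unfolded eq] h(1)[unfolded eq] h(3) False hn fn(3)])
    let ?v = "(1 - s) * v + s * v'"
    have hW: "hg (weight ?W) ?v h" using h(2,3) by (auto simp: hg_def weight_convex)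
    have nW: "?v < weight ?W \<mu>" if "\<mu> \<in> Poly_Mapping.keys n" for \<mu>
    proof (cases "s = 0")
      case True then show ?thesis using 1 that by simp
    next
      case False
      then have "s * v' < s * weight w' \<mu>" using s 2 that by simp
      moreover have "(1 - s) * v \<le> (1 - s) * weight w \<mu>" using s 1 that by (intro mult_left_mono) auto
      ultimately show ?thesis by (simp add: weight_convex)
    qed
    have "gcomp (weight ?W) ?v n = 0"
      using nW unfolding gcomp_def by (intro sum.neutral) force
    then have g: "gcomp (weight ?W) ?v (h - n) = h" using comp_hg[OF hW, of ?v] by (simp add: comp_diff)
    have "lowest ?W ?v (h + - n)"
      using hW nW by (intro lowest_add) (auto simp: lowest_def hg_def less_imp_le)
    then have "in_weight ?W (h - n) = h" using in_weight_lowest[of ?W ?v "h - n"] g False by simp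
    then show ?thesis using rm.span_base[OF imageI[OF hn, of "in_weight ?W"]] by simp
  qed (simp add: rm.span_zero)
  have gr: "gr (weight w) ?I" "gr (weight w') ?I" "gr total_degree ?I"
    using gr_weight_in[OF J, of w] gr_weight_in[OF J, of w'] gr_degree_in[OF J, of w] eq by simp_all
  have "x \<in> rm.span (in_weight ?W ` J)" if x: "x \<in> ?I" for x
  proof -
    have c: "gcomp total_degree d (gcomp (weight w') v' (gcomp (weight w) v x)) \<in> rm.span (in_weight ?W ` J)" for d v v'
      using x gr by (intro bihom[of _ v v' d]) (auto simp: gr_def intro: hg_comp hg_comp_other)
    have c2: "gcomp (weight w') v' (gcomp (weight w) v x) \<in> rm.span (in_weight ?W ` J)" for v v'
      by (rule span_gcomp_mem[OF c])
    have c3: "gcomp (weight w) v x \<in> rm.span (in_weight ?W ` J)" for v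
      by (rule span_gcomp_mem[OF c2])
    show ?thesis by (rule span_gcomp_mem[OF c3])
  qed
  then have "?I \<subseteq> rm.span (in_weight ?W ` J)" by blast
  then have "?I = rm.span (in_weight ?W ` J)"
    by (rule hf_eq_imp_eq) (simp_all only: gr_degree_in[OF J] hf_in[OF J])
  then show ?thesis by simp
qed

section \<open>Lengths and saturated ideals\<close>

text \<open>For a prime \<open>P\<close> these are the ideals contracted from the localization at
  \<open>P\<close>: factors outside \<open>P\<close> can be cancelled.\<close>

definition saturated :: "'a::comm_ring_1 set \<Rightarrow> 'a set \<Rightarrow> bool" where
  "saturated P K \<longleftrightarrow> idl K \<and> (\<forall>u s. u \<notin> P \<longrightarrow> u * s \<in> K \<longrightarrow> s \<in> K)"

definition sat_chain :: "'a::comm_ring_1 set \<Rightarrow> 'a set \<Rightarrow> nat \<Rightarrow> (nat \<Rightarrow> 'a set) \<Rightarrow> bool" where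
  "sat_chain P J k K \<longleftrightarrow> (\<forall>i\<le>k. saturated P (K i) \<and> J \<subseteq> K i) \<and> (\<forall>i<k. K i \<subset> K (Suc i))"

text \<open>The submodules of \<open>(S/J)\<^sub>P\<close> correspond to the \<open>P\<close>-saturated ideals containing \<open>J\<close>.\<close>

definition sat_length :: "'a::comm_ring_1 set \<Rightarrow> 'a set \<Rightarrow> enat" where
  "sat_length P J = Sup {enat k | k. \<exists>K. sat_chain P J k K}"

definition saturation :: "'a::comm_ring_1 set \<Rightarrow> 'a set \<Rightarrow> 'a set" where
  "saturation P J = {s. \<exists>u. u \<notin> P \<and> u * s \<in> J}"

lemma saturated_saturation:
  assumes P: "prm P" and J: "idl J"
  shows "saturated P (saturation P J)" "J \<subseteq> saturation P J"
proof -
  have mult: "u * v \<notin> P" if "u \<notin> P" "v \<notin> P" for u v using P that by (auto simp: prm_def)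
  have one: "1 \<notin> P" using P by (simp add: prm_def)
  show "J \<subseteq> saturation P J" using one by (auto simp: saturation_def intro!: exI[of _ 1])
  have "idl (saturation P J)"
  proof (rule rm.subspaceI)
    show "0 \<in> saturation P J" using one rm.subspace_0[OF J] by (auto simp: saturation_def intro!: exI[of _ 1])
    fix x y c assume "x \<in> saturation P J"
    then obtain u where u: "u \<notin> P" "u * x \<in> J" by (auto simp: saturation_def)
    have "u * (c * x) \<in> J" using idl_mult(1)[OF J u(2), of c] by (simp add: mult.left_commute)
    then show "c * x \<in> saturation P J" using u(1) by (auto simp: saturation_def)
    assume "y \<in> saturation P J"
    then obtain v where v: "v \<notin> P" "v * y \<in> J" by (auto simp: saturation_def)
    have "v * (u * x) + u * (v * y) \<in> J" by (intro rm.subspace_add[OF J] idl_mult(1)[OF J] u v)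
    then have "(u * v) * (x + y) \<in> J" by (simp add: distrib_left ac_simps)
    then show "x + y \<in> saturation P J" using mult[OF u(1) v(1)] by (auto simp: saturation_def)
  qed
  moreover have "s \<in> saturation P J" if us: "u \<notin> P" "u * s \<in> saturation P J" for u s
  proof -
    obtain v where v: "v \<notin> P" "v * (u * s) \<in> J" using us(2) by (auto simp: saturation_def)
    then have "(v * u) * s \<in> J" by (simp add: mult.assoc)
    then show ?thesis using mult[OF v(1) us(1)] by (auto simp: saturation_def)
  qed
  ultimately show "saturated P (saturation P J)" by (auto simp: saturated_def)
qed

lemma saturation_minimal: "saturated P K \<Longrightarrow> J \<subseteq> K \<Longrightarrow> saturation P J \<subseteq> K"
  by (auto simp: saturation_def saturated_def)

text \<open>Some \<open>u\<close> outside \<open>P\<close> kills \<open>f\<close> modulo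
  \<open>J\<close>, so \<open>f\<close> is 0 in the localized quotient and belongs to every
  saturated ideal over \<open>J\<close>.\<close>

lemma sat_length_outside:
  assumes "idl J" "\<not> colon J f \<subseteq> P"
  shows "sat_length P J = sat_length P (rm.span (insert f J))"
proof -
  obtain u where u: "u \<notin> P" "u * f \<in> J" using assms(2) by (auto simp: colon_def)
  have "rm.span (insert f J) \<subseteq> K \<longleftrightarrow> J \<subseteq> K" if K: "saturated P K" for K
  proof
    assume "J \<subseteq> K"
    then have "f \<in> K" using K u by (auto simp: saturated_def)
    then show "rm.span (insert f J) \<subseteq> K" using K \<open>J \<subseteq> K\<close> by (intro rm.span_minimal) (auto simp: saturated_def)
  next
    assume "rm.span (insert f J) \<subseteq> K"
    then show "J \<subseteq> K" using rm.span_superset[of "insert f J"] by auto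
  qed
  then have "sat_chain P J k K \<longleftrightarrow> sat_chain P (rm.span (insert f J)) k K" for k K
    unfolding sat_chain_def by blast
  then show ?thesis by (simp add: sat_length_def)
qed

lemma sat_length_0:
  assumes "idl J" "\<not> J \<subseteq> P"
  shows "sat_length P J = 0"
proof -
  obtain u where u: "u \<in> J" "u \<notin> P" using assms(2) by blast
  have all: "K = UNIV" if K: "saturated P K" "J \<subseteq> K" for K
  proof -
    have "u * 1 \<in> K" using u K by auto
    then have "1 \<in> K" using K(1) u(2) unfolding saturated_def by blast
    then have "x \<in> K" for x using K(1) idl_mult(1)[of K 1 x] by (simp add: saturated_def)
    then show ?thesis by blast
  qed
  have k: "k = 0" if K: "sat_chain P J k K" for k K
  proof (rule ccontr)
    assume "k \<noteq> 0"
    then have "K 0 = UNIV" "K 0 \<subset> K (Suc 0)" using K by (auto simp: sat_chain_def intro!: all)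
    then show False by blast
  qed
  have "sat_chain P J 0 (\<lambda>_. UNIV)" by (simp add: sat_chain_def saturated_def)
  then have "{enat k | k. \<exists>K. sat_chain P J k K} = {0}"
    using k by (auto simp: zero_enat_def)
  then show ?thesis by (simp add: sat_length_def)
qed

text \<open>Locally \<open>f\<close> generates a copy of the residue field of \<open>P\<close>,
  which has length 1. Additivity is obtained directly on chains: one step can be put below a chain
  over the enlarged ideal, and conversely adding \<open>f\<close> to the members of a chain costs at
  most one step.\<close>

lemma sat_length_prime:
  assumes J: "idl J" and P: "prm P" and f: "colon J f = P"
  shows "sat_length P J = eSuc (sat_length P (rm.span (insert f J)))"
proof (rule antisym)
  let ?J = "rm.span (insert f J)"
  have JJ: "J \<subseteq> ?J" "f \<in> ?J" using rm.span_superset[of "insert f J"] by auto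
  have le: "enat k \<le> sat_length P ?J" if "sat_chain P ?J k K" for k K
    unfolding sat_length_def using that by (intro Sup_upper) blast
  have "eSuc (enat k) \<le> sat_length P J" if K: "sat_chain P ?J k K" for k K
  proof -
    \<comment> \<open>The new bottom is the smallest saturated ideal over \<open>J\<close>; it omits
      \<open>f\<close> because \<open>(J : f)\<close> is exactly \<open>P\<close>.\<close>
    let ?K = "case_nat (saturation P J) K"
    have "f \<notin> saturation P J" using f by (auto simp: saturation_def colon_def)
    moreover have K0: "saturated P (K 0)" "?J \<subseteq> K 0" using K by (simp_all add: sat_chain_def)
    moreover have "saturation P J \<subseteq> K 0"
      by (rule saturation_minimal[OF K0(1) order_trans[OF JJ(1) K0(2)]])
    moreover have "f \<in> K 0" using JJ(2) K0(2) by blast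
    moreover have "J \<subseteq> K i" if "i \<le> k" for i
      using K that JJ(1) unfolding sat_chain_def by (meson order_trans)
    ultimately have "sat_chain P J (Suc k) ?K"
      using K saturated_saturation[OF P J] by (auto simp: sat_chain_def split: nat.split)
    then show ?thesis unfolding sat_length_def eSuc_enat by (intro Sup_upper) blast
  qed
  moreover have "sat_chain P ?J 0 (\<lambda>_. UNIV)" by (simp add: sat_chain_def saturated_def)
  ultimately have "eSuc ` {enat k | k. \<exists>K. sat_chain P ?J k K} \<noteq> {}"
    "\<And>x. x \<in> eSuc ` {enat k | k. \<exists>K. sat_chain P ?J k K} \<Longrightarrow> x \<le> sat_length P J" by auto
  moreover have "{enat k | k. \<exists>K. sat_chain P ?J k K} \<noteq> {}" using calculation(1) by auto
  ultimately show "eSuc (sat_length P ?J) \<le> sat_length P J"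
    unfolding sat_length_def[of P ?J] by (subst eSuc_Sup) (auto intro!: Sup_least)
  show "sat_length P J \<le> eSuc (sat_length P ?J)"
    unfolding sat_length_def[of P J]
  proof (rule Sup_least, clarify)
    fix k K assume K: "sat_chain P J k K"
    show "enat k \<le> eSuc (sat_length P ?J)"
    proof (cases k)
      case 0
      then show ?thesis by (simp add: zero_enat_def[symmetric])
    next
      case (Suc l)
      have sK: "saturated P (K i)" "J \<subseteq> K i" if "i \<le> k" for i using K that by (auto simp: sat_chain_def)
      have iK: "idl (K i)" if "i \<le> k" for i using sK[OF that] by (simp add: saturated_def)
      have mono: "K i \<subseteq> K j" if "i \<le> j" "j \<le> k" for i j
        using that
      proof (induction j rule: dec_induct)
        case (step n)
        have "K n \<subset> K (Suc n)" using K step.prems by (simp add: sat_chain_def)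
        then show ?case using step by simp
      qed simp
      define G where "G i = saturation P (rm.span (insert f (K i)))" for i
      have G: "saturated P (G i)" "?J \<subseteq> G i" if "i \<le> k" for i
      proof -
        show "saturated P (G i)" unfolding G_def by (intro saturated_saturation P rm.subspace_span)
        have "?J \<subseteq> rm.span (insert f (K i))" using sK(2)[OF that] by (intro rm.span_mono) auto
        then show "?J \<subseteq> G i" unfolding G_def using saturated_saturation(2)[OF P] rm.subspace_span by blast
      qed
      have Gmono: "G i \<subseteq> G j" if "i \<le> j" "j \<le> k" for i j
        unfolding G_def saturation_def using rm.span_mono[OF insert_mono[OF mono[OF that]], of f] by blast
      \<comment> \<open>While \<open>f\<close> is outside the larger ideal, enlarging by
        \<open>f\<close> identifies no neighbours: a coefficient \<open>s\<close> with
        \<open>s * f\<close> in \<open>K (Suc i)\<close> must lie in \<open>P\<close>, and then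
        \<open>s * f\<close> is already in \<open>J\<close>.\<close>
      have G_strict: "G i \<noteq> G (Suc i)" if i: "Suc i \<le> k" "f \<notin> K (Suc i)" for i
      proof
        assume eq: "G i = G (Suc i)"
        have "K i \<subset> K (Suc i)" using K i(1) by (simp add: sat_chain_def)
        then obtain x where x: "x \<in> K (Suc i)" "x \<notin> K i" by blast
        have "x \<in> G (Suc i)"
          unfolding G_def using x(1) saturated_saturation(2)[OF P rm.subspace_span, of "insert f (K (Suc i))"]
            rm.span_superset[of "insert f (K (Suc i))"] by auto
        then have "x \<in> G i" by (simp add: eq)
        then obtain u where u: "u \<notin> P" "u * x \<in> rm.span (insert f (K i))" by (auto simp: G_def saturation_def)
        obtain s where s: "u * x - s * f \<in> K i" using u(2) span_insert_idl[OF iK, of i "u * x" f] i(1) by auto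
        have sub: "K i \<subseteq> K (Suc i)" using mono[of i "Suc i"] i(1) by simp
        have "u * x - (u * x - s * f) \<in> K (Suc i)"
          by (rule rm.subspace_diff[OF iK[OF i(1)] idl_mult(1)[OF iK[OF i(1)] x(1)] subsetD[OF sub s]])
        then have "s * f \<in> K (Suc i)" by simp
        then have "s \<in> P" using sK(1)[OF i(1)] i(2) by (auto simp: saturated_def)
        then have "s * f \<in> J" using f by (auto simp: colon_def)
        then have sf: "s * f \<in> K i" using sK(2)[of i] i(1) by auto
        have "u * x - s * f + s * f \<in> K i" using i(1) by (intro rm.subspace_add[OF iK] s sf) simp
        then have "u * x \<in> K i" by simp
        then show False using u(1) x(2) sK(1)[of i] i(1) by (auto simp: saturated_def)
      qed
      have "\<exists>H. sat_chain P ?J l H"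
      proof (cases "\<exists>i\<le>k. f \<in> K i")
        case False
        have "sat_chain P ?J l G"
          unfolding sat_chain_def
        proof (intro conjI allI impI)
          fix i assume "i < l"
          then have "Suc i \<le> k" "f \<notin> K (Suc i)" using Suc False by auto
          then show "G i \<subset> G (Suc i)" using Gmono[of i "Suc i"] G_strict[of i] by auto
        qed (use G Suc in auto)
        then show ?thesis by blast
      next
        case True
        define q where "q = (LEAST i. f \<in> K i)"
        have q: "f \<in> K q" "q \<le> k" using True LeastI[of "\<lambda>i. f \<in> K i"] Least_le[of "\<lambda>i. f \<in> K i"]
          unfolding q_def by (auto intro: le_trans)
        have nq: "f \<notin> K i" if "i < q" for i using that not_less_Least unfolding q_def by blast
        have KJ: "?J \<subseteq> K i" if "q \<le> i" "i \<le> k" for i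
        proof (rule rm.span_minimal)
          show "insert f J \<subseteq> K i" using q mono[OF that] sK(2)[OF that(2)] by auto
        qed (rule iK[OF that(2)])
        \<comment> \<open>From the first index \<open>q\<close> with \<open>f\<close> in
          \<open>K q\<close> on, the chain itself lies over \<open>?J\<close>. Only
          \<open>K q\<close> is skipped, since it may coincide with
          \<open>G (q - 1)\<close>.\<close>
        define H where "H i = (if i < q then G i else K (Suc i))" for i
        have "sat_chain P ?J l H"
          unfolding sat_chain_def
        proof (intro conjI allI impI)
          fix i assume i: "i \<le> l"
          show "saturated P (H i)" using G(1)[of i] sK(1)[of "Suc i"] i Suc by (simp add: H_def)
          show "?J \<subseteq> H i" using G(2)[of i] KJ[of "Suc i"] i Suc by (simp add: H_def)
        next
          fix i assume i: "i < l"
          consider "Suc i < q" | "Suc i = q" | "q \<le> i" by linarith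
          then show "H i \<subset> H (Suc i)"
          proof cases
            case 1
            then have "G i \<subset> G (Suc i)" using Gmono[of i "Suc i"] G_strict[of i] nq[of "Suc i"] i Suc by auto
            then show ?thesis using 1 by (simp add: H_def)
          next
            case 2
            have "G i \<subseteq> K q"
              unfolding G_def
            proof (rule saturation_minimal)
              show "saturated P (K q)" using q(2) by (rule sK)
              show "rm.span (insert f (K i)) \<subseteq> K q"
                using q mono[of i q] 2 by (intro rm.span_minimal iK) auto
            qed
            moreover have "K q \<subset> K (Suc q)" using K 2 i Suc by (auto simp: sat_chain_def)
            ultimately show ?thesis using 2 by (auto simp: H_def)
          next
            case 3
            then show ?thesis using K i Suc by (auto simp: H_def sat_chain_def)
          qed
        qed
        then show ?thesis by blast
      qed
      then have "enat l \<le> sat_length P ?J" using le by blast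
      then show ?thesis using Suc by (simp add: eSuc_enat[symmetric])
    qed
  qed
qed

section \<open>Vanishing ideals of linear spaces\<close>

abbreviation ev :: "('v::finite \<Rightarrow> 'k::comm_ring_1) \<Rightarrow> ('v, 'k) mpol \<Rightarrow> 'k" where
  "ev a f \<equiv> mpol_subst (\<lambda>c. c) a f"

interpretation ev: coeff_hom "\<lambda>c :: 'k. c" a for a :: "'v::finite \<Rightarrow> 'k::comm_ring_1"
  by unfold_locales auto

interpretation sb: coeff_hom "mconst :: 'k \<Rightarrow> ('v, 'k) mpol" s for s :: "'v::finite \<Rightarrow> ('v, 'k::comm_ring_1) mpol"
  by unfold_locales (simp_all add: mconst_add mconst_mult)

lemma mpol_induct [case_names const var add mult]:
  fixes f :: "('v::finite, 'k::comm_ring_1) mpol"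
  assumes "\<And>c. \<Phi> (mconst c)" "\<And>i. \<Phi> (mvar i)" "\<And>f g. \<Phi> f \<Longrightarrow> \<Phi> g \<Longrightarrow> \<Phi> (f + g)" "\<And>f g. \<Phi> f \<Longrightarrow> \<Phi> g \<Longrightarrow> \<Phi> (f * g)"
  shows "\<Phi> f"
proof -
  have c: "\<Phi> 0" "\<Phi> 1" using assms(1)[of 0] assms(1)[of 1] by simp_all
  have pow: "\<Phi> (mvar i ^ k)" for i k by (induction k) (auto intro: assms c)
  have prod: "\<Phi> (\<Prod>i\<in>A. mvar i ^ k i)" for A k
    by (induction A rule: infinite_finite_induct) (auto intro: assms(4) pow c)
  have "\<Phi> (scl c (monomial \<nu>))" for c \<nu>
    unfolding scl_def monomial_eq_prod by (intro assms(4) assms(1) prod)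
  then have "\<Phi> (\<Sum>\<nu>\<in>A. scl (k \<nu>) (monomial \<nu>))" for A k
    by (induction A rule: infinite_finite_induct) (auto intro: assms(3) c)
  then have "\<Phi> (\<Sum>\<nu>\<in>Poly_Mapping.keys f. Poly_Mapping.single \<nu> (Poly_Mapping.lookup f \<nu>))"
    by (simp only: single_eq_scl)
  then show ?thesis by (simp only: sum_single_lookup)
qed

lemma ev_subst:
  fixes s :: "'v::finite \<Rightarrow> ('v, 'k::comm_ring_1) mpol"
  shows "ev a (mpol_subst mconst s f) = ev (\<lambda>i. ev a (s i)) f"
  by (induction f rule: mpol_induct) (simp_all add: ev.subst_add ev.subst_mult sb.subst_add sb.subst_mult)

lemma subst_cong_ideal:
  assumes Q: "idl Q" and v: "\<And>i. mvar i - s i \<in> Q"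
  shows "f - mpol_subst mconst s f \<in> Q"
proof (induction f rule: mpol_induct)
  case (add f g)
  then have "(f - mpol_subst mconst s f) + (g - mpol_subst mconst s g) \<in> Q" by (rule rm.subspace_add[OF Q])
  then show ?case by (simp add: sb.subst_add algebra_simps)
next
  case (mult f g)
  then have "g * (f - mpol_subst mconst s f) + mpol_subst mconst s f * (g - mpol_subst mconst s g) \<in> Q"
    by (intro rm.subspace_add[OF Q] idl_mult(1)[OF Q])
  then show ?case by (simp add: sb.subst_mult algebra_simps)
qed (use Q v in \<open>simp_all add: rm.subspace_0\<close>)

lemma ev_0_eq_lookup: "ev (\<lambda>_. 0) f = Poly_Mapping.lookup f 0"
  for f :: "('v::finite, 'k::comm_ring_1) mpol"
proof (induction f rule: mpol_induct)
  case (var i)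
  then show ?case using monomial_in_irrelevant[of "Poly_Mapping.single i 1"] mvar_in_irrelevant[of i] by (simp add: irrelevant_def)
qed (simp_all add: ev.subst_add ev.subst_mult lookup_add lookup_mult_0 mconst_def ev.subst_single)

text \<open>Kronecker substitution: the numbers \<open>T ^ to_nat i\<close> separate the given
  monomials as soon as \<open>T\<close> is no root of finitely many difference polynomials.\<close>

lemma separating_exponents:
  fixes M :: "('v::finite \<Rightarrow>\<^sub>0 nat) set"
  assumes "finite M"
  shows "\<exists>u :: 'v \<Rightarrow> nat. inj_on (\<lambda>\<nu>. \<Sum>i\<in>UNIV. u i * Poly_Mapping.lookup \<nu> i) M"
proof -
  define p where "p x = (\<Sum>i\<in>UNIV. Polynomial.monom (int (Poly_Mapping.lookup (fst x) i) - int (Poly_Mapping.lookup (snd x) i)) (to_nat i))" for x :: "('v \<Rightarrow>\<^sub>0 nat) \<times> ('v \<Rightarrow>\<^sub>0 nat)"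
  have p: "p (\<nu>, \<mu>) \<noteq> 0" if ne: "\<nu> \<noteq> \<mu>" for \<nu> \<mu>
  proof -
    obtain j where j: "Poly_Mapping.lookup \<nu> j \<noteq> Poly_Mapping.lookup \<mu> j" using ne poly_mapping_eqI by metis
    have "Polynomial.coeff (p (\<nu>, \<mu>)) (to_nat j) = (\<Sum>i\<in>UNIV. if i = j then int (Poly_Mapping.lookup \<nu> i) - int (Poly_Mapping.lookup \<mu> i) else 0)"
      unfolding p_def coeff_sum by (rule sum.cong) auto
    then show ?thesis using j by auto
  qed
  let ?Z = "\<Union>x\<in>{x\<in>M \<times> M. fst x \<noteq> snd x}. {t. poly (p x) t = 0}"
  have "finite ?Z" using assms p by (intro finite_UN_I) (auto intro: poly_roots_finite)
  then have "finite (int -` ?Z)" by (intro finite_vimageI) (auto simp: inj_def)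
  from ex_new_if_finite[OF infinite_UNIV_nat this] obtain T where T: "int T \<notin> ?Z"
    unfolding vimage_eq by (rule exE)
  have ev: "poly (p (\<nu>, \<mu>)) (int T) = int (\<Sum>i\<in>UNIV. T ^ to_nat i * Poly_Mapping.lookup \<nu> i) - int (\<Sum>i\<in>UNIV. T ^ to_nat i * Poly_Mapping.lookup \<mu> i)" for \<nu> \<mu>
    by (simp add: p_def poly_sum poly_monom sum_subtractf algebra_simps)
  have "inj_on (\<lambda>\<nu>. \<Sum>i\<in>UNIV. T ^ to_nat i * Poly_Mapping.lookup \<nu> i) M"
  proof (rule inj_onI, rule ccontr)
    fix \<nu> \<mu> assume x: "\<nu> \<in> M" "\<mu> \<in> M" "(\<Sum>i\<in>UNIV. T ^ to_nat i * Poly_Mapping.lookup \<nu> i) = (\<Sum>i\<in>UNIV. T ^ to_nat i * Poly_Mapping.lookup \<mu> i)" "\<nu> \<noteq> \<mu>"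
    have "poly (p (\<nu>, \<mu>)) (int T) = 0" by (simp only: ev x(3) diff_self)
    then show False using T x by auto
  qed
  then show ?thesis by (rule exI[of _ "\<lambda>i. T ^ to_nat i"])
qed

lemma poly_zero_if_vanishing:
  fixes q :: "'k::{idom, ring_char_0} poly"
  assumes "\<And>t. poly q t = 0"
  shows "q = 0"
  using assms poly_roots_finite[of q] infinite_UNIV_char_0[where 'a='k] by auto

text \<open>Setting the variables to powers of \<open>t\<close> with separating exponents turns
  \<open>f\<close> into a univariate polynomial with the same coefficients, which vanishes at every
  scalar of an infinite domain.\<close>

lemma zero_if_vanishing:
  fixes f :: "('v::finite, 'k::{idom, ring_char_0}) mpol"
  assumes "\<And>a. ev a f = 0"
  shows "f = 0"
proof (rule ccontr)
  assume "f \<noteq> 0"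
  then obtain \<nu>0 where \<nu>0: "\<nu>0 \<in> Poly_Mapping.keys f" by (metis all_not_in_conv keys_eq_empty)
  obtain u :: "'v \<Rightarrow> nat" where u: "inj_on (\<lambda>\<nu>. \<Sum>i\<in>UNIV. u i * Poly_Mapping.lookup \<nu> i) (Poly_Mapping.keys f)"
    using separating_exponents[OF finite_keys] by blast
  define U where "U \<nu> = (\<Sum>i\<in>UNIV. u i * Poly_Mapping.lookup \<nu> i)" for \<nu>
  define q where "q = (\<Sum>\<nu>\<in>Poly_Mapping.keys f. Polynomial.monom (Poly_Mapping.lookup f \<nu>) (U \<nu>))"
  have "poly q t = ev (\<lambda>i. t ^ u i) f" for t
    by (simp add: q_def mpol_subst_def poly_sum poly_monom U_def power_sum power_mult)
  then have "q = 0" using assms by (intro poly_zero_if_vanishing) simp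
  moreover have "Polynomial.coeff q (U \<nu>0) = (\<Sum>\<nu>\<in>Poly_Mapping.keys f. if \<nu> = \<nu>0 then Poly_Mapping.lookup f \<nu> else 0)"
    unfolding q_def coeff_sum using u \<nu>0 by (intro sum.cong) (auto simp: inj_on_def U_def)
  ultimately show False using \<nu>0 by (simp add: in_keys_iff)
qed

text \<open>Ideals of linear forms are introduced through their zero sets, where primality and
  gradedness are easier to see than from generators.\<close>

definition vanishing :: "('v::finite \<Rightarrow> 'k::field) set \<Rightarrow> ('v, 'k) mpol set" where
  "vanishing L = {f. \<forall>a\<in>L. ev a f = 0}"

lemma idl_vanishing: "idl (vanishing L)"
  by (rule rm.subspaceI) (auto simp: vanishing_def ev.subst_add ev.subst_mult)

text \<open>On the line through two points of \<open>L\<close> each factor becomes a nonzero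
  univariate polynomial, and some point of the line is a zero of neither.\<close>

lemma prm_vanishing:
  fixes L :: "('v::finite \<Rightarrow> 'k::field_char_0) set"
  assumes "L \<noteq> {}" "\<And>a b t. a \<in> L \<Longrightarrow> b \<in> L \<Longrightarrow> (\<lambda>i. (1 - t) * a i + t * b i) \<in> L"
  shows "prm (vanishing L)"
  unfolding prm_def
proof (intro conjI allI impI)
  show "1 \<notin> vanishing L" using assms(1) by (auto simp: vanishing_def)
  fix f g assume fg: "f * g \<in> vanishing L"
  show "f \<in> vanishing L \<or> g \<in> vanishing L"
  proof (rule ccontr)
    assume "\<not> ?thesis"
    then obtain a b where a: "a \<in> L" "ev a f \<noteq> 0" and b: "b \<in> L" "ev b g \<noteq> 0" by (auto simp: vanishing_def)
    define c where "c t = (\<lambda>i. (1 - t) * a i + t * b i)" for t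
    have "pcurve (\<lambda>t. t) (\<lambda>t. c t i)" for i
      unfolding c_def by (intro pcurve_add pcurve_mult pcurve_const pcurve_param pcurve_diff)
    then have curve: "pcurve (\<lambda>t. t) (\<lambda>t. ev (c t) h)" for h
      unfolding mpol_subst_def by (intro pcurve_sum pcurve_mult pcurve_const pcurve_prod pcurve_power)
    have "c 0 = a" "c 1 = b" by (auto simp: c_def)
    then have "finite {t. ev (c t) f = 0}" "finite {t. ev (c t) g = 0}"
      using a(2) b(2) pcurve_finite_zeros[OF curve[of f], of 0] pcurve_finite_zeros[OF curve[of g], of 1] by auto
    then have "finite ({t. ev (c t) f = 0} \<union> {t. ev (c t) g = 0})" by simp
    from ex_new_if_finite[OF infinite_UNIV_char_0 this] obtain t where "ev (c t) f \<noteq> 0" "ev (c t) g \<noteq> 0" by auto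
    then have "ev (c t) (f * g) \<noteq> 0" by (simp add: ev.subst_mult)
    moreover have "c t \<in> L" unfolding c_def by (intro assms a b)
    ultimately show False using fg by (auto simp: vanishing_def)
  qed
qed (rule idl_vanishing)

lemma ev_scale: "hg total_degree d f \<Longrightarrow> ev (\<lambda>i. t * a i) f = t ^ d * ev a f"
proof -
  assume f: "hg total_degree d f"
  have "ev (\<lambda>i. t * a i) f = (\<Sum>\<nu>\<in>Poly_Mapping.keys f. t ^ d * (Poly_Mapping.lookup f \<nu> * (\<Prod>v\<in>UNIV. a v ^ Poly_Mapping.lookup \<nu> v)))"
    unfolding mpol_subst_def
  proof (rule sum.cong[OF refl])
    fix \<nu> assume "\<nu> \<in> Poly_Mapping.keys f"
    then have "total_degree \<nu> = d" using f by (simp add: hg_def)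
    then have "(\<Prod>v\<in>UNIV. t ^ Poly_Mapping.lookup \<nu> v) = t ^ d"
      unfolding total_degree_def by (metis power_sum)
    then show "Poly_Mapping.lookup f \<nu> * (\<Prod>v\<in>UNIV. (t * a v) ^ Poly_Mapping.lookup \<nu> v) =
        t ^ d * (Poly_Mapping.lookup f \<nu> * (\<Prod>v\<in>UNIV. a v ^ Poly_Mapping.lookup \<nu> v))"
      by (simp add: power_mult_distrib prod.distrib mult.left_commute)
  qed
  then show ?thesis by (simp add: mpol_subst_def sum_distrib_left)
qed

text \<open>Along the multiples \<open>t a\<close> of a point, the values of the components of
  \<open>f\<close> at \<open>a\<close> are the coefficients of a polynomial in \<open>t\<close> that
  vanishes identically.\<close>

lemma gr_vanishing:
  fixes L :: "('v::finite \<Rightarrow> 'k::field_char_0) set"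
  assumes "\<And>a t. a \<in> L \<Longrightarrow> (\<lambda>i. t * a i) \<in> L"
  shows "gr total_degree (vanishing L)"
  unfolding gr_def
proof (intro conjI ballI allI)
  fix f :: "('v, 'k) mpol" and d assume f: "f \<in> vanishing L"
  have "ev a (gcomp total_degree d f) = 0" if a: "a \<in> L" for a
  proof -
    let ?D = "total_degree ` Poly_Mapping.keys f"
    define q where "q = (\<Sum>e\<in>?D. Polynomial.monom (ev a (gcomp total_degree e f)) e)"
    have "poly q t = ev (\<lambda>i. t * a i) f" for t
    proof -
      have "ev (\<lambda>i. t * a i) (\<Sum>e\<in>?D. gcomp total_degree e f) = (\<Sum>e\<in>?D. t ^ e * ev a (gcomp total_degree e f))"
        by (simp add: ev.subst_sum ev_scale[OF hg_comp])
      then show ?thesis by (simp add: sum_comp q_def poly_sum poly_monom mult.commute)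
    qed
    then have "q = 0" using f assms[OF a] by (intro poly_zero_if_vanishing) (simp add: vanishing_def)
    moreover have "Polynomial.coeff q d = (\<Sum>e\<in>?D. if e = d then ev a (gcomp total_degree d f) else 0)"
      unfolding q_def coeff_sum by (rule sum.cong) auto
    ultimately have "(\<Sum>e\<in>?D. if e = d then ev a (gcomp total_degree d f) else 0) = 0" by simp
    then have "d \<in> ?D \<Longrightarrow> ev a (gcomp total_degree d f) = 0" by (subst (asm) sum.delta) simp_all
    moreover have "d \<notin> ?D \<Longrightarrow> gcomp total_degree d f = 0" unfolding gcomp_def by (intro sum.neutral) auto
    ultimately show ?thesis by (cases "d \<in> ?D") simp_all
  qed
  then show "gcomp total_degree d f \<in> vanishing L" by (simp add: vanishing_def)
qed (rule idl_vanishing)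

lemma HS_irrelevant: "HS (irrelevant :: ('v::finite, 'k::field) mpol set) = 1"
proof (rule fps_ext)
  fix d
  have i: "idl (irrelevant :: ('v, 'k) mpol set)" by (rule prm_irrelevant[unfolded prm_def, THEN conjunct1])
  show "fps_nth (HS (irrelevant :: ('v, 'k) mpol set)) d = fps_nth 1 d"
  proof (cases d)
    case 0
    have "(irrelevant :: ('v, 'k) mpol set) \<inter> hom_part 0 \<subseteq> {0}"
    proof
      fix f :: "('v, 'k) mpol" assume f: "f \<in> irrelevant \<inter> hom_part 0"
      have "Poly_Mapping.lookup f \<nu> = 0" for \<nu>
        using f by (cases "\<nu> = 0") (auto simp: irrelevant_def hom_part_def in_keys_iff total_degree_eq_0)
      then show "f \<in> {0}" by (simp add: poly_mapping_eqI)
    qed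
    then have "Kv.dim ((irrelevant :: ('v, 'k) mpol set) \<inter> hom_part 0) = 0"
      using Kv.dim_le_card[of "irrelevant \<inter> hom_part 0" "{}"] by simp
    moreover have "{\<nu> :: 'v \<Rightarrow>\<^sub>0 nat. total_degree \<nu> = 0} = {0}" by (simp add: total_degree_eq_0)
    then have "Kv.dim (hom_part 0 :: ('v, 'k) mpol set) = 1" by (simp add: hom_part_Sp dim_Sp)
    ultimately show ?thesis using 0 by (simp add: hf_def)
  next
    case (Suc k)
    have "hom_part d \<subseteq> (irrelevant :: ('v, 'k) mpol set)"
      using Suc by (auto simp: hom_part_def irrelevant_def) (metis in_keys_iff nat.distinct(1) total_degree_0)
    then have "hf (irrelevant :: ('v, 'k) mpol set) d = 0" using hf_eq_0[OF i] by blast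
    then show ?thesis using Suc by simp
  qed
qed

section \<open>Counting the top-dimensional components of the initial ideal\<close>

text \<open>The homogenization of \<open>p\<close> to degree \<open>d\<close>, evaluated at
  \<open>X\<close> and \<open>Y\<close>; it acquires factors \<open>X\<close> when \<open>d\<close>
  exceeds the degree of \<open>p\<close>.\<close>

definition binform :: "('v, 'k::comm_ring_1) mpol \<Rightarrow> ('v, 'k) mpol \<Rightarrow> nat \<Rightarrow> 'k poly \<Rightarrow> ('v, 'k) mpol" where
  "binform X Y d p = (\<Sum>k\<le>d. scl (Polynomial.coeff p k) (Y ^ k * X ^ (d - k)))"

lemma binform_factor:
  fixes q :: "'k::field poly"
  assumes "Polynomial.degree q \<le> d"
  shows "binform X Y (Suc d) ([:- c, 1:] * q) = (Y - scl c X) * binform X Y d q"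
proof -
  have "[:- c, 1:] * q = pCons 0 q - Polynomial.smult c q" by simp
  then have "binform X Y (Suc d) ([:- c, 1:] * q) = binform X Y (Suc d) (pCons 0 q) - binform X Y (Suc d) (Polynomial.smult c q)"
    by (simp only: binform_def coeff_diff Kv.scale_left_diff_distrib sum_subtractf)
  moreover have "binform X Y (Suc d) (pCons 0 q) = Y * binform X Y d q"
    unfolding binform_def sum.atMost_Suc_shift
    by (simp add: sum_distrib_left scl_mult_right mult.assoc)
  moreover have "binform X Y (Suc d) (Polynomial.smult c q) = scl c X * binform X Y d q"
  proof -
    have "Polynomial.coeff q (Suc d) = 0" using assms by (intro coeff_eq_0) simp
    then have "binform X Y (Suc d) (Polynomial.smult c q) = (\<Sum>k\<le>d. scl (c * Polynomial.coeff q k) (Y ^ k * X ^ (Suc d - k)))"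
      by (simp add: binform_def)
    also have "\<dots> = (\<Sum>k\<le>d. scl c X * scl (Polynomial.coeff q k) (Y ^ k * X ^ (d - k)))"
    proof (rule sum.cong[OF refl])
      fix k assume "k \<in> {..d}"
      then have "Suc d - k = Suc (d - k)" by auto
      then show "scl (c * Polynomial.coeff q k) (Y ^ k * X ^ (Suc d - k)) = scl c X * scl (Polynomial.coeff q k) (Y ^ k * X ^ (d - k))"
        by (simp add: scl_def mconst_mult ac_simps)
    qed
    finally show ?thesis by (simp add: binform_def sum_distrib_left)
  qed
  ultimately show ?thesis by (simp add: left_diff_distrib)
qed

text \<open>Over an algebraically closed field a binary form splits into linear factors, one of
  which lies in the prime; \<open>X\<close> itself is excluded by hypothesis.\<close>

lemma binform_prime:
  fixes p :: "'k::alg_closed_field poly"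
  assumes P: "prm P" "X \<notin> P"
  shows "p \<noteq> 0 \<Longrightarrow> Polynomial.degree p \<le> d \<Longrightarrow> binform X Y d p \<in> P \<Longrightarrow> \<exists>c. poly p c = 0 \<and> Y - scl c X \<in> P"
proof (induction d arbitrary: p)
  case d: 0
  then obtain a where a: "p = [:a:]" "a \<noteq> 0" by (metis degree_eq_zeroE le_zero_eq pCons_eq_0_iff)
  then have "scl a 1 \<in> P" using d.prems by (simp add: binform_def)
  then have "scl (inverse a) (scl a 1) \<in> P" using P(1) idl_scl[of P "scl a 1" "inverse a"] by (auto simp: prm_def)
  then have "1 \<in> P" using a(2) by simp
  then show ?case using P(1) by (simp add: prm_def)
next
  case (Suc d)
  have iP: "idl P" using P(1) by (simp add: prm_def)
  show ?case
  proof (cases "Polynomial.degree p = 0")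
    case True
    then obtain a where a: "p = [:a:]" "a \<noteq> 0" using Suc.prems(1) by (metis degree_eq_zeroE pCons_eq_0_iff)
    have "binform X Y (Suc d) p = scl a (X ^ Suc d)"
      unfolding binform_def sum.atMost_Suc_shift a(1) by simp
    then have "scl (inverse a) (scl a (X ^ Suc d)) \<in> P" using Suc.prems(3) idl_scl[OF iP] by metis
    then have "X ^ Suc d \<in> P" using a(2) by simp
    then show ?thesis using prm_power[OF P(1)] P(2) by blast
  next
    case False
    then obtain c where c: "poly p c = 0" using alg_closed_imp_poly_has_root[of p] by blast
    then obtain q where q: "p = [:- c, 1:] * q" by (auto simp: poly_eq_0_iff_dvd)
    then have q0: "q \<noteq> 0" using Suc.prems(1) by auto
    then have "Polynomial.degree p = Suc (Polynomial.degree q)" unfolding q by (subst degree_mult_eq) auto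
    then have dq: "Polynomial.degree q \<le> d" using Suc.prems(2) by simp
    have "(Y - scl c X) * binform X Y d q \<in> P" using Suc.prems(3) unfolding q binform_factor[OF dq] .
    then have "Y - scl c X \<in> P \<or> binform X Y d q \<in> P" using P(1) by (simp add: prm_def)
    then show ?thesis
    proof
      assume "binform X Y d q \<in> P"
      then obtain c' where "poly q c' = 0" "Y - scl c' X \<in> P" using Suc.IH[OF q0 dq] by blast
      then show ?thesis by (intro exI[of _ c']) (simp add: q)
    qed (use c in blast)
  qed
qed

section \<open>Binary forms in the initial ideal\<close>

definition odeg :: "'v set \<Rightarrow> ('v::finite \<Rightarrow>\<^sub>0 nat) \<Rightarrow> nat" where
  "odeg A \<nu> = (\<Sum>b\<in>- A. Poly_Mapping.lookup \<nu> b)"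

lemma odeg_add: "odeg A (\<mu> + \<nu>) = odeg A \<mu> + odeg A \<nu>"
  by (simp add: odeg_def lookup_add sum.distrib)

lemma odeg_eq_0: "odeg A \<nu> = 0 \<longleftrightarrow> (\<forall>b\<in>- A. Poly_Mapping.lookup \<nu> b = 0)"
  by (simp add: odeg_def)

text \<open>What will be known about the initial ideal of a weight that is minimal exactly on
  \<open>A\<close>. Monomials in the variables of \<open>A\<close> have the least weight in their
  degree, which is the source of \<open>apart\<close>; \<open>params\<close> descends from the
  parameters of the original ideal.\<close>

locale initial_setup =
  fixes J :: "('v::finite, 'k::{alg_closed_field, field_char_0}) mpol set" and A :: "'v set" and i0 :: 'v and m :: nat
  assumes grJ: "gr total_degree J" and i0: "i0 \<in> A" and m: "Suc (card (- A)) = m"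
    and apart: "\<And>h. h \<in> J \<Longrightarrow> gcomp (odeg A) 0 h \<in> J"
    and params: "\<And>i. i \<in> A \<Longrightarrow> primary (insert i (- A)) J"
begin

lemma idlJ: "idl J"
  using grJ by (rule gr_idl)

abbreviation "F d \<equiv> free_mons (- A) d"

lemma finite_F: "finite (F d)"
  by (rule finite_subset[OF _ finite_total_degree[of d]]) (auto simp: free_mons_def)

lemma F_odeg: "\<nu> \<in> F d \<longleftrightarrow> total_degree \<nu> = d \<and> odeg A \<nu> = 0"
  by (auto simp: free_mons_def odeg_eq_0)

lemma hg_odeg_mvar: "i \<in> A \<Longrightarrow> hg (odeg A) 0 (mvar i)"
  using hg_monomial[of "odeg A" "Poly_Mapping.single i 1"]
  by (simp add: mvar_eq_monomial odeg_def lookup_single when_def sum.neutral)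

text \<open>The parameters give a relation modulo \<open>J\<close> and the variables outside
  \<open>A\<close>. Its part free of those variables retains only \<open>x_i\<close>, and
  \<open>apart\<close> keeps the remainder in \<open>J\<close>.\<close>

lemma reduce_monomial:
  assumes i: "i \<in> A"
  shows "\<exists>N. \<forall>d\<ge>N. \<forall>\<nu>\<in>F (Suc d). \<exists>f\<in>Sp (F d). monomial \<nu> - f * mvar i \<in> J"
proof -
  obtain N where N: "\<And>\<nu>. total_degree \<nu> \<ge> N \<Longrightarrow> monomial \<nu> \<in> rm.span (J \<union> mvar ` insert i (- A))"
    using params[OF i] by (auto simp: primary_def)
  have "\<exists>f\<in>Sp (F d). monomial \<nu> - f * mvar i \<in> J" if d: "d \<ge> N" and \<nu>: "\<nu> \<in> F (Suc d)" for d \<nu>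
  proof -
    have "J \<union> mvar ` insert i (- A) = insert (mvar i) (J \<union> mvar ` (- A))" by auto
    moreover have "monomial \<nu> \<in> rm.span (J \<union> mvar ` insert i (- A))" using d \<nu> by (intro N) (simp add: free_mons_def)
    ultimately have "monomial \<nu> \<in> rm.span (insert (mvar i) (J \<union> mvar ` (- A)))" by simp
    then obtain r where "monomial \<nu> - r * mvar i \<in> rm.span (J \<union> mvar ` (- A))" using rm.span_breakdown_eq by metis
    then have "monomial \<nu> - r * mvar i \<in> {x + y | x y. x \<in> rm.span J \<and> y \<in> rm.span (mvar ` (- A))}"
      by (simp only: rm.span_Un)
    then obtain x z where xz: "monomial \<nu> - r * mvar i = x + z" "x \<in> J" "z \<in> rm.span (mvar ` (- A))"
      using rm.span_eq_iff[THEN iffD2, OF idlJ] by auto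
    let ?c = "\<lambda>f. gcomp (odeg A) 0 (gcomp total_degree (Suc d) f)"
    define f where "f = gcomp (odeg A) 0 (gcomp total_degree d r)"
    have "?c z = 0"
    proof (rule poly_mapping_eqI)
      fix \<mu>
      have "odeg A \<mu> \<noteq> 0" if "\<mu> \<in> Poly_Mapping.keys z"
        using xz(3) that unfolding span_mvars_iff odeg_eq_0 by force
      then show "Poly_Mapping.lookup (?c z) \<mu> = Poly_Mapping.lookup 0 \<mu>" by (cases "\<mu> \<in> Poly_Mapping.keys z") (simp_all add: lookup_comp in_keys_iff)
    qed
    moreover have "?c (r * mvar i) = f * mvar i"
      using comp_mult_hg[OF total_degree_add hg_mvar, of d r i] comp_mult_hg[OF odeg_add hg_odeg_mvar[OF i], of 0 "gcomp total_degree d r"]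
      by (simp add: f_def)
    moreover have "?c (monomial \<nu>) = monomial \<nu>"
      using \<nu> by (simp add: F_odeg comp_hg[OF hg_monomial])
    moreover have "?c (monomial \<nu> - r * mvar i) = ?c x + ?c z" unfolding xz(1) by (simp only: comp_add)
    moreover have "?c (monomial \<nu> - r * mvar i) = ?c (monomial \<nu>) - ?c (r * mvar i)" by (simp only: comp_diff)
    ultimately have "monomial \<nu> - f * mvar i = ?c x" by (metis add.right_neutral)
    moreover have "?c x \<in> J" using grJ xz(2) by (intro apart) (simp add: gr_def)
    moreover have "f \<in> Sp (F d)" by (auto simp: f_def Sp_def keys_comp F_odeg)
    ultimately show ?thesis by metis
  qed
  then show ?thesis by blast
qed

text \<open>The degree \<open>N\<close> of the cofactor does not depend on \<open>e\<close>; this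
  leaves a space of fixed dimension for the pigeonhole argument in
  \<open>binary_form\<close>.\<close>

lemma reduce_power:
  assumes i: "i \<in> A"
  shows "\<exists>N. \<forall>e. \<forall>f\<in>Sp (F (N + e)). \<exists>g\<in>Sp (F N). f - g * mvar i ^ e \<in> J"
proof -
  obtain N where N: "\<And>d \<nu>. d \<ge> N \<Longrightarrow> \<nu> \<in> F (Suc d) \<Longrightarrow> \<exists>f\<in>Sp (F d). monomial \<nu> - f * mvar i \<in> J"
    using reduce_monomial[OF i] by blast
  have step: "\<exists>g\<in>Sp (F d). f - g * mvar i \<in> J" if d: "d \<ge> N" and f: "f \<in> Sp (F (Suc d))" for d f
  proof -
    have "\<forall>\<nu>\<in>F (Suc d). \<exists>f\<in>Sp (F d). monomial \<nu> - f * mvar i \<in> J" using N[OF d] by blast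
    then obtain G where G: "\<And>\<nu>. \<nu> \<in> F (Suc d) \<Longrightarrow> G \<nu> \<in> Sp (F d) \<and> monomial \<nu> - G \<nu> * mvar i \<in> J" by metis
    let ?K = "Poly_Mapping.keys f"
    define g where "g = (\<Sum>\<nu>\<in>?K. scl (Poly_Mapping.lookup f \<nu>) (G \<nu>))"
    have K: "?K \<subseteq> F (Suc d)" using f by (simp add: Sp_def)
    have "g \<in> Sp (F d)" unfolding g_def using G K by (intro Kv.subspace_sum Kv.subspace_scale subspace_Sp) auto
    moreover have "f - g * mvar i = (\<Sum>\<nu>\<in>?K. scl (Poly_Mapping.lookup f \<nu>) (monomial \<nu> - G \<nu> * mvar i))"
    proof -
      have "(\<Sum>\<nu>\<in>?K. scl (Poly_Mapping.lookup f \<nu>) (monomial \<nu>)) = f"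
        by (simp only: single_eq_scl[symmetric] sum_single_lookup)
      then show ?thesis
        by (simp add: g_def Kv.scale_right_diff_distrib sum_subtractf sum_distrib_right scl_mult_left)
    qed
    moreover have "\<dots> \<in> J" using G K by (intro rm.subspace_sum idl_scl idlJ) auto
    ultimately show ?thesis by metis
  qed
  have "\<exists>g\<in>Sp (F N). f - g * mvar i ^ e \<in> J" if "f \<in> Sp (F (N + e))" for e f
    using that
  proof (induction e arbitrary: f)
    case 0
    then show ?case using rm.subspace_0[OF idlJ] by (intro bexI[of _ f]) auto
  next
    case (Suc e)
    then obtain g where g: "g \<in> Sp (F (N + e))" "f - g * mvar i \<in> J" using step[of "N + e" f] by auto
    obtain h where h: "h \<in> Sp (F N)" "g - h * mvar i ^ e \<in> J" using Suc.IH[OF g(1)] by blast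
    have "(f - g * mvar i) + mvar i * (g - h * mvar i ^ e) \<in> J"
      by (intro rm.subspace_add[OF idlJ] g idl_mult(1)[OF idlJ] h)
    then have "f - h * mvar i ^ Suc e \<in> J" by (simp add: algebra_simps)
    then show ?case using h(1) by blast
  qed
  then show ?thesis by blast
qed

lemma binary_form:
  assumes i: "i \<in> A" and j: "j \<in> A"
  shows "\<exists>p d. p \<noteq> 0 \<and> Polynomial.degree p \<le> d \<and> binform (mvar i) (mvar j) d p \<in> J"
proof -
  obtain N where N: "\<And>e f. f \<in> Sp (F (N + e)) \<Longrightarrow> \<exists>g\<in>Sp (F N). f - g * mvar i ^ e \<in> J"
    using reduce_power[OF i] by blast
  \<comment> \<open>Modulo \<open>J\<close> the \<open>d + 1\<close> monomials of degree
    \<open>d\<close> in the two variables are multiples of one power of \<open>x_i\<close>, with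
    cofactors in a space of dimension \<open>card (F N) \<le> d\<close>; so the cofactors are
    dependent.\<close>
  define d where "d = N + card (F N)"
  have hgp: "hg \<phi> (k * w) (f ^ k)" if "\<And>\<mu> \<nu>. \<phi> (\<mu> + \<nu>) = \<phi> \<mu> + \<phi> \<nu>" "hg \<phi> w f" "\<phi> 0 = 0"
    for \<phi> :: "('v \<Rightarrow>\<^sub>0 nat) \<Rightarrow> nat" and k w and f :: "('v, 'k) mpol"
  proof (induction k)
    case 0
    then show ?case using hg_monomial[of \<phi> 0] that(3) by simp
  next
    case (Suc k)
    then show ?case using hg_mult[OF that(1) that(2) Suc] by simp
  qed
  have mon: "mvar j ^ k * mvar i ^ (d - k) \<in> (Sp (F d) :: ('v, 'k) mpol set)" if "k \<le> d" for k
  proof -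
    have "hg total_degree (k * 1 + (d - k) * 1) (mvar j ^ k * mvar i ^ (d - k) :: ('v, 'k) mpol)"
      by (intro hg_mult total_degree_add hgp hg_mvar) simp_all
    moreover have "hg (odeg A) (k * 0 + (d - k) * 0) (mvar j ^ k * mvar i ^ (d - k) :: ('v, 'k) mpol)"
      using i j by (intro hg_mult odeg_add hgp hg_odeg_mvar) (simp_all add: odeg_def)
    ultimately show ?thesis using that by (auto simp: Sp_def hg_def F_odeg)
  qed
  have "\<forall>k\<le>d. \<exists>g\<in>Sp (F N). mvar j ^ k * mvar i ^ (d - k) - g * mvar i ^ card (F N) \<in> J"
    using N mon by (simp add: d_def)
  then obtain G where G: "\<And>k. k \<le> d \<Longrightarrow> G k \<in> Sp (F N) \<and> mvar j ^ k * mvar i ^ (d - k) - G k * mvar i ^ card (F N) \<in> J"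
    by metis
  have "\<not> family_indep {..d} G"
  proof
    assume ind: "family_indep {..d} G"
    note ind2 = family_indep_independent[OF finite_atMost ind]
    have "G ` {..d} \<subseteq> Kv.span (monomial ` F N)" using G by (auto simp: span_monomials)
    then have "card (G ` {..d}) \<le> card (monomial ` F N :: ('v, 'k) mpol set)"
      using Kv.independent_span_bound[OF _ ind2(2)] finite_F by blast
    also have "\<dots> \<le> card (F N)" by (rule card_image_le[OF finite_F])
    finally show False using card_image[OF ind2(1)] by (simp add: d_def)
  qed
  then obtain c k0 where c: "(\<Sum>k\<le>d. scl (c k) (G k)) = 0" "k0 \<le> d" "c k0 \<noteq> 0" by (auto simp: family_indep_def)
  define p where "p = Poly (map c [0..<Suc d])"
  have coeff: "Polynomial.coeff p k = (if k \<le> d then c k else 0)" for k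
    by (auto simp: p_def coeff_Poly_eq nth_default_def simp del: upt_Suc)
  have "p \<noteq> 0" using coeff[of k0] c by auto
  moreover have "Polynomial.degree p \<le> d" by (rule degree_le) (simp add: coeff)
  moreover have "binform (mvar i) (mvar j) d p \<in> J"
  proof -
    have "binform (mvar i) (mvar j) d p = (\<Sum>k\<le>d. scl (c k) (mvar j ^ k * mvar i ^ (d - k)))"
      unfolding binform_def by (rule sum.cong) (auto simp: coeff)
    also have "\<dots> = (\<Sum>k\<le>d. scl (c k) (mvar j ^ k * mvar i ^ (d - k) - G k * mvar i ^ card (F N))) + (\<Sum>k\<le>d. scl (c k) (G k)) * mvar i ^ card (F N)"
      by (simp add: Kv.scale_right_diff_distrib sum_subtractf sum_distrib_right scl_mult_left)
    also have "\<dots> = (\<Sum>k\<le>d. scl (c k) (mvar j ^ k * mvar i ^ (d - k) - G k * mvar i ^ card (F N)))"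
      by (simp only: c(1)) simp
    also have "\<dots> \<in> J" using G by (intro rm.subspace_sum idl_scl idlJ) auto
    finally show ?thesis .
  qed
  ultimately show ?thesis by blast
qed

text \<open>A power of \<open>x_j\<close> lies in \<open>J\<close> plus the multiples of
  \<open>x_i\<close>, so a prime over \<open>J\<close> contains all variables of \<open>A\<close> or
  none.\<close>

lemma prime_vars:
  assumes P: "prm P" "J \<subseteq> P" "i \<in> A" "mvar i \<in> P" "j \<in> A"
  shows "mvar j \<in> P"
proof -
  have iP: "idl P" using P(1) by (simp add: prm_def)
  obtain N where "\<forall>d\<ge>N. \<forall>\<nu>\<in>F (Suc d). \<exists>f\<in>Sp (F d). monomial \<nu> - f * mvar i \<in> J"
    using reduce_monomial[OF P(3)] by blast
  moreover have "Poly_Mapping.single j (Suc N) \<in> F (Suc N)"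
    using P(5) by (auto simp: free_mons_def total_degree_single lookup_single when_def)
  ultimately obtain f where "monomial (Poly_Mapping.single j (Suc N)) - f * mvar i \<in> J" by blast
  then have "monomial (Poly_Mapping.single j (Suc N)) - f * mvar i + f * mvar i \<in> P"
    using P(2,4) by (intro rm.subspace_add[OF iP] idl_mult(1)[OF iP]) auto
  then have mP: "monomial (Poly_Mapping.single j (Suc N)) \<in> P" by simp
  have "mvar j ^ k = (monomial (Poly_Mapping.single j k) :: ('v, 'k) mpol)" for k
    by (induction k) (auto simp: mvar_eq_monomial monomial_add[symmetric] single_add[symmetric])
  then have "mvar j ^ Suc N \<in> P" using mP by metis
  then show ?thesis by (rule prm_power[OF P(1)])
qed

text \<open>A dehomogenized binary form of \<open>J\<close> in the variables \<open>i0\<close> and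
  \<open>j\<close>; its roots are the possible ratios of these coordinates where the first does not
  vanish.\<close>

definition bp :: "'v \<Rightarrow> 'k poly" where
  "bp j = (SOME p. p \<noteq> 0 \<and> (\<exists>d. Polynomial.degree p \<le> d \<and> binform (mvar i0) (mvar j) d p \<in> J))"

lemma bp: "j \<in> A \<Longrightarrow> bp j \<noteq> 0 \<and> (\<exists>d. Polynomial.degree (bp j) \<le> d \<and> binform (mvar i0) (mvar j) d (bp j) \<in> J)"
  unfolding bp_def by (rule someI_ex) (use binary_form[OF i0] in blast)

text \<open>A line through the origin in the coordinates of \<open>A\<close> is represented by its
  point with entry 1 at \<open>i0\<close>; zeros outside \<open>A\<close> make the representation
  unique.\<close>

definition normal :: "('v \<Rightarrow> 'k) \<Rightarrow> bool" where
  "normal c \<longleftrightarrow> c i0 = 1 \<and> (\<forall>j. j \<notin> A \<longrightarrow> c j = 0)"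

text \<open>The coordinates in \<open>A\<close> are proportional to \<open>c\<close>, those in
  \<open>E\<close> vanish, the others are free. For \<open>E = {}\<close> this is a candidate for a
  component of dimension \<open>m\<close>; larger \<open>E\<close> supply a chain of primes above
  its ideal.\<close>

definition lin :: "('v \<Rightarrow> 'k) \<Rightarrow> 'v set \<Rightarrow> ('v \<Rightarrow> 'k) set" where
  "lin c E = {a. (\<exists>s. \<forall>j\<in>A. a j = s * c j) \<and> (\<forall>b\<in>E. a b = 0)}"

abbreviation "V c E \<equiv> vanishing (lin c E)"

definition Z0 :: "('v \<Rightarrow> 'k) set" where
  "Z0 = {c. normal c \<and> (\<forall>j\<in>A. poly (bp j) (c j) = 0)}"

definition Zs :: "('v, 'k) mpol set set" where
  "Zs = (\<lambda>c. V c {}) ` Z0"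

lemma finite_Z0: "finite Z0"
proof (rule finite_subset)
  show "Z0 \<subseteq> (\<lambda>f v. if v \<in> A then f v else 0) ` (PiE A (\<lambda>j. {t. poly (bp j) t = 0}))"
  proof
    fix c assume c: "c \<in> Z0"
    then have "c = (\<lambda>v. if v \<in> A then restrict c A v else 0)" by (auto simp: Z0_def normal_def)
    moreover have "restrict c A \<in> PiE A (\<lambda>j. {t. poly (bp j) t = 0})" using c by (simp add: Z0_def)
    ultimately show "c \<in> (\<lambda>f v. if v \<in> A then f v else 0) ` (PiE A (\<lambda>j. {t. poly (bp j) t = 0}))" by (rule image_eqI)
  qed
  show "finite ((\<lambda>f v. if v \<in> A then f v else 0) ` (PiE A (\<lambda>j. {t. poly (bp j) t = 0})))"
    using bp by (intro finite_imageI finite_PiE) (auto intro: poly_roots_finite)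
qed

lemma lin_line: "a \<in> lin c E \<Longrightarrow> b \<in> lin c E \<Longrightarrow> (\<lambda>i. (1 - t) * a i + t * b i) \<in> lin c E"
proof -
  assume "a \<in> lin c E" "b \<in> lin c E"
  then obtain s s' where s: "\<And>j. j \<in> A \<Longrightarrow> a j = s * c j" "\<And>j. j \<in> A \<Longrightarrow> b j = s' * c j" "\<And>j. j \<in> E \<Longrightarrow> a j = 0" "\<And>j. j \<in> E \<Longrightarrow> b j = 0"
    unfolding lin_def by blast
  then have "\<forall>j\<in>A. (1 - t) * a j + t * b j = ((1 - t) * s + t * s') * c j" by (simp add: algebra_simps)
  then show ?thesis using s(3,4) by (auto simp: lin_def)
qed

lemma lin_scale: "a \<in> lin c E \<Longrightarrow> (\<lambda>i. t * a i) \<in> lin c E"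
proof -
  assume "a \<in> lin c E"
  then obtain s where s: "\<And>j. j \<in> A \<Longrightarrow> a j = s * c j" "\<And>j. j \<in> E \<Longrightarrow> a j = 0" by (auto simp: lin_def)
  then have "\<forall>j\<in>A. t * a j = (t * s) * c j" by simp
  then show ?thesis using s(2) by (auto simp: lin_def)
qed

lemma zero_in_lin: "(\<lambda>_. 0) \<in> lin c E"
  by (auto simp: lin_def intro: exI[of _ 0])

lemma prm_V: "prm (V c E)"
  using zero_in_lin lin_line by (intro prm_vanishing) blast+

lemma gr_V: "gr total_degree (V c E)"
  by (intro gr_vanishing lin_scale)

lemma V_i0: "normal c \<Longrightarrow> E \<subseteq> - A \<Longrightarrow> mvar i0 \<notin> V c E"
proof -
  assume c: "normal c" and E: "E \<subseteq> - A"
  have "c \<in> lin c E" using c E by (auto simp: lin_def normal_def intro: exI[of _ 1])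
  moreover have "ev c (mvar i0) \<noteq> 0" using c by (simp add: normal_def)
  ultimately show ?thesis unfolding vanishing_def by blast
qed

lemma V_outside: "b \<in> - A \<Longrightarrow> b \<notin> E \<Longrightarrow> mvar b \<notin> V c E"
proof -
  assume b: "b \<in> - A" "b \<notin> E"
  then have "(\<lambda>i. if i = b then 1 else 0) \<in> lin c E" by (auto simp: lin_def intro!: exI[of _ 0])
  moreover have "ev (\<lambda>i. if i = b then 1 else 0) (mvar b) \<noteq> (0 :: 'k)" by simp
  ultimately show ?thesis unfolding vanishing_def by blast
qed

lemma V_relation: "normal c \<Longrightarrow> j \<in> A \<Longrightarrow> mvar j - scl (c j) (mvar i0) \<in> V c E"
  using i0 by (auto simp: vanishing_def lin_def normal_def ev.subst_diff ev.subst_scl)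

text \<open>Replacing the variables of \<open>A\<close> by multiples of \<open>mvar i0\<close> shows
  that the linear forms generate the vanishing ideal: what remains of its elements vanishes at every
  point and so is 0.\<close>

lemma V_least:
  assumes c: "normal c" and P: "idl P" "\<And>j. j \<in> A \<Longrightarrow> mvar j - scl (c j) (mvar i0) \<in> P"
  shows "V c {} \<subseteq> P"
proof
  fix f assume f: "f \<in> V c {}"
  let ?s = "\<lambda>i. if i \<in> A then scl (c i) (mvar i0) else mvar i"
  have "f - mpol_subst mconst ?s f \<in> P" by (rule subst_cong_ideal) (use P rm.subspace_0 in auto)
  moreover have "mpol_subst mconst ?s f = 0"
  proof (rule zero_if_vanishing)
    fix a
    have "(\<lambda>i. ev a (?s i)) \<in> lin c {}" by (auto simp: lin_def ev.subst_scl intro: exI[of _ "a i0"])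
    then show "ev a (mpol_subst mconst ?s f) = 0" using f by (simp add: ev_subst vanishing_def)
  qed
  ultimately show "f \<in> P" by simp
qed

lemma V_unique:
  assumes "normal c" "normal c'" "idl P" "V c {} \<subseteq> P" "V c' {} \<subseteq> P" "mvar i0 \<notin> P"
  shows "c = c'"
proof
  fix j
  show "c j = c' j"
  proof (cases "j \<in> A")
    case True
    have "mvar j - scl (c j) (mvar i0) \<in> P" "mvar j - scl (c' j) (mvar i0) \<in> P"
      using V_relation[OF assms(1) True] V_relation[OF assms(2) True] assms(4,5) by blast+
    then have "(mvar j - scl (c' j) (mvar i0)) - (mvar j - scl (c j) (mvar i0)) \<in> P" by (rule rm.subspace_diff[OF assms(3), rotated])
    then have d: "scl (c j - c' j) (mvar i0) \<in> P" by (simp add: Kv.scale_left_diff_distrib)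
    show ?thesis
    proof (rule ccontr)
      assume "c j \<noteq> c' j"
      then show False using idl_scl[OF assms(3) d, of "inverse (c j - c' j)"] assms(6) by simp
    qed
  qed (use assms in \<open>simp add: normal_def\<close>)
qed

text \<open>Each binary form has a linear factor in \<open>P\<close>, and together these factors
  single out one of the finitely many candidates.\<close>

lemma prime_point:
  assumes P: "prm P" "J \<subseteq> P" "mvar i0 \<notin> P"
  shows "\<exists>c\<in>Z0. V c {} \<subseteq> P"
proof -
  have iP: "idl P" using P(1) by (simp add: prm_def)
  have "\<exists>t. poly (bp j) t = 0 \<and> mvar j - scl t (mvar i0) \<in> P" if j: "j \<in> A" for j
  proof -
    obtain d where "Polynomial.degree (bp j) \<le> d" "binform (mvar i0) (mvar j) d (bp j) \<in> P" using bp[OF j] P(2) by blast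
    then show ?thesis using bp[OF j] binform_prime[OF P(1,3)] by blast
  qed
  then obtain c where c: "\<And>j. j \<in> A \<Longrightarrow> poly (bp j) (c j) = 0 \<and> mvar j - scl (c j) (mvar i0) \<in> P" by metis
  define c' where "c' j = (if j \<in> A then c j else 0)" for j
  have "c i0 = 1"
  proof (rule ccontr)
    assume ne: "c i0 \<noteq> 1"
    have "scl (1 - c i0) (mvar i0) \<in> P" using c[OF i0] by (simp add: Kv.scale_left_diff_distrib)
    then show False using idl_scl[OF iP, of _ "inverse (1 - c i0)"] ne P(3) by fastforce
  qed
  then have n: "normal c'" using i0 by (simp add: normal_def c'_def)
  moreover have "c' \<in> Z0" using n c by (simp add: Z0_def c'_def)
  moreover have "V c' {} \<subseteq> P" by (rule V_least[OF n iP]) (use c in \<open>simp add: c'_def\<close>)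
  ultimately show ?thesis by blast
qed

lemma V_insert:
  assumes b: "b \<in> - A"
  shows "V c (insert b E) = rm.span (insert (mvar b) (V c E))"
proof
  show "rm.span (insert (mvar b) (V c E)) \<subseteq> V c (insert b E)"
  proof (rule rm.span_minimal[OF _ idl_vanishing])
    have "lin c (insert b E) \<subseteq> lin c E" by (auto simp: lin_def)
    then show "insert (mvar b) (V c E) \<subseteq> V c (insert b E)" by (auto simp: vanishing_def) (auto simp: lin_def)
  qed
  show "V c (insert b E) \<subseteq> rm.span (insert (mvar b) (V c E))"
  proof
    fix f assume f: "f \<in> V c (insert b E)"
    let ?s = "\<lambda>i. if i = b then 0 else mvar i"
    have "f - mpol_subst mconst ?s f \<in> rm.span {mvar b}"
      by (rule subst_cong_ideal) (auto simp: rm.span_base rm.span_zero)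
    then have 1: "f - mpol_subst mconst ?s f \<in> rm.span (insert (mvar b) (V c E))"
      using rm.span_mono[of "{mvar b}" "insert (mvar b) (V c E)"] by auto
    have "ev a (mpol_subst mconst ?s f) = 0" if a: "a \<in> lin c E" for a
    proof -
      have "(\<lambda>i. ev a (?s i)) \<in> lin c (insert b E)" using a b by (auto simp: lin_def)
      then show ?thesis using f by (simp add: ev_subst vanishing_def)
    qed
    then have "mpol_subst mconst ?s f \<in> V c E" by (simp add: vanishing_def)
    then have "mpol_subst mconst ?s f \<in> rm.span (insert (mvar b) (V c E))" by (intro rm.span_base) simp
    from rm.span_add[OF 1 this] show "f \<in> rm.span (insert (mvar b) (V c E))" by simp
  qed
qed

lemma V_insert_i0:
  assumes c: "normal c"
  shows "rm.span (insert (mvar i0) (V c (- A))) = irrelevant"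
proof
  have "idl (irrelevant :: ('v, 'k) mpol set)" by (rule prm_irrelevant[unfolded prm_def, THEN conjunct1])
  then show "rm.span (insert (mvar i0) (V c (- A))) \<subseteq> irrelevant"
  proof (rule rm.span_minimal[rotated])
    have "V c (- A) \<subseteq> irrelevant" using zero_in_lin[of c "- A"] by (auto simp: vanishing_def irrelevant_def ev_0_eq_lookup[symmetric])
    then show "insert (mvar i0) (V c (- A)) \<subseteq> irrelevant" using mvar_in_irrelevant[of i0] by simp
  qed
  show "irrelevant \<subseteq> rm.span (insert (mvar i0) (V c (- A)))"
  proof
    fix f :: "('v, 'k) mpol" assume f: "f \<in> irrelevant"
    let ?s = "\<lambda>i. mvar i - scl (c i) (mvar i0)"
    have "f - mpol_subst mconst ?s f \<in> rm.span {mvar i0}"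
      by (rule subst_cong_ideal) (simp_all add: idl_scl rm.span_base)
    then have 1: "f - mpol_subst mconst ?s f \<in> rm.span (insert (mvar i0) (V c (- A)))"
      using rm.span_mono[of "{mvar i0}" "insert (mvar i0) (V c (- A))"] by auto
    have "ev a (mpol_subst mconst ?s f) = 0" if a: "a \<in> lin c (- A)" for a
    proof -
      obtain s where s: "\<And>j. j \<in> A \<Longrightarrow> a j = s * c j" "\<And>j. j \<in> - A \<Longrightarrow> a j = 0" using a by (auto simp: lin_def)
      have "(\<lambda>i. ev a (?s i)) = (\<lambda>_. 0)"
      proof
        fix i
        show "ev a (?s i) = 0" using s(1)[of i] s(2)[of i] s(1)[OF i0] c
          by (cases "i \<in> A") (auto simp: ev.subst_diff ev.subst_scl normal_def)
      qed
      then show ?thesis using f by (simp add: ev_subst ev_0_eq_lookup irrelevant_def)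
    qed
    then have "mpol_subst mconst ?s f \<in> V c (- A)" by (simp add: vanishing_def)
    then have "mpol_subst mconst ?s f \<in> rm.span (insert (mvar i0) (V c (- A)))" by (intro rm.span_base) simp
    from rm.span_add[OF 1 this] show "f \<in> rm.span (insert (mvar i0) (V c (- A)))" by simp
  qed
qed

text \<open>Cutting by the variables outside \<open>A\<close> and then by \<open>mvar i0\<close>
  ends at the irrelevant ideal. Each is a nonzerodivisor at its stage, so exactly \<open>m\<close>
  factors appear and the candidate has multiplicity 1.\<close>

lemma HS_V: assumes c: "normal c" shows "HS (V c {}) * (1 - fps_X) ^ m = 1"
proof -
  have "HS (V c {}) * (1 - fps_X) ^ card E = HS (V c E)" if "E \<subseteq> - A" for E
    using finite[of E] that
  proof (induction E rule: finite_induct)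
    case (insert b E)
    have "HS (V c E) * (1 - fps_X) = HS (V c (insert b E))"
      using insert HS_insert_mvar[OF gr_V prm_V V_outside[of b E c]] V_insert[of b c E] by auto
    moreover have "HS (V c {}) * (1 - fps_X) ^ card E = HS (V c E)" using insert by auto
    ultimately show ?case using insert.hyps by (simp add: mult.assoc[symmetric] mult.commute[of "1 - fps_X"])
  qed simp
  then have "HS (V c {}) * (1 - fps_X) ^ card (- A) = HS (V c (- A))" by blast
  moreover have "HS (V c (- A)) * (1 - fps_X) = 1"
    using HS_insert_mvar[OF gr_V prm_V V_i0[OF c subset_refl]] V_insert_i0[OF c] HS_irrelevant by simp
  ultimately show ?thesis unfolding m[symmetric] by (simp add: mult.assoc[symmetric] mult.commute[of "1 - fps_X"])
qed

lemma chain_V: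
  assumes c: "normal c"
  shows "\<exists>p. prime_chain (V c {}) m p"
proof -
  have "\<exists>p. prime_chain (V c {}) (card E) p \<and> p (card E) = V c E" if "E \<subseteq> - A" for E
    using finite[of E] that
  proof (induction E rule: finite_induct)
    case empty
    show ?case by (intro exI[of _ "\<lambda>_. V c {}"]) (simp add: prime_chain_def prm_V)
  next
    case (insert b E)
    then obtain p where p: "prime_chain (V c {}) (card E) p" "p (card E) = V c E" by auto
    have "V c E \<subset> V c (insert b E)"
      using V_insert[of b c E] V_outside[of b E c] insert rm.span_superset[of "insert (mvar b) (V c E)"] by auto
    then have "prime_chain (V c {}) (Suc (card E)) (p(Suc (card E) := V c (insert b E)))"
      using p prm_V by (auto simp: prime_chain_def less_Suc_eq le_Suc_eq)
    then show ?case using insert.hyps by (intro exI[of _ "p(Suc (card E) := V c (insert b E))"]) (simp del: fun_upd_apply, simp)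
  qed
  then obtain p where p: "prime_chain (V c {}) (card (- A)) p" "p (card (- A)) = V c (- A)" by blast
  have "V c (- A) \<subset> irrelevant"
    using V_insert_i0[OF c] V_i0[OF c subset_refl] mvar_in_irrelevant[of i0] rm.span_superset[of "insert (mvar i0) (V c (- A))"] by auto
  then have "prime_chain (V c {}) (Suc (card (- A))) (p(Suc (card (- A)) := irrelevant))"
    using p prm_irrelevant by (auto simp: prime_chain_def less_Suc_eq le_Suc_eq)
  then show ?thesis unfolding m by blast
qed

lemma chain_V_bound: "normal c \<Longrightarrow> prime_chain (V c {}) k p \<Longrightarrow> k \<le> m"
  using prime_chain_bound(1)[OF gr_V, of c "{}" m 1 k p] HS_V[of c] by simp

section \<open>The primes over the initial ideal and their contributions\<close>

lemma primary_outside: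
  fixes P :: "('v, 'k) mpol set"
  assumes P: "idl P" "\<And>j. j \<in> A \<Longrightarrow> mvar j \<in> P"
  shows "primary (- A) P"
proof -
  have "irrelevant \<subseteq> rm.span (P \<union> mvar ` (- A))"
  proof (rule irrelevant_subset[OF rm.subspace_span])
    show "mvar i \<in> rm.span (P \<union> mvar ` (- A))" for i
      using P(2)[of i] by (intro rm.span_base) (cases "i \<in> A", auto)
  qed
  moreover have "monomial \<nu> \<in> (irrelevant :: ('v, 'k) mpol set)" if "total_degree \<nu> \<ge> 1" for \<nu>
    using that by (intro monomial_in_irrelevant) auto
  ultimately show ?thesis unfolding primary_def by (intro exI[of _ 1]) blast
qed

text \<open>A prime with \<open>mvar i0\<close> contains all variables of \<open>A\<close> and has
  dimension at most \<open>m - 1\<close>. Any other prime over \<open>J\<close> contains a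
  candidate, and a proper inclusion would give the candidate a chain longer than
  \<open>m\<close>.\<close>

lemma prime_dim:
  assumes P: "prm P" "J \<subseteq> P" and p: "prime_chain P m p"
  shows "P \<in> Zs"
proof (cases "mvar i0 \<in> P")
  case True
  let ?Q = "rm.span (mvar ` A) :: ('v, 'k) mpol set"
  have grQ: "gr total_degree ?Q" using hg_mvar by (intro gr_span total_degree_add) blast
  have "primary (- A) ?Q" by (rule primary_outside) (auto intro: rm.span_base)
  then obtain Q where Q: "HS ?Q * (1 - fps_X) ^ card (- A) = fps_of_poly Q" using hilbert_serre[OF grQ] by blast
  have "?Q \<subseteq> P" using prime_vars[OF P i0 True] P(1) by (intro rm.span_minimal) (auto simp: prm_def)
  then have "prime_chain ?Q m p" using p by (auto simp: prime_chain_def)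
  then have "m \<le> card (- A)" by (rule prime_chain_bound(1)[OF grQ Q])
  then show ?thesis using m by simp
next
  case False
  then obtain c where c: "c \<in> Z0" "V c {} \<subseteq> P" using prime_point[OF P] by blast
  have n: "normal c" using c(1) by (simp add: Z0_def)
  have "V c {} = P"
  proof (rule ccontr)
    assume "V c {} \<noteq> P"
    then have "V c {} \<subset> p 0" using c(2) p by (auto simp: prime_chain_def)
    then have "prime_chain (V c {}) (Suc m) (case_nat (V c {}) p)"
      using p prm_V by (auto simp: prime_chain_def split: nat.split)
    then show False using chain_V_bound[OF n] by force
  qed
  then show ?thesis using c(1) by (auto simp: Zs_def)
qed

text \<open>\<open>P\<close> omits \<open>mvar i0\<close>, hence so does \<open>P'\<close>, which
  then contains a candidate of its own; but two candidates inside \<open>P\<close> coincide.\<close>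

lemma Zs_maximal:
  assumes "P \<in> Zs" "prm P'" "J \<subseteq> P'" "P' \<subseteq> P"
  shows "P' = P"
proof -
  obtain c where c: "c \<in> Z0" "P = V c {}" using assms(1) by (auto simp: Zs_def)
  have n: "normal c" using c(1) by (simp add: Z0_def)
  have i: "mvar i0 \<notin> P" using V_i0[OF n] c(2) by simp
  then obtain c' where c': "c' \<in> Z0" "V c' {} \<subseteq> P'" using prime_point[OF assms(2,3)] assms(4) by blast
  have "normal c'" using c'(1) by (simp add: Z0_def)
  then have "c = c'" using n c c' assms(4) i idl_vanishing by (intro V_unique[of c c' P]) auto
  then show ?thesis using c' c(2) assms(4) by blast
qed

lemma Zs_no_monomial:
  assumes "P \<in> Zs" "J \<subseteq> P"
  shows "monomial \<nu> \<notin> P"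
proof
  assume mP: "monomial \<nu> \<in> P"
  obtain c where c: "c \<in> Z0" "P = V c {}" using assms(1) by (auto simp: Zs_def)
  have n: "normal c" using c(1) by (simp add: Z0_def)
  have p: "prm P" using prm_V c(2) by simp
  have "(\<Prod>v\<in>UNIV. mvar v ^ Poly_Mapping.lookup \<nu> v) \<in> P" using mP by (simp only: monomial_eq_prod)
  then obtain v where "mvar v ^ Poly_Mapping.lookup \<nu> v \<in> P" using prm_prod[OF finite[of UNIV] p] by blast
  then have v: "mvar v \<in> P" by (rule prm_power[OF p])
  show False
  proof (cases "v \<in> A")
    case True
    then show False using prime_vars[OF p assms(2) True v i0] V_i0[OF n] c(2) by auto
  next
    case False
    then show False using v V_outside[of v "{}" c] c(2) by auto
  qed
qed

text \<open>If \<open>mvar i0\<close> lies in \<open>P\<close>, then \<open>m - 1\<close> parameters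
  suffice. For a candidate the series is known. A graded prime strictly above a candidate is
  squeezed between 0 and the candidate enlarged by a form, whose numerator \<open>1 - t^e\<close>
  vanishes at 1.\<close>

lemma associated_prime_multiplicity:
  assumes P: "prm P" "gr total_degree P" "J \<subseteq> P"
  shows "\<exists>q. HS P * (1 - fps_X) ^ m = fps_of_poly q \<and> poly q 1 = (if P \<in> Zs then 1 else 0)"
proof (cases "mvar i0 \<in> P")
  case True
  have "primary (- A) P" using prime_vars[OF P(1,3) i0 True] P(1) by (intro primary_outside) (auto simp: prm_def)
  then obtain Q where Q: "HS P * (1 - fps_X) ^ card (- A) = fps_of_poly Q" using hilbert_serre[OF P(2)] by blast
  have "HS P * (1 - fps_X) ^ m = fps_of_poly (Q * [:1, - 1:])"
    unfolding m[symmetric] fps_of_poly_mult fps_of_poly_one_minus_X Q[symmetric] by (simp add: ac_simps)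
  moreover have "P \<notin> Zs" using True V_i0 by (auto simp: Zs_def Z0_def)
  ultimately show ?thesis by (intro exI[of _ "Q * [:1, - 1:]"]) simp
next
  case False
  then obtain c where c: "c \<in> Z0" "V c {} \<subseteq> P" using prime_point[OF P(1,3)] by blast
  have n: "normal c" using c(1) by (simp add: Z0_def)
  show ?thesis
  proof (cases "V c {} = P")
    case True
    then have "P \<in> Zs" using c(1) by (auto simp: Zs_def)
    then show ?thesis using HS_V[OF n] True by (intro exI[of _ 1]) simp
  next
    case ne: False
    let ?V = "V c {}"
    have "P \<notin> Zs"
    proof
      assume "P \<in> Zs"
      then obtain c' where c': "c' \<in> Z0" "P = V c' {}" by (auto simp: Zs_def)
      then have "c = c'" using n c False idl_vanishing by (intro V_unique[of c c' P]) (auto simp: Z0_def)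
      then show False using ne c' by simp
    qed
    obtain f where "f \<in> P" "f \<notin> ?V" using c(2) ne by blast
    then have "\<exists>e. gcomp total_degree e f \<notin> ?V" using gr_decomp[OF gr_V, of f c "{}"] by metis
    moreover have "gcomp total_degree e f \<in> P" for e using P(2) \<open>f \<in> P\<close> by (simp add: gr_def)
    ultimately obtain e where e: "gcomp total_degree e f \<in> P" "gcomp total_degree e f \<notin> ?V" by metis
    let ?f = "gcomp total_degree e f" and ?W = "rm.span (insert (gcomp total_degree e f) (V c {}))"
    have "HS ?V = HS ?W + fps_X ^ e * HS ?V"
      using HS_insert[OF gr_V hg_comp, of c "{}" e f] colon_prime[OF prm_V e(2)] by simp
    then have "HS ?W = (1 - fps_X ^ e) * HS ?V" by (simp add: algebra_simps)
    then have "HS ?W * (1 - fps_X) ^ m = 1 - fps_X ^ e" using HS_V[OF n] by (simp add: mult.assoc)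
    then have W: "HS ?W * (1 - fps_X) ^ m = fps_of_poly (1 - Polynomial.monom 1 e)"
      by (simp add: fps_of_poly_diff fps_of_poly_monom')
    have "?W \<subseteq> P" using c(2) e(1) P(1) by (intro rm.span_minimal) (auto simp: prm_def)
    then have le: "hf P d \<le> hf ?W d" for d by (rule hf_le)
    have "primary (insert i0 (- A)) P" using primary_mono[OF params[OF i0] P(3)] by blast
    moreover have "card (insert i0 (- A)) = m" using i0 m by simp
    ultimately obtain q where q: "HS P * (1 - fps_X) ^ m = fps_of_poly q" using hilbert_serre[OF P(2)] by metis
    have "0 \<le> poly q 1" using q by (intro numerator_nonneg[of "HS P" m]) simp
    moreover have "0 \<le> poly (1 - Polynomial.monom 1 e - q) 1"
    proof (rule numerator_nonneg[of "HS ?W - HS P" m])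
      show "0 \<le> fps_nth (HS ?W - HS P) d" for d using le[of d] by simp
      show "(HS ?W - HS P) * (1 - fps_X) ^ m = fps_of_poly (1 - Polynomial.monom 1 e - q)"
        using W q by (simp only: left_diff_distrib fps_of_poly_diff)
    qed
    ultimately have "poly q 1 = 0" by (simp add: poly_monom)
    then show ?thesis using q \<open>P \<notin> Zs\<close> by auto
  qed
qed

text \<open>Both sides change alike along the filtration: a factor \<open>S/P\<close> with
  \<open>P\<close> in \<open>Zs\<close> adds 1 to the value at 1 and to the length at
  \<open>P\<close>, and other factors change neither. Candidates that do not contain
  \<open>J\<close> may stay in the sum, as their length is 0.\<close>

theorem multiplicity_count:
  "\<exists>Q. HS J * (1 - fps_X) ^ m = fps_of_poly Q \<and> 0 \<le> poly Q 1 \<and> (\<Sum>P\<in>Zs. sat_length P J) = enat (nat (poly Q 1))"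
proof (rule graded_ideal_induct[OF grJ, where \<Phi> = "\<lambda>K. \<exists>Q. HS K * (1 - fps_X) ^ m = fps_of_poly Q \<and> 0 \<le> poly Q 1 \<and> (\<Sum>P\<in>Zs. sat_length P K) = enat (nat (poly Q 1))"], goal_cases)
  case 1
  have "sat_length P UNIV = 0" if "P \<in> Zs" for P
  proof -
    have "prm P" using that prm_V by (auto simp: Zs_def)
    then have "\<not> UNIV \<subseteq> P" by (auto simp: prm_def)
    then show ?thesis by (intro sat_length_0) simp_all
  qed
  then show ?case by (intro exI[of _ 0]) (simp add: zero_enat_def[symmetric])
next
  case step: (2 J' f e)
  have idl: "idl J'" using step(1) by (rule gr_idl)
  let ?P = "colon J' f" and ?W = "rm.span (insert f J')"
  have JP: "J \<subseteq> ?P" using step(2) colon_superset[OF idl, of f] by blast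
  obtain Q where Q: "HS ?W * (1 - fps_X) ^ m = fps_of_poly Q" "0 \<le> poly Q 1" "(\<Sum>P\<in>Zs. sat_length P ?W) = enat (nat (poly Q 1))"
    using step(8) by blast
  obtain q where q: "HS ?P * (1 - fps_X) ^ m = fps_of_poly q" "poly q 1 = (if ?P \<in> Zs then 1 else 0)"
    using associated_prime_multiplicity[OF step(5,6) JP] by blast
  have "HS J' * (1 - fps_X) ^ m = fps_of_poly (Q + Polynomial.monom 1 e * q)"
    unfolding HS_insert[OF step(1,4)] fps_of_poly_add fps_of_poly_mult Q(1)[symmetric] q(1)[symmetric]
    by (simp add: fps_of_poly_monom' algebra_simps)
  moreover have val: "poly (Q + Polynomial.monom 1 e * q) 1 = poly Q 1 + (if ?P \<in> Zs then 1 else 0)"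
    by (simp add: q(2) poly_monom)
  moreover have "(\<Sum>P\<in>Zs. sat_length P J') = enat (nat (poly Q 1 + (if ?P \<in> Zs then 1 else 0)))"
  proof -
    have "sat_length P J' = sat_length P ?W + (if P = ?P then 1 else 0)" if P: "P \<in> Zs" for P
    proof (cases "P = ?P")
      case True
      then have "sat_length P J' = eSuc (sat_length P ?W)" using step(5) by (intro sat_length_prime idl) auto
      then show ?thesis using True by (simp add: plus_1_eSuc)
    next
      case False
      then have "\<not> ?P \<subseteq> P" using Zs_maximal[OF P step(5) JP] by blast
      then show ?thesis using sat_length_outside[OF idl] False by simp
    qed
    then have "(\<Sum>P\<in>Zs. sat_length P J') = (\<Sum>P\<in>Zs. sat_length P ?W) + (\<Sum>P\<in>Zs. if P = ?P then 1 else 0)"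
      by (simp add: sum.distrib)
    also have "(\<Sum>P\<in>Zs. if P = ?P then 1 else 0 :: enat) = (if ?P \<in> Zs then 1 else 0)"
      using finite_Z0 by (simp add: Zs_def)
    finally show ?thesis using Q(2,3) by (simp add: one_enat_def nat_add_distrib zero_enat_def)
  qed
  ultimately show ?case using Q(2) by (intro exI[of _ "Q + Polynomial.monom 1 e * q"]) simp
qed

end

section \<open>The quotient ring and its localizations\<close>

lemma graded_ideal_iff: "graded_ideal I \<longleftrightarrow> gr total_degree I"
  by (auto simp: graded_ideal_def gr_def ideal_iff_idl hom_component_eq_comp)

lemma primeideal_iff_prm: "primeideal P (mpol_ring :: ('v, 'k::comm_ring_1) mpol ring) \<longleftrightarrow> prm P"
proof
  assume P: "primeideal P (mpol_ring :: ('v, 'k) mpol ring)"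
  then interpret primeideal P "mpol_ring :: ('v, 'k) mpol ring" .
  have i: "idl P" using ideal_iff_idl ideal_axioms by blast
  have "1 \<notin> P"
  proof
    assume 1: "1 \<in> P"
    have "x \<in> P" for x using idl_mult(1)[OF i 1, of x] by simp
    then show False using I_notcarr by auto
  qed
  then show "prm P" using i I_prime by (simp add: prm_def)
next
  assume P: "prm P"
  show "primeideal P (mpol_ring :: ('v, 'k) mpol ring)"
  proof (rule primeidealI)
    show "ideal P mpol_ring" using P by (simp add: ideal_iff_idl prm_def)
    show "carrier mpol_ring \<noteq> P" using P by (auto simp: prm_def)
  qed (use P cring_mpol in \<open>auto simp: prm_def\<close>)
qed

abbreviation qc :: "('v, 'k::comm_ring_1) mpol set \<Rightarrow> ('v, 'k) mpol \<Rightarrow> ('v, 'k) mpol set" where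
  "qc J f \<equiv> J +>\<^bsub>mpol_ring\<^esub> f"

lemma qc_eq_image: "qc J f = (\<lambda>h. h + f) ` J"
  by (auto simp: a_r_coset_def r_coset_def)

context
  fixes J :: "('v, 'k::comm_ring_1) mpol set"
  assumes J: "idl J"
begin

lemma ideal_J: "ideal J mpol_ring"
  using J by (simp add: ideal_iff_idl)

lemma qc_eq: "qc J f = qc J g \<longleftrightarrow> f - g \<in> J"
proof
  assume "qc J f = qc J g"
  moreover have "f \<in> qc J f" unfolding qc_eq_image using rm.subspace_0[OF J] by (intro image_eqI[of _ _ 0]) auto
  ultimately obtain h where "h \<in> J" "f = h + g" by (auto simp: qc_eq_image)
  then show "f - g \<in> J" by simp
next
  assume fg: "f - g \<in> J"
  have "x \<in> qc J g" if x: "x \<in> qc J f" and fg: "f - g \<in> J" for x f g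
  proof -
    obtain h where h: "h \<in> J" "x = h + f" using x by (auto simp: qc_eq_image)
    then have "x = (h + (f - g)) + g" by simp
    moreover have "h + (f - g) \<in> J" using h fg by (intro rm.subspace_add[OF J])
    ultimately show ?thesis unfolding qc_eq_image by blast
  qed
  moreover have "g - f \<in> J" using rm.subspace_neg[OF J fg] by simp
  ultimately show "qc J f = qc J g" using fg by blast
qed

lemma quot_simps:
  "carrier (mpol_ring Quot J) = range (qc J)"
  "qc J f \<otimes>\<^bsub>mpol_ring Quot J\<^esub> qc J g = qc J (f * g)"
  "qc J f \<oplus>\<^bsub>mpol_ring Quot J\<^esub> qc J g = qc J (f + g)"
  "\<one>\<^bsub>mpol_ring Quot J\<^esub> = qc J 1"
  "\<zero>\<^bsub>mpol_ring Quot J\<^esub> = qc J 0"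
proof -
  interpret ideal J "mpol_ring :: ('v, 'k) mpol ring" by (rule ideal_J)
  show "carrier (mpol_ring Quot J) = range (qc J)" by (auto simp: FactRing_def A_RCOSETS_def RCOSETS_def a_r_coset_def)
  show "qc J f \<otimes>\<^bsub>mpol_ring Quot J\<^esub> qc J g = qc J (f * g)"
    using rcoset_mult_add[of f g] by (simp add: FactRing_def)
  show "qc J f \<oplus>\<^bsub>mpol_ring Quot J\<^esub> qc J g = qc J (f + g)"
    using a_rcos_sum[of f g] by (simp add: FactRing_def)
  show "\<one>\<^bsub>mpol_ring Quot J\<^esub> = qc J 1" by (simp add: FactRing_def)
  show "\<zero>\<^bsub>mpol_ring Quot J\<^esub> = qc J 0" by (simp add: FactRing_def qc_eq_image)
qed

lemma cring_quot: "cring (mpol_ring Quot J)"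
  by (rule ideal.quotient_is_cring[OF ideal_J cring_mpol])

lemma prm_vimage:
  assumes "primeideal p (mpol_ring Quot J)"
  shows "prm {f. qc J f \<in> p}" and "J \<subseteq> {f. qc J f \<in> p}"
proof -
  have "primeideal {f \<in> carrier mpol_ring. qc J f \<in> p} mpol_ring"
    by (rule ring_hom_ring.primeideal_vimage[OF ideal.rcos_ring_hom_ring[OF ideal_J] cring_mpol assms])
  then show "prm {f. qc J f \<in> p}" by (simp add: primeideal_iff_prm)
  interpret primeideal p "mpol_ring Quot J" by (rule assms)
  have "qc J 0 \<in> p" using additive_subgroup.zero_closed[OF additive_subgroup_axioms] by (simp add: quot_simps)
  moreover have "qc J f = qc J 0" if "f \<in> J" for f using that by (simp add: qc_eq)
  ultimately show "J \<subseteq> {f. qc J f \<in> p}" by auto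
qed

lemma qc_mem_image: "idl P \<Longrightarrow> J \<subseteq> P \<Longrightarrow> qc J f \<in> qc J ` P \<longleftrightarrow> f \<in> P"
proof
  assume P: "idl P" "J \<subseteq> P" and "qc J f \<in> qc J ` P"
  then obtain g where g: "g \<in> P" "qc J f = qc J g" by blast
  then have "f - g \<in> P" using P(2) qc_eq by blast
  then show "f \<in> P" using rm.subspace_add[OF P(1) _ g(1)] by force
qed blast

lemma primeideal_image:
  assumes P: "prm P" "J \<subseteq> P"
  shows "primeideal (qc J ` P) (mpol_ring Quot J)"
proof (rule primeidealI)
  have iP: "idl P" using P by (simp add: prm_def)
  interpret R: ring "mpol_ring :: ('v, 'k) mpol ring" using cring_mpol by (rule cring.axioms(1))
  show "ideal (qc J ` P) (mpol_ring Quot J)"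
    by (rule R.ring_ideal_imp_quot_ideal[OF ideal_J]) (simp add: ideal_iff_idl iP)
  show "cring (mpol_ring Quot J)" by (rule cring_quot)
  have "qc J 1 \<notin> qc J ` P" using qc_mem_image[OF iP P(2)] P(1) by (simp add: prm_def)
  then show "carrier (mpol_ring Quot J) \<noteq> qc J ` P" by (auto simp: quot_simps)
  fix a b assume "a \<in> carrier (mpol_ring Quot J)" "b \<in> carrier (mpol_ring Quot J)"
    and ab: "a \<otimes>\<^bsub>mpol_ring Quot J\<^esub> b \<in> qc J ` P"
  then obtain f g where fg: "a = qc J f" "b = qc J g" by (auto simp: quot_simps)
  then have "f * g \<in> P" using ab qc_mem_image[OF iP P(2)] by (simp add: quot_simps)
  then show "a \<in> qc J ` P \<or> b \<in> qc J ` P" using P(1) fg by (auto simp: prm_def)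
qed

end

lemma ideal_dim_eq:
  fixes J :: "('v::finite, 'k::field) mpol set"
  assumes J: "idl J"
  shows "ideal_dim J = Sup {enat k | k. \<exists>p. prime_chain J k p}"
proof -
  have "(\<exists>p. (\<forall>i\<le>k. primeideal (p i) (mpol_ring Quot J)) \<and> (\<forall>i<k. p i \<subset> p (Suc i))) \<longleftrightarrow> (\<exists>p. prime_chain J k p)" for k
  proof
    assume "\<exists>p. (\<forall>i\<le>k. primeideal (p i) (mpol_ring Quot J)) \<and> (\<forall>i<k. p i \<subset> p (Suc i))"
    then obtain p where p: "\<And>i. i \<le> k \<Longrightarrow> primeideal (p i) (mpol_ring Quot J)" "\<And>i. i < k \<Longrightarrow> p i \<subset> p (Suc i)" by blast
    have "{f. qc J f \<in> p i} \<subset> {f. qc J f \<in> p (Suc i)}" if i: "i < k" for i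
    proof -
      obtain x where x: "x \<in> p (Suc i)" "x \<notin> p i" using p(2)[OF i] by blast
      interpret primeideal "p (Suc i)" "mpol_ring Quot J" using p(1) i by simp
      have "x \<in> carrier (mpol_ring Quot J)" using x(1) a_subset by blast
      then obtain f where "x = qc J f" by (auto simp: quot_simps[OF J])
      then show ?thesis using x p(2)[OF i] by blast
    qed
    then have "prime_chain J k (\<lambda>i. {f. qc J f \<in> p i})"
      unfolding prime_chain_def using prm_vimage[OF J p(1)] by simp
    then show "\<exists>p. prime_chain J k p" by blast
  next
    assume "\<exists>p. prime_chain J k p"
    then obtain p where p: "prime_chain J k p" by blast
    have sub: "J \<subseteq> p i" if "i \<le> k" for i
      using that
    proof (induction i)
      case 0
      then show ?case using p by (simp add: prime_chain_def)
    next
      case (Suc i)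
      then have "p i \<subset> p (Suc i)" using p by (simp add: prime_chain_def)
      then show ?case using Suc by auto
    qed
    have prm: "prm (p i)" if "i \<le> k" for i using p that by (simp add: prime_chain_def)
    have "qc J ` p i \<subset> qc J ` p (Suc i)" if i: "i < k" for i
    proof -
      have ss: "p i \<subset> p (Suc i)" using p i by (simp add: prime_chain_def)
      then obtain f where f: "f \<in> p (Suc i)" "f \<notin> p i" by blast
      have "qc J f \<notin> qc J ` p i" using qc_mem_image[OF J _ sub, of i f] prm[of i] i f by (simp add: prm_def)
      then show ?thesis using ss f by blast
    qed
    then show "\<exists>p. (\<forall>i\<le>k. primeideal (p i) (mpol_ring Quot J)) \<and> (\<forall>i<k. p i \<subset> p (Suc i))"
      using primeideal_image[OF J prm sub] by (intro exI[of _ "\<lambda>i. qc J ` p i"]) simp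
  qed
  then show ?thesis unfolding ideal_dim_def krull_dim_def by simp
qed

lemma ideal_dim_eqI:
  fixes J :: "('v::finite, 'k::field) mpol set"
  assumes J: "idl J" and "prime_chain J m p" "\<And>k p. prime_chain J k p \<Longrightarrow> k \<le> m"
  shows "ideal_dim J = enat m"
  unfolding ideal_dim_eq[OF J]
proof (rule antisym)
  show "Sup {enat k |k. \<exists>p. prime_chain J k p} \<le> enat m" using assms(3) by (intro Sup_least) auto
  show "enat m \<le> Sup {enat k |k. \<exists>p. prime_chain J k p}" using assms(2) by (intro Sup_upper) auto
qed

text \<open>Chain lengths are bounded by \<open>m\<close>, so the supremum is attained unless there
  is no chain at all; in that case it would be 0, which \<open>m > 0\<close> excludes.\<close>

lemma ideal_dim_eqD:
  fixes J :: "('v::finite, 'k::field) mpol set"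
  assumes J: "idl J" and dim: "ideal_dim J = enat m"
  shows "prime_chain J k p \<Longrightarrow> k \<le> m" and "m > 0 \<Longrightarrow> \<exists>p. prime_chain J m p"
proof -
  let ?S = "{enat k |k. \<exists>p. prime_chain J k p}"
  have sup: "Sup ?S = enat m" using dim by (simp add: ideal_dim_eq[OF J])
  have le: "k \<le> m" if "prime_chain J k p" for k p
  proof -
    have "enat k \<le> Sup ?S" using that by (intro Sup_upper) auto
    then show ?thesis by (simp add: sup)
  qed
  show "prime_chain J k p \<Longrightarrow> k \<le> m" by (rule le)
  assume "m > 0"
  have "finite ?S" by (rule finite_subset[of _ "enat ` {..m}"]) (use le in auto)
  moreover have ne: "?S \<noteq> {}"
  proof
    assume e: "?S = {}"
    show False using sup \<open>m > 0\<close> unfolding e by (simp add: bot_enat_def zero_enat_def)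
  qed
  ultimately have "Max ?S \<in> ?S" by (rule Max_in)
  moreover have "Sup ?S = Max ?S" using \<open>finite ?S\<close> ne unfolding Sup_enat_def by (simp only: if_True if_False)
  ultimately have "Sup ?S \<in> ?S" by simp
  then show "\<exists>p. prime_chain J m p" unfolding sup by auto
qed

section \<open>The Hilbert series of the quotient record\<close>

lemma subfield_mconst: "subfield (range mconst) (mpol_ring :: ('v, 'k::field) mpol ring)"
proof -
  interpret cring "mpol_ring :: ('v, 'k) mpol ring" by (rule cring_mpol)
  have add: "mconst a + mconst b = (mconst (a + b) :: ('v, 'k) mpol)" for a b by (simp add: mconst_def single_add)
  have inv: "\<ominus>\<^bsub>mpol_ring\<^esub> (mconst c :: ('v, 'k) mpol) = mconst (- c)" for c
    by (rule minus_equality) (simp_all add: mconst_def single_add[symmetric])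
  have one: "mconst 1 = (1 :: ('v, 'k) mpol)" by (simp add: mconst_def)
  have inj: "mconst c = (0 :: ('v, 'k) mpol) \<longleftrightarrow> c = 0" for c unfolding mconst_def by (metis lookup_single_eq single_zero)
  show ?thesis
  proof (rule subfieldI)
    show "subcring (range mconst) (mpol_ring :: ('v, 'k) mpol ring)"
    proof (rule subcringI', rule subringI)
      show "\<one>\<^bsub>mpol_ring\<^esub> \<in> (range mconst :: ('v, 'k) mpol set)" unfolding mpol_ring_simps using one by (metis rangeI)
    qed (auto simp: inv add mconst_mult[symmetric])
  next
    have "mconst c \<in> Units ((mpol_ring :: ('v, 'k) mpol ring)\<lparr>carrier := range mconst\<rparr>) \<longleftrightarrow> mconst c \<noteq> (0 :: ('v, 'k) mpol)" for c :: 'k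
    proof
      assume "mconst c \<in> Units ((mpol_ring :: ('v, 'k) mpol ring)\<lparr>carrier := range mconst\<rparr>)"
      then obtain y :: "('v, 'k) mpol" where "y * mconst c = 1" by (auto simp: Units_def)
      then show "mconst c \<noteq> (0 :: ('v, 'k) mpol)" by force
    next
      assume "mconst c \<noteq> (0 :: ('v, 'k) mpol)"
      then have "mconst (inverse c) * mconst c = (1 :: ('v, 'k) mpol)" "mconst c * mconst (inverse c) = (1 :: ('v, 'k) mpol)"
        using one inj[of c] by (metis mconst_mult left_inverse mult.commute)+
      then show "mconst c \<in> Units ((mpol_ring :: ('v, 'k) mpol ring)\<lparr>carrier := range mconst\<rparr>)"
        unfolding Units_def by auto
    qed
    moreover have "Units ((mpol_ring :: ('v, 'k) mpol ring)\<lparr>carrier := range mconst\<rparr>) \<subseteq> range mconst"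
      by (auto simp: Units_def)
    moreover have "(0 :: ('v, 'k) mpol) \<notin> Units (mpol_ring\<lparr>carrier := range mconst\<rparr>)"
      using calculation(1)[of 0] by (simp add: inj[of 0])
    ultimately show "Units ((mpol_ring :: ('v, 'k) mpol ring)\<lparr>carrier := range mconst\<rparr>) = range mconst - {\<zero>\<^bsub>mpol_ring\<^esub>}"
      unfolding mpol_ring_simps by fast
  qed
qed

text \<open>\<open>R.dim\<close> is built on successive line extensions, so a basis \<open>B\<close>
  of a complement of the degree \<open>d\<close> part of \<open>I\<close> is added one vector at a
  time. The constants form a subfield of the quotient because 1 is not in \<open>I\<close>.\<close>

lemma hilbert_series_eq:
  fixes I :: "('v::finite, 'k::field) mpol set"
  assumes I: "idl I" "1 \<notin> I"
  shows "hilbert_series I = HS I"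
proof (rule fps_ext)
  fix d
  let ?R = "mpol_ring Quot I" and ?K = "(\<lambda>c. qc I (mconst c)) ` UNIV"
  interpret R: cring ?R by (rule cring_quot[OF I(1)])
  have "qc I 1 \<noteq> qc I 0" using I by (simp add: qc_eq[OF I(1)])
  then have "subfield (qc I ` range mconst) ?R"
    by (intro ring_hom_ring.img_is_subfield(2)[OF ideal.rcos_ring_hom_ring[OF ideal_J[OF I(1)]] subfield_mconst])
      (simp add: quot_simps[OF I(1)])
  then have K: "subfield ?K ?R" by (simp add: image_image)
  obtain A B where AB: "finite A" "finite B" "A \<inter> B = {}" "Kv.independent (A \<union> B)"
    "Kv.span A = I \<inter> hom_part d" "Kv.span (A \<union> B) = (hom_part d :: ('v, 'k) mpol set)"
    "card A = Kv.dim (I \<inter> hom_part d)" "card A + card B = Kv.dim (hom_part d :: ('v, 'k) mpol set)"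
    by (rule Kv.basis_extension[of "I \<inter> hom_part d" "hom_part d :: ('v, 'k) mpol set" "monomial ` {\<nu>. total_degree \<nu> = d}" "hom_part d"])
      (simp_all add: hom_part_Sp span_monomials Kv.subspace_inter idl_Kv[OF I(1)] finite_total_degree Kv.span_superset)
  have "R.dimension (card C) ?K (qc I ` Kv.span (A \<union> C))" if "C \<subseteq> B" for C
    using finite_subset[OF that AB(2)] that
  proof (induction C rule: finite_induct)
    case empty
    have "qc I ` Kv.span A = {qc I 0}"
    proof -
      have "qc I f = qc I 0" if "f \<in> Kv.span A" for f using that AB(5) by (simp add: qc_eq[OF I(1)])
      then show ?thesis using Kv.span_zero[of A] by blast
    qed
    then show ?case using R.zero_dim[of ?K] by (simp add: quot_simps[OF I(1)])
  next
    case (insert c C)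
    have c: "c \<notin> Kv.span (A \<union> C)"
    proof
      assume "c \<in> Kv.span (A \<union> C)"
      moreover have "A \<union> C \<subseteq> (A \<union> B) - {c}" using insert AB(3) by blast
      ultimately have "c \<in> Kv.span ((A \<union> B) - {c})" using Kv.span_mono by blast
      then show False using AB(4) insert.prems unfolding Kv.dependent_def by blast
    qed
    have hom: "Kv.span (A \<union> C) \<subseteq> hom_part d" using AB(6) insert.prems Kv.span_mono[of "A \<union> C" "A \<union> B"] by blast
    have "c \<in> hom_part d" using AB(6) insert.prems Kv.span_base[of c "A \<union> B"] by auto
    have "qc I c \<notin> qc I ` Kv.span (A \<union> C)"
    proof
      assume "qc I c \<in> qc I ` Kv.span (A \<union> C)"
      then obtain x where x: "x \<in> Kv.span (A \<union> C)" "c - x \<in> I" by (auto simp: qc_eq[OF I(1)])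
      have "c - x \<in> hom_part d"
        using x(1) hom \<open>c \<in> hom_part d\<close> unfolding hom_part_Sp by (intro Kv.subspace_diff[OF subspace_Sp]) auto
      then have "c - x \<in> Kv.span A" using x(2) AB(5) by blast
      then have "c - x \<in> Kv.span (A \<union> C)" using Kv.span_mono[of A "A \<union> C"] by blast
      from Kv.span_add[OF this x(1)] show False using c by simp
    qed
    moreover have "R.line_extension ?K (qc I c) (qc I ` Kv.span (A \<union> C)) = qc I ` Kv.span (A \<union> insert c C)"
    proof -
      have "R.line_extension ?K (qc I c) (qc I ` Kv.span (A \<union> C)) = {qc I (mconst k * c + x) | k x. x \<in> Kv.span (A \<union> C)}"
        unfolding R.line_extension_def set_add_def set_mult_def r_coset_def
        by (auto simp: quot_simps[OF I(1)])
      also have "\<dots> = qc I ` Kv.span (insert c (A \<union> C))"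
      proof (intro equalityI subsetI)
        fix y assume "y \<in> {qc I (mconst k * c + x) | k x. x \<in> Kv.span (A \<union> C)}"
        then obtain k x where kx: "y = qc I (scl k c + x)" "x \<in> Kv.span (A \<union> C)" by (auto simp: scl_def)
        have "scl k c + x - scl k c \<in> Kv.span (A \<union> C)" using kx(2) by simp
        then have "scl k c + x \<in> Kv.span (insert c (A \<union> C))" by (metis Kv.span_breakdown_eq)
        then show "y \<in> qc I ` Kv.span (insert c (A \<union> C))" using kx(1) by blast
      next
        fix y assume "y \<in> qc I ` Kv.span (insert c (A \<union> C))"
        then obtain x where x: "y = qc I x" "x \<in> Kv.span (insert c (A \<union> C))" by blast
        then obtain k where k: "x - scl k c \<in> Kv.span (A \<union> C)" by (metis Kv.span_breakdown_eq)
        have "y = qc I (mconst k * c + (x - scl k c))" using x(1) by (simp add: scl_def)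
        then show "y \<in> {qc I (mconst k * c + x) | k x. x \<in> Kv.span (A \<union> C)}" using k by blast
      qed
      finally show ?thesis by simp
    qed
    moreover have "R.dimension (Suc (card C)) ?K (R.line_extension ?K (qc I c) (qc I ` Kv.span (A \<union> C)))"
      using calculation(1) insert by (intro R.Suc_dim) (auto simp: quot_simps[OF I(1)])
    ultimately show ?case using insert.hyps by simp
  qed
  from this[OF subset_refl] have "R.dim ?K (qc I ` hom_part d) = card B"
    using R.dimI[OF K, of "card B" "qc I ` hom_part d"] AB(6) by (simp add: over_def)
  moreover have "card B = hf I d" using AB(7,8) by (simp add: hf_def)
  ultimately show "fps_nth (hilbert_series I) d = fps_nth (HS I) d" by (simp add: hilbert_series_def)
qed

section \<open>The localized module and its submodules\<close>

context
  fixes J P :: "('v, 'k::comm_ring_1) mpol set"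
  assumes J: "idl J" and P: "prm P"
begin

abbreviation "frm f s \<equiv> fraction mpol_ring (- P) (quotient_module mpol_ring J) (qc J f) s"
abbreviation "frr f s \<equiv> fraction mpol_ring (- P) (self_module mpol_ring) f s"

lemma P_mult: "s \<notin> P \<Longrightarrow> t \<notin> P \<Longrightarrow> s * t \<notin> P"
  using P by (auto simp: prm_def)

lemma one_P: "1 \<notin> P"
  using P by (simp add: prm_def)

lemma quotient_module_simps:
  "carrier (quotient_module mpol_ring J) = range (qc J)"
  "r \<odot>\<^bsub>quotient_module mpol_ring J\<^esub> qc J f = qc J (r * f)"
  "qc J f \<oplus>\<^bsub>quotient_module mpol_ring J\<^esub> qc J g = qc J (f + g)"
  "\<zero>\<^bsub>quotient_module mpol_ring J\<^esub> = qc J 0"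
  by (simp_all add: quotient_module_def quot_simps[OF J])

lemma mem_frm: "(x, s') \<in> frm f s \<longleftrightarrow> s' \<notin> P \<and> (\<exists>g. x = qc J g \<and> (\<exists>u. u \<notin> P \<and> u * (s' * f - s * g) \<in> J))"
proof -
  have "u \<odot>\<^bsub>quotient_module mpol_ring J\<^esub> (s' \<odot>\<^bsub>quotient_module mpol_ring J\<^esub> qc J f) =
      u \<odot>\<^bsub>quotient_module mpol_ring J\<^esub> (s \<odot>\<^bsub>quotient_module mpol_ring J\<^esub> qc J g) \<longleftrightarrow> u * (s' * f - s * g) \<in> J" for u g
    by (simp add: quotient_module_simps(2) qc_eq[OF J] right_diff_distrib)
  then show ?thesis by (auto simp: fraction_def quotient_module_simps(1))
qed

lemma mem_frr: "(r', s') \<in> frr r s \<longleftrightarrow> s' \<notin> P \<and> (\<exists>u. u \<notin> P \<and> u * (s' * r - s * r') = 0)"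
  by (auto simp: fraction_def self_module_def right_diff_distrib)

lemma frac_trans:
  assumes "s \<notin> P" "s' \<notin> P" "s'' \<notin> P" and "u \<notin> P" "u * (s' * f - s * f') \<in> J" and "v \<notin> P" "v * (s'' * f' - s' * f'') \<in> J"
  shows "\<exists>w. w \<notin> P \<and> w * (s'' * f - s * f'') \<in> J"
proof -
  have "(v * s'') * (u * (s' * f - s * f')) + (u * s) * (v * (s'' * f' - s' * f'')) \<in> J"
    by (intro rm.subspace_add[OF J] idl_mult(1)[OF J] assms)
  moreover have "(v * s'') * (u * (s' * f - s * f')) + (u * s) * (v * (s'' * f' - s' * f'')) = (u * v * s') * (s'' * f - s * f'')"
    by (simp add: algebra_simps)
  ultimately show ?thesis using assms P_mult by metis
qed

lemma frac_sym: "u * (s' * f - s * f') \<in> J \<Longrightarrow> u * (s * f' - s' * f) \<in> J"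
  using rm.subspace_neg[OF J, of "u * (s' * f - s * f')"] by (simp add: algebra_simps)

lemma frm_eq:
  assumes s: "s \<notin> P" "s' \<notin> P"
  shows "frm f s = frm f' s' \<longleftrightarrow> (\<exists>u. u \<notin> P \<and> u * (s' * f - s * f') \<in> J)"
proof
  assume "frm f s = frm f' s'"
  moreover have "(qc J f', s') \<in> frm f' s'"
    unfolding mem_frm using s one_P rm.subspace_0[OF J] by (intro conjI exI[of _ f'] exI[of _ 1]) (auto simp: mult.commute)
  ultimately have "(qc J f', s') \<in> frm f s" by simp
  then obtain g u where g: "qc J f' = qc J g" "u \<notin> P" "u * (s' * f - s * g) \<in> J" unfolding mem_frm by blast
  have "u * (s' * f - s * g) - (u * s) * (f' - g) \<in> J"
    using g(1) unfolding qc_eq[OF J] by (intro rm.subspace_diff[OF J g(3)] idl_mult(1)[OF J])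
  then have "u * (s' * f - s * f') \<in> J" by (simp add: algebra_simps)
  then show "\<exists>u. u \<notin> P \<and> u * (s' * f - s * f') \<in> J" using g(2) by blast
next
  assume "\<exists>u. u \<notin> P \<and> u * (s' * f - s * f') \<in> J"
  then obtain u where u: "u \<notin> P" "u * (s' * f - s * f') \<in> J" by blast
  have "x \<in> frm f' s'" if "x \<in> frm f s" "u * (s' * f - s * f') \<in> J" "s \<notin> P" "s' \<notin> P" for x s s' f f'
  proof -
    obtain g t where x: "x = (qc J g, t)" "(qc J g, t) \<in> frm f s" using \<open>x \<in> frm f s\<close> by (cases x) (auto simp: mem_frm)
    then obtain g' v where g': "t \<notin> P" "qc J g = qc J g'" "v \<notin> P" "v * (t * f - s * g') \<in> J" unfolding mem_frm by blast
    have "\<exists>w. w \<notin> P \<and> w * (t * f' - s' * g') \<in> J"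
      by (rule frac_trans[of s' s t u f' f v g']) (use that g' u frac_sym in auto)
    then show ?thesis unfolding x(1) mem_frm using g' by blast
  qed
  then show "frm f s = frm f' s'" using u frac_sym[OF u(2)] s by blast
qed

abbreviation "LM \<equiv> local_module mpol_ring P (quotient_module mpol_ring J)"
abbreviation "LR \<equiv> local_ring mpol_ring P"

text \<open>The operations of the localized records are unions over all representatives; a result
  independent of the representatives lets the union collapse.\<close>

lemma UN_const: "X \<noteq> {} \<Longrightarrow> (\<And>x. x \<in> X \<Longrightarrow> g x = c) \<Longrightarrow> (\<Union>x\<in>X. g x) = c"
  by auto

lemma frm_self: "s \<notin> P \<Longrightarrow> (qc J f, s) \<in> frm f s"
  unfolding mem_frm using one_P rm.subspace_0[OF J] by (intro conjI exI[of _ f] exI[of _ 1]) auto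

lemma frr_self: "s \<notin> P \<Longrightarrow> (f, s) \<in> frr f s"
  unfolding mem_frr using one_P by (intro conjI exI[of _ 1]) auto

lemma LM_simps:
  "carrier LM = {frm f s | f s. s \<notin> P}"
  "\<zero>\<^bsub>LM\<^esub> = frm 0 1"
  "carrier LR = {frr f s | f s. s \<notin> P}"
  by (auto simp: local_module_def local_ring_def quotient_module_simps Let_def Compl_eq_Diff_UNIV[symmetric])

lemma LM_add:
  assumes s: "s \<notin> P" "t \<notin> P"
  shows "frm f s \<oplus>\<^bsub>LM\<^esub> frm g t = frm (t * f + s * g) (s * t)"
proof -
  have "frm f s \<oplus>\<^bsub>LM\<^esub> frm g t = (\<Union>x\<in>frm f s. \<Union>y\<in>frm g t.
     fraction mpol_ring (- P) (quotient_module mpol_ring J) ((snd y \<odot>\<^bsub>quotient_module mpol_ring J\<^esub> fst x)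
      \<oplus>\<^bsub>quotient_module mpol_ring J\<^esub> (snd x \<odot>\<^bsub>quotient_module mpol_ring J\<^esub> fst y)) (snd x * snd y))"
    by (simp add: local_module_def Let_def Compl_eq_Diff_UNIV[symmetric])
  also have "\<dots> = frm (t * f + s * g) (s * t)"
  proof (rule UN_const, use frm_self[OF s(1)] in blast, rule UN_const, use frm_self[OF s(2)] in blast)
    fix x y assume "x \<in> frm f s" "y \<in> frm g t"
    then obtain f' s' g' t' u v where x: "x = (qc J f', s')" "s' \<notin> P" "u \<notin> P" "u * (s' * f - s * f') \<in> J"
      and y: "y = (qc J g', t')" "t' \<notin> P" "v \<notin> P" "v * (t' * g - t * g') \<in> J"
      by (cases x, cases y) (auto simp: mem_frm)
    have "(v * t * t') * (u * (s' * f - s * f')) + (u * s * s') * (v * (t' * g - t * g')) \<in> J"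
      by (intro rm.subspace_add[OF J] idl_mult(1)[OF J] x y)
    then have "(u * v) * ((s' * t') * (t * f + s * g) - (s * t) * (t' * f' + s' * g')) \<in> J" by (simp add: algebra_simps)
    then have "frm (t * f + s * g) (s * t) = frm (t' * f' + s' * g') (s' * t')"
      using x y s P_mult by (subst frm_eq) blast+
    then show "fraction mpol_ring (- P) (quotient_module mpol_ring J) ((snd y \<odot>\<^bsub>quotient_module mpol_ring J\<^esub> fst x)
      \<oplus>\<^bsub>quotient_module mpol_ring J\<^esub> (snd x \<odot>\<^bsub>quotient_module mpol_ring J\<^esub> fst y)) (snd x * snd y) = frm (t * f + s * g) (s * t)"
      by (simp add: x y quotient_module_simps)
  qed
  finally show ?thesis .
qed

lemma LM_smult:
  assumes s: "s \<notin> P" "t \<notin> P"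
  shows "frr r s \<odot>\<^bsub>LM\<^esub> frm f t = frm (r * f) (s * t)"
proof -
  have "frr r s \<odot>\<^bsub>LM\<^esub> frm f t = (\<Union>a\<in>frr r s. \<Union>x\<in>frm f t.
     fraction mpol_ring (- P) (quotient_module mpol_ring J) (fst a \<odot>\<^bsub>quotient_module mpol_ring J\<^esub> fst x) (snd a * snd x))"
    by (simp add: local_module_def Let_def Compl_eq_Diff_UNIV[symmetric])
  also have "\<dots> = frm (r * f) (s * t)"
  proof (rule UN_const, use frr_self[OF s(1)] in blast, rule UN_const, use frm_self[OF s(2)] in blast)
    fix a x assume "a \<in> frr r s" "x \<in> frm f t"
    then obtain r' s' f' t' u v where a: "a = (r', s')" "s' \<notin> P" "u \<notin> P" "u * (s' * r - s * r') = 0"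
      and x: "x = (qc J f', t')" "t' \<notin> P" "v \<notin> P" "v * (t' * f - t * f') \<in> J"
      by (cases a, cases x) (auto simp: mem_frm mem_frr)
    have "(u * (s' * r - s * r')) * (v * t' * f) + (u * s * r') * (v * (t' * f - t * f')) \<in> J"
      unfolding a(4) using idl_mult(1)[OF J x(4)] by simp
    then have "(u * v) * ((s' * t') * (r * f) - (s * t) * (r' * f')) \<in> J" by (simp add: algebra_simps)
    then have "frm (r * f) (s * t) = frm (r' * f') (s' * t')"
      using x a s P_mult by (subst frm_eq) blast+
    then show "fraction mpol_ring (- P) (quotient_module mpol_ring J) (fst a \<odot>\<^bsub>quotient_module mpol_ring J\<^esub> fst x) (snd a * snd x) = frm (r * f) (s * t)"
      by (simp add: x a quotient_module_simps)
  qed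
  finally show ?thesis .
qed

lemma LM_neg:
  assumes s: "s \<notin> P"
  shows "inv\<^bsub>add_monoid LM\<^esub> (frm f s) = frm (- f) s"
  unfolding m_inv_def
proof (rule the_equality)
  have "frm f s \<oplus>\<^bsub>LM\<^esub> frm (- f) s = frm 0 1" "frm (- f) s \<oplus>\<^bsub>LM\<^esub> frm f s = frm 0 1"
    using s P_mult one_P rm.subspace_0[OF J] by (auto simp: LM_add frm_eq)
  then show "frm (- f) s \<in> carrier (add_monoid LM) \<and> frm f s \<otimes>\<^bsub>add_monoid LM\<^esub> frm (- f) s = \<one>\<^bsub>add_monoid LM\<^esub> \<and>
    frm (- f) s \<otimes>\<^bsub>add_monoid LM\<^esub> frm f s = \<one>\<^bsub>add_monoid LM\<^esub>" using s by (auto simp: LM_simps)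
  fix y assume "y \<in> carrier (add_monoid LM) \<and> frm f s \<otimes>\<^bsub>add_monoid LM\<^esub> y = \<one>\<^bsub>add_monoid LM\<^esub> \<and> y \<otimes>\<^bsub>add_monoid LM\<^esub> frm f s = \<one>\<^bsub>add_monoid LM\<^esub>"
  then obtain g t where y: "y = frm g t" "t \<notin> P" "frm f s \<oplus>\<^bsub>LM\<^esub> frm g t = frm 0 1" by (auto simp: LM_simps)
  then obtain u where "u \<notin> P" "u * (t * f + s * g) \<in> J"
    using s P_mult one_P by (auto simp: LM_add frm_eq)
  then show "y = frm (- f) s" using s y(2) unfolding y(1) by (subst frm_eq) (auto simp: algebra_simps)
qed

text \<open>Elements outside \<open>P\<close> act invertibly on fractions, so a submodule is
  determined by its members with denominator 1, and their numerators form a saturated ideal.\<close>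

lemma submodule_saturated:
  assumes N: "submodule N LR LM"
  shows "saturated P {f. frm f 1 \<in> N}" and "J \<subseteq> {f. frm f 1 \<in> N}" and "s \<notin> P \<Longrightarrow> frm f s \<in> N \<longleftrightarrow> frm f 1 \<in> N"
proof -
  interpret submodule N LR LM by (rule N)
  have sm: "frm (r * f) (s * t) \<in> N" if "frm f t \<in> N" "s \<notin> P" "t \<notin> P" for r f s t
    using smult_closed[of "frr r s" "frm f t"] that by (auto simp: LM_simps LM_smult)
  have eq: "frm (s * f) s = frm f 1" if "s \<notin> P" for f s
    using that one_P rm.subspace_0[OF J] by (subst frm_eq) (auto intro!: exI[of _ 1])
  show f1: "frm f s \<in> N \<longleftrightarrow> frm f 1 \<in> N" if s: "s \<notin> P" for f s
    using sm[of f s 1 s] sm[of f 1 s 1] s one_P eq[OF s] by auto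
  have zero: "frm 0 1 \<in> N" using one_closed by (simp add: LM_simps)
  show "J \<subseteq> {f. frm f 1 \<in> N}"
  proof clarify
    fix f assume "f \<in> J"
    then have "frm f 1 = frm 0 1" using one_P by (subst frm_eq) (auto intro!: exI[of _ 1])
    then show "frm f 1 \<in> N" using zero by simp
  qed
  show "saturated P {f. frm f 1 \<in> N}"
    unfolding saturated_def
  proof (intro conjI allI impI rm.subspaceI; clarify?)
    show "frm 0 1 \<in> N" by (rule zero)
    fix f g assume "frm f 1 \<in> N" "frm g 1 \<in> N"
    then show "frm (f + g) 1 \<in> N" using m_closed[of "frm f 1" "frm g 1"] one_P by (simp add: LM_add)
  next
    fix c f assume "frm f 1 \<in> N"
    then show "frm (c * f) 1 \<in> N" using sm[of f 1 1 c] one_P by simp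
  next
    fix u f assume u: "u \<notin> P" "frm (u * f) 1 \<in> N"
    then show "frm f 1 \<in> N" using f1[OF u(1), of "u * f"] eq[OF u(1), of f] by simp
  qed
qed

lemma saturated_mem:
  assumes K: "saturated P K" "J \<subseteq> K" and s: "s \<notin> P"
  shows "frm f s \<in> {frm f s | f s. f \<in> K \<and> s \<notin> P} \<longleftrightarrow> f \<in> K"
proof
  have iK: "idl K" using K(1) by (simp add: saturated_def)
  assume "frm f s \<in> {frm f s | f s. f \<in> K \<and> s \<notin> P}"
  then obtain f' s' where f': "f' \<in> K" "s' \<notin> P" "frm f s = frm f' s'" by blast
  then obtain u where u: "u \<notin> P" "u * (s' * f - s * f') \<in> J" using frm_eq[OF s f'(2)] by blast
  have "u * (s' * f - s * f') + (u * s) * f' \<in> K" using u(2) K(2) f'(1) by (intro rm.subspace_add[OF iK] idl_mult(1)[OF iK, of f']) auto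
  then have "(u * s') * f \<in> K" by (simp add: algebra_simps)
  then show "f \<in> K" using K(1) P_mult[OF u(1) f'(2)] unfolding saturated_def by blast
qed (use s in blast)

lemma saturated_submodule:
  assumes K: "saturated P K" "J \<subseteq> K"
  shows "submodule {frm f s | f s. f \<in> K \<and> s \<notin> P} LR LM"
proof -
  have iK: "idl K" using K(1) by (simp add: saturated_def)
  show ?thesis
  proof (intro submodule.intro subgroup.intro submodule_axioms.intro)
    fix x y assume "x \<in> {frm f s | f s. f \<in> K \<and> s \<notin> P}" "y \<in> {frm f s | f s. f \<in> K \<and> s \<notin> P}"
    then obtain f s g t where fg: "x = frm f s" "y = frm g t" "f \<in> K" "g \<in> K" "s \<notin> P" "t \<notin> P" by blast
    have "x \<otimes>\<^bsub>add_monoid LM\<^esub> y = frm (t * f + s * g) (s * t)" using fg by (simp add: LM_add)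
    moreover have "t * f + s * g \<in> K" using fg by (intro rm.subspace_add[OF iK] idl_mult(1)[OF iK])
    ultimately show "x \<otimes>\<^bsub>add_monoid LM\<^esub> y \<in> {frm f s | f s. f \<in> K \<and> s \<notin> P}" using P_mult[OF fg(5,6)] by blast
  next
    show "{frm f s | f s. f \<in> K \<and> s \<notin> P} \<subseteq> carrier (add_monoid LM)" by (auto simp: LM_simps)
    show "\<one>\<^bsub>add_monoid LM\<^esub> \<in> {frm f s | f s. f \<in> K \<and> s \<notin> P}"
      using one_P rm.subspace_0[OF iK] by (auto simp: LM_simps)
  next
    fix x assume "x \<in> {frm f s | f s. f \<in> K \<and> s \<notin> P}"
    then obtain f s where f: "x = frm f s" "f \<in> K" "s \<notin> P" by blast
    then show "inv\<^bsub>add_monoid LM\<^esub> x \<in> {frm f s | f s. f \<in> K \<and> s \<notin> P}"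
      using LM_neg[OF f(3), of f] rm.subspace_neg[OF iK f(2)] by blast
  next
    fix a x assume "a \<in> carrier LR" "x \<in> {frm f s | f s. f \<in> K \<and> s \<notin> P}"
    then obtain r t f s where f: "a = frr r t" "t \<notin> P" "x = frm f s" "f \<in> K" "s \<notin> P" by (auto simp: LM_simps)
    then have "a \<odot>\<^bsub>LM\<^esub> x = frm (r * f) (t * s)" by (simp add: LM_smult)
    then show "a \<odot>\<^bsub>LM\<^esub> x \<in> {frm f s | f s. f \<in> K \<and> s \<notin> P}"
      using idl_mult(1)[OF iK f(4), of r] P_mult[OF f(2,5)] by blast
  qed
qed

text \<open>Taking numerators of submodules and taking fractions of saturated ideals both preserve
  strict inclusions, so the same chain lengths occur.\<close>

lemma module_length_eq: "module_length LR LM = sat_length P J"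
proof -
  have "(\<exists>N. (\<forall>i\<le>k. submodule (N i) LR LM) \<and> (\<forall>i<k. N i \<subset> N (Suc i))) \<longleftrightarrow> (\<exists>K. sat_chain P J k K)" for k
  proof
    assume "\<exists>N. (\<forall>i\<le>k. submodule (N i) LR LM) \<and> (\<forall>i<k. N i \<subset> N (Suc i))"
    then obtain N where N: "\<And>i. i \<le> k \<Longrightarrow> submodule (N i) LR LM" "\<And>i. i < k \<Longrightarrow> N i \<subset> N (Suc i)" by blast
    have "{f. frm f 1 \<in> N i} \<subset> {f. frm f 1 \<in> N (Suc i)}" if i: "i < k" for i
    proof -
      obtain x where x: "x \<in> N (Suc i)" "x \<notin> N i" using N(2)[OF i] by blast
      interpret submodule "N (Suc i)" LR LM using N(1) i by simp
      have "x \<in> carrier (add_monoid LM)" using x(1) subset by blast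
      then obtain f s where f: "x = frm f s" "s \<notin> P" by (auto simp: LM_simps)
      then have "frm f 1 \<in> N (Suc i)" "frm f 1 \<notin> N i"
        using submodule_saturated(3)[OF N(1) f(2)] x i by auto
      then show ?thesis using N(2)[OF i] by blast
    qed
    then have "sat_chain P J k (\<lambda>i. {f. frm f 1 \<in> N i})"
      unfolding sat_chain_def using submodule_saturated(1,2)[OF N(1)] by simp
    then show "\<exists>K. sat_chain P J k K" by blast
  next
    assume "\<exists>K. sat_chain P J k K"
    then obtain K where K: "\<And>i. i \<le> k \<Longrightarrow> saturated P (K i)" "\<And>i. i \<le> k \<Longrightarrow> J \<subseteq> K i" "\<And>i. i < k \<Longrightarrow> K i \<subset> K (Suc i)"
      unfolding sat_chain_def by blast
    let ?N = "\<lambda>i. {frm f s | f s. f \<in> K i \<and> s \<notin> P}"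
    have "?N i \<subset> ?N (Suc i)" if i: "i < k" for i
    proof -
      obtain f where f: "f \<in> K (Suc i)" "f \<notin> K i" using K(3)[OF i] by blast
      have "frm f 1 \<in> ?N (Suc i)" using f(1) one_P by blast
      moreover have "frm f 1 \<notin> ?N i" using saturated_mem[OF K(1,2) one_P, of i f] f(2) i by simp
      moreover have "?N i \<subseteq> ?N (Suc i)" using K(3)[OF i] by blast
      ultimately show ?thesis by blast
    qed
    then show "\<exists>N. (\<forall>i\<le>k. submodule (N i) LR LM) \<and> (\<forall>i<k. N i \<subset> N (Suc i))"
      using saturated_submodule[OF K(1,2)] by (intro exI[of _ ?N]) simp
  qed
  then show ?thesis unfolding module_length_def sat_length_def by simp
qed

end

section \<open>Maximal cones of the generic tropical variety\<close>

definition argm :: "real ^ 'n \<Rightarrow> 'n set" where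
  "argm w = {i. \<forall>j. w $ i \<le> w $ j}"

lemma argm_nonempty: "argm (w :: real ^ 'n::finite) \<noteq> {}"
proof -
  have "Min (range (($) w)) \<in> range (($) w)" by (intro Min_in) auto
  then obtain i where i: "Min (range (($) w)) = w $ i" by (elim imageE)
  have "w $ i \<le> w $ j" for j unfolding i[symmetric] by (rule Min_le) auto
  then have "i \<in> argm w" by (simp add: argm_def)
  then show ?thesis by blast
qed

lemma argm_eq: "i \<in> argm w \<Longrightarrow> j \<in> argm w \<longleftrightarrow> w $ j = w $ i"
  by (auto simp: argm_def intro: antisym)

text \<open>The excess over the bound is a sum of nonnegative terms, one for each variable; it
  vanishes just for the monomials in the variables where \<open>w\<close> is minimal.\<close>

lemma weight_argm:
  assumes i: "i \<in> argm w"
  shows "w $ i * real (total_degree \<nu>) \<le> weight w \<nu>" and "weight w \<nu> = w $ i * real (total_degree \<nu>) \<longleftrightarrow> odeg (argm w) \<nu> = 0"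
proof -
  have eq: "weight w \<nu> - w $ i * real (total_degree \<nu>) = (\<Sum>j\<in>UNIV. (w $ j - w $ i) * real (Poly_Mapping.lookup \<nu> j))"
    by (simp add: weight_def total_degree_def sum_distrib_left sum_subtractf left_diff_distrib)
  have nn: "0 \<le> (w $ j - w $ i) * real (Poly_Mapping.lookup \<nu> j)" for j
    using i by (simp add: argm_def)
  show "w $ i * real (total_degree \<nu>) \<le> weight w \<nu>"
    using sum_nonneg[of UNIV "\<lambda>j. (w $ j - w $ i) * real (Poly_Mapping.lookup \<nu> j)"] nn eq by simp
  have "weight w \<nu> = w $ i * real (total_degree \<nu>) \<longleftrightarrow> (\<forall>j. (w $ j - w $ i) * real (Poly_Mapping.lookup \<nu> j) = 0)"
    using sum_nonneg_eq_0_iff[of UNIV "\<lambda>j. (w $ j - w $ i) * real (Poly_Mapping.lookup \<nu> j)"] nn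
    unfolding eq[symmetric] by simp
  also have "\<dots> \<longleftrightarrow> odeg (argm w) \<nu> = 0"
    by (auto simp: odeg_eq_0 argm_eq[OF i] Ball_def)
  finally show "weight w \<nu> = w $ i * real (total_degree \<nu>) \<longleftrightarrow> odeg (argm w) \<nu> = 0" .
qed

text \<open>Among the terms of its degree \<open>\<nu>\<close> has the least weight. The initial
  form of the part in \<open>J\<close> is therefore \<open>\<nu>\<close> minus the lowest terms of
  the remainder, each of which still involves a variable of \<open>D\<close>.\<close>

lemma in_weight_relation:
  fixes J :: "('n::finite, 'k::field) mpol set"
  assumes J: "gr total_degree J" and \<nu>: "monomial \<nu> \<in> rm.span (J \<union> mvar ` D)"
    "\<forall>j\<in>D. Poly_Mapping.lookup \<nu> j = 0" "odeg (argm w) \<nu> = 0"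
  shows "\<exists>h. monomial \<nu> - h \<in> rm.span (in_weight w ` J) \<and>
    (\<forall>\<mu>\<in>Poly_Mapping.keys h. odeg (argm w) \<mu> = 0 \<and> (\<exists>j\<in>D. Poly_Mapping.lookup \<mu> j > 0))"
proof -
  obtain i where i: "i \<in> argm w" using argm_nonempty[of w] by blast
  let ?d = "total_degree \<nu>" and ?v = "w $ i * real (total_degree \<nu>)"
  have "monomial \<nu> \<in> {x + y | x y. x \<in> rm.span J \<and> y \<in> rm.span (mvar ` D)}"
    using \<nu>(1) by (simp only: rm.span_Un)
  then obtain f h where fh: "monomial \<nu> = f + h" "f \<in> J" "h \<in> rm.span (mvar ` D)"
    using rm.span_eq_iff[THEN iffD2, OF gr_idl[OF J]] by auto
  define f' where "f' = gcomp total_degree ?d f"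
  define h' where "h' = gcomp (weight w) ?v (gcomp total_degree ?d h)"
  have f': "f' \<in> J" using J fh(2) by (simp add: gr_def f'_def)
  have "lowest w ?v f'"
    unfolding lowest_def
  proof
    fix \<mu> assume "\<mu> \<in> Poly_Mapping.keys f'"
    then show "?v \<le> weight w \<mu>" using weight_argm(1)[OF i, of \<mu>] by (simp add: f'_def keys_comp)
  qed
  have keys: "Poly_Mapping.keys h' \<subseteq> {\<mu>. odeg (argm w) \<mu> = 0 \<and> (\<exists>j\<in>D. Poly_Mapping.lookup \<mu> j > 0)}"
    unfolding h'_def keys_comp using fh(3)[unfolded span_mvars_iff] by (auto simp: weight_argm(2)[OF i, symmetric])
  have m1: "gcomp total_degree ?d (monomial \<nu> :: ('n, 'k) mpol) = monomial \<nu>"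
    by (simp add: comp_hg[OF hg_monomial])
  have m2: "gcomp (weight w) ?v (monomial \<nu> :: ('n, 'k) mpol) = monomial \<nu>"
    using weight_argm(2)[OF i, of \<nu>] \<nu>(3) by (simp add: comp_hg[OF hg_monomial])
  have "f = monomial \<nu> - h" using fh(1) by simp
  then have g: "gcomp (weight w) ?v f' = monomial \<nu> - h'" unfolding f'_def h'_def by (simp only: comp_diff m1 m2)
  have "\<nu> \<notin> Poly_Mapping.keys h'" using keys \<nu>(2) by auto
  then have "Poly_Mapping.lookup (monomial \<nu> - h') \<nu> = 1" by (simp add: lookup_minus monomial_def in_keys_iff)
  then have "gcomp (weight w) ?v f' \<noteq> 0" unfolding g by (metis lookup_zero zero_neq_one)
  then have "in_weight w f' = monomial \<nu> - h'" using in_weight_lowest[OF \<open>lowest w ?v f'\<close>] g by simp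
  then have "monomial \<nu> - h' \<in> rm.span (in_weight w ` J)" using f' by (metis imageI rm.span_base)
  then show ?thesis using keys by blast
qed

lemma argm_perturb:
  assumes B: "- argm w \<subseteq> B" "B \<noteq> UNIV" and e: "e > 0"
  shows "argm (w + e *\<^sub>R (\<chi> i. if i \<in> B then 1 else 0)) = - B"
proof -
  obtain i where i: "i \<notin> B" using B(2) by blast
  have A: "j \<in> argm w" if "j \<notin> B" for j using B(1) that by blast
  have wi: "w $ i \<le> w $ j" for j using A[OF i] by (simp add: argm_def)
  have wj: "w $ j = w $ i" if "j \<notin> B" for j using argm_eq[OF A[OF i]] A[OF that] by blast
  show ?thesis
  proof (intro equalityI subsetI)
    fix j assume "j \<in> argm (w + e *\<^sub>R (\<chi> i. if i \<in> B then 1 else 0))"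
    then have "(w + e *\<^sub>R (\<chi> i. if i \<in> B then 1 else 0)) $ j \<le> (w + e *\<^sub>R (\<chi> i. if i \<in> B then 1 else 0)) $ i"
      unfolding argm_def by blast
    then show "j \<in> - B" using i e wi[of j] by (auto split: if_splits)
  next
    fix j assume "j \<in> - B"
    then have j: "j \<notin> B" by simp
    have "(w + e *\<^sub>R (\<chi> i. if i \<in> B then 1 else 0)) $ j \<le> (w + e *\<^sub>R (\<chi> i. if i \<in> B then 1 else 0)) $ l" for l
      using j wj[OF j] wi[of l] e by simp
    then show "j \<in> argm (w + e *\<^sub>R (\<chi> i. if i \<in> B then 1 else 0))" by (simp add: argm_def)
  qed
qed

lemma in_weight_monomial: "in_weight w (monomial \<nu> :: ('n::finite, 'k::field) mpol) = monomial \<nu>"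
proof -
  have "gcomp (weight w) (weight w \<nu>) (monomial \<nu> :: ('n, 'k) mpol) = monomial \<nu>"
    by (simp add: comp_hg[OF hg_monomial])
  moreover have "(monomial \<nu> :: ('n, 'k) mpol) \<noteq> 0" by (simp add: monomial_def) (metis lookup_single_eq lookup_zero zero_neq_one)
  ultimately show ?thesis
    using in_weight_lowest[of w "weight w \<nu>" "monomial \<nu> :: ('n, 'k) mpol"] by (simp add: lowest_def monomial_def)
qed

locale generic_ideal =
  fixes J :: "('n::finite, 'k::{alg_closed_field, field_char_0}) mpol set" and m :: nat and Q :: "int poly"
  assumes grJ: "gr total_degree J" and m0: "m > 0" and mn: "m \<le> CARD('n)"
    and params: "\<And>D. card D = m \<Longrightarrow> primary D J"
    and Q: "HS J * (1 - fps_X) ^ m = fps_of_poly Q" "poly Q 1 \<noteq> 0"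
begin

abbreviation "inJ' w \<equiv> rm.span (in_weight w ` J)"

text \<open>Take \<open>m\<close> non-minimal coordinates as \<open>D\<close>. Modulo the initial
  ideal a power of a minimal variable equals a polynomial whose terms would both avoid and involve
  \<open>D\<close>; so there are none, and the power lies in the initial ideal.\<close>

lemma card_argm_if_tropical:
  assumes w: "w \<in> tropical_variety J"
  shows "card (- argm w) < m"
proof (rule ccontr)
  assume "\<not> card (- argm w) < m"
  then obtain D where D: "D \<subseteq> - argm w" "card D = m" using obtain_subset_with_card_n[of m "- argm w"] by (metis not_less)
  obtain i where i: "i \<in> argm w" using argm_nonempty[of w] by blast
  obtain N where "\<And>\<nu>. total_degree \<nu> \<ge> N \<Longrightarrow> monomial \<nu> \<in> rm.span (J \<union> mvar ` D)"
    using params[OF D(2)] unfolding primary_def by blast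
  then have "monomial (Poly_Mapping.single i N) \<in> rm.span (J \<union> mvar ` D)" by (simp add: total_degree_single)
  then obtain h where h: "monomial (Poly_Mapping.single i N) - h \<in> inJ' w"
    "\<forall>\<mu>\<in>Poly_Mapping.keys h. odeg (argm w) \<mu> = 0 \<and> (\<exists>j\<in>D. Poly_Mapping.lookup \<mu> j > 0)"
  proof -
    have "\<forall>j\<in>D. Poly_Mapping.lookup (Poly_Mapping.single i N) j = 0" "odeg (argm w) (Poly_Mapping.single i N) = 0"
      using D(1) i by (auto simp: odeg_eq_0 lookup_single when_def)
    then show ?thesis using in_weight_relation[OF grJ \<open>monomial (Poly_Mapping.single i N) \<in> _\<close>] that by metis
  qed
  have "Poly_Mapping.keys h = {}" using h(2) D(1) unfolding odeg_eq_0 by fastforce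
  then have "monomial (Poly_Mapping.single i N) \<in> inJ' w" using h(1) by simp
  then show False using w by (auto simp: tropical_variety_def contains_monomial_def in_weight_ideal_eq)
qed

lemma HS_in: "HS (inJ' w) = HS J"
  by (rule fps_ext) (simp add: hf_in[OF grJ])

text \<open>Within one degree, being free of the variables outside \<open>argm w\<close> means
  having the least weight, so this part is a weight component and stays in the initial ideal. The
  parameters are carried over by \<open>in_weight_relation\<close>.\<close>

lemma initial_setup_in:
  assumes w: "Suc (card (- argm w)) = m" and i0: "i0 \<in> argm w"
  shows "initial_setup (inJ' w) (argm w) i0 m"
proof
  show gr: "gr total_degree (inJ' w)" by (rule gr_degree_in[OF grJ])
  show "i0 \<in> argm w" "Suc (card (- argm w)) = m" by (rule i0, rule w)
  fix h assume h: "h \<in> inJ' w"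
  have "gcomp total_degree d (gcomp (odeg (argm w)) 0 h) \<in> inJ' w" for d
  proof -
    have "gcomp total_degree d (gcomp (odeg (argm w)) 0 h) = gcomp (weight w) (w $ i0 * real d) (gcomp total_degree d h)"
      using weight_argm(2)[OF i0] by (intro poly_mapping_eqI) (auto simp: lookup_comp)
    then show ?thesis using h gr gr_weight_in[OF grJ, of w] by (simp add: gr_def)
  qed
  then show "gcomp (odeg (argm w)) 0 h \<in> inJ' w" using gr_decomp[OF gr, of "gcomp (odeg (argm w)) 0 h"] by blast
next
  fix i assume i: "i \<in> argm w"
  let ?D = "insert i (- argm w)"
  have "card ?D = m" using i w by simp
  then obtain N where N: "\<And>\<nu>. total_degree \<nu> \<ge> N \<Longrightarrow> monomial \<nu> \<in> rm.span (J \<union> mvar ` ?D)"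
    using params unfolding primary_def by blast
  have sub: "rm.span (mvar ` ?D) \<subseteq> rm.span (inJ' w \<union> mvar ` ?D)" by (rule rm.span_mono) blast
  have "monomial \<nu> \<in> rm.span (inJ' w \<union> mvar ` ?D)" if \<nu>: "total_degree \<nu> \<ge> N" for \<nu>
  proof (cases "\<forall>j\<in>?D. Poly_Mapping.lookup \<nu> j = 0")
    case True
    then have "odeg (argm w) \<nu> = 0" by (simp add: odeg_eq_0)
    then obtain h where h: "monomial \<nu> - h \<in> inJ' w"
      "\<forall>\<mu>\<in>Poly_Mapping.keys h. \<exists>j\<in>?D. Poly_Mapping.lookup \<mu> j > 0"
      using in_weight_relation[OF grJ N[OF \<nu>] True] by metis
    have "h \<in> rm.span (inJ' w \<union> mvar ` ?D)" using h(2) sub unfolding span_mvars_iff[symmetric] by blast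
    moreover have "monomial \<nu> - h \<in> rm.span (inJ' w \<union> mvar ` ?D)" using h(1) by (intro rm.span_base) blast
    ultimately show ?thesis using rm.span_add by fastforce
  next
    case False
    then have "monomial \<nu> \<in> (rm.span (mvar ` ?D) :: ('n, 'k) mpol set)"
      unfolding span_mvars_iff by (auto simp: monomial_def)
    then show ?thesis using sub by blast
  qed
  then show "primary ?D (inJ' w)" unfolding primary_def by blast
qed

lemma initial_ideal_multiplicity:
  assumes w: "Suc (card (- argm w)) = m"
  shows "w \<in> tropical_variety J" and
    "(\<Sum>P | minimal_prime_over mpol_ring (inJ' w) P \<and> ideal_dim P = ideal_dim (inJ' w) \<and> \<not> contains_monomial P.
       module_length (local_ring mpol_ring P) (local_module mpol_ring P (quotient_module mpol_ring (inJ' w))))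
     = enat (nat (poly Q 1)) \<and> poly Q 1 \<ge> 0"
proof -
  obtain i0 where i0: "i0 \<in> argm w" using argm_nonempty[of w] by blast
  interpret initial_setup "inJ' w" "argm w" i0 m by (rule initial_setup_in[OF w i0])
  let ?I = "inJ' w"
  obtain Q' where Q': "HS ?I * (1 - fps_X) ^ m = fps_of_poly Q'" "0 \<le> poly Q' 1" "(\<Sum>P\<in>Zs. sat_length P ?I) = enat (nat (poly Q' 1))"
    using multiplicity_count by blast
  have "Q' = Q" using Q'(1) Q(1) by (simp add: HS_in fps_of_poly_eq_iff)
  note Q' = Q'[unfolded this]
  have Zs: "\<exists>c. normal c \<and> P = V c {}" if "P \<in> Zs" for P using that by (auto simp: Zs_def Z0_def)
  have prmZ: "prm P" if "P \<in> Zs" for P using Zs[OF that] prm_V by blast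
  have sat0: "sat_length P ?I = 0" if "\<not> ?I \<subseteq> P" for P using that by (intro sat_length_0 idlJ)
  \<comment> \<open>A nonzero value of \<open>Q\<close> at 1 leaves some candidate over the initial
    ideal. It provides a chain of length \<open>m\<close> and, being free of monomials, shows that
    the weight is tropical.\<close>
  have "\<exists>P\<in>Zs. ?I \<subseteq> P"
  proof (rule ccontr)
    assume "\<not> (\<exists>P\<in>Zs. ?I \<subseteq> P)"
    then have "(\<Sum>P\<in>Zs. sat_length P ?I) = 0" by (intro sum.neutral ballI sat0) blast
    then show False using Q'(2,3) Q(2) by (simp add: zero_enat_def)
  qed
  then obtain P0 where P0: "P0 \<in> Zs" "?I \<subseteq> P0" by blast
  have dimZ: "ideal_dim P = enat m" if P: "P \<in> Zs" for P
  proof -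
    obtain c where c: "normal c" "P = V c {}" using Zs[OF P] by blast
    obtain p where "prime_chain P m p" using chain_V[OF c(1)] c(2) by blast
    moreover have "idl P" using prmZ[OF P] by (simp add: prm_def)
    ultimately show ?thesis using chain_V_bound[OF c(1)] c(2) by (intro ideal_dim_eqI) auto
  qed
  have dim: "ideal_dim ?I = enat m"
  proof -
    obtain c where c: "normal c" "P0 = V c {}" using Zs[OF P0(1)] by blast
    obtain p where "prime_chain P0 m p" using chain_V[OF c(1)] c(2) by blast
    then have "prime_chain ?I m p" using P0(2) unfolding prime_chain_def by blast
    then show ?thesis using prime_chain_bound(1)[OF grJ Q'(1)] by (intro ideal_dim_eqI[OF idlJ]) auto
  qed
  show "w \<in> tropical_variety J"
    using Zs_no_monomial[OF P0] P0(2) by (auto simp: tropical_variety_def contains_monomial_def in_weight_ideal_eq)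
  have set: "minimal_prime_over mpol_ring ?I P \<and> ideal_dim P = ideal_dim ?I \<and> \<not> contains_monomial P \<longleftrightarrow> P \<in> Zs \<and> ?I \<subseteq> P" for P
  proof
    assume "minimal_prime_over mpol_ring ?I P \<and> ideal_dim P = ideal_dim ?I \<and> \<not> contains_monomial P"
    then have P: "prm P" "?I \<subseteq> P" "ideal_dim P = enat m" by (simp_all add: minimal_prime_over_def primeideal_iff_prm dim)
    moreover obtain p where "prime_chain P m p" using ideal_dim_eqD(2)[OF _ P(3) m0] P(1) by (auto simp: prm_def)
    ultimately show "P \<in> Zs \<and> ?I \<subseteq> P" using prime_dim by blast
  next
    assume P: "P \<in> Zs \<and> ?I \<subseteq> P"
    then show "minimal_prime_over mpol_ring ?I P \<and> ideal_dim P = ideal_dim ?I \<and> \<not> contains_monomial P"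
      using Zs_no_monomial[of P] prmZ[of P] dimZ[of P] dim Zs_maximal[of P]
      by (simp add: minimal_prime_over_def primeideal_iff_prm contains_monomial_def)
  qed
  have "(\<Sum>P | P \<in> Zs \<and> ?I \<subseteq> P. module_length (local_ring mpol_ring P) (local_module mpol_ring P (quotient_module mpol_ring ?I)))
     = (\<Sum>P | P \<in> Zs \<and> ?I \<subseteq> P. sat_length P ?I)"
    by (rule sum.cong[OF refl]) (use prmZ in \<open>simp add: module_length_eq[OF idlJ]\<close>)
  also have "\<dots> = (\<Sum>P\<in>Zs. sat_length P ?I)"
    using finite_Z0 sat0 by (intro sum.mono_neutral_left) (auto simp: Zs_def)
  finally show "(\<Sum>P | minimal_prime_over mpol_ring ?I P \<and> ideal_dim P = ideal_dim ?I \<and> \<not> contains_monomial P.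
       module_length (local_ring mpol_ring P) (local_module mpol_ring P (quotient_module mpol_ring ?I)))
     = enat (nat (poly Q 1)) \<and> poly Q 1 \<ge> 0"
    unfolding set using Q' by simp
qed

lemma extend_argm:
  fixes w :: "real ^ 'n"
  assumes "card (- argm w) < m"
  obtains B where "- argm w \<subseteq> B" "Suc (card B) = m" "B \<noteq> UNIV"
proof -
  have "card (- argm w) \<le> m - 1" "m - 1 \<le> card (UNIV :: 'n set)" using assms mn by auto
  then obtain B where B: "- argm w \<subseteq> B" "card B = m - 1"
    using exists_subset_between[of "- argm w" "m - 1" UNIV] by auto
  moreover have "B \<noteq> UNIV" using B(2) m0 mn by auto
  ultimately show ?thesis using that m0 by auto
qed

text \<open>A weight with too few non-minimal coordinates is moved towards \<open>B\<close>, where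
  \<open>initial_ideal_multiplicity\<close> applies. A monomial in its initial ideal is its own
  initial form and would persist after the move.\<close>

lemma tropical_iff: "w \<in> tropical_variety J \<longleftrightarrow> card (- argm w) < m"
proof
  assume "card (- argm w) < m"
  then obtain B where B: "- argm w \<subseteq> B" "Suc (card B) = m" "B \<noteq> UNIV" by (rule extend_argm)
  define \<eta> :: "real ^ 'n" where "\<eta> = (\<chi> i. if i \<in> B then 1 else 0)"
  obtain e0 where e0: "e0 > 0" "\<And>e. 0 < e \<Longrightarrow> e < e0 \<Longrightarrow> inJ' (w + e *\<^sub>R \<eta>) = rm.span (in_weight \<eta> ` inJ' w)"
    using initial_ideal_perturb[OF grJ] by metis
  have "argm (w + (e0 / 2) *\<^sub>R \<eta>) = - B" unfolding \<eta>_def using e0(1) by (intro argm_perturb B) simp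
  then have t: "w + (e0 / 2) *\<^sub>R \<eta> \<in> tropical_variety J" using B(2) by (intro initial_ideal_multiplicity(1)) simp
  have "monomial \<nu> \<notin> inJ' w" for \<nu>
  proof
    assume "monomial \<nu> \<in> inJ' w"
    then have "monomial \<nu> \<in> inJ' (w + (e0 / 2) *\<^sub>R \<eta>)"
      using e0 in_weight_monomial[of \<eta> \<nu>, where 'k = 'k] by (metis half_gt_zero field_sum_of_halves image_eqI less_add_same_cancel1 rm.span_base)
    then show False using t by (auto simp: tropical_variety_def contains_monomial_def in_weight_ideal_eq)
  qed
  then show "w \<in> tropical_variety J" by (simp add: tropical_variety_def contains_monomial_def in_weight_ideal_eq)
qed (rule card_argm_if_tropical)

text \<open>Admitting every small \<open>B\<close> that covers the non-minimal coordinates turns the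
  condition into finitely many systems of weak inequalities.\<close>

lemma closed_tropical: "closed (tropical_variety J)"
proof -
  have "w \<in> tropical_variety J \<longleftrightarrow> (\<exists>B\<in>{B. card B < m}. \<forall>i\<in>- B. \<forall>j. w $ i \<le> w $ j)" for w
  proof
    assume "w \<in> tropical_variety J"
    then show "\<exists>B\<in>{B. card B < m}. \<forall>i\<in>- B. \<forall>j. w $ i \<le> w $ j"
      by (intro bexI[of _ "- argm w"]) (auto simp: tropical_iff argm_def)
  next
    assume "\<exists>B\<in>{B. card B < m}. \<forall>i\<in>- B. \<forall>j. w $ i \<le> w $ j"
    then obtain B where B: "card B < m" "\<forall>i\<in>- B. \<forall>j. w $ i \<le> w $ j" by blast
    then have "- argm w \<subseteq> B" by (auto simp: argm_def)
    then have "card (- argm w) \<le> card B" by (intro card_mono) auto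
    then show "w \<in> tropical_variety J" using B(1) by (simp add: tropical_iff)
  qed
  then have "tropical_variety J = (\<Union>B\<in>{B. card B < m}. \<Inter>i\<in>- B. \<Inter>j. {w. w $ i \<le> w $ j})" by auto
  moreover have "closed {w :: real ^ 'n. w $ i \<le> w $ j}" for i j
    by (intro closed_Collect_le continuous_intros)
  then have "closed (\<Union>B\<in>{B. card B < m}. \<Inter>i\<in>- B. \<Inter>j. {w :: real ^ 'n. w $ i \<le> w $ j})"
    by (intro closed_UN closed_INT ballI finite) auto
  ultimately show ?thesis by simp
qed

abbreviation "same_initial w \<equiv> {w'. in_weight_ideal w' J = in_weight_ideal w J}"

lemma convex_same_initial: "convex (same_initial w)"
proof -
  have "(1 - u) *\<^sub>R x + u *\<^sub>R y \<in> same_initial w" if "x \<in> same_initial w" "y \<in> same_initial w" "0 \<le> u" "u \<le> 1" for x y u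
    using initial_ideal_convex[OF grJ, of x y u] that by (simp add: in_weight_ideal_eq)
  then show ?thesis by (simp add: convex_alt)
qed

text \<open>A convex set and its closure have the same relative interior, so any weight chosen by
  \<open>in_cone_ideal\<close> belongs to the class that defines the cone.\<close>

lemma rel_interior_cone: "rel_interior (closure (same_initial w)) \<subseteq> same_initial w"
  using convex_rel_interior_closure[OF convex_same_initial] rel_interior_subset by metis

text \<open>All weights of the class have the same iterated initial ideal in direction
  \<open>\<eta>\<close>, so each of them is a limit of weights in the class of \<open>w1\<close>.
  The cone of \<open>w1\<close> is tropical and contains \<open>C\<close>; maximality identifies the
  two, and \<open>w1\<close> has exactly \<open>m - 1\<close> non-minimal coordinates.\<close>

lemma maximal_cone_multiplicity:
  assumes C: "maximal_cone C (tropical_fan J)"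
  shows "intrinsic_multiplicity J C = enat (nat (poly Q 1)) \<and> poly Q 1 \<ge> 0"
proof -
  have "C \<in> groebner_fan J" and trop: "C \<subseteq> tropical_variety J" using C by (auto simp: maximal_cone_def tropical_fan_def)
  then obtain w0 where w0: "C = closure (same_initial w0)" by (auto simp: groebner_fan_def)
  have "rel_interior C \<noteq> {}"
    unfolding w0 convex_rel_interior_closure[OF convex_same_initial] rel_interior_eq_empty[OF convex_same_initial] by blast
  define w where "w = (SOME w. w \<in> rel_interior C)"
  have w: "w \<in> rel_interior C" unfolding w_def using \<open>rel_interior C \<noteq> {}\<close> by (simp add: some_in_eq)
  then have ww0: "in_weight_ideal w J = in_weight_ideal w0 J" using rel_interior_cone w0 by blast
  have "w \<in> tropical_variety J" using w trop rel_interior_subset by blast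
  then obtain B where B: "- argm w \<subseteq> B" "Suc (card B) = m" "B \<noteq> UNIV" using extend_argm tropical_iff by metis
  define \<eta> :: "real ^ 'n" where "\<eta> = (\<chi> i. if i \<in> B then 1 else 0)"
  have pert: "\<exists>e0>0. \<forall>e. 0 < e \<and> e < e0 \<longrightarrow> in_weight_ideal (w' + e *\<^sub>R \<eta>) J = rm.span (in_weight \<eta> ` in_weight_ideal w J)"
    if "w' \<in> same_initial w" for w'
    using initial_ideal_perturb[OF grJ, of w' \<eta>] that by (simp add: in_weight_ideal_eq)
  obtain e where e: "e > 0" "in_weight_ideal (w + e *\<^sub>R \<eta>) J = rm.span (in_weight \<eta> ` in_weight_ideal w J)"
    using pert[of w] by (metis (mono_tags, lifting) dense mem_Collect_eq)
  define w1 where "w1 = w + e *\<^sub>R \<eta>"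
  have "argm w1 = - B" unfolding w1_def \<eta>_def by (intro argm_perturb B e)
  then have w1: "Suc (card (- argm w1)) = m" using B(2) by simp
  let ?D = "closure (same_initial w1)"
  have "same_initial w1 \<subseteq> tropical_variety J"
    using initial_ideal_multiplicity(1)[OF w1] by (auto simp: tropical_variety_def)
  then have "?D \<subseteq> tropical_variety J" by (rule closure_minimal[OF _ closed_tropical])
  then have D: "?D \<in> tropical_fan J" by (auto simp: tropical_fan_def groebner_fan_def)
  have "same_initial w \<subseteq> ?D"
  proof
    fix w' assume "w' \<in> same_initial w"
    then obtain e0 where e0: "e0 > 0" "\<And>t. 0 < t \<Longrightarrow> t < e0 \<Longrightarrow> in_weight_ideal (w' + t *\<^sub>R \<eta>) J = in_weight_ideal w1 J"
      using pert[of w'] e(2) unfolding w1_def by metis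
    have "((\<lambda>t. w' + t *\<^sub>R \<eta>) \<longlongrightarrow> w' + 0 *\<^sub>R \<eta>) (at_right 0)" by (intro tendsto_intros)
    moreover have "\<forall>\<^sub>F t in at_right 0. w' + t *\<^sub>R \<eta> \<in> ?D"
      using eventually_at_right_less[of 0 ] eventually_at_right_real[OF e0(1)]
    proof eventually_elim
      case (elim t)
      then show ?case using e0(2)[of t] closure_subset[of "same_initial w1"] by auto
    qed
    ultimately show "w' \<in> ?D" using Lim_in_closed_set[of ?D "\<lambda>t. w' + t *\<^sub>R \<eta>" "at_right 0" "w' + 0 *\<^sub>R \<eta>"] by simp
  qed
  then have "C \<subseteq> ?D" unfolding w0 ww0[symmetric] by (simp add: closure_minimal)
  then have "?D = C" using C D unfolding maximal_cone_def by blast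
  then have "in_weight_ideal w J = in_weight_ideal w1 J" using w rel_interior_cone by blast
  then have "in_cone_ideal C J = inJ' w1" by (simp add: in_cone_ideal_def w_def[symmetric] in_weight_ideal_eq)
  then show ?thesis unfolding intrinsic_multiplicity_def Let_def using initial_ideal_multiplicity(2)[OF w1] by simp
qed

end

text \<open>Some substitution makes the variables of \<open>D\<close> parameters, hence one in
  \<open>U\<close> does, and the initial ideals for \<open>tord D\<close>, being equal on
  \<open>U\<close>, carry this to the given \<open>g\<close>. The Hilbert series is not changed by
  \<open>g\<close>, and a prime chain of length \<open>m\<close> keeps its numerator from vanishing
  at 1.\<close>

lemma generic_coordinates:
  fixes I :: "('n::finite, 'k::{alg_closed_field, field_char_0}) mpol set"
  assumes I: "gr total_degree I" and dim: "ideal_dim I = enat m" "m > 0" and U: "generic_for I U" and g: "g \<in> U"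
  shows "generic_ideal (gl_act g ` I) m (hilbert_numerator I)"
proof -
  have iI: "idl I" using I by (rule gr_idl)
  have U': "U \<noteq> {}" "zariski_open_GL U" "\<And>r. term_order r \<Longrightarrow> \<exists>gin. \<forall>g\<in>U. in_order_ideal r (gl_act g ` I) = gin"
    using U by (simp_all add: generic_for_def)
  have inv: "invertible g" if "g \<in> U" for g using U'(2) that by (auto simp: zariski_open_GL_def)
  obtain p where p: "prime_chain I m p" using ideal_dim_eqD(2)[OF iI dim] by blast
  \<comment> \<open>All variables together satisfy the condition trivially; the resulting pole order
    bounds \<open>m\<close> by the number of variables.\<close>
  have "primary UNIV I"
  proof -
    have "monomial \<nu> \<in> rm.span (mvar ` UNIV :: ('n, 'k) mpol set)" if "1 \<le> total_degree \<nu>" for \<nu>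
    proof -
      have "\<exists>j. Poly_Mapping.lookup \<nu> j > 0" using that by (rule contrapos_pp) (simp add: total_degree_def)
      then show ?thesis unfolding span_mvars_iff by (simp add: monomial_def)
    qed
    then show ?thesis unfolding primary_def using rm.span_mono[of "mvar ` UNIV" "I \<union> mvar ` UNIV"] by blast
  qed
  then obtain Q0 where "HS I * (1 - fps_X) ^ CARD('n) = fps_of_poly Q0" using hilbert_serre[OF I] by blast
  then have mn: "m \<le> CARD('n)" using prime_chain_bound(1)[OF I _ p] by blast
  have params: "primary D (gl_act g ` I)" if D: "card D = m" for D
  proof -
    have "chain_dim_le I (card D)" unfolding chain_dim_le_def D using ideal_dim_eqD(1)[OF iI dim(1)] by blast
    then obtain g0 where "invertible g0" "primary D (gl_act g0 ` I)" using parameters_exist[OF I, of "{}" D] by auto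
    then obtain g' where g': "g' \<in> U" "primary D (gl_act g' ` I)" using generic_primary[OF I] U' by metis
    have "in_order_ideal (tord D) (gl_act g' ` I) = in_order_ideal (tord D) (gl_act g ` I)"
      using U'(3)[OF term_order_tord] g g'(1) by metis
    then show ?thesis
      using primary_if_same_initial[OF gr_gl[OF inv I] gr_gl[OF inv I] g'(2)] g g'(1)
      by (simp add: in_order_ideal_def genideal_eq_span)
  qed
  obtain D :: "'n set" where D: "card D = m" using obtain_subset_with_card_n[OF mn] by metis
  have HS: "HS (gl_act g ` I) = HS I" using hf_gl[OF inv[OF g] iI] by (intro fps_ext) simp
  obtain Q where Q: "HS I * (1 - fps_X) ^ m = fps_of_poly Q"
    using hilbert_serre[OF gr_gl[OF inv[OF g] I] params[OF D]] D HS by auto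
  have Q1: "poly Q 1 \<noteq> 0" using prime_chain_bound(2)[OF I Q p] by blast
  have "1 \<notin> I" using p by (auto simp: prime_chain_def prm_def)
  then have Q': "hilbert_numerator I = Q"
    unfolding hilbert_numerator_def hilbert_series_eq[OF iI \<open>1 \<notin> I\<close>] dim(1) the_enat.simps
    using Q Q1 by (intro the_equality) (auto simp: fps_of_poly_eq_iff)
  show "generic_ideal (gl_act g ` I) m (hilbert_numerator I)"
    unfolding Q' by unfold_locales (use params mn dim gr_gl[OF inv[OF g] I] Q Q1 HS in auto)
qed

theorem theorem6p8:
  fixes I :: "('n::finite, 'k::{alg_closed_field, field_char_0}) mpol set"
    and U :: "('k ^ 'n ^ 'n) set"
    and m :: nat
  assumes "graded_ideal I" and "I \<noteq> {0}"
    and "ideal_dim I = enat m" and "m > 0"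
    and "generic_for I U"
  shows "\<forall>g\<in>U. \<forall>C. maximal_cone C (tropical_fan (gl_act g ` I)) \<longrightarrow>
    ereal_of_enat (intrinsic_multiplicity (gl_act g ` I) C) = ereal (of_int (multiplicity_of_ideal I))"
proof (intro ballI allI impI)
  fix g C assume g: "g \<in> U" and C: "maximal_cone C (tropical_fan (gl_act g ` I))"
  have I: "gr total_degree I" using assms(1) by (simp add: graded_ideal_iff)
  interpret generic_ideal "gl_act g ` I" m "hilbert_numerator I"
    by (rule generic_coordinates[OF I assms(3-5) g])
  \<comment> \<open>The value at 1 is nonnegative, so nothing is lost in passing through
    \<open>nat\<close>.\<close>
  show "ereal_of_enat (intrinsic_multiplicity (gl_act g ` I) C) = ereal (of_int (multiplicity_of_ideal I))"
    using maximal_cone_multiplicity[OF C] by (simp add: multiplicity_of_ideal_def)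
qed

end
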